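(* Let $A_0$ be a real $2\times2$ matrix with eigenvalues $\mu_1,\mu_2$ and let $B_0\in\mathbb{R}^2$. Consider the boundary control system $$y_t-y_{xx}=A_0y\ \text{ in }(0,\pi)\times(0,T),\qquad y(0,\cdot)=B_0u,\quad y(\pi,\cdot)=0\ \text{ in }(0,T),\qquad y(\cdot,0)=y_0\ \text{ in }(0,\pi),$$ with scalar control $u$ and initial state $y_0\in L^2(0,\pi)^2$. Assume that the system is null controllable, i.e. that $\mathrm{rank}[B_0,A_0B_0]=2$ and $\mu_1-\mu_2\neq j^2-k^2$ for all $j,k\in\{1,2,\dots\}$ with $j\neq k$. Then the system is NCVE if and only if $\mathrm{Re}(\mu_i)\le1$ for $i=1,2$.
   Context: The state space is $H=L^2(0,\pi;\mathbb{C})^2$ (complexification of $L^2(0,\pi)^2$) and controls are scalar, $u\in L^2_{\rm loc}(0,+\infty)$ (control space $U=\mathbb{C}$). The solution of the boundary control system $y_t-y_{xx}=A_0y$ in $(0,\pi)\times(0,T)$, $y(0,\cdot)=B_0u$, $y(\pi,\cdot)=0$ in $(0,T)$, $y(\cdot,0)=y_0$ in $(0,\pi)$, is defined by transposition: for $T>0$, $Q=(0,\pi)\times(0,T)$, $y_0\in L^2(0,\pi)^2$, $u\in L^2(0,T)$, it is the unique $y\in L^2(Q)^2$ such that for each $g\in L^2(Q)^2$ $$\int_Q y\cdot g\,dx\,dt=\langle y_0,\phi(\cdot,0)\rangle+\int_0^TB_0\cdot\phi_x(0,t)u(t)\,dt,$$ where $\langle\cdot,\cdot\rangle$ is the inner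 product of $L^2(0,\pi)^2$ and $\phi\in L^2(0,T;H^2(0,\pi)^2)\cap C^0([0,T];H^1_0(0,\pi)^2)$ is the unique strong solution of $-\phi_t-\phi_{xx}=A_0^*\phi+g$ in $Q$, $\phi(0,\cdot)=\phi(\pi,\cdot)=0$ in $(0,T)$, $\phi(\cdot,T)=0$. (Identity stated for real data and extended by complex linearity in $(y_0,u)$ to complex data.) For $y_0\in H$ and $u\in L^2_{\rm loc}(0,+\infty)$ the solution $y^{y_0,u}$ on $(0,+\infty)$ is the function whose restriction to each $(0,T)$, $T>0$, is the solution by transposition on $(0,\pi)\times(0,T)$ with initial state $y_0$ and control $u|_{(0,T)}$, i.e. the unique $y\in L^2((0,\pi)\times(0,T))^2$ satisfying $\int_0^T\int_0^\pi y\cdot g\,dx\,dt=\langle y_0,\phi(\cdot,0)\rangle+\int_0^TB_0\cdot\phi_x(0,t)u(t)\,dt$ for each $g\in L^2((0,\pi)\times(0,T))^2$, with $\phi$ the strong solution of the backward problem $-\phi_t-\phi_{xx}=A_0^*\phi+g$, $\phi(0,\cdot)=\phi(\pi,\cdot)=0$, $\phi(\cdot,T)=0$ (extended by complex linearity in $(y_0,u)$ to complex data). $y_0$ can be steered to the rest in time (at most) $T$ if there is a control $u$ with support in $[0,T]$ such that $y^{y_0,u}$ (as a function of $t$) has support in $[0,T]$ too. The system is null controllable if every $y_0\in H$ can be steered to the rest in a suitable time $T_{y_0}$ at most; for this system null controllability at any time $T>0$ is known to be equivalent to the algebraic condition that $\mathrm{rank}[B_0,A_0B_0]=2$ and $\mu_1-\mu_2\neq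 j^2-k^2$ for all $j,k\in\{1,2,\dots\}$ with $j\neq k$, where $\mu_1,\mu_2$ are the eigenvalues of $A_0$. An element $y_0$ that can be steered to the rest is NCVE if for every $\epsilon>0$ there are a time $T_\epsilon$ and a control $u_\epsilon$ with support in $[0,T_\epsilon]$ steering $y_0$ to the rest in time at most $T_\epsilon$ with $\int_0^{+\infty}|u_\epsilon(s)|^2ds\le\epsilon^2$. The system is NCVE (null controllable with vanishing energy) if every element of $H$ is NCVE. *)

theory Defs
  imports "HOL-Analysis.Analysis"
begin

section \<open>Lebesgue and Sobolev spaces\<close>

text \<open>
  Elements of \<open>L\<^sup>2\<close> are represented by functions. Changing a state, a control, a source term
  or a transposition solution on a null set affects no predicate below.
\<close>

definition L2_on :: "'a::euclidean_space set \<Rightarrow> ('a \<Rightarrow> 'b::euclidean_space) \<Rightarrow> bool" where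
  "L2_on S f \<longleftrightarrow>
     f \<in> borel_measurable (lebesgue_on S) \<and>
     integrable (lebesgue_on S) (\<lambda>x. (norm (f x))\<^sup>2)"

definition C1_test_function :: "real \<Rightarrow> real \<Rightarrow> (real \<Rightarrow> real) \<Rightarrow> (real \<Rightarrow> real) \<Rightarrow> bool" where
  "C1_test_function a b \<psi> \<psi>' \<longleftrightarrow>
     (\<forall>x. (\<psi> has_real_derivative \<psi>' x) (at x)) \<and>
     continuous_on UNIV \<psi>' \<and>
     (\<exists>c d. a < c \<and> d < b \<and> (\<forall>x. x \<notin> {c..d} \<longrightarrow> \<psi> x = 0))"

text \<open>
  \<open>H1_deriv a b f f'\<close>: the function \<open>f\<close> belongs to \<open>H\<^sup>1(a,b)\<close> and \<open>f'\<close> is its weak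
  derivative. As usual in dimension one, compactly supported \<open>C\<^sup>1\<close> test functions are used;
  \<open>C\<^sup>\<infinity>\<close> test functions give the same notion.
\<close>

definition H1_deriv ::
  "real \<Rightarrow> real \<Rightarrow> (real \<Rightarrow> 'b::euclidean_space) \<Rightarrow> (real \<Rightarrow> 'b) \<Rightarrow> bool" where
  "H1_deriv a b f f' \<longleftrightarrow>
     L2_on {a<..<b} f \<and> L2_on {a<..<b} f' \<and>
     (\<forall>\<psi> \<psi>'. C1_test_function a b \<psi> \<psi>' \<longrightarrow>
        (LINT x|lebesgue_on {a<..<b}. \<psi>' x *\<^sub>R f x) =
        - (LINT x|lebesgue_on {a<..<b}. \<psi> x *\<^sub>R f' x))"

section \<open>The backward adjoint problem\<close>

abbreviation space_time :: "real \<Rightarrow> (real \<times> real) set" where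
  "space_time T \<equiv> {0<..<pi} \<times> {0<..<T}"

text \<open>
  Functions on the space-time cylinder take pairs \<open>(x, t)\<close>.
  \<open>strong_adjoint_solution A T g \<phi> \<phi>x\<close>: the function \<open>\<phi>\<close> is the strong solution of
  \<open>- \<phi>\<^sub>t - \<phi>\<^sub>x\<^sub>x = A\<^sup>* \<phi> + g\<close> with zero Dirichlet data and zero final state, and \<open>\<phi>x\<close> is
  its space derivative. The representatives are chosen so that point values make sense:
  \<open>\<phi>(\<cdot>,t)\<close> is continuous on \<open>[0,\<pi>]\<close> for every \<open>t\<close>, and \<open>\<phi>x(\<cdot>,t)\<close> is continuous on \<open>[0,\<pi>]\<close>
  for almost every \<open>t\<close> (those with \<open>\<phi>(\<cdot>,t) \<in> H\<^sup>2(0,\<pi>)\<close>). Hence \<open>\<phi>x(0,t)\<close> is the trace of the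
  derivative for almost every \<open>t\<close>. In dimension one, \<open>H\<^sup>1\<^sub>0(0,\<pi>)\<close> consists of the elements of
  \<open>H\<^sup>1(0,\<pi>)\<close> whose continuous representative vanishes at \<open>0\<close> and \<open>\<pi>\<close>.
\<close>

definition strong_adjoint_solution ::
  "real^2^2 \<Rightarrow> real \<Rightarrow> (real \<times> real \<Rightarrow> real^2) \<Rightarrow>
   (real \<times> real \<Rightarrow> real^2) \<Rightarrow> (real \<times> real \<Rightarrow> real^2) \<Rightarrow> bool" where
  "strong_adjoint_solution A T g \<phi> \<phi>x \<longleftrightarrow>
     \<comment> \<open>\<open>\<phi> \<in> C\<^sup>0([0,T]; H\<^sup>1\<^sub>0(0,\<pi>))\<close>\<close>
     (\<forall>t\<in>{0..T}.
        continuous_on {0..pi} (\<lambda>x. \<phi> (x, t)) \<and>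
        H1_deriv 0 pi (\<lambda>x. \<phi> (x, t)) (\<lambda>x. \<phi>x (x, t)) \<and>
        \<phi> (0, t) = 0 \<and> \<phi> (pi, t) = 0) \<and>
     (\<forall>s\<in>{0..T}.
        ((\<lambda>t. LINT x|lebesgue_on {0<..<pi}.
             (norm (\<phi> (x, t) - \<phi> (x, s)))\<^sup>2 + (norm (\<phi>x (x, t) - \<phi>x (x, s)))\<^sup>2)
          \<longlongrightarrow> 0) (at s within {0..T})) \<and>
     (\<forall>x\<in>{0..pi}. \<phi> (x, T) = 0) \<and>
     (\<exists>\<phi>xx \<phi>t.
        \<comment> \<open>\<open>\<phi> \<in> L\<^sup>2(0,T; H\<^sup>2(0,\<pi>))\<close>\<close>
        L2_on (space_time T) \<phi> \<and> L2_on (space_time T) \<phi>x \<and> L2_on (space_time T) \<phi>xx \<and>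
        (AE t in lebesgue_on {0<..<T}.
           continuous_on {0..pi} (\<lambda>x. \<phi>x (x, t)) \<and>
           H1_deriv 0 pi (\<lambda>x. \<phi>x (x, t)) (\<lambda>x. \<phi>xx (x, t))) \<and>
        \<comment> \<open>\<open>\<phi> \<in> H\<^sup>1(0,T; L\<^sup>2(0,\<pi>))\<close>\<close>
        L2_on (space_time T) \<phi>t \<and>
        (AE x in lebesgue_on {0<..<pi}. H1_deriv 0 T (\<lambda>t. \<phi> (x, t)) (\<lambda>t. \<phi>t (x, t))) \<and>
        (AE p in lebesgue_on (space_time T).
           - \<phi>t p - \<phi>xx p = transpose A *v \<phi> p + g p))"

section \<open>Solutions by transposition\<close>

text \<open>
  The bilinear pairing with a real vector. Testing complex data against real \<open>g\<close> with this
  pairing is the complex linear extension of the transposition identity for real data.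
\<close>

definition real_pairing :: "complex^2 \<Rightarrow> real^2 \<Rightarrow> complex" where
  "real_pairing v w = (\<Sum>i\<in>UNIV. v $ i * complex_of_real (w $ i))"

text \<open>
  For every \<open>g\<close> there is exactly one strong solution \<open>\<phi>\<close> of the adjoint problem, so quantifying
  over all \<open>\<phi>\<close> and \<open>\<phi>x\<close> below only names that solution. The solution \<open>y\<close> is likewise determined
  almost everywhere by \<open>y\<^sub>0\<close> and \<open>u\<close>.
\<close>

definition transposition_solution ::
  "real^2^2 \<Rightarrow> real^2 \<Rightarrow> real \<Rightarrow> (real \<Rightarrow> complex^2) \<Rightarrow> (real \<Rightarrow> complex) \<Rightarrow>
   (real \<times> real \<Rightarrow> complex^2) \<Rightarrow> bool" where
  "transposition_solution A B T y0 u y \<longleftrightarrow>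
     L2_on (space_time T) y \<and>
     (\<forall>g \<phi> \<phi>x. L2_on (space_time T) g \<and> strong_adjoint_solution A T g \<phi> \<phi>x \<longrightarrow>
        (LINT p|lebesgue_on (space_time T). real_pairing (y p) (g p)) =
        (LINT x|lebesgue_on {0<..<pi}. real_pairing (y0 x) (\<phi> (x, 0))) +
        (LINT t|lebesgue_on {0<..<T}. complex_of_real (B \<bullet> \<phi>x (0, t)) * u t))"

definition global_solution ::
  "real^2^2 \<Rightarrow> real^2 \<Rightarrow> (real \<Rightarrow> complex^2) \<Rightarrow> (real \<Rightarrow> complex) \<Rightarrow>
   (real \<times> real \<Rightarrow> complex^2) \<Rightarrow> bool" where
  "global_solution A B y0 u y \<longleftrightarrow> (\<forall>T>0. transposition_solution A B T y0 u y)"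

section \<open>Null controllability with vanishing energy\<close>

definition state_space :: "(real \<Rightarrow> complex^2) set" where
  "state_space = {y0. L2_on {0<..<pi} y0}"

definition admissible_controls :: "(real \<Rightarrow> complex) set" where
  "admissible_controls = {u. \<forall>T>0. L2_on {0<..<T} u}"

text \<open>
  The control \<open>u\<close> steers \<open>y\<^sub>0\<close> to the rest in time at most \<open>T\<close>. Supports are those of
  almost-everywhere classes, so support in \<open>[0,T]\<close> means vanishing almost everywhere
  after time \<open>T\<close>.
\<close>

definition steers_to_rest ::
  "real^2^2 \<Rightarrow> real^2 \<Rightarrow> real \<Rightarrow> (real \<Rightarrow> complex^2) \<Rightarrow> (real \<Rightarrow> complex) \<Rightarrow> bool" where
  "steers_to_rest A B T y0 u \<longleftrightarrow>
     0 \<le> T \<and> u \<in> admissible_controls \<and>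
     (AE t in lebesgue_on {T<..}. u t = 0) \<and>
     (\<exists>y. global_solution A B y0 u y \<and>
          (AE p in lebesgue_on ({0<..<pi} \<times> {T<..}). y p = 0))"

definition NCVE_state :: "real^2^2 \<Rightarrow> real^2 \<Rightarrow> (real \<Rightarrow> complex^2) \<Rightarrow> bool" where
  "NCVE_state A B y0 \<longleftrightarrow>
     (\<exists>T u. steers_to_rest A B T y0 u) \<and>
     (\<forall>\<epsilon>>0. \<exists>T u. steers_to_rest A B T y0 u \<and>
        (LINT s|lebesgue_on {0<..}. (norm (u s))\<^sup>2) \<le> \<epsilon>\<^sup>2)"

definition NCVE :: "real^2^2 \<Rightarrow> real^2 \<Rightarrow> bool" where
  "NCVE A B \<longleftrightarrow> (\<forall>y0\<in>state_space. NCVE_state A B y0)"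

section \<open>Eigenvalues\<close>

definition complex_eigenvalues :: "real^'n^'n \<Rightarrow> complex set" where
  "complex_eigenvalues A =
     {\<mu>. \<exists>v::complex^'n. v \<noteq> 0 \<and> (\<chi> i j. complex_of_real (A $ i $ j)) *v v = \<mu> *s v}"

end

theory Submission
  imports Defs "HOL-Real_Asymp.Real_Asymp"
begin

text \<open>With \<open>C = (A - \<mu>1) B\<close>, an eigenvector for \<open>\<mu>2\<close>, the coefficients of a solution along \<open>B\<close> and \<open>C\<close>
  in the basis \<open>sin (k x)\<close> solve triangular systems with eigenvalues \<open>\<mu>1 - k\<^sup>2\<close> and \<open>\<mu>2 - k\<^sup>2\<close>. Steering to
  rest therefore prescribes the moments of the control against \<open>exp ((k\<^sup>2 - \<mu>1) s)\<close> and against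
  the product of \<open>exp (k\<^sup>2 s)\<close> with a divided difference of \<open>\<mu> \<mapsto> exp (- \<mu> s)\<close>.

  Sufficiency. A control acting on the \<open>k\<close>-th mode alone arises from a bump by an infinite product of
  difference operators \<open>f(s + a) - q f(s)\<close>, each of which annihilates the moments belonging to one other
  eigenvalue. Its size is at most \<open>exp (c k\<^sup>2)\<close>, which the dissipation during a waiting time
  compensates, so these controls can be summed over \<open>k\<close>. If \<open>Re \<mu>i \<le> 1\<close>, no mode grows
  exponentially; removing an \<open>n\<close>-th part of the state in each of \<open>n\<close> successive stages then
  costs energy \<open>O(1/n)\<close>.

  Necessity. If \<open>Re \<mu>1 > 1\<close> and \<open>v\<close> is a left eigenvector for \<open>\<mu>1\<close>, testing with the adjoint
  solution \<open>exp ((1 - \<mu>1) t) sin x v\<close> shows that the component of \<open>y0\<close> along \<open>sin x v\<close> is an integral of the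
  control against an exponentially decaying function, hence bounded by its norm in \<open>L\<^sup>2\<close>.\<close>

section \<open>Controls and their moments\<close>

text \<open>At \<open>Re \<mu>i = 1\<close> the first mode does not decay, so a smaller energy
  cannot be bought by waiting. It is bought by linearity: \<open>null_moments\<close> has a cost
  linear in the data on an interval of fixed length, and equal fractions on consecutive intervals
  add up in L2 like \<open>n * (1 / n)^2\<close>.

  Each difference operator is a translation minus a multiple of the identity. Translations act on
  exponential moments by scalars, so zeros can be prescribed one at a time while the support grows
  only by the sum of the translations; the real work is the lower bound for the surviving mode,
  \<open>factor_lower_bound\<close>. A loss \<open>exp (c k^2)\<close> with any fixed
  \<open>c\<close> is affordable because it has the same order in \<open>k\<close> as the heat
  decay.

  Controls are kept C1 because subtracting the boundary lift from the solution puts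
  \<open>u'\<close> into the equations of the modes. In the converse the steering time is unknown,
  so the constant must be uniform in it; square integrability of the decaying weight on the whole
  half line gives this.\<close>

definition C1_supported :: "real \<Rightarrow> real \<Rightarrow> (real \<Rightarrow> complex) \<Rightarrow> (real \<Rightarrow> complex) \<Rightarrow> bool" where
  "C1_supported a b f f' \<longleftrightarrow>
     (\<forall>s. (f has_vector_derivative f' s) (at s)) \<and> continuous_on UNIV f' \<and>
     (\<forall>s. s \<notin> {a..b} \<longrightarrow> f s = 0 \<and> f' s = 0)"

lemma C1_supported_cont:
  assumes "C1_supported a b f f'"
  shows "continuous_on A f" "continuous_on A f'"
proof -
  have "continuous_on UNIV f"
    using assms unfolding C1_supported_def
    by (meson continuous_at_imp_continuous_on has_vector_derivative_continuous)
  then show "continuous_on A f" by (rule continuous_on_subset) auto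
  show "continuous_on A f'"
    using assms unfolding C1_supported_def by (meson continuous_on_subset subset_UNIV)
qed

lemma C1_supported_mono:
  "C1_supported a b f f' \<Longrightarrow> c \<le> a \<Longrightarrow> b \<le> d \<Longrightarrow> C1_supported c d f f'"
  unfolding C1_supported_def by auto

lemma C1_supported_shift:
  assumes "C1_supported a b f f'"
  shows "C1_supported (a - c) (b - c) (\<lambda>s. f (s + c)) (\<lambda>s. f' (s + c))"
proof -
  have "((\<lambda>s. f (s + c)) has_vector_derivative f' (s + c)) (at s)" for s
  proof -
    have "(f has_vector_derivative f' (s + c)) (at (s + c))"
      using assms unfolding C1_supported_def by blast
    then have "((f \<circ> (\<lambda>s. s + c)) has_vector_derivative 1 *\<^sub>R f' (s + c)) (at s)"
      by (intro vector_diff_chain_at) (auto intro!: derivative_eq_intros)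
    then show ?thesis by (simp add: o_def)
  qed
  moreover have "continuous_on UNIV (\<lambda>s. f' (s + c))"
    by (rule continuous_on_compose2[of UNIV f']) (auto intro!: continuous_intros C1_supported_cont[OF assms])
  ultimately show ?thesis
    using assms unfolding C1_supported_def by auto
qed

lemma C1_supported_add:
  assumes "C1_supported a b f f'" "C1_supported a b g g'"
  shows "C1_supported a b (\<lambda>s. f s + g s) (\<lambda>s. f' s + g' s)"
  using assms unfolding C1_supported_def
  by (auto intro!: has_vector_derivative_add continuous_intros)

lemma C1_supported_cmult:
  assumes "C1_supported a b f f'"
  shows "C1_supported a b (\<lambda>s. c * f s) (\<lambda>s. c * f' s)"
  using assms unfolding C1_supported_def
  by (auto intro!: has_vector_derivative_mult_right continuous_intros)

lemma C1_supported_zero: "C1_supported a b (\<lambda>_. 0) (\<lambda>_. 0)"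
  unfolding C1_supported_def by auto

lemma C1_supported_sum:
  assumes "\<And>i. i \<in> I \<Longrightarrow> C1_supported a b (f i) (f' i)"
  shows "C1_supported a b (\<lambda>s. \<Sum>i\<in>I. f i s) (\<lambda>s. \<Sum>i\<in>I. f' i s)"
proof (cases "finite I")
  case True
  then show ?thesis using assms
    by (induction I rule: finite_induct) (auto intro: C1_supported_zero C1_supported_add)
qed (auto intro: C1_supported_zero)

text \<open>Weighted moments are taken over the whole line so that translation needs no bookkeeping of
  supports.\<close>

definition moment :: "(real \<Rightarrow> complex) \<Rightarrow> (real \<Rightarrow> complex) \<Rightarrow> complex" where
  "moment e f = (LINT s|lborel. e s * f s)"

lemma integrable_cont_supported:
  fixes f :: "real \<Rightarrow> 'a::{banach, second_countable_topology}"
  assumes "continuous_on UNIV f" "\<And>s. s \<notin> {a..b} \<Longrightarrow> f s = 0"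
  shows "integrable lborel f"
proof -
  have "integrable lborel (\<lambda>s. indicator {a..b} s *\<^sub>R f s)"
    by (intro borel_integrable_compact) (auto intro: continuous_on_subset[OF assms(1)])
  also have "(\<lambda>s. indicator {a..b} s *\<^sub>R f s) = f"
    using assms(2) by (auto simp: indicator_def fun_eq_iff)
  finally show ?thesis .
qed

lemma moment_integrable:
  assumes "continuous_on UNIV e" "C1_supported a b f f'"
  shows "integrable lborel (\<lambda>s. e s * f s)"
  by (rule integrable_cont_supported[of _ a b])
     (use assms(2) in \<open>auto intro!: continuous_intros assms C1_supported_cont[OF assms(2)] simp: C1_supported_def\<close>)

lemma moment_shift: "moment e (\<lambda>s. f (s + c)) = moment (\<lambda>s. e (s - c)) f"
  unfolding moment_def
  by (subst lborel_integral_real_affine[where c=1 and t="-c"]) auto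

lemma moment_cmult_left: "moment (\<lambda>s. c * e s) f = c * moment e f"
  unfolding moment_def by (simp add: mult.assoc)

lemma moment_cmult_right: "moment e (\<lambda>s. c * f s) = c * moment e f"
  unfolding moment_def by (simp add: mult.left_commute[of "e _"])

lemma moment_add:
  assumes "continuous_on UNIV e" "C1_supported a b f f'" "C1_supported a b g g'"
  shows "moment e (\<lambda>s. f s + g s) = moment e f + moment e g"
  unfolding moment_def distrib_left
  by (rule Bochner_Integration.integral_add; rule moment_integrable[OF assms(1)]) (fact assms)+

lemma moment_diff:
  assumes "continuous_on UNIV e" "C1_supported a b f f'" "C1_supported a b g g'"
  shows "moment e (\<lambda>s. f s - g s) = moment e f - moment e g"
  unfolding moment_def right_diff_distrib
  by (rule Bochner_Integration.integral_diff; rule moment_integrable[OF assms(1)]) (fact assms)+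

lemma moment_sum:
  assumes "continuous_on UNIV e" "\<And>i. i \<in> I \<Longrightarrow> C1_supported a b (f i) (f' i)"
  shows "moment e (\<lambda>s. \<Sum>i\<in>I. f i s) = (\<Sum>i\<in>I. moment e (f i))"
  unfolding moment_def sum_distrib_left
  by (rule Bochner_Integration.integral_sum; rule moment_integrable[OF assms(1)]) (fact assms(2))

lemma moment_add_left:
  assumes "continuous_on UNIV e" "continuous_on UNIV d" "C1_supported a b f f'"
  shows "moment (\<lambda>s. e s + d s) f = moment e f + moment d f"
  unfolding moment_def distrib_right
  by (rule Bochner_Integration.integral_add; rule moment_integrable[OF _ assms(3)]) (fact assms)+

lemma moment_norm_le:
  assumes "continuous_on UNIV e" "C1_supported a b f f'"
    and "\<And>s. s \<in> {a..b} \<Longrightarrow> norm (e s) \<le> E" "\<And>s. norm (f s) \<le> K" and "a \<le> b" "0 \<le> E"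
  shows "norm (moment e f) \<le> (b - a) * (E * K)"
proof -
  have K: "0 \<le> K" using assms(4)[of 0] by (meson norm_ge_zero order_trans)
  have "norm (moment e f) \<le> (LINT s|lborel. norm (e s * f s))"
    unfolding moment_def by (rule integral_norm_bound)
  also have "\<dots> \<le> (LINT s|lborel. (E * K) * indicator {a..b} s)"
  proof (rule integral_mono)
    show "integrable lborel (\<lambda>s. norm (e s * f s))"
      by (rule integrable_norm[OF moment_integrable[OF assms(1,2)]])
    show "integrable lborel (\<lambda>s. (E * K) * indicator {a..b} s :: real)"
      by (intro integrable_mult_right integrable_real_indicator) (use assms(5) in auto)
    show "norm (e s * f s) \<le> E * K * indicator {a..b} s" for s
      using assms(2,3,4,6) K unfolding C1_supported_def
      by (auto simp: indicator_def norm_mult intro!: mult_mono)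
  qed
  also have "\<dots> = (b - a) * (E * K)"
    using assms(5) by simp
  finally show ?thesis .
qed

text \<open>The bounds \<open>\<epsilon> n\<close> do not depend on \<open>s\<close>, so the
  telescoping series of \<open>f n\<close> and of \<open>f' n\<close> converge uniformly by the
  Weierstrass test. Uniform convergence of the derivatives makes the limit C1, and the common
  bounded support carries moments to the limit against every continuous weight, however fast it
  grows.\<close>

lemma C1_supported_limit:
  fixes f f' :: "nat \<Rightarrow> real \<Rightarrow> complex"
  assumes f: "\<And>n. C1_supported a b (f n) (f' n)"
    and d: "\<And>n s. norm (f (Suc n) s - f n s) \<le> \<epsilon> n" "\<And>n s. norm (f' (Suc n) s - f' n s) \<le> \<epsilon> n"
    and \<epsilon>: "summable \<epsilon>"
  obtains g g' where "C1_supported a b g g'" "\<And>s. (\<lambda>n. f n s) \<longlonglongrightarrow> g s" "\<And>s. (\<lambda>n. f' n s) \<longlonglongrightarrow> g' s"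
    "\<And>e. continuous_on UNIV e \<Longrightarrow> (\<lambda>n. moment e (f n)) \<longlonglongrightarrow> moment e g"
proof -
  have unif: "\<exists>h. uniform_limit UNIV F h sequentially"
    if "\<And>n s. norm (F (Suc n) s - F n s) \<le> \<epsilon> n" for F :: "nat \<Rightarrow> real \<Rightarrow> complex"
  proof -
    have "uniformly_convergent_on UNIV (\<lambda>n x. \<Sum>i<n. F (Suc i) x - F i x)"
      by (rule Weierstrass_m_test'[OF _ \<epsilon>]) (use that in auto)
    then obtain h where h: "uniform_limit UNIV (\<lambda>n x. \<Sum>i<n. F (Suc i) x - F i x) h sequentially"
      unfolding uniformly_convergent_on_def by blast
    have "uniform_limit UNIV (\<lambda>n x. F 0 x + (\<Sum>i<n. F (Suc i) x - F i x)) (\<lambda>x. F 0 x + h x) sequentially"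
      by (intro uniform_limit_intros h)
    moreover have "F 0 x + (\<Sum>i<n. F (Suc i) x - F i x) = F n x" for n x
      using sum_lessThan_telescope[of "\<lambda>i. F i x" n] by simp
    ultimately show ?thesis by auto
  qed
  obtain g where g: "uniform_limit UNIV f g sequentially" using unif[of f, OF d(1)] by blast
  obtain g' where g': "uniform_limit UNIV f' g' sequentially" using unif[of f', OF d(2)] by blast
  have lim: "(\<lambda>n. f n s) \<longlonglongrightarrow> g s" "(\<lambda>n. f' n s) \<longlonglongrightarrow> g' s" for s
    using tendsto_uniform_limitI[OF g] tendsto_uniform_limitI[OF g'] by auto
  have supp: "s \<notin> {a..b} \<Longrightarrow> g s = 0 \<and> g' s = 0" for s
    using f lim[of s] unfolding C1_supported_def by (simp add: LIMSEQ_const_iff)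
  have cg': "continuous_on UNIV g'"
    by (rule uniform_limit_theorem[OF _ g']) (auto intro!: always_eventually C1_supported_cont[OF f])
  have cg: "continuous_on UNIV g"
    by (rule uniform_limit_theorem[OF _ g]) (auto intro!: always_eventually C1_supported_cont[OF f])
  have "\<exists>G. \<forall>x\<in>UNIV. (\<lambda>n. f n x) \<longlonglongrightarrow> G x \<and> (G has_derivative (\<lambda>h. h *\<^sub>R g' x)) (at x within UNIV)"
  proof (rule has_derivative_sequence[where f'="\<lambda>n x h. h *\<^sub>R f' n x" and ?x0.0=0 and l="g 0"])
    show "(f n has_derivative (\<lambda>h. h *\<^sub>R f' n x)) (at x within UNIV)" for n x
      using f[of n] unfolding C1_supported_def has_vector_derivative_def by auto
    show "\<forall>\<^sub>F n in sequentially. \<forall>x\<in>UNIV. \<forall>h. norm (h *\<^sub>R f' n x - h *\<^sub>R g' x) \<le> e * norm h"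
      if "e > 0" for e
      using uniform_limitD[OF g' that]
    proof eventually_elim
      case (elim n)
      show ?case
      proof (intro ballI allI)
        fix x h
        have "norm (h *\<^sub>R f' n x - h *\<^sub>R g' x) = \<bar>h\<bar> * dist (f' n x) (g' x)"
          by (simp add: dist_norm flip: scaleR_diff_right)
        also have "\<dots> \<le> \<bar>h\<bar> * e" using elim by (intro mult_left_mono) (auto intro: less_imp_le)
        finally show "norm (h *\<^sub>R f' n x - h *\<^sub>R g' x) \<le> e * norm h" by (simp add: mult.commute)
      qed
    qed
  qed (use lim in auto)
  then obtain G where G: "\<And>x. (\<lambda>n. f n x) \<longlonglongrightarrow> G x" "\<And>x. (G has_vector_derivative g' x) (at x)"
    unfolding has_vector_derivative_def by auto
  have "G = g" using G(1) lim(1) LIMSEQ_unique by blast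
  then have C: "C1_supported a b g g'"
    using G(2) cg' supp unfolding C1_supported_def by auto
  have "(\<lambda>n. moment e (f n)) \<longlonglongrightarrow> moment e g" if e: "continuous_on UNIV e" for e
  proof (cases "a \<le> b")
    case False
    then have "f n = (\<lambda>_. 0)" "g = (\<lambda>_. 0)" for n
      using f[of n] C unfolding C1_supported_def by auto
    then show ?thesis by (simp add: moment_def)
  next
    case True
    have "bounded (e ` {a..b})"
      by (intro compact_imp_bounded compact_continuous_image continuous_on_subset[OF e]) auto
    then obtain E where E: "E > 0" "\<And>s. s \<in> {a..b} \<Longrightarrow> norm (e s) \<le> E"
      unfolding bounded_pos by auto
    show ?thesis
    proof (rule metric_LIMSEQ_I)
      fix r :: real assume "r > 0"
      \<comment> \<open>Solves \<open>(b - a + 1) * E * \<eta> = r / 2\<close>; the summand 1 keeps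
        the denominator positive when \<open>a = b\<close>.\<close>
      define \<eta> where "\<eta> = r / (2 * ((b - a + 1) * E))"
      have \<eta>: "\<eta> > 0" using \<open>r > 0\<close> E True unfolding \<eta>_def by (intro divide_pos_pos mult_pos_pos) auto
      obtain N where N: "\<And>n x. n \<ge> N \<Longrightarrow> dist (f n x) (g x) < \<eta>"
        using uniform_limitD[OF g \<eta>] unfolding eventually_sequentially by auto
      show "\<exists>no. \<forall>n\<ge>no. dist (moment e (f n)) (moment e g) < r"
      proof (intro exI allI impI)
        fix n assume n: "n \<ge> N"
        have Cd: "C1_supported a b (\<lambda>s. f n s - g s) (\<lambda>s. f' n s - g' s)"
          using C1_supported_add[OF f[of n] C1_supported_cmult[OF C, of "-1"]] by simp
        have "dist (moment e (f n)) (moment e g) = norm (moment e (\<lambda>s. f n s - g s))"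
          unfolding dist_norm moment_diff[OF e f[of n] C] ..
        also have "\<dots> \<le> (b - a) * (E * \<eta>)"
          using N[OF n] E True by (intro moment_norm_le[OF e Cd]) (auto simp: dist_norm intro: less_imp_le)
        also have "\<dots> \<le> (b - a + 1) * (E * \<eta>)"
          using E \<eta> by (intro mult_right_mono) auto
        also have "\<dots> = (b - a + 1) * E * \<eta>" by simp
        also have "\<dots> = r / 2"
        proof -
          have "Z * (r / (2 * Z)) = r / 2" if "Z > 0" for Z :: real using that by simp
          moreover have "(b - a + 1) * E > 0" using E True by (intro mult_pos_pos) auto
          ultimately show ?thesis unfolding \<eta>_def by blast
        qed
        also have "\<dots> < r" using \<open>r > 0\<close> by simp
        finally show "dist (moment e (f n)) (moment e g) < r" .
      qed
    qed
  qed
  then show ?thesis using that C lim by blast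
qed

text \<open>The zeros of \<open>1 - exp (- x)\<close> are the multiples of 2 pi i; confining
  \<open>Im x\<close> to [-1, 1] leaves only 0 among them, so the distance to 0 controls the
  modulus. One of \<open>\<bar>Re x\<bar>\<close>, \<open>\<bar>Im x\<bar>\<close> is at least
  \<open>t / 2\<close>: a large real part is seen by comparing moduli, a large imaginary part by the
  component \<open>exp (- Re x) * sin (Im x)\<close>.\<close>

lemma norm_one_minus_exp_lower:
  fixes x :: complex
  assumes "0 < t" "t \<le> 1" "t \<le> norm x" "\<bar>Im x\<bar> \<le> 1"
  shows "t / 16 \<le> norm (1 - exp (- x))"
proof -
  define r y where "r = Re x" "y = Im x"
  have nx: "norm x \<le> \<bar>r\<bar> + \<bar>y\<bar>" unfolding r_y_def by (rule cmod_le)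
  have ge1: "\<bar>1 - exp (- r)\<bar> \<le> norm (1 - exp (- x))"
    using norm_triangle_ineq3[of 1 "exp (- x)"] by (simp add: r_y_def)
  have "Im (1 - exp (- x)) = exp (- r) * sin y" by (simp add: r_y_def Im_exp)
  then have ge2: "exp (- r) * \<bar>sin y\<bar> \<le> norm (1 - exp (- x))"
    using abs_Im_le_cmod[of "1 - exp (- x)"] by (simp add: abs_mult)
  show ?thesis
  proof (cases "\<bar>r\<bar> \<ge> t / 2")
    case True
    have "\<bar>1 - exp (- r)\<bar> \<ge> t / 16"
    proof (cases "r \<ge> 0")
      case True
      then have r: "r \<ge> t / 2" using \<open>\<bar>r\<bar> \<ge> t / 2\<close> by simp
      have "exp (- r) \<le> exp (- (t/2))" using r by simp
      also have "\<dots> = 1 / exp (t/2)" by (simp add: exp_minus field_simps)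
      also have "\<dots> \<le> 1 / (1 + t/2)" using assms(1) exp_ge_add_one_self[of "t/2"]
        by (intro divide_left_mono) auto
      also have "\<dots> \<le> 1 - t / 16"
      proof -
        have "t * t \<le> t * 1" using assms(1,2) by (intro mult_left_mono) auto
        then have "1 \<le> (1 - t / 16) * (1 + t / 2)" using assms(1) by (simp add: field_simps)
        then show ?thesis using assms(1) by (simp add: pos_divide_le_eq)
      qed
      finally show ?thesis by linarith
    next
      case False
      then have "exp (- r) \<ge> 1 + t / 2"
        using exp_ge_add_one_self[of "- r"] \<open>\<bar>r\<bar> \<ge> t / 2\<close> by linarith
      then show ?thesis using assms(1) by linarith
    qed
    then show ?thesis using ge1 by linarith
  next
    case False
    then have y: "\<bar>y\<bar> \<ge> t / 2" using nx assms(3) by linarith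
    have "\<bar>y\<bar> \<le> 1" using assms(4) by (simp add: r_y_def)
    \<comment> \<open>On [0, 1], which lies inside [0, pi / 3], the cosine is at least 1/2, so
      \<open>sin z - z / 2\<close> is nondecreasing there.\<close>
    have siny: "\<bar>sin y\<bar> \<ge> \<bar>y\<bar> / 2"
    proof -
      have "sin 0 - 0 / 2 \<le> sin \<bar>y\<bar> - \<bar>y\<bar> / 2"
      proof (rule DERIV_nonneg_imp_nondecreasing[of 0 "\<bar>y\<bar>" "\<lambda>z. sin z - z / 2"])
        fix z assume z: "0 \<le> z" "z \<le> \<bar>y\<bar>"
        have "cos (pi / 3) \<le> cos z"
          using z \<open>\<bar>y\<bar> \<le> 1\<close> pi_gt3 by (intro cos_monotone_0_pi_le) auto
        then have "0 \<le> cos z - 1 / 2" by (simp add: cos_60)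
        then show "\<exists>d. ((\<lambda>z. sin z - z / 2) has_real_derivative d) (at z) \<and> 0 \<le> d"
          by (intro exI[of _ "cos z - 1/2"]) (auto intro!: derivative_eq_intros)
      qed auto
      then have "sin \<bar>y\<bar> \<ge> \<bar>y\<bar> / 2" by simp
      then show ?thesis by (simp add: abs_if split: if_splits)
    qed
    have "exp (- r) \<ge> 1/4"
    proof -
      have "exp (- r) \<ge> 1 - r" using exp_ge_add_one_self[of "- r"] by simp
      then show ?thesis using False assms(2) by linarith
    qed
    then have "exp (- r) * \<bar>sin y\<bar> \<ge> 1/4 * (t/4)"
      using siny y assms(1) by (intro mult_mono) auto
    then show ?thesis using ge2 by simp
  qed
qed

section \<open>The moment problem\<close>

text \<open>\<open>gap\<close> says that \<open>\<mu>1 - j^2\<close> and \<open>\<mu>2 - k^2\<close>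
  differ for distinct \<open>j\<close>, \<open>k\<close>, so different modes never share an
  exponent. Equality \<open>\<mu>1 = \<mu>2\<close> is allowed; each mode then has a double
  exponent.\<close>

locale decoupled_spectrum =
  fixes \<mu>1 \<mu>2 :: complex
  assumes Re_le: "Re \<mu>1 \<le> 1" "Re \<mu>2 \<le> 1"
    and gap: "\<And>j k :: nat. j \<ge> 1 \<Longrightarrow> k \<ge> 1 \<Longrightarrow> j \<noteq> k \<Longrightarrow>
           \<mu>1 - \<mu>2 \<noteq> of_nat j ^ 2 - of_nat k ^ 2"
begin

text \<open>Differences of squares are integers, and only finitely many integers come within
  distance 1 of \<open>\<mu>1 - \<mu>2\<close>; the minimum over these is positive by
  \<open>gap\<close>. Exponents with the same eigenvalue differ by a nonzero integer, hence the cap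
  of \<open>\<kappa>\<close> at 1.\<close>

lemma gap_uniform:
  obtains \<kappa> :: real where "0 < \<kappa>" "\<kappa> \<le> 1"
    "\<And>j k \<nu> \<nu>'. j \<ge> 1 \<Longrightarrow> k \<ge> 1 \<Longrightarrow> j \<noteq> k \<Longrightarrow> \<nu> \<in> {\<mu>1, \<mu>2} \<Longrightarrow> \<nu>' \<in> {\<mu>1, \<mu>2} \<Longrightarrow>
       \<kappa> \<le> norm ((of_nat j ^ 2 - \<nu>') - (of_nat k ^ 2 - \<nu>) :: complex)"
proof -
  define \<delta> where "\<delta> = \<mu>1 - \<mu>2"
  define N where "N = \<lceil>norm \<delta> + 1\<rceil>"
  define D :: "int set" where "D = {int j ^ 2 - int k ^ 2 | j k. j \<ge> 1 \<and> k \<ge> 1 \<and> j \<noteq> k}"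
  define S where "S = (\<lambda>n. norm (of_int n - \<delta>)) ` (D \<inter> {-N..N})"
  have fin: "finite S" unfolding S_def by auto
  have pos: "s > 0" if s: "s \<in> S" for s
  proof -
    obtain n where n: "n \<in> D" "s = norm (of_int n - \<delta>)"
      using s unfolding S_def by blast
    then obtain j k :: nat where jk: "j \<ge> 1" "k \<ge> 1" "j \<noteq> k" "n = int j ^ 2 - int k ^ 2"
      unfolding D_def by blast
    then show ?thesis using n gap[OF jk(1-3)] by (auto simp: \<delta>_def)
  qed
  define \<kappa> where "\<kappa> = Min (insert 1 S)"
  have "0 < \<kappa>" unfolding \<kappa>_def using fin pos by simp
  have "\<kappa> \<le> 1" unfolding \<kappa>_def using fin by simp
  have main: "\<kappa> \<le> norm (of_int n - \<delta>)" if "n \<in> D" for n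
  proof (cases "n \<in> {-N..N}")
    case True
    then have "norm (of_int n - \<delta>) \<in> S" using that unfolding S_def by auto
    then show ?thesis unfolding \<kappa>_def using fin by simp
  next
    case False
    then have "\<bar>n\<bar> \<ge> N" by auto
    then have "norm \<delta> + 1 \<le> real_of_int \<bar>n\<bar>" unfolding N_def by linarith
    then have "1 \<le> norm (of_int n :: complex) - norm \<delta>" by simp
    also have "\<dots> \<le> norm (of_int n - \<delta>)" by (rule norm_triangle_ineq2)
    finally show ?thesis using \<open>\<kappa> \<le> 1\<close> by simp
  qed
  have D_sym: "j \<ge> 1 \<Longrightarrow> k \<ge> 1 \<Longrightarrow> j \<noteq> k \<Longrightarrow> int j ^ 2 - int k ^ 2 \<in> D" for j k :: nat
    unfolding D_def by blast
  have diag: "1 \<le> norm (of_nat j ^ 2 - of_nat k ^ 2 :: complex)" if "j \<noteq> k" for j k :: nat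
  proof -
    have "int j ^ 2 - int k ^ 2 \<noteq> 0" using that by simp
    then have "1 \<le> \<bar>int j ^ 2 - int k ^ 2\<bar>" by linarith
    then have "1 \<le> real_of_int \<bar>int j ^ 2 - int k ^ 2\<bar>" by linarith
    also have "\<dots> = norm (of_int (int j ^ 2 - int k ^ 2) :: complex)" by (simp only: norm_of_int of_int_abs)
    also have "\<dots> = norm (of_nat j ^ 2 - of_nat k ^ 2 :: complex)" by simp
    finally show ?thesis .
  qed
  have "\<kappa> \<le> norm ((of_nat j ^ 2 - \<nu>') - (of_nat k ^ 2 - \<nu>) :: complex)"
    if jk: "j \<ge> 1" "k \<ge> 1" "j \<noteq> k" and \<nu>: "\<nu> \<in> {\<mu>1, \<mu>2}" "\<nu>' \<in> {\<mu>1, \<mu>2}" for j k :: nat and \<nu> \<nu>'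
  proof -
    consider "\<nu> = \<nu>'" | "\<nu>' = \<mu>1" "\<nu> = \<mu>2" | "\<nu>' = \<mu>2" "\<nu> = \<mu>1" using \<nu> by auto
    then show ?thesis
    proof cases
      case 1
      then show ?thesis using diag[OF jk(3)] \<open>\<kappa> \<le> 1\<close> by simp
    next
      case 2
      have "\<kappa> \<le> norm (of_int (int j ^ 2 - int k ^ 2) - \<delta>)" by (rule main[OF D_sym[OF jk]])
      also have "of_int (int j ^ 2 - int k ^ 2) - \<delta> = (of_nat j ^ 2 - \<nu>') - (of_nat k ^ 2 - \<nu>)"
        using 2 by (simp add: \<delta>_def)
      finally show ?thesis .
    next
      case 3
      have "\<kappa> \<le> norm (of_int (int k ^ 2 - int j ^ 2) - \<delta>)"
        using jk by (intro main D_sym) auto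
      also have "of_int (int k ^ 2 - int j ^ 2) - \<delta> = - ((of_nat j ^ 2 - \<nu>') - (of_nat k ^ 2 - \<nu>))"
        using 3 by (simp add: \<delta>_def)
      finally show ?thesis by (simp only: norm_minus_cancel)
    qed
  qed
  then show ?thesis using that \<open>0 < \<kappa>\<close> \<open>\<kappa> \<le> 1\<close> by blast
qed

text \<open>Gives \<open>\<alpha> * norm (\<mu>1 - \<mu>2) \<le> 1\<close>: multiplied by a shift,
  the difference of two exponents keeps its imaginary part in [-1, 1], as
  \<open>norm_one_minus_exp_lower\<close> demands.\<close>

definition \<alpha> :: real where "\<alpha> = 1 / (1 + norm (\<mu>1 - \<mu>2))"

text \<open>The shifts are summable, so the infinite product of difference operators has compact support;
  on the other hand \<open>j\<^sup>2 * shift j\<close> grows fast enough for the coefficients \<open>rate_bound\<close> to be summable.\<close>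

definition shift :: "nat \<Rightarrow> real" where "shift j = \<alpha> * real j powr (- 3 / 2)"

definition rate_bound :: "nat \<Rightarrow> real" where "rate_bound j = exp (- (real j ^ 2 - 1) * shift j)"

lemma \<alpha>_pos: "0 < \<alpha>" "\<alpha> \<le> 1"
  by (auto simp: \<alpha>_def divide_simps add_pos_nonneg intro: add_pos_nonneg)

lemma shift_nonneg: "0 \<le> shift j" using \<alpha>_pos by (simp add: shift_def)

lemma shift_pos: "1 \<le> j \<Longrightarrow> 0 < shift j" using \<alpha>_pos by (simp add: shift_def)

lemma shift_le_1: "shift j \<le> 1"
proof (cases "j = 0")
  case False
  then have "real j powr (- 3 / 2) \<le> real j powr 0" by (intro powr_mono) auto
  then have "real j powr (- 3 / 2) \<le> 1" using False by simp
  then show ?thesis using \<alpha>_pos mult_mono[of \<alpha> 1 "real j powr (- 3 / 2)" 1] by (simp add: shift_def)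
qed (simp add: shift_def)

lemma summable_shift: "summable shift"
  unfolding shift_def[abs_def] by (intro summable_mult) (simp add: summable_real_powr_iff)

lemma rate_bound_pos: "0 \<le> rate_bound j" by (simp add: rate_bound_def)

lemma rate_bound_le_1: "1 \<le> j \<Longrightarrow> rate_bound j \<le> 1"
  using mult_nonpos_nonneg[OF _ shift_nonneg[of j], of "1 - real j ^ 2"] one_le_power[of "real j" 2]
  by (simp add: rate_bound_def)

lemma square_mult_shift: "1 \<le> j \<Longrightarrow> real j ^ 2 * shift j = \<alpha> * sqrt j"
proof -
  assume "1 \<le> j"
  then have "real j ^ 2 * real j powr (- 3 / 2) = real j powr (1/2)"
    by (simp add: powr_add[symmetric] flip: powr_numeral)
  then show ?thesis using \<open>1 \<le> j\<close> by (simp add: shift_def powr_half_sqrt)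
qed

text \<open>The exponent \<open>(j^2 - 1) * shift j\<close> is at least
  \<open>\<alpha> * sqrt j / 2\<close> for \<open>j \<ge> 2\<close>, and
  \<open>(1 + y / 4) ^ 4 \<le> exp y\<close> turns this into decay of order \<open>1 / j^2\<close>;
  4096 is \<open>8 ^ 4\<close>.\<close>

lemma summable_rate_bound: "summable rate_bound"
proof (rule summable_comparison_test_ev)
  show "summable (\<lambda>j. 4096 / \<alpha> ^ 4 * (1 / real j ^ 2))"
    by (intro summable_mult) (use inverse_power_summable[of 2, where 'a=real] in \<open>simp add: divide_inverse\<close>)
  show "\<forall>\<^sub>F j in sequentially. norm (rate_bound j) \<le> 4096 / \<alpha> ^ 4 * (1 / real j ^ 2)"
    using eventually_ge_at_top[of 2]
  proof eventually_elim
    case (elim j)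
    define y where "y = (real j ^ 2 - 1) * shift j"
    have "real j ^ 2 \<ge> 2 ^ 2" using elim by (intro power_mono) auto
    then have "real j ^ 2 / 2 \<le> real j ^ 2 - 1" by simp
    then have "(real j ^ 2 / 2) * shift j \<le> y"
      unfolding y_def by (rule mult_right_mono) (rule shift_nonneg)
    then have y: "\<alpha> * sqrt j / 2 \<le> y" using square_mult_shift[of j] elim by simp
    have "0 < \<alpha> * sqrt j / 2" using \<alpha>_pos elim by simp
    then have "0 < y" using y by linarith
    have "(\<alpha> * sqrt j / 8) ^ 4 \<le> (1 + y / 4) ^ 4"
      using y \<alpha>_pos by (intro power_mono) auto
    also have "\<dots> \<le> exp y"
      using exp_ge_one_plus_x_over_n_power_n[of 4 y] \<open>0 < y\<close> by simp
    finally have "exp y \<ge> \<alpha> ^ 4 * real j ^ 2 / 4096"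
    proof -
      assume "(\<alpha> * sqrt j / 8) ^ 4 \<le> exp y"
      moreover have "(sqrt j) ^ 4 = real j ^ 2"
        using power_mult[of "sqrt j" 2 2] by simp
      ultimately show ?thesis by (simp add: power_mult_distrib power_divide)
    qed
    moreover have "0 < \<alpha> ^ 4 * real j ^ 2 / 4096" using \<alpha>_pos elim by simp
    ultimately have "1 / exp y \<le> 1 / (\<alpha> ^ 4 * real j ^ 2 / 4096)"
      by (intro divide_left_mono) (auto intro: mult_pos_pos)
    then show ?case
      by (simp add: rate_bound_def y_def exp_minus inverse_eq_divide algebra_simps exp_diff)
  qed
qed

section \<open>Difference operators and their truncated products\<close>

definition step :: "complex \<Rightarrow> real \<Rightarrow> (real \<Rightarrow> complex) \<Rightarrow> real \<Rightarrow> complex" where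
  "step q a f = (\<lambda>s. f (s + a) - q * f s)"

text \<open>The factor by which a translation by \<open>shift j\<close> multiplies the moment
  against \<open>exp ((j^2 - \<nu>) s)\<close>; a \<open>step\<close> with exactly this
  \<open>q\<close> annihilates that moment.\<close>

definition rate :: "complex \<Rightarrow> nat \<Rightarrow> complex" where
  "rate \<nu> j = exp (- ((of_nat j ^ 2 - \<nu>) * of_real (shift j)))"

text \<open>Stage \<open>k\<close> is skipped so that mode \<open>k\<close> survives. At every other
  stage the two steps share one shift and form a double zero when \<open>\<mu>1 = \<mu>2\<close>,
  which is what removes the weight carrying an extra factor \<open>s\<close>.\<close>

fun annihilate :: "nat \<Rightarrow> (real \<Rightarrow> complex) \<Rightarrow> nat \<Rightarrow> real \<Rightarrow> complex" where
  "annihilate k f 0 = f"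
| "annihilate k f (Suc n) = (if Suc n = k then annihilate k f n else
     step (rate \<mu>2 (Suc n)) (shift (Suc n)) (step (rate \<mu>1 (Suc n)) (shift (Suc n)) (annihilate k f n)))"

text \<open>One constant serves as sup bound and as Lipschitz constant: the Lipschitz part makes
  \<open>f (s + a) - f s\<close> small for small \<open>a\<close>, which lets the infinite product
  converge.\<close>

definition size_bound :: "real \<Rightarrow> (real \<Rightarrow> complex) \<Rightarrow> bool" where
  "size_bound K f \<longleftrightarrow> (\<forall>s. norm (f s) \<le> K) \<and> (\<forall>s t. norm (f s - f t) \<le> K * \<bar>s - t\<bar>)"

lemma size_bound_nonneg: "size_bound K f \<Longrightarrow> 0 \<le> K"
  unfolding size_bound_def by (meson norm_ge_zero order_trans)

lemma size_bound_mono: "size_bound K f \<Longrightarrow> K \<le> K' \<Longrightarrow> size_bound K' f"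
  unfolding size_bound_def by (meson abs_ge_zero mult_right_mono order_trans)

lemma step_size_bound:
  assumes f: "size_bound K f" and q: "norm q \<le> b"
  shows "size_bound ((1 + b) * K) (step q a f)"
  unfolding size_bound_def
proof (intro conjI allI)
  have K: "0 \<le> K" by (rule size_bound_nonneg[OF f])
  fix s t
  have "norm (step q a f s) \<le> norm (f (s + a)) + norm q * norm (f s)"
    unfolding step_def by (metis norm_mult norm_triangle_ineq4)
  also have "\<dots> \<le> K + b * K"
    using f K q unfolding size_bound_def by (intro add_mono mult_mono) (auto intro: order_trans[OF norm_ge_zero q])
  finally show "norm (step q a f s) \<le> (1 + b) * K" by (simp add: algebra_simps)
  have "step q a f s - step q a f t = (f (s + a) - f (t + a)) - q * (f s - f t)"
    by (simp add: step_def algebra_simps)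
  then have "norm (step q a f s - step q a f t) \<le> norm (f (s + a) - f (t + a)) + norm q * norm (f s - f t)"
    by (metis norm_mult norm_triangle_ineq4)
  also have "\<dots> \<le> K * \<bar>s - t\<bar> + b * (K * \<bar>s - t\<bar>)"
  proof (intro add_mono mult_mono)
    show "norm (f (s + a) - f (t + a)) \<le> K * \<bar>s - t\<bar>"
      using f unfolding size_bound_def by (metis add_diff_cancel_right)
  qed (use f q in \<open>auto simp: size_bound_def intro: order_trans[OF norm_ge_zero q]\<close>)
  finally show "norm (step q a f s - step q a f t) \<le> (1 + b) * K * \<bar>s - t\<bar>"
    by (simp add: algebra_simps)
qed

lemma step_close:
  assumes f: "size_bound K f" and q: "norm q \<le> b" and a: "0 \<le> a"
  shows "norm (step q a f s - f s) \<le> K * (a + b)"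
proof -
  have K: "0 \<le> K" by (rule size_bound_nonneg[OF f])
  have "step q a f s - f s = (f (s + a) - f s) - q * f s" by (simp add: step_def)
  then have "norm (step q a f s - f s) \<le> norm (f (s + a) - f s) + norm q * norm (f s)"
    by (metis norm_mult norm_triangle_ineq4)
  also have "\<dots> \<le> K * a + b * K"
  proof (intro add_mono mult_mono)
    show "norm (f (s + a) - f s) \<le> K * a"
      using f a unfolding size_bound_def by (metis abs_of_nonneg add_diff_cancel_left')
  qed (use f q in \<open>auto simp: size_bound_def intro: order_trans[OF norm_ge_zero q]\<close>)
  finally show ?thesis by (simp add: algebra_simps)
qed

lemma norm_rate_le:
  assumes "\<nu> \<in> {\<mu>1, \<mu>2}"
  shows "norm (rate \<nu> j) \<le> rate_bound j"
proof -
  have "Re \<nu> \<le> 1" using assms Re_le by auto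
  then have "(real j ^ 2 - 1) * shift j \<le> (real j ^ 2 - Re \<nu>) * shift j"
    using shift_nonneg by (intro mult_right_mono) auto
  moreover have "Re ((of_nat j)^2 :: complex) = real j ^ 2"
    by (metis Re_complex_of_real of_real_of_nat_eq of_real_power)
  ultimately show ?thesis
    by (simp add: rate_def rate_bound_def algebra_simps)
qed

text \<open>Bounds the infinite product of \<open>(1 + rate_bound j)^2\<close>, the growth of the
  constant in \<open>size_bound\<close> under all steps; index 0 contributes only a fixed
  factor.\<close>

definition total_variation :: real where "total_variation = exp (2 * suminf rate_bound)"

lemma total_variation_pos: "0 < total_variation" by (simp add: total_variation_def)

lemma annihilate_size_bound:
  assumes f: "size_bound K f"
  shows "size_bound (K * total_variation) (annihilate k f n)"
proof -
  have K: "0 \<le> K" by (rule size_bound_nonneg[OF f])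
  have "size_bound (K * exp (\<Sum>j<Suc n. 2 * rate_bound j)) (annihilate k f n)"
  proof (induction n)
    case 0
    have "K * 1 \<le> K * exp (\<Sum>j<Suc 0. 2 * rate_bound j)"
      using K by (intro mult_left_mono) (auto simp: rate_bound_pos)
    then show ?case using size_bound_mono[OF f] by simp
  next
    case (Suc n)
    let ?b = "rate_bound (Suc n)" and ?K = "K * exp (\<Sum>j<Suc n. 2 * rate_bound j)"
    have "(1 + ?b) * ((1 + ?b) * ?K) \<le> exp ?b * (exp ?b * ?K)"
      using K rate_bound_pos[of "Suc n"] exp_ge_add_one_self[of ?b] by (intro mult_mono) auto
    also have "\<dots> = K * exp (\<Sum>j<Suc (Suc n). 2 * rate_bound j)"
      by (simp add: exp_add[symmetric] algebra_simps)
    finally have le: "(1 + ?b) * ((1 + ?b) * ?K) \<le> K * exp (\<Sum>j<Suc (Suc n). 2 * rate_bound j)" .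
    have "1 * ?K \<le> (1 + ?b) * ((1 + ?b) * ?K)"
      using K rate_bound_pos[of "Suc n"] mult_mono[of 1 "(1 + ?b) * (1 + ?b)" ?K ?K] mult_mono[of 1 "1 + ?b" 1 "1 + ?b"]
      by (simp add: mult.assoc)
    then have "?K \<le> K * exp (\<Sum>j<Suc (Suc n). 2 * rate_bound j)" using le by simp
    then have *: "size_bound (K * exp (\<Sum>j<Suc (Suc n). 2 * rate_bound j)) (annihilate k f n)"
      by (rule size_bound_mono[OF Suc.IH])
    have "size_bound ((1 + ?b) * ((1 + ?b) * ?K)) (step (rate \<mu>2 (Suc n)) (shift (Suc n))
        (step (rate \<mu>1 (Suc n)) (shift (Suc n)) (annihilate k f n)))"
      by (intro step_size_bound Suc.IH norm_rate_le) simp_all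
    from * size_bound_mono[OF this le] show ?case unfolding annihilate.simps by presburger
  qed
  moreover have "(\<Sum>j<Suc n. 2 * rate_bound j) \<le> 2 * suminf rate_bound"
    using sum_le_suminf[OF summable_rate_bound, of "{..<Suc n}"]
    by (simp add: sum_distrib_left[symmetric] rate_bound_pos del: sum.lessThan_Suc)
  ultimately show ?thesis
    unfolding total_variation_def using K by (elim size_bound_mono) (intro mult_left_mono, auto)
qed

text \<open>The inner step moves the function by at most \<open>?K * (?a + ?b)\<close>, the outer
  one by at most twice that since \<open>1 + rate_bound j \<le> 2\<close>; hence the factor 3. The
  right-hand side is summable over \<open>n\<close>, as \<open>C1_supported_limit\<close>
  requires.\<close>

lemma annihilate_close:
  assumes f: "size_bound K f"
  shows "norm (annihilate k f (Suc n) s - annihilate k f n s)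
           \<le> 3 * (K * total_variation) * (shift (Suc n) + rate_bound (Suc n))"
proof -
  let ?b = "rate_bound (Suc n)" and ?a = "shift (Suc n)" and ?K = "K * total_variation"
  let ?g = "annihilate k f n"
  have g: "size_bound ?K ?g" by (rule annihilate_size_bound[OF f])
  have K: "0 \<le> ?K" by (rule size_bound_nonneg[OF g])
  have b: "0 \<le> ?b" "?b \<le> 1" using rate_bound_pos rate_bound_le_1 by auto
  have a: "0 \<le> ?a" by (rule shift_nonneg)
  let ?g1 = "step (rate \<mu>1 (Suc n)) ?a ?g"
  have 1: "norm (?g1 s - ?g s) \<le> ?K * (?a + ?b)"
    by (rule step_close[OF g norm_rate_le a]) simp
  have 2: "norm (step (rate \<mu>2 (Suc n)) ?a ?g1 s - ?g1 s) \<le> ((1 + ?b) * ?K) * (?a + ?b)"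
    by (intro step_close[OF step_size_bound[OF g]] norm_rate_le a) simp_all
  also have "\<dots> \<le> (2 * ?K) * (?a + ?b)" using a b K by (intro mult_right_mono) auto
  finally have "norm ((step (rate \<mu>2 (Suc n)) ?a ?g1 s - ?g1 s) + (?g1 s - ?g s)) \<le> 3 * ?K * (?a + ?b)"
    using 1 by (intro order_trans[OF norm_triangle_ineq]) (simp add: algebra_simps)
  moreover have "0 \<le> 3 * ?K * (?a + ?b)"
    using mult_nonneg_nonneg[OF K add_nonneg_nonneg[OF a b(1)]] by (simp only: mult.assoc)
  moreover have "annihilate k f (Suc n) s = (if Suc n = k then ?g s else step (rate \<mu>2 (Suc n)) ?a ?g1 s)"
    unfolding annihilate.simps by (rule if_distrib[of "\<lambda>g. g s"])
  ultimately show ?thesis by (cases "Suc n = k") (simp_all only: if_True if_False simp_thms diff_self norm_zero diff_add_cancel add_diff_eq)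
qed

lemma step_C1_supported:
  assumes "C1_supported a b f f'" "0 \<le> c" "a \<le> b"
  shows "C1_supported (a - c) b (step q c f) (step q c f')"
proof -
  have "C1_supported (a - c) b (\<lambda>s. f (s + c)) (\<lambda>s. f' (s + c))"
    by (rule C1_supported_mono[OF C1_supported_shift[OF assms(1)]]) (use assms in auto)
  moreover have "C1_supported (a - c) b (\<lambda>s. (- q) * f s) (\<lambda>s. (- q) * f' s)"
    by (rule C1_supported_mono[OF C1_supported_cmult[OF assms(1)]]) (use assms in auto)
  ultimately show ?thesis
    unfolding step_def using C1_supported_add by fastforce
qed

text \<open>A step extends the support to the left by its shift and keeps the right end; two steps
  per stage give twice the sum of all shifts.\<close>

lemma annihilate_C1_supported:
  assumes "C1_supported a b f f'" "a \<le> b"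
  shows "C1_supported (a - 2 * suminf shift) b (annihilate k f n) (annihilate k f' n)"
proof -
  have "C1_supported (a - (\<Sum>j<Suc n. 2 * shift j)) b (annihilate k f n) (annihilate k f' n)"
  proof (induction n)
    case 0
    show ?case using C1_supported_mono[OF assms(1)] shift_nonneg by simp
  next
    case (Suc n)
    let ?a = "shift (Suc n)" and ?A = "a - (\<Sum>j<Suc n. 2 * shift j)"
    have A: "?A \<le> b" using assms(2) sum_nonneg[of "{..<Suc n}" "\<lambda>j. 2 * shift j"] shift_nonneg
      by (auto simp del: sum.lessThan_Suc)
    have "C1_supported (?A - ?a - ?a) b (step q' ?a (step q ?a (annihilate k f n)))
       (step q' ?a (step q ?a (annihilate k f' n)))" for q q'
      by (intro step_C1_supported Suc.IH shift_nonneg A) (use A shift_nonneg[of "Suc n"] in linarith)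
    moreover have eq: "?A - ?a - ?a = a - (\<Sum>j<Suc (Suc n). 2 * shift j)" by simp
    moreover have "C1_supported (?A - ?a - ?a) b (annihilate k f n) (annihilate k f' n)"
      by (rule C1_supported_mono[OF Suc.IH]) (use shift_nonneg[of "Suc n"] in auto)
    ultimately show ?case unfolding eq annihilate.simps by presburger
  qed
  moreover have "(\<Sum>j<Suc n. 2 * shift j) \<le> 2 * suminf shift"
    using sum_le_suminf[OF summable_shift, of "{..<Suc n}"]
    by (simp add: sum_distrib_left[symmetric] shift_nonneg del: sum.lessThan_Suc)
  ultimately show ?thesis by (elim C1_supported_mono) auto
qed

section \<open>Exponential weights and the size of the surviving moment\<close>

definition exp_weight :: "complex \<Rightarrow> real \<Rightarrow> complex" where
  "exp_weight z s = exp (z * of_real s)"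

lemma exp_weight_cont [continuous_intros]: "continuous_on A (exp_weight z)"
  unfolding exp_weight_def[abs_def] by (intro continuous_intros)

lemma moment_step:
  assumes e: "continuous_on UNIV e" and f: "C1_supported a b f f'"
  shows "moment e (step q c f) = moment (\<lambda>s. e (s - c)) f - q * moment e f"
proof -
  define A B where "A = min a (a - c)" "B = max b (b - c)"
  have "C1_supported A B (\<lambda>s. f (s + c)) (\<lambda>s. f' (s + c))"
    by (rule C1_supported_mono[OF C1_supported_shift[OF f]]) (auto simp: A_B_def)
  moreover have "C1_supported A B (\<lambda>s. q * f s) (\<lambda>s. q * f' s)"
    by (rule C1_supported_mono[OF C1_supported_cmult[OF f]]) (auto simp: A_B_def)
  ultimately show ?thesis
    unfolding step_def by (subst moment_diff[OF e]) (auto simp: moment_shift moment_cmult_right)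
qed

lemma exp_weight_shift: "exp_weight z (s - c) = exp (- (z * of_real c)) * exp_weight z s"
  by (simp add: exp_weight_def exp_add[symmetric] algebra_simps)

lemma moment_exp_step:
  assumes f: "C1_supported a b f f'"
  shows "moment (exp_weight z) (step q c f) = (exp (- (z * of_real c)) - q) * moment (exp_weight z) f"
  by (subst moment_step[OF exp_weight_cont f])
     (simp add: exp_weight_shift moment_cmult_left left_diff_distrib)

text \<open>Each factor is \<open>exp (- (k^2 - \<nu>) a) (1 - exp (- x))\<close> with
  \<open>a = shift j\<close> and \<open>x = ((j^2 - \<nu>') - (k^2 - \<nu>)) a\<close>. The
  prefactors multiply to \<open>exp (- O(k^2))\<close> because the shifts are summable. For
  \<open>j\<close> up to \<open>m * k\<close> the spectral gap gives
  \<open>norm x \<ge> \<kappa> a\<close>, so the factor is at least a multiple of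
  \<open>j powr (- 3 / 2)\<close>, and there are only \<open>m * k\<close> of these. For larger
  \<open>j\<close> the real part of \<open>x\<close> grows like \<open>sqrt j\<close> and the
  product of the factors converges.\<close>

lemma factor_lower_bound:
  obtains C where "0 \<le> C" "\<And>k n \<nu> \<nu>'. k \<ge> 1 \<Longrightarrow> \<nu> \<in> {\<mu>1, \<mu>2} \<Longrightarrow> \<nu>' \<in> {\<mu>1, \<mu>2} \<Longrightarrow>
     exp (- C * real k ^ 2) \<le>
       (\<Prod>j\<in>{1..n} - {k}. norm (exp (- ((of_nat k ^ 2 - \<nu>) * of_real (shift j))) - rate \<nu>' j))"
proof -
  obtain \<kappa> where \<kappa>: "0 < \<kappa>" "\<kappa> \<le> 1"
    "\<And>j k \<nu> \<nu>'. j \<ge> 1 \<Longrightarrow> k \<ge> 1 \<Longrightarrow> j \<noteq> k \<Longrightarrow> \<nu> \<in> {\<mu>1, \<mu>2} \<Longrightarrow> \<nu>' \<in> {\<mu>1, \<mu>2} \<Longrightarrow>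
       \<kappa> \<le> norm ((of_nat j ^ 2 - \<nu>') - (of_nat k ^ 2 - \<nu>) :: complex)"
    using gap_uniform by blast
  define d where "d = norm (\<mu>1 - \<mu>2)"
  have d: "0 \<le> d" "\<alpha> * d \<le> 1"
    unfolding d_def \<alpha>_def by (auto simp: divide_simps) (use norm_ge_zero[of "\<mu>1 - \<mu>2"] in linarith)+
  \<comment> \<open>For \<open>j > m * k\<close> this gives \<open>j^2 \<ge> 2 (1 + d) k^2\<close>,
    so that the real part of the difference of the exponents is at least
    \<open>j^2 / 2\<close>.\<close>
  define m where "m = nat \<lceil>2 * (1 + d)\<rceil>"
  have m: "2 * (1 + d) \<le> real m" unfolding m_def by linarith
  \<comment> \<open>\<open>c0 * j powr (- 3 / 2)\<close> is the bound of
    \<open>norm_one_minus_exp_lower\<close> for \<open>t = \<kappa> * shift j\<close>, and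
    \<open>C1\<close> is chosen so that \<open>exp (- C1 * j)\<close> stays below it for all
    \<open>j \<ge> 1\<close>. In \<open>C2\<close>, 216 is \<open>27 * 2 ^ 3\<close>, from
    \<open>y ^ 3 / 27 \<le> exp y - 1\<close> with \<open>y = \<alpha> * sqrt j / 2\<close>.\<close>
  define c0 where "c0 = \<kappa> * \<alpha> / 16"
  have c0: "0 < c0" "c0 \<le> 1/16" using \<kappa> \<alpha>_pos mult_mono[of \<kappa> 1 \<alpha> 1] by (auto simp: c0_def)
  define C1 where "C1 = 2 - ln c0"
  have C1: "2 \<le> C1" using c0 by (simp add: C1_def)
  define C2 where "C2 = 216 / \<alpha> ^ 4"
  have C2: "0 \<le> C2" using \<alpha>_pos by (simp add: C2_def)
  define h where "h k j = (if j \<le> m * k then C1 * real j else 0) + C2 * shift j" for k j :: nat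
  define M where "M = Max {norm \<mu>1, norm \<mu>2}"
  have M: "0 \<le> M" "\<nu> \<in> {\<mu>1, \<mu>2} \<Longrightarrow> norm \<nu> \<le> M" for \<nu> by (auto simp: M_def max_def)
  have fac: "exp (- h k j) \<le> norm (1 - exp (- (((of_nat j ^ 2 - \<nu>') - (of_nat k ^ 2 - \<nu>)) * of_real (shift j))))"
    if k: "k \<ge> 1" and \<nu>: "\<nu> \<in> {\<mu>1, \<mu>2}" and \<nu>': "\<nu>' \<in> {\<mu>1, \<mu>2}" and j: "j \<ge> 1" "j \<noteq> k" for k \<nu> \<nu>' j
  proof -
    define w where "w = (of_nat j ^ 2 - \<nu>') - (of_nat k ^ 2 - \<nu>)"
    define x where "x = w * of_real (shift j)"
    have diff: "norm (\<nu> - \<nu>') \<le> d" using \<nu> \<nu>' d by (auto simp: d_def norm_minus_commute)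
    have [simp]: "Im (of_nat i ^ 2 :: complex) = 0" "Re (of_nat i ^ 2 :: complex) = real i ^ 2" for i
      by (metis Im_complex_of_real of_real_of_nat_eq of_real_power, metis Re_complex_of_real of_real_of_nat_eq of_real_power)
    have "\<bar>Im w\<bar> \<le> d" using diff abs_Im_le_cmod[of "\<nu> - \<nu>'"] by (simp add: w_def)
    then have "\<bar>Im x\<bar> \<le> d * shift j"
      using shift_nonneg[of j] by (simp add: x_def abs_mult mult_right_mono)
    also have "\<dots> \<le> d * \<alpha>"
    proof -
      have "real j powr (- 3 / 2) \<le> real j powr 0" using j by (intro powr_mono) auto
      then have "shift j \<le> \<alpha> * 1" unfolding shift_def using j \<alpha>_pos by (intro mult_left_mono) auto
      then show ?thesis using d by (simp add: mult_left_mono)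
    qed
    finally have Imx: "\<bar>Im x\<bar> \<le> 1" using d by (simp add: mult.commute)
    show ?thesis
    proof (cases "j \<le> m * k")
      case True
      have "\<kappa> * shift j \<le> norm x"
        using \<kappa>(3)[OF j(1) k j(2) \<nu> \<nu>'] shift_nonneg[of j]
        by (simp add: x_def w_def norm_mult mult_right_mono)
      then have 1: "\<kappa> * shift j / 16 \<le> norm (1 - exp (- x))"
        using \<kappa> shift_pos[OF j(1)] shift_le_1[of j] mult_mono[of \<kappa> 1 "shift j" 1] Imx
        by (intro norm_one_minus_exp_lower) auto
      have "exp (- (C1 * real j)) \<le> exp (- ((2 - ln c0) * 1) - 2 * (real j - 1))"
      proof -
        have "2 * (real j - 1) + C1 \<le> C1 * (real j - 1) + C1"
          using C1 j by (intro add_mono mult_right_mono) auto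
        then show ?thesis by (simp add: C1_def algebra_simps)
      qed
      also have "\<dots> = c0 * exp (- 2 * real j)"
        using c0 by (simp add: exp_diff exp_add exp_minus field_simps flip: exp_add)
      also have "\<dots> \<le> c0 * real j powr (- 3 / 2)"
      proof (rule mult_left_mono)
        have "real j powr (3/2) \<le> real j powr 2" using j by (intro powr_mono) auto
        also have "\<dots> = real j ^ 2" by (simp add: powr_numeral)
        also have "\<dots> \<le> (exp (real j)) ^ 2"
          using exp_ge_add_one_self[of "real j"] by (intro power_mono) (linarith, simp)
        also have "\<dots> = exp (2 * real j)" by (simp add: exp_double)
        finally have "1 / exp (2 * real j) \<le> 1 / real j powr (3/2)"
          using j by (intro divide_left_mono) auto
        then show "exp (- 2 * real j) \<le> real j powr (- 3 / 2)"
          by (simp add: exp_minus powr_minus inverse_eq_divide)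
      qed (use c0 in auto)
      also have "\<dots> = \<kappa> * shift j / 16" by (simp add: c0_def shift_def)
      finally have "exp (- (C1 * real j)) \<le> norm (1 - exp (- x))" using 1 by linarith
      moreover have "exp (- h k j) \<le> exp (- (C1 * real j))"
        using True C2 shift_nonneg[of j] by (simp add: h_def)
      ultimately show ?thesis unfolding x_def w_def by linarith
    next
      case False
      have jk: "real m * real k \<le> real j" using False
        by (metis less_imp_le not_le of_nat_le_iff of_nat_mult)
      have "2 * (1 + d) \<le> real m ^ 2"
      proof -
        have "real m * 1 \<le> real m * real m" using m d by (intro mult_left_mono) auto
        then show ?thesis using m by (simp add: power2_eq_square)
      qed
      then have "2 * (1 + d) * real k ^ 2 \<le> (real m * real k) ^ 2"
        by (simp add: power_mult_distrib mult_right_mono)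
      also have "\<dots> \<le> real j ^ 2" using jk by (intro power_mono) auto
      finally have jj: "2 * (1 + d) * real k ^ 2 \<le> real j ^ 2" .
      have "1 \<le> real k ^ 2" using k by simp
      then have "d * 1 \<le> d * real k ^ 2" using d by (intro mult_left_mono) auto
      then have "real k ^ 2 + d \<le> real j ^ 2 / 2" using jj by (simp add: algebra_simps)
      moreover have "Re w \<ge> real j ^ 2 - real k ^ 2 - d"
        using diff abs_Re_le_cmod[of "\<nu> - \<nu>'"] by (simp add: w_def)
      ultimately have "real j ^ 2 / 2 \<le> Re w" by linarith
      then have "real j ^ 2 / 2 * shift j \<le> Re x"
        using mult_right_mono[OF _ shift_nonneg[of j]] by (simp add: x_def del: times_divide_eq_left)
      then have Rex: "\<alpha> * sqrt j / 2 \<le> Re x" using square_mult_shift[OF j(1)] by simp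
      define y where "y = \<alpha> * sqrt j / 2"
      have y: "0 < y" using \<alpha>_pos j by (simp add: y_def)
      have "y ^ 3 / 27 \<le> (1 + y / 3) ^ 3 - 1"
      proof -
        have "(1 + y / 3) ^ 3 = 1 + y + y\<^sup>2 / 3 + y ^ 3 / 27"
          by (simp add: power3_eq_cube power2_eq_square field_simps)
        then show ?thesis using y by simp
      qed
      also have "\<dots> \<le> exp y - 1"
        using exp_ge_one_plus_x_over_n_power_n[of 3 y] y by simp
      finally have ey: "y ^ 3 / 27 \<le> exp y - 1" .
      have jp: "sqrt j ^ 3 = real j powr (3/2)"
      proof -
        have "sqrt j ^ 3 = (real j powr (1/2)) ^ 3" by (subst powr_half_sqrt) auto
        also have "\<dots> = real j powr (real 3 * (1/2))" by (rule powr_power) (use j in auto)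
        finally show ?thesis by simp
      qed
      have jp': "real j * sqrt j = real j powr (3/2)" using jp by (simp add: power3_eq_cube)
      have ypos: "0 < y ^ 3 / 27" using y by simp
      have "1 / (exp y - 1) \<le> 1 / (y ^ 3 / 27)"
        using ey ypos by (intro divide_left_mono) auto
      also have "\<dots> = C2 * shift j"
        using \<alpha>_pos j by (simp add: y_def power_divide power_mult_distrib jp jp' C2_def shift_def powr_minus field_simps eval_nat_numeral)
      finally have t: "1 / (exp y - 1) \<le> C2 * shift j" .
      \<comment> \<open>\<open>1 - exp (- y)\<close> is the reciprocal of
        \<open>1 + 1 / (exp y - 1)\<close>, so an exponential upper bound for the latter is the
        lower bound wanted for the factor.\<close>
      have "1 + 1 / (exp y - 1) \<le> exp (C2 * shift j)"
        using t exp_ge_add_one_self[of "C2 * shift j"] by linarith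
      moreover have "0 < 1 + 1 / (exp y - 1)" using ey ypos by (intro add_pos_pos) auto
      ultimately have "1 / exp (C2 * shift j) \<le> 1 / (1 + 1 / (exp y - 1))"
        by (intro divide_left_mono) auto
      also have "\<dots> = 1 - exp (- y)"
        using ey ypos by (simp add: exp_minus field_simps)
      also have "\<dots> \<le> 1 - exp (- Re x)" using Rex by (simp add: y_def)
      also have "\<dots> \<le> norm (1 - exp (- x))"
        using norm_triangle_ineq2[of 1 "exp (- x)"] by simp
      finally have "1 / exp (C2 * shift j) \<le> norm (1 - exp (- x))" .
      then show ?thesis using False
        unfolding x_def w_def by (simp add: h_def exp_minus inverse_eq_divide)
    qed
  qed
  define S where "S = suminf shift"
  have S: "0 \<le> S" "(\<Sum>j=1..n. shift j) \<le> S" for n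
    unfolding S_def using summable_shift shift_nonneg by (auto intro: suminf_nonneg sum_le_suminf)
  \<comment> \<open>Three sources: the prefactors, at most \<open>m * k\<close> factors of size at
    least \<open>exp (- C1 * m * k)\<close>, and the convergent tail.\<close>
  define C where "C = (1 + M) * S + C1 * real m ^ 2 + C2 * S"
  show ?thesis
  proof (rule that)
    show "0 \<le> C" using M(1) S(1) C1 C2 by (auto simp: C_def)
    fix k n :: nat and \<nu> \<nu>' assume k: "k \<ge> 1" and \<nu>: "\<nu> \<in> {\<mu>1, \<mu>2}" and \<nu>': "\<nu>' \<in> {\<mu>1, \<mu>2}"
    define F where "F j = norm (exp (- ((of_nat k ^ 2 - \<nu>) * of_real (shift j))) - rate \<nu>' j)" for j
    have k2: "1 \<le> real k ^ 2" using k by simp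
    have F: "exp (- ((real k ^ 2 + M) * shift j + h k j)) \<le> F j" if j: "j \<in> {1..n} - {k}" for j
    proof -
      define x where "x = ((of_nat j ^ 2 - \<nu>') - (of_nat k ^ 2 - \<nu>)) * of_real (shift j)"
      have "exp (- ((of_nat k ^ 2 - \<nu>) * of_real (shift j))) - rate \<nu>' j
          = exp (- ((of_nat k ^ 2 - \<nu>) * of_real (shift j))) * (1 - exp (- x))"
        by (simp add: rate_def x_def right_diff_distrib exp_add[symmetric]) (simp add: algebra_simps)
      then have Fj: "F j = exp (- Re ((of_nat k ^ 2 - \<nu>) * of_real (shift j))) * norm (1 - exp (- x))"
        by (simp add: F_def norm_mult)
      have Rk: "Re (of_nat k ^ 2 :: complex) = real k ^ 2"
        by (metis Re_complex_of_real of_real_of_nat_eq of_real_power)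
      have "- M \<le> Re \<nu>" using M(2)[OF \<nu>] abs_Re_le_cmod[of \<nu>] by linarith
      then have "Re ((of_nat k ^ 2 - \<nu>) * of_real (shift j)) \<le> (real k ^ 2 + M) * shift j"
        using shift_nonneg[of j] Rk by (simp add: mult_right_mono)
      then have "exp (- ((real k ^ 2 + M) * shift j)) * exp (- h k j) \<le> F j"
        unfolding Fj x_def using j k \<nu> \<nu>' by (intro mult_mono fac) auto
      then show ?thesis by (simp add: exp_add[symmetric])
    qed
    have h_nonneg: "0 \<le> h k j" for j using C1 C2 shift_nonneg by (simp add: h_def)
    have "(\<Sum>j\<in>{1..n} - {k}. (real k ^ 2 + M) * shift j + h k j) \<le> (\<Sum>j=1..n. (real k ^ 2 + M) * shift j + h k j)"
      by (intro sum_mono2) (use M h_nonneg shift_nonneg in auto)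
    also have "\<dots> = (real k ^ 2 + M) * (\<Sum>j=1..n. shift j) + (\<Sum>j=1..n. if j \<le> m * k then C1 * real j else 0)
        + C2 * (\<Sum>j=1..n. shift j)"
      by (simp add: h_def sum.distrib sum_distrib_left)
    also have "\<dots> \<le> ((1 + M) * real k ^ 2) * S + (C1 * real m ^ 2) * real k ^ 2 + (C2 * S) * real k ^ 2"
    proof (intro add_mono)
      have "M * 1 \<le> M * real k ^ 2" using M k2 by (intro mult_left_mono) auto
      then show "(real k ^ 2 + M) * (\<Sum>j=1..n. shift j) \<le> ((1 + M) * real k ^ 2) * S"
        using S M by (intro mult_mono) (auto simp: algebra_simps intro: sum_nonneg shift_nonneg)
      have "C2 * (\<Sum>j=1..n. shift j) \<le> (C2 * S) * 1" using S C2 by (auto intro: mult_left_mono)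
      also have "\<dots> \<le> (C2 * S) * real k ^ 2" using S C2 k2 by (intro mult_left_mono) auto
      finally show "C2 * (\<Sum>j=1..n. shift j) \<le> (C2 * S) * real k ^ 2" .
      have "(\<Sum>j=1..n. if j \<le> m * k then C1 * real j else 0) = (\<Sum>j\<in>{1..n} \<inter> {..m * k}. C1 * real j)"
        by (subst sum.inter_restrict) auto
      also have "\<dots> \<le> (\<Sum>j\<in>{1..m * k}. C1 * real (m * k))"
      proof (rule order_trans)
        show "(\<Sum>j\<in>{1..n} \<inter> {..m * k}. C1 * real j) \<le> (\<Sum>j\<in>{1..n} \<inter> {..m * k}. C1 * real (m * k))"
        proof (intro sum_mono mult_left_mono)
          fix j assume "j \<in> {1..n} \<inter> {..m * k}"
          then have "j \<le> m * k" by auto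
          then show "real j \<le> real (m * k)" by (rule of_nat_mono)
        qed (use C1 in auto)
        show "(\<Sum>j\<in>{1..n} \<inter> {..m * k}. C1 * real (m * k)) \<le> (\<Sum>j\<in>{1..m * k}. C1 * real (m * k))"
          using C1 by (intro sum_mono2) auto
      qed
      also have "\<dots> = (C1 * real m ^ 2) * real k ^ 2" by (simp add: power2_eq_square)
      finally show "(\<Sum>j=1..n. if j \<le> m * k then C1 * real j else 0) \<le> (C1 * real m ^ 2) * real k ^ 2" .
    qed
    also have "\<dots> = C * real k ^ 2" by (simp add: C_def algebra_simps)
    finally have "exp (- C * real k ^ 2) \<le> exp (- (\<Sum>j\<in>{1..n} - {k}. (real k ^ 2 + M) * shift j + h k j))" by simp
    also have "\<dots> = (\<Prod>j\<in>{1..n} - {k}. exp (- ((real k ^ 2 + M) * shift j + h k j)))"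
      by (simp add: exp_sum sum_negf[symmetric])
    also have "\<dots> \<le> (\<Prod>j\<in>{1..n} - {k}. F j)"
      by (intro prod_mono conjI F) auto
    finally show "exp (- C * real k ^ 2) \<le>
       (\<Prod>j\<in>{1..n} - {k}. norm (exp (- ((of_nat k ^ 2 - \<nu>) * of_real (shift j))) - rate \<nu>' j))"
      unfolding F_def .
  qed
qed

end

text \<open>The divided difference of \<open>\<mu> \<mapsto> exp (\<mu> t)\<close>, which treats distinct and double eigenvalues alike.\<close>

definition ddexp :: "complex \<Rightarrow> complex \<Rightarrow> real \<Rightarrow> complex" where
  "ddexp \<mu> \<nu> t = (if \<mu> = \<nu> then of_real t * exp (\<mu> * of_real t)
     else (exp (\<mu> * of_real t) - exp (\<nu> * of_real t)) / (\<mu> - \<nu>))"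

section \<open>Calculus of divided differences of the exponential\<close>

lemma ddexp_0 [simp]: "ddexp \<mu> \<nu> 0 = 0"
  by (simp add: ddexp_def)

text \<open>The Leibniz rule for divided differences in the variable \<open>\<mu>\<close>, applied
  to the product of \<open>exp (\<mu> s)\<close> and \<open>exp (\<mu> t)\<close>.\<close>

lemma ddexp_add:
  "ddexp \<mu> \<nu> (s + t) = exp (\<nu> * of_real s) * ddexp \<mu> \<nu> t + ddexp \<mu> \<nu> s * exp (\<mu> * of_real t)"
proof (cases "\<mu> = \<nu>")
  case False
  then have "\<mu> - \<nu> \<noteq> 0" by simp
  then show ?thesis using False
    by (simp add: ddexp_def distrib_left exp_add divide_simps) (simp add: algebra_simps)
qed (simp add: ddexp_def distrib_left exp_add algebra_simps)

lemma ddexp_mult: "(\<mu> - \<nu>) * ddexp \<mu> \<nu> t = exp (\<mu> * of_real t) - exp (\<nu> * of_real t)"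
  by (simp add: ddexp_def)

lemma ddexp_cont [continuous_intros]:
  "continuous_on A f \<Longrightarrow> continuous_on A (\<lambda>x. ddexp \<mu> \<nu> (f x))"
  unfolding ddexp_def by (cases "\<mu> = \<nu>") (auto intro!: continuous_intros)

lemma ddexp_deriv:
  "(ddexp \<mu> \<nu> has_vector_derivative (\<mu> * ddexp \<mu> \<nu> t + exp (\<nu> * of_real t))) (at t within A)"
proof (cases "\<mu> = \<nu>")
  case True
  have "ddexp \<mu> \<nu> = (\<lambda>t. of_real t * exp (\<mu> * of_real t))"
    using True by (auto simp: ddexp_def fun_eq_iff)
  then show ?thesis using True
    by (auto intro!: derivative_eq_intros has_vector_derivative_real_field simp: ddexp_def algebra_simps)
next
  case False
  then have *: "\<mu> - \<nu> \<noteq> 0" by simp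
  have "ddexp \<mu> \<nu> = (\<lambda>t. (exp (\<mu> * of_real t) - exp (\<nu> * of_real t)) / (\<mu> - \<nu>))"
    using False by (auto simp: ddexp_def fun_eq_iff)
  then show ?thesis using False *
    by (auto intro!: derivative_eq_intros has_vector_derivative_real_field simp: ddexp_def divide_simps) (simp add: algebra_simps)
qed

text \<open>For distinct \<open>\<mu>\<close>, \<open>\<nu>\<close> the zeros are the
  \<open>b\<close> with \<open>(\<mu> - \<nu>) * b\<close> a multiple of 2 pi i; scaling this
  product to modulus at most 1 avoids all of them except 0. The point found is the extra translation
  in \<open>mode_control\<close>.\<close>

lemma ddexp_nonzero:
  obtains b where "0 < b" "b \<le> 1" "ddexp \<mu> \<nu> b \<noteq> 0"
proof (cases "\<mu> = \<nu>")
  case True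
  then show ?thesis using that[of 1] by (simp add: ddexp_def)
next
  case False
  define t where "t = min 1 (norm (\<mu> - \<nu>))"
  define b where "b = t / norm (\<mu> - \<nu>)"
  have t: "0 < t" "t \<le> 1" using False by (auto simp: t_def)
  have b: "0 < b" "b \<le> 1" using False by (auto simp: b_def t_def)
  define x where "x = (\<mu> - \<nu>) * of_real b"
  have nx: "norm x = t" using False t by (simp add: x_def b_def norm_mult norm_divide)
  have "t / 16 \<le> norm (1 - exp (- x))"
    using t nx abs_Im_le_cmod[of x] by (intro norm_one_minus_exp_lower) auto
  then have "exp (- x) \<noteq> 1" using t by auto
  then have "exp (\<mu> * of_real b) \<noteq> exp (\<nu> * of_real b)"
    by (metis x_def exp_minus exp_diff left_diff_distrib divide_self exp_not_eq_zero inverse_1)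
  then show ?thesis using that[of b] b False by (simp add: ddexp_def)
qed

text \<open>The positive part becomes C1 when squared; the bump and the cut-off
  \<open>quad_step\<close> are assembled from it.\<close>

lemma max_zero_square_deriv:
  "((\<lambda>x::real. (max 0 x)\<^sup>2) has_real_derivative 2 * max 0 x) (at x)"
proof -
  consider "x > 0" | "x < 0" | "x = 0" by linarith
  then show ?thesis
  proof cases
    case 1
    have "((\<lambda>x. x\<^sup>2) has_real_derivative 2 * max 0 x) (at x)"
      using 1 by (auto intro!: derivative_eq_intros)
    then show ?thesis
      by (rule has_field_derivative_transform_within_open[where S="{0<..}"]) (use 1 in auto)
  next
    case 2
    have "((\<lambda>x. 0) has_real_derivative 2 * max 0 x) (at x)"
      using 2 by (auto intro!: derivative_eq_intros)
    then show ?thesis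
      by (rule has_field_derivative_transform_within_open[where S="{..<0}"]) (use 2 in auto)
  next
    case 3
    have "((\<lambda>h::real. (max 0 h)\<^sup>2 / h) \<longlongrightarrow> 0) (at 0)"
    proof (rule Lim_null_comparison)
      show "\<forall>\<^sub>F h in at 0. norm ((max 0 h)\<^sup>2 / h) \<le> \<bar>h :: real\<bar>"
        by (intro always_eventually allI) (auto simp: max_def power2_eq_square)
      show "((\<lambda>h::real. \<bar>h\<bar>) \<longlongrightarrow> 0) (at 0)"
        by (rule tendsto_eq_intros refl)+ simp
    qed
    then show ?thesis unfolding DERIV_def using 3 by simp
  qed
qed

section \<open>A bump and the limit of the annihilating products\<close>

context decoupled_spectrum
begin

text \<open>A moment of a nonnegative function against an oscillating exponential could vanish. The
  support is so short that the phase of the weight stays within 1, where the cosine is at least 1/2;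
  the integrand then has nonnegative real part. The square of the positive part of a parabola is
  used because it has a Lipschitz derivative, so both \<open>f\<close> and \<open>f'\<close> satisfy
  \<open>size_bound\<close>.\<close>

lemma bump:
  obtains h K I f f' where "0 < h" "h \<le> 1" "C1_supported (- h) 0 f f'" "size_bound K f" "size_bound K f'"
    "0 < I" "\<And>k \<nu>. k \<ge> 1 \<Longrightarrow> \<nu> \<in> {\<mu>1, \<mu>2} \<Longrightarrow>
       I * exp (- (real k ^ 2)) \<le> norm (moment (exp_weight (of_nat k ^ 2 - \<nu>)) f)"
proof -
  define m where "m = max \<bar>Im \<mu>1\<bar> \<bar>Im \<mu>2\<bar>"
  \<comment> \<open>Gives \<open>h * m \<le> 1\<close>, which bounds the phase, and \<open>h * (1 +
    \<bar>Re \<mu>1\<bar> + \<bar>Re \<mu>2\<bar>) \<le> 1\<close>, which bounds the weight below by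
    \<open>exp (- (k^2 + 1))\<close>.\<close>
  define h where "h = 1 / (2 + 2 * m + \<bar>Re \<mu>1\<bar> + \<bar>Re \<mu>2\<bar>)"
  have m: "0 \<le> m" "\<nu> \<in> {\<mu>1, \<mu>2} \<Longrightarrow> \<bar>Im \<nu>\<bar> \<le> m" for \<nu> by (auto simp: m_def)
  have h: "0 < h" "h \<le> 1 / 2" "h * (1 + m) \<le> 1" "h * (1 + \<bar>Re \<mu>1\<bar> + \<bar>Re \<mu>2\<bar>) \<le> 1"
    using m by (auto simp: h_def divide_simps add_pos_nonneg)
  define g :: "real \<Rightarrow> real" where "g s = - s * (s + h)" for s
  \<comment> \<open>Clipping to [-h, 0] replaces the positive part by the polynomial
    \<open>g (c s)\<close>; the Lipschitz bounds then reduce to a polynomial on a bounded interval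
    and the fact that \<open>c\<close> is a contraction.\<close>
  define c :: "real \<Rightarrow> real" where "c s = max (- h) (min 0 s)" for s
  define f where "f s = complex_of_real ((max 0 (g s))\<^sup>2)" for s
  define f' where "f' s = complex_of_real (2 * max 0 (g s) * (- 2 * s - h))" for s
  have g_out: "g s \<le> 0" if "s \<notin> {-h..0}" for s
    using that h by (auto simp: g_def mult_le_0_iff zero_le_mult_iff)
  have g_in: "0 \<le> g s" if "s \<in> {-h..0}" for s
    using that h by (auto simp: g_def mult_nonneg_nonneg mult_nonpos_nonneg)
  have clip: "max 0 (g s) = g (c s)" for s
  proof (cases "s \<in> {-h..0}")
    case True
    then have "c s = s" by (auto simp: c_def)
    then show ?thesis using g_in[OF True] by simp
  next
    case False
    then have "c s = - h \<or> c s = 0" using h by (auto simp: c_def)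
    then show ?thesis using g_out[OF False] by (auto simp: g_def)
  qed
  have clip': "f' s = complex_of_real (2 * g (c s) * (- 2 * c s - h))" for s
  proof (cases "s \<in> {-h..0}")
    case True
    then have "c s = s" by (auto simp: c_def)
    then show ?thesis unfolding f'_def clip by simp
  next
    case False
    then have "c s = - h \<or> c s = 0" using h by (auto simp: c_def)
    then show ?thesis unfolding f'_def clip by (auto simp: g_def)
  qed
  have c: "- h \<le> c s" "c s \<le> 0" "\<bar>c s - c t\<bar> \<le> \<bar>s - t\<bar>" for s t
    using h by (auto simp: c_def max_def min_def abs_if)
  have gc: "\<bar>g (c s)\<bar> \<le> 1" "\<bar>- 2 * c s - h\<bar> \<le> 1" for s
  proof -
    have "\<bar>c s\<bar> * \<bar>c s + h\<bar> \<le> 1 * 1" using c[of s] h by (intro mult_mono) auto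
    then show "\<bar>g (c s)\<bar> \<le> 1" by (simp add: g_def abs_mult)
    show "\<bar>- 2 * c s - h\<bar> \<le> 1" using c[of s] h by auto
  qed
  have gl: "\<bar>g (c s) - g (c t)\<bar> \<le> 2 * \<bar>s - t\<bar>" for s t
  proof -
    have "g (c s) - g (c t) = (c s + c t + h) * (c t - c s)" by (simp add: g_def algebra_simps)
    then have "\<bar>g (c s) - g (c t)\<bar> = \<bar>c s + c t + h\<bar> * \<bar>c s - c t\<bar>" by (simp add: abs_mult abs_minus_commute)
    also have "\<dots> \<le> 2 * \<bar>s - t\<bar>" using c[of s] c[of t] c(3)[of s t] h by (intro mult_mono) auto
    finally show ?thesis .
  qed
  have f_clip: "f s = complex_of_real ((g (c s))\<^sup>2)" for s by (simp add: f_def clip)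
  have size_f: "size_bound 8 f" unfolding size_bound_def
  proof (intro conjI allI)
    fix s t
    have "\<bar>g (c s)\<bar>\<^sup>2 \<le> 1\<^sup>2" by (rule power_mono[OF gc(1)]) simp
    then show "norm (f s) \<le> 8" by (simp add: f_clip norm_power)
    have "norm (f s - f t) = \<bar>(g (c s))\<^sup>2 - (g (c t))\<^sup>2\<bar>"
      unfolding f_clip of_real_diff[symmetric] norm_of_real ..
    also have "\<dots> = \<bar>g (c s) + g (c t)\<bar> * \<bar>g (c s) - g (c t)\<bar>"
      by (simp add: power2_eq_square abs_mult[symmetric] algebra_simps)
    also have "\<dots> \<le> 2 * (2 * \<bar>s - t\<bar>)"
      using gc(1)[of s] gc(1)[of t] by (intro mult_mono gl) auto
    also have "\<dots> \<le> 8 * \<bar>s - t\<bar>" by simp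
    finally show "norm (f s - f t) \<le> 8 * \<bar>s - t\<bar>" .
  qed
  have size_f': "size_bound 8 f'" unfolding size_bound_def
  proof (intro conjI allI)
    fix s t
    have "\<bar>g (c s)\<bar> * \<bar>- 2 * c s - h\<bar> \<le> 1 * 1" by (intro mult_mono gc) auto
    then show "norm (f' s) \<le> 8" unfolding clip' norm_of_real by (simp add: abs_mult)
    have "norm (f' s - f' t) = \<bar>2 * (g (c s) - g (c t)) * (- 2 * c s - h) + 2 * g (c t) * (- 2 * (c s - c t))\<bar>"
      unfolding clip' of_real_diff[symmetric] norm_of_real by (simp add: algebra_simps)
    also have "\<dots> \<le> \<bar>2 * (g (c s) - g (c t)) * (- 2 * c s - h)\<bar> + \<bar>2 * g (c t) * (- 2 * (c s - c t))\<bar>"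
      by (rule abs_triangle_ineq)
    also have "\<dots> = 2 * (\<bar>g (c s) - g (c t)\<bar> * \<bar>- 2 * c s - h\<bar>) + 4 * (\<bar>g (c t)\<bar> * \<bar>c s - c t\<bar>)"
      by (simp only: abs_mult) simp
    also have "\<dots> \<le> 2 * ((2 * \<bar>s - t\<bar>) * 1) + 4 * (1 * \<bar>s - t\<bar>)"
      by (intro add_mono mult_left_mono mult_mono gc gl c) auto
    finally show "norm (f' s - f' t) \<le> 8 * \<bar>s - t\<bar>" by simp
  qed
  have der: "(f has_vector_derivative f' s) (at s)" for s
  proof -
    have "(g has_real_derivative (- 2 * s - h)) (at s)"
      unfolding g_def by (auto intro!: derivative_eq_intros)
    from DERIV_chain2[OF max_zero_square_deriv this]
    have "((\<lambda>s. (max 0 (g s))\<^sup>2) has_real_derivative 2 * max 0 (g s) * (- 2 * s - h)) (at s)" .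
    then have "((\<lambda>s. (max 0 (g s))\<^sup>2) has_vector_derivative 2 * max 0 (g s) * (- 2 * s - h)) (at s)"
      by (simp add: has_real_derivative_iff_has_vector_derivative)
    then show ?thesis unfolding f_def f'_def by (rule bounded_linear.has_vector_derivative[OF bounded_linear_of_real])
  qed
  have cont': "continuous_on UNIV f'"
    unfolding f'_def g_def by (intro continuous_intros)
  have supp: "f s = 0 \<and> f' s = 0" if "s \<notin> {-h..0}" for s
    using g_out[OF that] by (simp add: f_def f'_def)
  have C1: "C1_supported (- h) 0 f f'" unfolding C1_supported_def using der cont' supp by blast
  \<comment> \<open>\<open>h / 2\<close> is the length of the middle half of the support,
    \<open>9 * h ^ 4 / 256\<close> the minimum of \<open>g^2\<close> there, 1/2 bounds the cosine,
    and \<open>exp (- 1)\<close> splits off from \<open>exp (- (k^2 + 1))\<close>.\<close>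
  define I where "I = h / 2 * (9 * h ^ 4 / 256) / 2 * exp (- 1)"
  have I: "0 < I" using h by (simp add: I_def)
  have "I * exp (- (real k ^ 2)) \<le> norm (moment (exp_weight (of_nat k ^ 2 - \<nu>)) f)"
    if k: "k \<ge> 1" and \<nu>: "\<nu> \<in> {\<mu>1, \<mu>2}" for k :: nat and \<nu>
  proof -
    define z where "z = of_nat k ^ 2 - \<nu>"
    have Rk: "Re (of_nat k ^ 2 :: complex) = real k ^ 2" "Im (of_nat k ^ 2 :: complex) = 0"
      by (metis Re_complex_of_real of_real_of_nat_eq of_real_power, metis Im_complex_of_real of_real_of_nat_eq of_real_power)
    have k2: "1 \<le> real k ^ 2" using k by simp
    have Rez: "0 \<le> Re z" using \<nu> Re_le k2 by (auto simp: z_def Rk)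
    have Rezh: "Re z * h \<le> real k ^ 2 + 1"
    proof -
      have "Re z \<le> real k ^ 2 + \<bar>Re \<mu>1\<bar> + \<bar>Re \<mu>2\<bar>" using \<nu> by (auto simp: z_def Rk)
      then have "Re z * h \<le> (real k ^ 2 + \<bar>Re \<mu>1\<bar> + \<bar>Re \<mu>2\<bar>) * h" using h by (intro mult_right_mono) auto
      also have "\<dots> \<le> real k ^ 2 * 1 + h * (1 + \<bar>Re \<mu>1\<bar> + \<bar>Re \<mu>2\<bar>)"
        using h mult_left_mono[of h 1 "real k ^ 2"] by (simp add: algebra_simps)
      finally show ?thesis using h(4) by linarith
    qed
    have low: "exp (- (real k ^ 2 + 1)) / 2 * (9 * h ^ 4 / 256) * indicator {- (3 * h / 4)..- (h / 4)} s \<le> Re (exp_weight z s * f s)" for s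
    proof (cases "s \<in> {-h..0}")
      case False
      then show ?thesis using supp[OF False] h by (auto simp: indicator_def)
    next
      case True
      have "\<bar>Im z\<bar> \<le> m" using m(2)[OF \<nu>] by (simp add: z_def Rk)
      then have "\<bar>Im z\<bar> * \<bar>s\<bar> \<le> m * h" using True m(1) by (intro mult_mono) auto
      then have "\<bar>Im z * s\<bar> \<le> m * h" by (simp add: abs_mult)
      also have "\<dots> \<le> 1" using h by (simp add: algebra_simps)
      finally have im: "\<bar>Im z * s\<bar> \<le> 1" .
      have "cos (pi / 3) \<le> cos \<bar>Im z * s\<bar>"
        using im pi_gt3 by (intro cos_monotone_0_pi_le) auto
      then have cos: "1 / 2 \<le> cos (Im z * s)" by (simp add: cos_60)
      have "- (Re z * h) \<le> Re z * s" using True Rez mult_left_mono[of "- h" s "Re z"] by auto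
      then have "exp (- (real k ^ 2 + 1)) \<le> exp (Re z * s)" using Rezh by simp
      then have 1: "exp (- (real k ^ 2 + 1)) * (1/2) \<le> exp (Re z * s) * cos (Im z * s)"
        using cos by (intro mult_mono) auto
      have 2: "9 * h ^ 4 / 256 * indicator {- (3 * h / 4)..- (h / 4)} s \<le> (max 0 (g s))\<^sup>2"
      proof (cases "s \<in> {- (3 * h / 4)..- (h / 4)}")
        case s: True
        have "- (h / 4) \<le> s + h / 2" "s + h / 2 \<le> h / 4" using s by auto
        then have "\<bar>s + h / 2\<bar> \<le> \<bar>h / 4\<bar>" by linarith
        then have "(s + h / 2)\<^sup>2 \<le> (h / 4)\<^sup>2" by (simp only: abs_le_square_iff)
        then have "3 * h\<^sup>2 / 16 \<le> g s" by (simp add: g_def power2_eq_square algebra_simps)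
        then have "(3 * h\<^sup>2 / 16)\<^sup>2 \<le> (max 0 (g s))\<^sup>2" by (intro power_mono) auto
        then show ?thesis using s by (simp add: power_divide power_mult_distrib flip: power_mult)
      qed auto
      have "exp (- (real k ^ 2 + 1)) * (1/2) * (9 * h ^ 4 / 256 * indicator {- (3 * h / 4)..- (h / 4)} s)
          \<le> (exp (Re z * s) * cos (Im z * s)) * (max 0 (g s))\<^sup>2"
        by (rule mult_mono[OF 1 2]) (use cos in auto)
      then show ?thesis
        by (simp add: exp_weight_def f_def Re_exp)
    qed
    have int: "integrable lborel (\<lambda>s. exp_weight z s * f s)"
      by (rule moment_integrable[OF exp_weight_cont C1])
    have "I * exp (- (real k ^ 2)) = (LINT s|lborel. exp (- (real k ^ 2 + 1)) / 2 * (9 * h ^ 4 / 256) * indicator {- (3 * h / 4)..- (h / 4)} s)"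
      using h by (simp add: I_def exp_diff exp_minus field_simps)
    also have "\<dots> \<le> (LINT s|lborel. Re (exp_weight z s * f s))"
      by (rule integral_mono[OF _ integrable_Re[OF int] low])
         (intro integrable_mult_right integrable_real_indicator, auto simp: emeasure_lborel_Icc_eq)
    also have "\<dots> = Re (moment (exp_weight z) f)"
      unfolding moment_def by (rule integral_Re[OF int])
    also have "\<dots> \<le> norm (moment (exp_weight z) f)" by (rule complex_Re_le_cmod)
    finally show ?thesis by (simp add: z_def)
  qed
  then show ?thesis using that[of h f f' 8 I] h C1 size_f size_f' I by auto
qed

text \<open>\<open>exp_weight z\<close> is an eigenfunction of translations, so every step
  multiplies the moment by a number; the moduli collect into the two products that
  \<open>factor_lower_bound\<close> estimates.\<close>

lemma moment_exp_annihilate: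
  assumes f: "C1_supported a b f f'" "a \<le> b"
  shows "norm (moment (exp_weight z) (annihilate k f n)) =
    (\<Prod>j\<in>{1..n} - {k}. norm (exp (- (z * of_real (shift j))) - rate \<mu>1 j)) *
    (\<Prod>j\<in>{1..n} - {k}. norm (exp (- (z * of_real (shift j))) - rate \<mu>2 j)) *
    norm (moment (exp_weight z) f)"
proof (induction n)
  case (Suc n)
  have C: "C1_supported (a - 2 * suminf shift) b (annihilate k f n) (annihilate k f' n)"
    by (rule annihilate_C1_supported[OF f])
  have "0 \<le> suminf shift" by (rule suminf_nonneg[OF summable_shift shift_nonneg])
  then have C': "C1_supported (a - 2 * suminf shift - shift (Suc n)) b
     (step (rate \<mu>1 (Suc n)) (shift (Suc n)) (annihilate k f n))
     (step (rate \<mu>1 (Suc n)) (shift (Suc n)) (annihilate k f' n))"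
    using f(2) by (intro step_C1_supported[OF C] shift_nonneg) auto
  show ?case
  proof (cases "Suc n = k")
    case True
    then have "{1..Suc n} - {k} = {1..n} - {k}" by auto
    moreover have "annihilate k f (Suc n) = annihilate k f n"
      unfolding annihilate.simps using True by (simp only: simp_thms if_True)
    ultimately show ?thesis using Suc.IH by (simp only:)
  next
    case False
    have *: "{1..Suc n} - {k} = insert (Suc n) ({1..n} - {k})" using False by auto
    show ?thesis
      unfolding * using False
      by (simp add: moment_exp_step[OF C'] moment_exp_step[OF C] norm_mult Suc.IH mult_ac)
  qed
qed simp

text \<open>For \<open>\<mu>1 = \<mu>2 = \<mu>\<close> this is
  \<open>- s * exp ((k^2 - \<mu>) s)\<close>, the generalized exponential of a Jordan block.\<close>

definition dd_weight :: "nat \<Rightarrow> real \<Rightarrow> complex" where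
  "dd_weight k s = exp (of_nat k ^ 2 * of_real s) * ddexp \<mu>1 \<mu>2 (- s)"

lemma dd_weight_cont [continuous_intros]: "continuous_on A (dd_weight k)"
  unfolding dd_weight_def[abs_def] by (intro continuous_intros)

text \<open>From \<open>ddexp_add\<close>: translations act triangularly on the pair
  \<open>dd_weight k\<close>, \<open>exp_weight (k^2 - \<mu>1)\<close>, with the scalar factors of
  \<open>\<mu>2\<close> and \<open>\<mu>1\<close> on the diagonal.\<close>

lemma dd_weight_shift:
  "dd_weight k (s - c) = exp (- ((of_nat k ^ 2 - \<mu>2) * of_real c)) * dd_weight k s
     + exp (- (of_nat k ^ 2 * of_real c)) * ddexp \<mu>1 \<mu>2 c * exp_weight (of_nat k ^ 2 - \<mu>1) s"
proof -
  have "ddexp \<mu>1 \<mu>2 (c + - s) = exp (\<mu>2 * of_real c) * ddexp \<mu>1 \<mu>2 (- s) + ddexp \<mu>1 \<mu>2 c * exp (\<mu>1 * of_real (- s))"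
    by (rule ddexp_add)
  then show ?thesis
    by (simp add: dd_weight_def exp_weight_def algebra_simps exp_add exp_diff exp_minus divide_inverse)
qed

lemma moment_dd_shift:
  assumes f: "C1_supported a b f f'"
  shows "moment (\<lambda>s. dd_weight k (s - c)) f = exp (- ((of_nat k ^ 2 - \<mu>2) * of_real c)) * moment (dd_weight k) f
     + exp (- (of_nat k ^ 2 * of_real c)) * ddexp \<mu>1 \<mu>2 c * moment (exp_weight (of_nat k ^ 2 - \<mu>1)) f"
  unfolding dd_weight_shift
  by (subst moment_add_left[OF _ _ f]) (auto intro!: continuous_intros simp: moment_cmult_left)

lemma moment_dd_step:
  assumes f: "C1_supported a b f f'"
  shows "moment (dd_weight k) (step q c f) =
    (exp (- ((of_nat k ^ 2 - \<mu>2) * of_real c)) - q) * moment (dd_weight k) f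
     + exp (- (of_nat k ^ 2 * of_real c)) * ddexp \<mu>1 \<mu>2 c * moment (exp_weight (of_nat k ^ 2 - \<mu>1)) f"
  by (simp add: moment_step[OF dd_weight_cont f] moment_dd_shift[OF f] algebra_simps)

text \<open>By \<open>ddexp_mult\<close>, the two tracked moments determine the one for
  \<open>\<mu>2\<close>, in a form that also makes sense for a double eigenvalue.\<close>

lemma moment_exp_second:
  assumes f: "C1_supported a b f f'"
  shows "moment (exp_weight (of_nat k ^ 2 - \<mu>2)) f =
    moment (exp_weight (of_nat k ^ 2 - \<mu>1)) f - (\<mu>1 - \<mu>2) * moment (dd_weight k) f"
proof -
  have "exp_weight (of_nat k ^ 2 - \<mu>2) s = exp_weight (of_nat k ^ 2 - \<mu>1) s + (- (\<mu>1 - \<mu>2)) * dd_weight k s" for s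
  proof -
    have "(- (\<mu>1 - \<mu>2)) * dd_weight k s = - exp (of_nat k ^ 2 * of_real s) * ((\<mu>1 - \<mu>2) * ddexp \<mu>1 \<mu>2 (- s))"
      by (simp add: dd_weight_def algebra_simps)
    also have "\<dots> = - exp (of_nat k ^ 2 * of_real s) * (exp (\<mu>1 * of_real (- s)) - exp (\<mu>2 * of_real (- s)))"
      by (simp only: ddexp_mult)
    finally show ?thesis
      by (simp add: exp_weight_def algebra_simps exp_add exp_diff exp_minus divide_inverse)
  qed
  then have "moment (exp_weight (of_nat k ^ 2 - \<mu>2)) f =
      moment (\<lambda>s. exp_weight (of_nat k ^ 2 - \<mu>1) s + (- (\<mu>1 - \<mu>2)) * dd_weight k s) f"
    by presburger
  also have "\<dots> = moment (exp_weight (of_nat k ^ 2 - \<mu>1)) f + (- (\<mu>1 - \<mu>2)) * moment (dd_weight k) f"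
    by (subst moment_add_left[OF _ _ f]) (auto intro!: continuous_intros simp only: moment_cmult_left)
  finally show ?thesis by (simp add: algebra_simps)
qed

text \<open>At stage \<open>j\<close> the inner step kills the exponential moment; the mixed term of
  \<open>moment_dd_step\<close> is then gone, and the outer step kills the divided-difference
  moment. Later stages act linearly on this pair of moments and keep both zero.\<close>

lemma annihilate_moments_zero:
  assumes f: "C1_supported a b f f'" "a \<le> b" and j: "1 \<le> j" "j \<noteq> k" "j \<le> n"
  shows "moment (exp_weight (of_nat j ^ 2 - \<mu>1)) (annihilate k f n) = 0 \<and>
         moment (dd_weight j) (annihilate k f n) = 0"
  using j(3)
proof (induction n)
  case 0
  then show ?case using j by simp
next
  case (Suc n)
  have C: "C1_supported (a - 2 * suminf shift) b (annihilate k f n) (annihilate k f' n)"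
    by (rule annihilate_C1_supported[OF f])
  have "0 \<le> suminf shift" by (rule suminf_nonneg[OF summable_shift shift_nonneg])
  then have C': "C1_supported (a - 2 * suminf shift - shift (Suc n)) b
     (step (rate \<mu>1 (Suc n)) (shift (Suc n)) (annihilate k f n))
     (step (rate \<mu>1 (Suc n)) (shift (Suc n)) (annihilate k f' n))"
    using f(2) by (intro step_C1_supported[OF C] shift_nonneg) auto
  note st = moment_exp_step[OF C] moment_exp_step[OF C'] moment_dd_step[OF C] moment_dd_step[OF C']
  show ?case
  proof (cases "j = Suc n")
    case True
    have "exp (- ((of_nat j ^ 2 - \<mu>1) * of_real (shift j))) = rate \<mu>1 j"
         "exp (- ((of_nat j ^ 2 - \<mu>2) * of_real (shift j))) = rate \<mu>2 j"
      by (simp_all add: rate_def)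
    then show ?thesis using j(2) unfolding True by (simp add: st del: of_nat_Suc)
  next
    case False
    then show ?thesis using Suc by (simp add: st)
  qed
qed

text \<open>The lower bound from the bump and from \<open>factor_lower_bound\<close> is uniform in
  the number of stages, and each unwanted moment is exactly zero from its stage on; both facts pass
  to the limit of the products.\<close>

lemma annihilator:
  obtains L C where "0 \<le> L" "0 \<le> C"
    "\<And>k. k \<ge> 1 \<Longrightarrow> \<exists>g g'. C1_supported (- L) 0 g g' \<and> (\<forall>s. norm (g s) \<le> C \<and> norm (g' s) \<le> C) \<and>
       (\<forall>j\<ge>1. j \<noteq> k \<longrightarrow> moment (exp_weight (of_nat j ^ 2 - \<mu>1)) g = 0 \<and> moment (dd_weight j) g = 0) \<and>
       (\<forall>\<nu>\<in>{\<mu>1, \<mu>2}. exp (- C * real k ^ 2) \<le> norm (moment (exp_weight (of_nat k ^ 2 - \<nu>)) g))"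
proof -
  obtain h K I f f' where b: "0 < h" "h \<le> 1" "C1_supported (- h) 0 f f'" "size_bound K f" "size_bound K f'"
    "0 < I" "\<And>k \<nu>. k \<ge> 1 \<Longrightarrow> \<nu> \<in> {\<mu>1, \<mu>2} \<Longrightarrow>
       I * exp (- (real k ^ 2)) \<le> norm (moment (exp_weight (of_nat k ^ 2 - \<nu>)) f)"
    by (rule bump) blast
  obtain D where D: "0 \<le> D" "\<And>k n \<nu> \<nu>'. k \<ge> 1 \<Longrightarrow> \<nu> \<in> {\<mu>1, \<mu>2} \<Longrightarrow> \<nu>' \<in> {\<mu>1, \<mu>2} \<Longrightarrow>
     exp (- D * real k ^ 2) \<le>
       (\<Prod>j\<in>{1..n} - {k}. norm (exp (- ((of_nat k ^ 2 - \<nu>) * of_real (shift j))) - rate \<nu>' j))"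
    by (rule factor_lower_bound) blast
  define L where "L = h + 2 * suminf shift"
  define B where "B = K * total_variation"
  have S0: "0 \<le> suminf shift" by (rule suminf_nonneg[OF summable_shift shift_nonneg])
  have B0: "0 \<le> B" using size_bound_nonneg[OF b(4)] total_variation_pos by (simp add: B_def)
  \<comment> \<open>One constant for the sup bound and for the exponent: \<open>D\<close> for each
    of the two products, 1 for the decay \<open>exp (- k^2)\<close> in \<open>bump\<close>, and
    \<open>\<bar>ln I\<bar>\<close> to absorb \<open>I\<close>, using
    \<open>k \<ge> 1\<close>.\<close>
  define C where "C = max B (2 * D + 1 + \<bar>ln I\<bar>)"
  have "\<exists>g g'. C1_supported (- L) 0 g g' \<and> (\<forall>s. norm (g s) \<le> C \<and> norm (g' s) \<le> C) \<and>
       (\<forall>j\<ge>1. j \<noteq> k \<longrightarrow> moment (exp_weight (of_nat j ^ 2 - \<mu>1)) g = 0 \<and> moment (dd_weight j) g = 0) \<and>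
       (\<forall>\<nu>\<in>{\<mu>1, \<mu>2}. exp (- C * real k ^ 2) \<le> norm (moment (exp_weight (of_nat k ^ 2 - \<nu>)) g))"
    if k: "k \<ge> 1" for k
  proof -
    have hb: "- h \<le> 0" using b by simp
    have supp: "C1_supported (- L) 0 (annihilate k f n) (annihilate k f' n)" for n
      using annihilate_C1_supported[OF b(3) hb, of k n] by (simp add: L_def)
    have "summable (\<lambda>n. shift (Suc n) + rate_bound (Suc n))"
      by (intro summable_add) (use summable_shift summable_rate_bound in \<open>simp_all add: summable_Suc_iff\<close>)
    then have sm: "summable (\<lambda>n. 3 * (K * total_variation) * (shift (Suc n) + rate_bound (Suc n)))"
      by (rule summable_mult)
    obtain g g' where g: "C1_supported (- L) 0 g g'" "\<And>s. (\<lambda>n. annihilate k f n s) \<longlonglongrightarrow> g s"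
       "\<And>s. (\<lambda>n. annihilate k f' n s) \<longlonglongrightarrow> g' s"
       "\<And>e. continuous_on UNIV e \<Longrightarrow> (\<lambda>n. moment e (annihilate k f n)) \<longlonglongrightarrow> moment e g"
      by (rule C1_supported_limit[OF supp annihilate_close[OF b(4)] annihilate_close[OF b(5)] sm]) blast
    have bd: "norm (annihilate k f n s) \<le> B" "norm (annihilate k f' n s) \<le> B" for n s
      using annihilate_size_bound[OF b(4), of k n] annihilate_size_bound[OF b(5), of k n]
      by (auto simp: size_bound_def B_def)
    have bg: "norm (g s) \<le> B" "norm (g' s) \<le> B" for s
      by (rule LIMSEQ_le_const2[OF tendsto_norm[OF g(2)]], use bd in blast,
          rule LIMSEQ_le_const2[OF tendsto_norm[OF g(3)]], use bd in blast)
    have z: "moment (exp_weight (of_nat j ^ 2 - \<mu>1)) g = 0" "moment (dd_weight j) g = 0" if j: "j \<ge> 1" "j \<noteq> k" for j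
    proof -
      have ev: "\<forall>\<^sub>F n in sequentially. moment (exp_weight (of_nat j ^ 2 - \<mu>1)) (annihilate k f n) = 0"
        "\<forall>\<^sub>F n in sequentially. moment (dd_weight j) (annihilate k f n) = 0"
        using annihilate_moments_zero[OF b(3) hb j] unfolding eventually_sequentially by blast+
      show "moment (exp_weight (of_nat j ^ 2 - \<mu>1)) g = 0"
        by (rule LIMSEQ_unique[OF g(4)[OF exp_weight_cont] tendsto_eventually[OF ev(1)]])
      show "moment (dd_weight j) g = 0"
        by (rule LIMSEQ_unique[OF g(4)[OF dd_weight_cont] tendsto_eventually[OF ev(2)]])
    qed
    have low: "exp (- C * real k ^ 2) \<le> norm (moment (exp_weight (of_nat k ^ 2 - \<nu>)) g)" if \<nu>: "\<nu> \<in> {\<mu>1, \<mu>2}" for \<nu>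
    proof (rule LIMSEQ_le_const[OF tendsto_norm[OF g(4)[OF exp_weight_cont]]], intro exI allI impI)
      fix n
      have k2: "1 \<le> real k ^ 2" using k by simp
      have "- \<bar>ln I\<bar> * real k ^ 2 \<le> - \<bar>ln I\<bar> * 1" using k2 by (intro mult_left_mono_neg) auto
      also have "\<dots> \<le> ln I" by simp
      finally have lnI: "- \<bar>ln I\<bar> * real k ^ 2 \<le> ln I" .
      have "- C * real k ^ 2 \<le> - (2 * D + 1 + \<bar>ln I\<bar>) * real k ^ 2"
        by (intro mult_right_mono) (auto simp: C_def)
      also have "\<dots> \<le> - D * real k ^ 2 + - D * real k ^ 2 + (ln I + - (real k ^ 2))"
        using lnI by (simp add: algebra_simps)
      finally have "exp (- C * real k ^ 2) \<le> exp (- D * real k ^ 2 + - D * real k ^ 2 + (ln I + - (real k ^ 2)))"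
        by simp
      also have "\<dots> = exp (- D * real k ^ 2) * exp (- D * real k ^ 2) * (I * exp (- (real k ^ 2)))"
        using b(6) by (simp only: exp_add exp_ln)
      also have "\<dots> \<le> norm (moment (exp_weight (of_nat k ^ 2 - \<nu>)) (annihilate k f n))"
        unfolding moment_exp_annihilate[OF b(3) hb] using b(6)
        by (intro mult_mono D b k \<nu> prod_nonneg mult_nonneg_nonneg) auto
      finally show "exp (- C * real k ^ 2) \<le> norm (moment (exp_weight (of_nat k ^ 2 - \<nu>)) (annihilate k f n))" .
    qed
    have "B \<le> C" by (simp add: C_def)
    then show ?thesis using g(1) bg z low by (meson order_trans)
  qed
  moreover have "0 \<le> L" "0 \<le> C" using b S0 B0 by (auto simp: L_def C_def)
  ultimately show ?thesis using that by blast
qed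

section \<open>One mode with prescribed moments, and the sum over all modes\<close>

lemma step_bound:
  assumes "\<And>s. norm (f s) \<le> C" "norm q \<le> 1"
  shows "norm (step q a f s) \<le> 2 * C"
proof -
  have C: "0 \<le> C" using assms(1)[of 0] by (meson norm_ge_zero order_trans)
  have "norm (step q a f s) \<le> norm (f (s + a)) + norm q * norm (f s)"
    unfolding step_def by (metis norm_mult norm_triangle_ineq4)
  also have "\<dots> \<le> C + 1 * C" using assms C by (intro add_mono mult_mono) auto
  finally show ?thesis by simp
qed

text \<open>The annihilator \<open>g\<close> has two moments at mode \<open>k\<close>,
  \<open>N1\<close> and \<open>R\<close>, of which only the first is bounded below. One more step
  removes the exponential moment and gives a second function \<open>h\<close> with moments 0 and
  \<open>G\<close>, so that \<open>x\<close> and \<open>y\<close> solve a triangular system with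
  pivots \<open>N1\<close> and \<open>G\<close>. The other modes stay annihilated because a step
  maps vanishing moments to vanishing moments.\<close>

lemma mode_control:
  obtains L C where "0 \<le> L" "0 \<le> C"
    "\<And>k p r. k \<ge> 1 \<Longrightarrow> \<exists>v v'. C1_supported (- L) 0 v v' \<and>
       (\<forall>s. norm (v s) \<le> C * exp (C * real k ^ 2) * (norm p + norm r) \<and>
            norm (v' s) \<le> C * exp (C * real k ^ 2) * (norm p + norm r)) \<and>
       moment (exp_weight (of_nat k ^ 2 - \<mu>1)) v = p \<and> moment (dd_weight k) v = r \<and>
       (\<forall>j\<ge>1. j \<noteq> k \<longrightarrow> moment (exp_weight (of_nat j ^ 2 - \<mu>1)) v = 0 \<and> moment (dd_weight j) v = 0)"
proof -
  obtain L0 C0 where L0: "0 \<le> L0" "0 \<le> C0" and an: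
    "\<And>k. k \<ge> 1 \<Longrightarrow> \<exists>g g'. C1_supported (- L0) 0 g g' \<and> (\<forall>s. norm (g s) \<le> C0 \<and> norm (g' s) \<le> C0) \<and>
       (\<forall>j\<ge>1. j \<noteq> k \<longrightarrow> moment (exp_weight (of_nat j ^ 2 - \<mu>1)) g = 0 \<and> moment (dd_weight j) g = 0) \<and>
       (\<forall>\<nu>\<in>{\<mu>1, \<mu>2}. exp (- C0 * real k ^ 2) \<le> norm (moment (exp_weight (of_nat k ^ 2 - \<nu>)) g))"
    by (rule annihilator) blast
  obtain b where b: "0 < b" "b \<le> 1" "ddexp \<mu>1 \<mu>2 b \<noteq> 0" by (rule ddexp_nonzero)
  define L where "L = L0 + b"
  have "bounded ((\<lambda>s. ddexp \<mu>1 \<mu>2 (- s)) ` {- L0..0})"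
    by (intro compact_imp_bounded compact_continuous_image continuous_intros) auto
  then obtain E where E: "E > 0" "\<And>s. s \<in> {- L0..0} \<Longrightarrow> norm (ddexp \<mu>1 \<mu>2 (- s)) \<le> E"
    unfolding bounded_pos by auto
  define R0 where "R0 = L0 * (E * C0)"
  have R0: "0 \<le> R0" using L0 E by (simp add: R0_def)
  define d where "d = norm (ddexp \<mu>1 \<mu>2 b)"
  have d: "0 < d" using b by (simp add: d_def)
  \<comment> \<open>The first entry dominates the growth exponent \<open>2 * C0 + b\<close>, two
    reciprocals of the lower bound and one of \<open>exp (- k^2 b)\<close>; the second collects the
    coefficients of \<open>x\<close> and \<open>y\<close>.\<close>
  define C where "C = max (1 + 2 * C0 + b) (C0 + 2 * C0 * (1 + R0) / d)"
  have C: "1 + 2 * C0 + b \<le> C" "C0 + 2 * C0 * (1 + R0) / d \<le> C" by (auto simp: C_def)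
  have Cpos: "0 \<le> C" using C(1) L0(2) b(1) by linarith
  have "\<exists>v v'. C1_supported (- L) 0 v v' \<and>
       (\<forall>s. norm (v s) \<le> C * exp (C * real k ^ 2) * (norm p + norm r) \<and>
            norm (v' s) \<le> C * exp (C * real k ^ 2) * (norm p + norm r)) \<and>
       moment (exp_weight (of_nat k ^ 2 - \<mu>1)) v = p \<and> moment (dd_weight k) v = r \<and>
       (\<forall>j\<ge>1. j \<noteq> k \<longrightarrow> moment (exp_weight (of_nat j ^ 2 - \<mu>1)) v = 0 \<and> moment (dd_weight j) v = 0)"
    if k: "k \<ge> 1" for k p r
  proof -
    obtain g g' where g: "C1_supported (- L0) 0 g g'" "\<And>s. norm (g s) \<le> C0" "\<And>s. norm (g' s) \<le> C0"
      and gz: "\<And>j. j \<ge> 1 \<Longrightarrow> j \<noteq> k \<Longrightarrow> moment (exp_weight (of_nat j ^ 2 - \<mu>1)) g = 0"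
       "\<And>j. j \<ge> 1 \<Longrightarrow> j \<noteq> k \<Longrightarrow> moment (dd_weight j) g = 0"
      and gl: "\<And>\<nu>. \<nu> \<in> {\<mu>1, \<mu>2} \<Longrightarrow> exp (- C0 * real k ^ 2) \<le> norm (moment (exp_weight (of_nat k ^ 2 - \<nu>)) g)"
      using an[OF k] by blast
    define q where "q = exp (- ((of_nat k ^ 2 - \<mu>1) * of_real b))"
    define N1 N2 R where "N1 = moment (exp_weight (of_nat k ^ 2 - \<mu>1)) g"
      "N2 = moment (exp_weight (of_nat k ^ 2 - \<mu>2)) g" "R = moment (dd_weight k) g"
    define e where "e = exp (- C0 * real k ^ 2)"
    have e: "0 < e" by (simp add: e_def)
    have N: "e \<le> norm N1" "e \<le> norm N2" using gl by (auto simp: N1_N2_R_def e_def)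
    then have N0: "N1 \<noteq> 0" "N2 \<noteq> 0" using e by auto
    \<comment> \<open>The moment of \<open>h\<close> against \<open>dd_weight k\<close>: its
      contributions from \<open>N1\<close> and \<open>R\<close> recombine by
      \<open>moment_exp_second\<close> into \<open>N2\<close>, for which \<open>annihilator\<close>
      supplies a lower bound.\<close>
    define G where "G = of_real (exp (- (real k ^ 2 * b))) * ddexp \<mu>1 \<mu>2 b * N2"
    have G0: "G \<noteq> 0" using b N0 by (simp add: G_def)
    define x where "x = p / N1"
    define y where "y = (r - x * R) / G"
    define h h' where "h = step q b g" "h' = step q b g'"
    have hC: "C1_supported (- L) 0 h h'"
      using step_C1_supported[OF g(1), of b q] b L0 unfolding h_h'_def L_def by (simp add: algebra_simps)
    have gC: "C1_supported (- L) 0 g g'"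
      by (rule C1_supported_mono[OF g(1)]) (use b in \<open>auto simp: L_def\<close>)
    define v v' where "v = (\<lambda>s. x * g s + y * h s)" "v' = (\<lambda>s. x * g' s + y * h' s)"
    have vC: "C1_supported (- L) 0 v v'"
      unfolding v_v'_def by (intro C1_supported_add C1_supported_cmult gC hC)
    have mv: "moment w v = x * moment w g + y * moment w h" if "continuous_on UNIV w" for w
      unfolding v_v'_def
      by (subst moment_add[OF that C1_supported_cmult[OF gC] C1_supported_cmult[OF hC]])
         (simp add: moment_cmult_right)
    have exp_k: "exp (- (of_nat k ^ 2 * of_real b :: complex)) = of_real (exp (- (real k ^ 2 * b)))"
      unfolding exp_of_real[symmetric] by simp
    have hk: "moment (exp_weight (of_nat k ^ 2 - \<mu>1)) h = 0"
      unfolding h_h'_def moment_exp_step[OF g(1)] by (simp add: q_def)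
    have hR: "moment (dd_weight k) h = G"
    proof -
      have eq: "exp (- ((of_nat k ^ 2 - \<mu>2) * of_real b)) - q
          = - (of_real (exp (- (real k ^ 2 * b))) * ((\<mu>1 - \<mu>2) * ddexp \<mu>1 \<mu>2 b))"
        unfolding ddexp_mult exp_k[symmetric] q_def
        by (simp add: algebra_simps exp_add exp_diff exp_minus divide_inverse)
      have N2: "N2 = N1 - (\<mu>1 - \<mu>2) * R"
        unfolding N1_N2_R_def by (rule moment_exp_second[OF g(1)])
      show ?thesis
        unfolding h_h'_def moment_dd_step[OF g(1)] exp_k G_def N1_N2_R_def(1,3)[symmetric] eq N2
        by (simp add: algebra_simps)
    qed
    have "norm v1 \<le> C * exp (C * real k ^ 2) * (norm p + norm r)"
      if v1: "norm v1 \<le> norm x * C0 + norm y * (2 * C0)" for v1 :: complex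
    proof -
      have einv: "1 / e = exp (C0 * real k ^ 2)" by (simp add: e_def exp_minus divide_inverse)
      have x: "norm x \<le> norm p / e"
        unfolding x_def norm_divide
        by (rule divide_left_mono[OF N(1) norm_ge_zero]) (intro mult_pos_pos e, simp add: N0(1))
      have "norm R \<le> (0 - - L0) * (E * C0)" unfolding N1_N2_R_def
      proof (rule moment_norm_le[OF dd_weight_cont g(1)])
        fix s assume s: "s \<in> {- L0..0}"
        have "exp (of_nat k ^ 2 * of_real s :: complex) = of_real (exp (real k ^ 2 * s))"
          unfolding exp_of_real[symmetric] by simp
        moreover have "exp (real k ^ 2 * s) \<le> 1" using s by (simp add: mult_nonneg_nonpos)
        ultimately have "norm (exp (of_nat k ^ 2 * of_real s :: complex)) \<le> 1" by simp
        then have "norm (exp (of_nat k ^ 2 * of_real s :: complex)) * norm (ddexp \<mu>1 \<mu>2 (- s)) \<le> 1 * E"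
          using E(2)[OF s] by (intro mult_mono) auto
        then show "norm (dd_weight k s) \<le> E" by (simp add: dd_weight_def norm_mult)
      qed (use g L0 E in auto)
      then have R: "norm R \<le> R0" by (simp add: R0_def)
      define Z where "Z = exp (- (real k ^ 2 * b))"
      have Z: "0 < Z" "1 / Z = exp (real k ^ 2 * b)" unfolding Z_def by (rule exp_gt_zero) (simp add: exp_minus divide_inverse)
      have nG: "norm G = Z * d * norm N2"
        unfolding G_def norm_mult d_def norm_of_real Z_def abs_exp_cancel ..
      have Zde: "0 < Z * d * e" by (intro mult_pos_pos Z d e)
      have "norm y = norm (r - x * R) / (Z * d * norm N2)"
        unfolding y_def norm_divide nG ..
      also have "\<dots> \<le> norm (r - x * R) / (Z * d * e)"
      proof (rule divide_left_mono)
        show "Z * d * e \<le> Z * d * norm N2"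
          by (intro mult_left_mono N mult_nonneg_nonneg less_imp_le Z d)
        show "0 < Z * d * norm N2 * (Z * d * e)"
          by (intro mult_pos_pos Zde Z d less_le_trans[OF e N(2)])
      qed simp
      also have "\<dots> \<le> (norm r + norm p / e * R0) / (Z * d * e)"
      proof (rule divide_right_mono)
        have "norm (r - x * R) \<le> norm r + norm x * norm R"
          by (metis norm_mult norm_triangle_ineq4)
        also have "\<dots> \<le> norm r + norm p / e * R0"
          using x R e by (intro add_mono mult_mono) auto
        finally show "norm (r - x * R) \<le> norm r + norm p / e * R0" .
      qed (rule less_imp_le[OF Zde])
      also have "\<dots> = (norm r + norm p * (1 / e) * R0) * ((1 / Z) / d) * (1 / e)"
        by simp
      finally have y: "norm y \<le> (norm r + norm p * (1 / e) * R0) * (exp (real k ^ 2 * b) / d) * (1 / e)"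
        unfolding Z .
      define X where "X = exp (C0 * real k ^ 2)"
      define Y where "Y = exp (real k ^ 2 * b)"
      have X1: "1 \<le> X" "1 \<le> Y" using L0 b by (auto simp: X_def Y_def)
      have y': "norm y \<le> (norm p + norm r) * ((1 + R0) / d) * (X * X * Y)"
      proof -
        have "norm r + norm p * X * R0 \<le> (norm r * X) * (1 + R0) + (norm p * X) * (1 + R0)"
        proof (intro add_mono)
          have "norm r * (1 * 1) \<le> norm r * (X * (1 + R0))"
            using X1 R0 by (intro mult_left_mono mult_mono) auto
          then show "norm r \<le> norm r * X * (1 + R0)" by (simp add: mult.assoc)
          show "norm p * X * R0 \<le> norm p * X * (1 + R0)" using X1 by (intro mult_left_mono) auto
        qed
        then have "(norm r + norm p * X * R0) * (Y / d) * X \<le> ((norm r * X) * (1 + R0) + (norm p * X) * (1 + R0)) * (Y / d) * X"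
          using X1 d by (intro mult_right_mono) auto
        also have "\<dots> = (norm p + norm r) * ((1 + R0) / d) * (X * X * Y)" by (simp add: field_simps)
        finally show ?thesis using y unfolding einv X_def Y_def by simp
      qed
      have x': "norm x \<le> (norm p + norm r) * (X * X * Y)"
      proof -
        have "1 * 1 \<le> X * Y" using X1 by (intro mult_mono) auto
        then have "norm p * X * 1 \<le> norm p * X * (X * Y)" using X1 by (intro mult_left_mono) auto
        also have "\<dots> \<le> (norm p + norm r) * X * (X * Y)" using X1 by (intro mult_right_mono) auto
        finally have "norm p * X \<le> (norm p + norm r) * X * (X * Y)" by (simp only: mult_1_right)
        moreover have "norm p / e = norm p * X"
        proof -
          have "norm p / e = norm p * (1 / e)" by simp
          then show ?thesis unfolding einv X_def .
        qed
        ultimately show ?thesis using x by (simp only: mult.assoc)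
      qed
      have "norm v1 \<le> ((norm p + norm r) * (X * X * Y)) * C0 + ((norm p + norm r) * ((1 + R0) / d) * (X * X * Y)) * (2 * C0)"
        using v1 x' y' L0 by (meson add_mono mult_right_mono order_trans mult_nonneg_nonneg zero_le_numeral)
      also have "\<dots> = (C0 + 2 * C0 * (1 + R0) / d) * (X * X * Y) * (norm p + norm r)"
        by (simp add: field_simps)
      also have "\<dots> \<le> C * (X * X * Y) * (norm p + norm r)"
        using C X1 by (intro mult_right_mono) auto
      also have "\<dots> \<le> C * exp (C * real k ^ 2) * (norm p + norm r)"
      proof (intro mult_right_mono mult_left_mono)
        have "X * X * Y = exp ((2 * C0 + b) * real k ^ 2)"
          by (simp add: X_def Y_def exp_add[symmetric] algebra_simps)
        also have "\<dots> \<le> exp (C * real k ^ 2)"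
        proof -
          have "(2 * C0 + b) * real k ^ 2 \<le> C * real k ^ 2" using C by (intro mult_right_mono) auto
          then show ?thesis by simp
        qed
        finally show "X * X * Y \<le> exp (C * real k ^ 2)" .
      qed (use Cpos in simp_all)
      finally show ?thesis .
    qed
    note bound = this
    have nq: "norm q \<le> 1"
    proof -
      have "Re (of_nat k ^ 2 :: complex) = real k ^ 2"
        by (metis Re_complex_of_real of_real_of_nat_eq of_real_power)
      moreover have "1 \<le> real k ^ 2" using k by simp
      ultimately have "0 \<le> Re (of_nat k ^ 2 - \<mu>1)" using Re_le by simp
      then have "0 \<le> Re ((of_nat k ^ 2 - \<mu>1) * of_real b)" using b by simp
      then show ?thesis by (simp add: q_def del: Re_complex_of_real minus_complex.simps times_complex.simps)
    qed
    have "norm (v s) \<le> norm x * C0 + norm y * (2 * C0)" "norm (v' s) \<le> norm x * C0 + norm y * (2 * C0)" for s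
      unfolding v_v'_def h_h'_def
      by (rule order_trans[OF norm_triangle_ineq], unfold norm_mult,
          intro add_mono mult_left_mono g step_bound nq, auto)+
    then have "\<forall>s. norm (v s) \<le> C * exp (C * real k ^ 2) * (norm p + norm r) \<and>
            norm (v' s) \<le> C * exp (C * real k ^ 2) * (norm p + norm r)"
      using bound by blast
    moreover have "moment (exp_weight (of_nat k ^ 2 - \<mu>1)) v = p"
      using N0 by (simp add: mv[OF exp_weight_cont] hk x_def N1_N2_R_def)
    moreover have "moment (dd_weight k) v = r"
      using G0 by (simp add: mv[OF dd_weight_cont] hR y_def N1_N2_R_def(3)[symmetric])
    moreover have "moment (exp_weight (of_nat j ^ 2 - \<mu>1)) v = 0 \<and> moment (dd_weight j) v = 0"
      if j: "j \<ge> 1" "j \<noteq> k" for j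
      using gz[OF j]
      by (simp add: mv[OF dd_weight_cont] mv[OF exp_weight_cont] h_h'_def moment_exp_step[OF g(1)] moment_dd_step[OF g(1)])
    ultimately show ?thesis using vC by blast
  qed
  moreover have "0 \<le> L" using L0 b by (simp add: L_def)
  ultimately show ?thesis using that Cpos by blast
qed

text \<open>Moving the control to the right by \<open>\<tau>\<close> means prescribing the moments
  multiplied by \<open>exp (- (k^2 - \<mu>) \<tau>)\<close>, up to the triangular coupling. This
  beats the cost \<open>exp (C k^2)\<close> of one mode, and the single-mode controls can be summed
  together with their derivatives.\<close>

lemma null_moments:
  obtains T C where "0 < T" "0 \<le> C"
    "\<And>p r M. (\<And>k. k \<ge> 1 \<Longrightarrow> norm (p k) \<le> M \<and> norm (r k) \<le> M) \<Longrightarrow> 0 \<le> M \<Longrightarrow>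
       \<exists>u u'. C1_supported 0 T u u' \<and> (\<forall>s. norm (u s) \<le> C * M) \<and>
         (\<forall>k\<ge>1. moment (exp_weight (of_nat k ^ 2 - \<mu>1)) u = p k \<and> moment (dd_weight k) u = r k)"
proof -
  obtain L C where L: "0 \<le> L" "0 \<le> C" and mode:
    "\<And>k p r. k \<ge> 1 \<Longrightarrow> \<exists>v v'. C1_supported (- L) 0 v v' \<and>
       (\<forall>s. norm (v s) \<le> C * exp (C * real k ^ 2) * (norm p + norm r) \<and>
            norm (v' s) \<le> C * exp (C * real k ^ 2) * (norm p + norm r)) \<and>
       moment (exp_weight (of_nat k ^ 2 - \<mu>1)) v = p \<and> moment (dd_weight k) v = r \<and>
       (\<forall>j\<ge>1. j \<noteq> k \<longrightarrow> moment (exp_weight (of_nat j ^ 2 - \<mu>1)) v = 0 \<and> moment (dd_weight j) v = 0)"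
    by (rule mode_control) blast
  \<comment> \<open>\<open>\<tau> \<ge> L\<close> moves the support from [-L, 0] into
    \<open>[0, \<tau>]\<close>; \<open>\<tau> \<ge> C + 1\<close> leaves a decay of
    \<open>exp (- k^2)\<close> in the weights, which is all that the comparison with
    \<open>exp (- k)\<close> uses.\<close>
  define \<tau> where "\<tau> = L + C + 1"
  have \<tau>: "0 < \<tau>" "L \<le> \<tau>" "C + 1 \<le> \<tau>" using L by (auto simp: \<tau>_def)
  define Q where "Q = 2 + norm (exp (\<mu>1 * of_real \<tau>) * ddexp \<mu>1 \<mu>2 (- \<tau>))"
  have Q: "0 \<le> Q" by (simp add: Q_def)
  define w where "w k = C * exp (C * real k ^ 2) * (exp (- ((real k ^ 2 - 1) * \<tau>)) * Q)" for k
  have w_le: "w k \<le> C * Q * exp \<tau> * exp (- real k)" for k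
  proof -
    define K where "K = real k ^ 2"
    have "real k * 1 \<le> real k * real k" by (cases "k = 0") (auto intro!: mult_left_mono)
    then have "real k \<le> K" unfolding K_def power2_eq_square by (simp only: mult_1_right)
    moreover have "(C + 1) * K \<le> \<tau> * K" using \<tau> by (intro mult_right_mono) (auto simp: K_def)
    ultimately have "C * K + - ((K - 1) * \<tau>) \<le> \<tau> + - real k" by (simp add: algebra_simps)
    then have "C * real k ^ 2 + - ((real k ^ 2 - 1) * \<tau>) \<le> \<tau> + - real k" unfolding K_def .
    then have "exp (C * real k ^ 2) * exp (- ((real k ^ 2 - 1) * \<tau>)) \<le> exp \<tau> * exp (- real k)"
      unfolding exp_add[symmetric] by simp
    then have "(C * Q) * (exp (C * real k ^ 2) * exp (- ((real k ^ 2 - 1) * \<tau>))) \<le> (C * Q) * (exp \<tau> * exp (- real k))"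
      using L Q by (intro mult_left_mono) auto
    then show ?thesis by (simp add: w_def mult_ac)
  qed
  have w0: "0 \<le> w k" for k using L Q by (simp add: w_def)
  have w_sum: "summable w"
  proof (rule summable_comparison_test')
    have "summable (\<lambda>k. exp (- 1) ^ k :: real)" by (rule summable_geometric) simp
    then have "summable (\<lambda>k. exp (- real k))" by (simp add: exp_of_nat_mult[symmetric])
    then show "summable (\<lambda>k. C * Q * exp \<tau> * exp (- real k))" by (rule summable_mult)
    show "norm (w k) \<le> C * Q * exp \<tau> * exp (- real k)" if "k \<ge> 0" for k
      using w_le[of k] w0[of k] by simp
  qed
  define C' where "C' = suminf w"
  have C': "0 \<le> C'" unfolding C'_def by (rule suminf_nonneg[OF w_sum w0])
  have "\<exists>u u'. C1_supported 0 \<tau> u u' \<and> (\<forall>s. norm (u s) \<le> C' * M) \<and>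
         (\<forall>k\<ge>1. moment (exp_weight (of_nat k ^ 2 - \<mu>1)) u = p k \<and> moment (dd_weight k) u = r k)"
    if pr: "\<And>k. k \<ge> 1 \<Longrightarrow> norm (p k) \<le> M \<and> norm (r k) \<le> M" and M: "0 \<le> M"
    for p r :: "nat \<Rightarrow> complex" and M
  proof -
    \<comment> \<open>\<open>p'\<close> and \<open>r'\<close> are the targets before the translation
      by \<open>\<tau>\<close>, obtained by inverting the triangular action of
      \<open>moment_dd_shift\<close> with \<open>c = - \<tau>\<close>.\<close>
    define p' where "p' k = exp (- ((of_nat k ^ 2 - \<mu>1) * of_real \<tau>)) * p k" for k
    define r' where "r' k = exp (- ((of_nat k ^ 2 - \<mu>2) * of_real \<tau>)) *
       (r k - exp (\<mu>1 * of_real \<tau>) * ddexp \<mu>1 \<mu>2 (- \<tau>) * p k)" for k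
    have dec: "norm (exp (- ((of_nat k ^ 2 - \<nu>) * of_real \<tau>))) \<le> exp (- ((real k ^ 2 - 1) * \<tau>))" if "\<nu> \<in> {\<mu>1, \<mu>2}" for k \<nu>
    proof -
      have "Re (of_nat k ^ 2 :: complex) = real k ^ 2"
        by (metis Re_complex_of_real of_real_of_nat_eq of_real_power)
      moreover have "Re \<nu> \<le> 1" using that Re_le by auto
      then have "(real k ^ 2 - 1) * \<tau> \<le> (real k ^ 2 - Re \<nu>) * \<tau>"
        using \<tau> by (intro mult_right_mono) auto
      ultimately show ?thesis by simp
    qed
    have pr': "norm (p' k) + norm (r' k) \<le> exp (- ((real k ^ 2 - 1) * \<tau>)) * Q * M" if k: "k \<ge> 1" for k
    proof -
      have "norm (p' k) \<le> exp (- ((real k ^ 2 - 1) * \<tau>)) * M"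
        unfolding p'_def norm_mult by (intro mult_mono dec) (use pr[OF k] in auto)
      moreover have "norm (r' k) \<le> exp (- ((real k ^ 2 - 1) * \<tau>)) * (M + (Q - 2) * M)"
        unfolding r'_def norm_mult
      proof (intro mult_mono dec)
        have "norm (r k - exp (\<mu>1 * of_real \<tau>) * ddexp \<mu>1 \<mu>2 (- \<tau>) * p k) \<le> norm (r k) + (Q - 2) * norm (p k)"
          by (rule order_trans[OF norm_triangle_ineq4]) (simp add: norm_mult Q_def)
        also have "\<dots> \<le> M + (Q - 2) * M"
          using pr[OF k] by (intro add_mono mult_left_mono) (auto simp: Q_def)
        finally show "norm (r k - exp (\<mu>1 * of_real \<tau>) * ddexp \<mu>1 \<mu>2 (- \<tau>) * p k) \<le> M + (Q - 2) * M" .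
      qed auto
      ultimately show ?thesis by (simp add: algebra_simps)
    qed
    have "\<forall>k. \<exists>v v'. k \<ge> 1 \<longrightarrow> C1_supported (- L) 0 v v' \<and>
       (\<forall>s. norm (v s) \<le> w k * M \<and> norm (v' s) \<le> w k * M) \<and>
       moment (exp_weight (of_nat k ^ 2 - \<mu>1)) v = p' k \<and> moment (dd_weight k) v = r' k \<and>
       (\<forall>j\<ge>1. j \<noteq> k \<longrightarrow> moment (exp_weight (of_nat j ^ 2 - \<mu>1)) v = 0 \<and> moment (dd_weight j) v = 0)"
    proof (intro allI)
      fix k :: nat
      show "\<exists>v v'. k \<ge> 1 \<longrightarrow> C1_supported (- L) 0 v v' \<and>
       (\<forall>s. norm (v s) \<le> w k * M \<and> norm (v' s) \<le> w k * M) \<and>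
       moment (exp_weight (of_nat k ^ 2 - \<mu>1)) v = p' k \<and> moment (dd_weight k) v = r' k \<and>
       (\<forall>j\<ge>1. j \<noteq> k \<longrightarrow> moment (exp_weight (of_nat j ^ 2 - \<mu>1)) v = 0 \<and> moment (dd_weight j) v = 0)"
      proof (cases "k \<ge> 1")
        case True
        have "C * exp (C * real k ^ 2) * (norm (p' k) + norm (r' k)) \<le> C * exp (C * real k ^ 2) * (exp (- ((real k ^ 2 - 1) * \<tau>)) * Q * M)"
          using L pr'[OF True] by (intro mult_left_mono) auto
        also have "\<dots> = w k * M" by (simp add: w_def)
        finally show ?thesis using mode[OF True, of "p' k" "r' k"] by (meson order_trans)
      qed auto
    qed
    then obtain v v' where v: "\<And>k. k \<ge> 1 \<Longrightarrow> C1_supported (- L) 0 (v k) (v' k)"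
       "\<And>k s. k \<ge> 1 \<Longrightarrow> norm (v k s) \<le> w k * M" "\<And>k s. k \<ge> 1 \<Longrightarrow> norm (v' k s) \<le> w k * M"
       "\<And>k. k \<ge> 1 \<Longrightarrow> moment (exp_weight (of_nat k ^ 2 - \<mu>1)) (v k) = p' k"
       "\<And>k. k \<ge> 1 \<Longrightarrow> moment (dd_weight k) (v k) = r' k"
       "\<And>j k. k \<ge> 1 \<Longrightarrow> j \<ge> 1 \<Longrightarrow> j \<noteq> k \<Longrightarrow> moment (exp_weight (of_nat j ^ 2 - \<mu>1)) (v k) = 0"
       "\<And>j k. k \<ge> 1 \<Longrightarrow> j \<ge> 1 \<Longrightarrow> j \<noteq> k \<Longrightarrow> moment (dd_weight j) (v k) = 0"
      unfolding choice_iff by blast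
    define f f' where "f n s = (\<Sum>k=1..n. v k s)" "f' n s = (\<Sum>k=1..n. v' k s)" for n s
    have fC: "C1_supported (- L) 0 (f n) (f' n)" for n
      unfolding f_f'_def by (rule C1_supported_sum) (use v(1) in auto)
    have "summable (\<lambda>n. w (Suc n) * M)" using w_sum by (intro summable_mult2) (simp add: summable_Suc_iff)
    moreover have "norm (f (Suc n) s - f n s) \<le> w (Suc n) * M" "norm (f' (Suc n) s - f' n s) \<le> w (Suc n) * M" for n s
      using v(2,3)[of "Suc n" s] by (simp_all add: f_f'_def)
    ultimately obtain g g' where g: "C1_supported (- L) 0 g g'" "\<And>s. (\<lambda>n. f n s) \<longlonglongrightarrow> g s"
       "\<And>e. continuous_on UNIV e \<Longrightarrow> (\<lambda>n. moment e (f n)) \<longlonglongrightarrow> moment e g"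
      using C1_supported_limit[of "- L" 0 f f' "\<lambda>n. w (Suc n) * M", OF fC] by metis
    have mf: "moment e (f n) = (\<Sum>k=1..n. moment e (v k))" if "continuous_on UNIV e" for e n
      unfolding f_f'_def by (rule moment_sum[OF that v(1)]) simp
    have mg: "moment e g = moment e (v k)" if e: "continuous_on UNIV e" and k: "k \<ge> 1"
      and z: "\<And>j. j \<ge> 1 \<Longrightarrow> j \<noteq> k \<Longrightarrow> moment e (v j) = 0" for e k
    proof -
      have "moment e (f n) = moment e (v k)" if "n \<ge> k" for n
      proof -
        have "moment e (f n) = (\<Sum>j\<in>{k}. moment e (v j))"
          unfolding mf[OF e] using k that z by (intro sum.mono_neutral_right) auto
        then show ?thesis by simp
      qed
      then have "\<forall>\<^sub>F n in sequentially. moment e (f n) = moment e (v k)"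
        unfolding eventually_sequentially by blast
      then show ?thesis by (rule LIMSEQ_unique[OF g(3)[OF e] tendsto_eventually])
    qed
    have g1: "moment (exp_weight (of_nat k ^ 2 - \<mu>1)) g = p' k" "moment (dd_weight k) g = r' k" if k: "k \<ge> 1" for k
      using mg[OF exp_weight_cont k, of "of_nat k ^ 2 - \<mu>1"] mg[OF dd_weight_cont k, of k] v k by auto
    have bg: "norm (g s) \<le> C' * M" for s
    proof (rule LIMSEQ_le_const2[OF tendsto_norm[OF g(2)]], intro exI allI impI)
      fix n
      have "norm (f n s) \<le> (\<Sum>k=1..n. w k * M)"
        unfolding f_f'_def by (rule sum_norm_le) (use v(2) in auto)
      also have "\<dots> = (\<Sum>k=1..n. w k) * M" by (simp add: sum_distrib_right)
      also have "\<dots> \<le> C' * M" unfolding C'_def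
        using M by (intro mult_right_mono sum_le_suminf[OF w_sum]) (auto intro: w0)
      finally show "norm (f n s) \<le> C' * M" .
    qed
    define u u' where "u s = g (s + - \<tau>)" "u' s = g' (s + - \<tau>)" for s
    have uC: "C1_supported 0 \<tau> u u'"
      unfolding u_u'_def by (rule C1_supported_mono[OF C1_supported_shift[OF g(1)]]) (use \<tau> in auto)
    have "moment (exp_weight (of_nat k ^ 2 - \<mu>1)) u = p k \<and> moment (dd_weight k) u = r k" if k: "k \<ge> 1" for k
    proof
      show "moment (exp_weight (of_nat k ^ 2 - \<mu>1)) u = p k"
        unfolding u_u'_def moment_shift exp_weight_shift moment_cmult_left g1[OF k] p'_def
        by (simp add: mult.assoc[symmetric] exp_add[symmetric])
      have E: "A * B = 1 \<Longrightarrow> F * G = H \<Longrightarrow> A * (B * (R - H * D * P)) + F * D * (G * P) = R" for A B F G H D P R :: complex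
      proof -
        assume "A * B = 1" "F * G = H"
        moreover have "A * (B * (R - H * D * P)) + F * D * (G * P) = (A * B) * (R - H * D * P) + (F * G) * D * P"
          by (simp add: algebra_simps)
        ultimately show ?thesis by simp
      qed
      show "moment (dd_weight k) u = r k"
        unfolding u_u'_def moment_shift moment_dd_shift[OF g(1)] g1[OF k] p'_def r'_def
        by (rule E) (simp_all add: exp_add[symmetric] algebra_simps)
    qed
    moreover have "norm (u s) \<le> C' * M" for s unfolding u_u'_def by (rule bg)
    ultimately show ?thesis using uC by blast
  qed
  then show ?thesis using that[of \<tau> C'] \<tau>(1) C' by blast
qed

end

section \<open>Vanishing energy\<close>

lemma sum_split_add: "(\<Sum>i<m + n. g i) = (\<Sum>i<m. g i) + (\<Sum>i<n. g (m + i :: nat) :: 'a::comm_monoid_add)"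
  by (induction n) (simp_all add: add.assoc)

context decoupled_spectrum
begin

lemma norm_exp_decay:
  assumes "k \<ge> 1" "\<nu> \<in> {\<mu>1, \<mu>2}" "0 \<le> t"
  shows "norm (exp (- ((of_nat k ^ 2 - \<nu>) * of_real t))) \<le> 1"
proof -
  have "Re (of_nat k ^ 2 :: complex) = real k ^ 2"
    by (metis Re_complex_of_real of_real_of_nat_eq of_real_power)
  moreover have "1 \<le> real k ^ 2" using assms(1) by simp
  moreover have "Re \<nu> \<le> 1" using assms(2) Re_le by auto
  ultimately have "0 \<le> (Re (of_nat k ^ 2) - Re \<nu>) * t" using assms(3) by simp
  then show ?thesis by simp
qed

text \<open>Null controls for the data of stage \<open>i\<close> are run on the consecutive
  intervals \<open>[i T, (i + 1) T]\<close>; translation turns their moments into the summands on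
  the right. The sup norms do not add up, because at any time at most two copies can be nonzero,
  which accounts for the doubled constant.\<close>

lemma staged_control:
  obtains T C where "0 < T" "0 \<le> C"
    "\<And>n p r K. 0 \<le> K \<Longrightarrow> (\<And>i k. k \<ge> 1 \<Longrightarrow> norm (p i k) \<le> K \<and> norm (r i k) \<le> K) \<Longrightarrow>
      \<exists>u u'. C1_supported 0 (real n * T) u u' \<and> (\<forall>s. norm (u s) \<le> C * K) \<and>
       (\<forall>k\<ge>1. moment (exp_weight (of_nat k ^ 2 - \<mu>1)) u =
            (\<Sum>i<n. exp ((of_nat k ^ 2 - \<mu>1) * of_real (real i * T)) * p i k) \<and>
          moment (dd_weight k) u =
            (\<Sum>i<n. exp ((of_nat k ^ 2 - \<mu>2) * of_real (real i * T)) * r i k +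
               exp (of_nat k ^ 2 * of_real (real i * T)) * ddexp \<mu>1 \<mu>2 (- (real i * T)) * p i k))"
proof -
  obtain T C where T: "0 < T" "0 \<le> C" and null:
    "\<And>p r M. (\<And>k. k \<ge> 1 \<Longrightarrow> norm (p k) \<le> M \<and> norm (r k) \<le> M) \<Longrightarrow> 0 \<le> M \<Longrightarrow>
       \<exists>u u'. C1_supported 0 T u u' \<and> (\<forall>s. norm (u s) \<le> C * M) \<and>
         (\<forall>k\<ge>1. moment (exp_weight (of_nat k ^ 2 - \<mu>1)) u = p k \<and> moment (dd_weight k) u = r k)"
    by (rule null_moments) blast
  have "\<exists>u u'. C1_supported 0 (real n * T) u u' \<and> (\<forall>s. norm (u s) \<le> (2 * C) * K) \<and>
       (\<forall>k\<ge>1. moment (exp_weight (of_nat k ^ 2 - \<mu>1)) u =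
            (\<Sum>i<n. exp ((of_nat k ^ 2 - \<mu>1) * of_real (real i * T)) * p i k) \<and>
          moment (dd_weight k) u =
            (\<Sum>i<n. exp ((of_nat k ^ 2 - \<mu>2) * of_real (real i * T)) * r i k +
               exp (of_nat k ^ 2 * of_real (real i * T)) * ddexp \<mu>1 \<mu>2 (- (real i * T)) * p i k))"
    if K: "0 \<le> K" and pr: "\<And>i k. k \<ge> 1 \<Longrightarrow> norm (p i k) \<le> K \<and> norm (r i k) \<le> K"
    for n K and p r :: "nat \<Rightarrow> nat \<Rightarrow> complex"
  proof -
    have "\<forall>i. \<exists>u u'. C1_supported 0 T u u' \<and> (\<forall>s. norm (u s) \<le> C * K) \<and>
         (\<forall>k\<ge>1. moment (exp_weight (of_nat k ^ 2 - \<mu>1)) u = p i k \<and> moment (dd_weight k) u = r i k)"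
    proof
      fix i
      show "\<exists>u u'. C1_supported 0 T u u' \<and> (\<forall>s. norm (u s) \<le> C * K) \<and>
         (\<forall>k\<ge>1. moment (exp_weight (of_nat k ^ 2 - \<mu>1)) u = p i k \<and> moment (dd_weight k) u = r i k)"
        by (rule null[of "p i" K "r i"]) (use pr K in auto)
    qed
    then obtain v v' where v: "\<And>i. C1_supported 0 T (v i) (v' i)" "\<And>i s. norm (v i s) \<le> C * K"
      "\<And>i k. k \<ge> 1 \<Longrightarrow> moment (exp_weight (of_nat k ^ 2 - \<mu>1)) (v i) = p i k"
      "\<And>i k. k \<ge> 1 \<Longrightarrow> moment (dd_weight k) (v i) = r i k"
      unfolding choice_iff by blast
    define w w' where "w i s = v i (s + - (real i * T))" "w' i s = v' i (s + - (real i * T))" for i s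
    have w_eq: "w i = (\<lambda>s. v i (s + - (real i * T)))" for i by (simp add: w_w'_def fun_eq_iff)
    have wC: "C1_supported 0 (real n * T) (w i) (w' i)" if "i < n" for i
      unfolding w_w'_def
    proof (rule C1_supported_mono[OF C1_supported_shift[OF v(1)]])
      have "(real i + 1) * T \<le> real n * T" using that T by (intro mult_right_mono) auto
      then show "T - - (real i * T) \<le> real n * T" by (simp add: algebra_simps)
    qed (use T in auto)
    define u u' where "u s = (\<Sum>i<n. w i s)" "u' s = (\<Sum>i<n. w' i s)" for s
    have uC: "C1_supported 0 (real n * T) u u'"
      unfolding u_u'_def by (rule C1_supported_sum) (use wC in auto)
    have m1: "moment (exp_weight (of_nat k ^ 2 - \<mu>1)) u =
            (\<Sum>i<n. exp ((of_nat k ^ 2 - \<mu>1) * of_real (real i * T)) * p i k)" if k: "k \<ge> 1" for k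
    proof -
      have "moment (exp_weight (of_nat k ^ 2 - \<mu>1)) u = (\<Sum>i<n. moment (exp_weight (of_nat k ^ 2 - \<mu>1)) (w i))"
        unfolding u_u'_def by (rule moment_sum[OF exp_weight_cont wC]) simp
      also have "\<dots> = (\<Sum>i<n. exp ((of_nat k ^ 2 - \<mu>1) * of_real (real i * T)) * p i k)"
        unfolding w_eq moment_shift exp_weight_shift moment_cmult_left v(3)[OF k] by simp
      finally show ?thesis .
    qed
    have m2: "moment (dd_weight k) u = (\<Sum>i<n. exp ((of_nat k ^ 2 - \<mu>2) * of_real (real i * T)) * r i k +
               exp (of_nat k ^ 2 * of_real (real i * T)) * ddexp \<mu>1 \<mu>2 (- (real i * T)) * p i k)" if k: "k \<ge> 1" for k
    proof -
      have "moment (dd_weight k) u = (\<Sum>i<n. moment (dd_weight k) (w i))"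
        unfolding u_u'_def by (rule moment_sum[OF dd_weight_cont wC]) simp
      also have "\<dots> = (\<Sum>i<n. exp ((of_nat k ^ 2 - \<mu>2) * of_real (real i * T)) * r i k +
               exp (of_nat k ^ 2 * of_real (real i * T)) * ddexp \<mu>1 \<mu>2 (- (real i * T)) * p i k)"
        unfolding w_eq moment_shift moment_dd_shift[OF v(1)] v(3,4)[OF k] by simp
      finally show ?thesis .
    qed
    have "norm (u s) \<le> (2 * C) * K" for s
    proof -
      define x where "x = s / T"
      \<comment> \<open>The stage containing \<open>s\<close> and the one before it, which shares an
        endpoint. Truncated subtraction at 0 only repeats the first stage.\<close>
      define S where "S = {nat \<lfloor>x\<rfloor>, nat \<lfloor>x\<rfloor> - 1}"
      have out: "w i s = 0" if "i \<notin> S" for i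
      proof -
        have "s + - (real i * T) \<notin> {0..T}"
        proof
          assume "s + - (real i * T) \<in> {0..T}"
          then have "real i * T \<le> s" "s \<le> (real i + 1) * T" by (auto simp: algebra_simps)
          then have "real i \<le> x" "x \<le> real i + 1" using T by (auto simp: x_def field_simps)
          then have "i = nat \<lfloor>x\<rfloor> \<or> i = nat \<lfloor>x\<rfloor> - 1" by linarith
          then show False using that by (simp add: S_def)
        qed
        then show ?thesis using v(1)[of i] unfolding w_w'_def C1_supported_def by blast
      qed
      have CK: "0 \<le> C * K" using T K by simp
      have "norm (u s) \<le> (\<Sum>i<n. norm (w i s))" unfolding u_u'_def by (rule norm_sum)
      also have "\<dots> = (\<Sum>i\<in>{..<n} \<inter> S. norm (w i s))"
        by (rule sum.mono_neutral_right) (use out in auto)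
      also have "\<dots> \<le> of_nat (card ({..<n} \<inter> S)) * (C * K)"
        by (rule sum_bounded_above) (simp add: w_w'_def v)
      also have "\<dots> \<le> 2 * (C * K)"
      proof (intro mult_right_mono CK)
        have "card ({..<n} \<inter> S) \<le> card S" by (intro card_mono) (auto simp: S_def)
        also have "\<dots> \<le> 2" unfolding S_def using card_insert_le_m1[of 2 "{nat \<lfloor>x\<rfloor> - 1}" "nat \<lfloor>x\<rfloor>"] by simp
        finally show "real (card ({..<n} \<inter> S)) \<le> 2" by simp
      qed
      finally show ?thesis by simp
    qed
    then show ?thesis using uC m1 m2 by blast
  qed
  then show ?thesis using that[of T "2 * C"] T by auto
qed

lemma staged_control_energy:
  assumes "C1_supported 0 T u u'" "\<And>s. norm (u s) \<le> K" "0 \<le> T"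
  shows "(LINT s|lborel. (norm (u s))\<^sup>2) \<le> T * K\<^sup>2"
proof -
  have "(LINT s|lborel. (norm (u s))\<^sup>2) \<le> (LINT s|lborel. K\<^sup>2 * indicator {0..T} s)"
  proof (rule integral_mono)
    show "integrable lborel (\<lambda>s. (norm (u s))\<^sup>2)"
    proof (rule integrable_cont_supported[of _ 0 T])
      show "continuous_on UNIV (\<lambda>s. (norm (u s))\<^sup>2)"
        by (intro continuous_on_power continuous_on_norm C1_supported_cont[OF assms(1)])
    qed (use assms(1) in \<open>simp add: C1_supported_def\<close>)
    show "integrable lborel (\<lambda>s. K\<^sup>2 * indicator {0..T} s :: real)"
      by (intro integrable_mult_right integrable_real_indicator) (use assms(3) in auto)
    show "(norm (u s))\<^sup>2 \<le> K\<^sup>2 * indicator {0..T} s" for s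
      using assms(1) power_mono[OF assms(2)[of s] norm_ge_zero, of 2] unfolding C1_supported_def
      by (auto simp: indicator_def)
  qed
  also have "\<dots> = T * K\<^sup>2" using assms(3) by simp
  finally show ?thesis .
qed

text \<open>Each stage cancels a fraction of the free state. For a double eigenvalue the free state has a
  part growing linearly with the stage; weights \<open>w i\<close> of sum \<open>1\<close> with \<open>\<Sum>i. i * w i = 0\<close> over \<open>2 n\<close> stages
  remove its contribution.\<close>

lemma small_control:
  assumes ab: "\<And>k. k \<ge> 1 \<Longrightarrow> norm (a k) \<le> M \<and> norm (b k) \<le> M" and "0 < \<epsilon>"
  obtains T u u' where "0 < T" "C1_supported 0 T u u'" "(LINT s|lborel. (norm (u s))\<^sup>2) \<le> \<epsilon>\<^sup>2"
    "\<And>k. k \<ge> 1 \<Longrightarrow> moment (exp_weight (of_nat k ^ 2 - \<mu>1)) u = a k"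
    "\<And>k. k \<ge> 1 \<Longrightarrow> moment (dd_weight k) u = b k"
proof -
  obtain T C where T: "0 < T" "0 \<le> C" and staged:
    "\<And>n p r K. 0 \<le> K \<Longrightarrow> (\<And>i k. k \<ge> 1 \<Longrightarrow> norm (p i k) \<le> K \<and> norm (r i k) \<le> K) \<Longrightarrow>
      \<exists>u u'. C1_supported 0 (real n * T) u u' \<and> (\<forall>s. norm (u s) \<le> C * K) \<and>
       (\<forall>k\<ge>1. moment (exp_weight (of_nat k ^ 2 - \<mu>1)) u =
            (\<Sum>i<n. exp ((of_nat k ^ 2 - \<mu>1) * of_real (real i * T)) * p i k) \<and>
          moment (dd_weight k) u =
            (\<Sum>i<n. exp ((of_nat k ^ 2 - \<mu>2) * of_real (real i * T)) * r i k +
               exp (of_nat k ^ 2 * of_real (real i * T)) * ddexp \<mu>1 \<mu>2 (- (real i * T)) * p i k))"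
    by (rule staged_control) blast
  have M: "0 \<le> M" using ab[of 1] norm_ge_zero[of "a 1"] by linarith
  have "\<exists>Q\<ge>0. \<forall>n\<ge>1. \<exists>N u u'. 1 \<le> N \<and> N \<le> 2 * n \<and> C1_supported 0 (real N * T) u u' \<and>
       (\<forall>s. norm (u s) \<le> C * (Q / real n)) \<and>
       (\<forall>k\<ge>1. moment (exp_weight (of_nat k ^ 2 - \<mu>1)) u = a k \<and> moment (dd_weight k) u = b k)"
  proof (cases "\<mu>1 = \<mu>2")
    case False
    define d where "d = norm (\<mu>1 - \<mu>2)"
    have d: "0 < d" using False by (simp add: d_def)
    define Q where "Q = M * (1 + 2 / d)"
    have Q: "0 \<le> Q" "M \<le> Q" using M d by (auto simp: Q_def algebra_simps)
    have "\<exists>u u'. C1_supported 0 (real n * T) u u' \<and> (\<forall>s. norm (u s) \<le> C * (Q / real n)) \<and>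
       (\<forall>k\<ge>1. moment (exp_weight (of_nat k ^ 2 - \<mu>1)) u = a k \<and> moment (dd_weight k) u = b k)"
      if n: "n \<ge> 1" for n
    proof -
      define p where "p i k = exp (- ((of_nat k ^ 2 - \<mu>1) * of_real (real i * T))) * (a k / of_nat n)" for i k
      \<comment> \<open>The second summand cancels the coupling term of the translated moments, so
        each stage contributes exactly \<open>a k / n\<close> and \<open>b k / n\<close>. It stays
        bounded because both exponentials have modulus at most 1 and \<open>\<mu>1 - \<mu>2\<close>
        is nonzero; this is the \<open>2 / d\<close> in \<open>Q\<close>.\<close>
      define r where "r i k = exp (- ((of_nat k ^ 2 - \<mu>2) * of_real (real i * T))) * (b k / of_nat n) +
        (exp (- ((of_nat k ^ 2 - \<mu>1) * of_real (real i * T))) - exp (- ((of_nat k ^ 2 - \<mu>2) * of_real (real i * T)))) / (\<mu>1 - \<mu>2) * (a k / of_nat n)" for i k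
      have ab_n: "norm (a k / of_nat n) \<le> M / n" "norm (b k / of_nat n) \<le> M / n" if "k \<ge> 1" for k
        using ab[OF that] by (auto simp: norm_divide divide_right_mono)
      have iT: "0 \<le> real i * T" for i using T by simp
      have pr: "norm (p i k) \<le> Q / real n \<and> norm (r i k) \<le> Q / real n" if k: "k \<ge> 1" for i k
      proof
        have "norm (p i k) \<le> 1 * (M / n)"
          unfolding p_def norm_mult using M by (intro mult_mono ab_n k norm_exp_decay iT) auto
        also have "\<dots> \<le> Q / n" using Q by (simp add: divide_right_mono)
        finally show "norm (p i k) \<le> Q / real n" .
        let ?e1 = "exp (- ((of_nat k ^ 2 - \<mu>1) * of_real (real i * T)))" and ?e2 = "exp (- ((of_nat k ^ 2 - \<mu>2) * of_real (real i * T)))"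
        have e: "norm ?e1 \<le> 1" "norm ?e2 \<le> 1" by (rule norm_exp_decay[OF k _ iT], simp)+
        have "norm (?e1 - ?e2) \<le> 2" using e norm_triangle_ineq4[of ?e1 ?e2] by linarith
        then have "norm ((?e1 - ?e2) / (\<mu>1 - \<mu>2)) \<le> 2 / d"
          unfolding norm_divide d_def[symmetric] using d by (intro divide_right_mono) auto
        then have "norm (?e2 * (b k / of_nat n)) + norm ((?e1 - ?e2) / (\<mu>1 - \<mu>2) * (a k / of_nat n)) \<le> 1 * (M / n) + (2 / d) * (M / n)"
          unfolding norm_mult[of ?e2] norm_mult[of "(?e1 - ?e2) / (\<mu>1 - \<mu>2)"]
          using M d by (intro add_mono mult_mono ab_n k e) auto
        then have "norm (r i k) \<le> 1 * (M / n) + (2 / d) * (M / n)"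
          unfolding r_def by (rule order_trans[OF norm_triangle_ineq])
        also have "\<dots> = Q / n" by (simp add: Q_def add_divide_distrib algebra_simps)
        finally show "norm (r i k) \<le> Q / real n" .
      qed
      obtain u u' where u: "C1_supported 0 (real n * T) u u'" "\<And>s. norm (u s) \<le> C * (Q / real n)"
        "\<And>k. k \<ge> 1 \<Longrightarrow> moment (exp_weight (of_nat k ^ 2 - \<mu>1)) u =
            (\<Sum>i<n. exp ((of_nat k ^ 2 - \<mu>1) * of_real (real i * T)) * p i k)"
        "\<And>k. k \<ge> 1 \<Longrightarrow> moment (dd_weight k) u =
            (\<Sum>i<n. exp ((of_nat k ^ 2 - \<mu>2) * of_real (real i * T)) * r i k +
               exp (of_nat k ^ 2 * of_real (real i * T)) * ddexp \<mu>1 \<mu>2 (- (real i * T)) * p i k)"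
        using staged[of "Q / n" p r n] pr Q by auto
      have cancel: "exp z * (exp (- z) * x) = x" for z x :: complex
        by (simp add: mult.assoc[symmetric] exp_add[symmetric])
      have "exp ((of_nat k ^ 2 - \<mu>2) * of_real t) * (exp (- ((of_nat k ^ 2 - \<mu>2) * of_real t)) * y +
          (exp (- ((of_nat k ^ 2 - \<mu>1) * of_real t)) - exp (- ((of_nat k ^ 2 - \<mu>2) * of_real t))) / (\<mu>1 - \<mu>2) * x) +
          exp (of_nat k ^ 2 * of_real t) * ddexp \<mu>1 \<mu>2 (- t) * (exp (- ((of_nat k ^ 2 - \<mu>1) * of_real t)) * x) = y" for k t x y
      proof -
        have 1: "exp (of_nat k ^ 2 * of_real t) * (exp (- ((of_nat k ^ 2 - \<mu>1) * of_real t))) = exp (\<mu>1 * of_real t)"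
          by (simp add: exp_add[symmetric] algebra_simps)
        have 2: "exp ((of_nat k ^ 2 - \<mu>2) * of_real t) * exp (- ((of_nat k ^ 2 - \<mu>1) * of_real t)) = exp ((\<mu>1 - \<mu>2) * of_real t)"
          by (simp add: exp_add[symmetric] algebra_simps)
        have 3: "exp ((of_nat k ^ 2 - \<mu>2) * of_real t) * exp (- ((of_nat k ^ 2 - \<mu>2) * of_real t)) = 1"
          by (simp add: exp_add[symmetric])
        have 4: "exp (\<mu>1 * of_real t) * ddexp \<mu>1 \<mu>2 (- t) = (1 - exp ((\<mu>1 - \<mu>2) * of_real t)) / (\<mu>1 - \<mu>2)"
          using False by (simp add: ddexp_def right_diff_distrib exp_add[symmetric] algebra_simps)
        have "exp ((of_nat k ^ 2 - \<mu>2) * of_real t) * (exp (- ((of_nat k ^ 2 - \<mu>2) * of_real t)) * y +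
          (exp (- ((of_nat k ^ 2 - \<mu>1) * of_real t)) - exp (- ((of_nat k ^ 2 - \<mu>2) * of_real t))) / (\<mu>1 - \<mu>2) * x) +
          exp (of_nat k ^ 2 * of_real t) * ddexp \<mu>1 \<mu>2 (- t) * (exp (- ((of_nat k ^ 2 - \<mu>1) * of_real t)) * x)
          = (exp ((of_nat k ^ 2 - \<mu>2) * of_real t) * exp (- ((of_nat k ^ 2 - \<mu>2) * of_real t))) * y
          + (exp ((of_nat k ^ 2 - \<mu>2) * of_real t) * exp (- ((of_nat k ^ 2 - \<mu>1) * of_real t)) - exp ((of_nat k ^ 2 - \<mu>2) * of_real t) * exp (- ((of_nat k ^ 2 - \<mu>2) * of_real t))) / (\<mu>1 - \<mu>2) * x
          + (exp (of_nat k ^ 2 * of_real t) * exp (- ((of_nat k ^ 2 - \<mu>1) * of_real t))) * ddexp \<mu>1 \<mu>2 (- t) * x"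
          by (simp add: distrib_left right_diff_distrib mult_ac)
        also have "\<dots> = y" unfolding 1 2 3 4 by (simp add: diff_divide_distrib algebra_simps)
        finally show ?thesis .
      qed
      then have "moment (exp_weight (of_nat k ^ 2 - \<mu>1)) u = a k \<and> moment (dd_weight k) u = b k" if k: "k \<ge> 1" for k
        unfolding u(3)[OF k] u(4)[OF k] using n by (simp only: p_def r_def cancel) simp
      then show ?thesis using u(1,2) by blast
    qed
    note stage = this
    show ?thesis
    proof (intro exI[of _ Q] conjI allI impI)
      fix n :: nat assume n: "1 \<le> n"
      show "\<exists>N u u'. 1 \<le> N \<and> N \<le> 2 * n \<and> C1_supported 0 (real N * T) u u' \<and>
       (\<forall>s. norm (u s) \<le> C * (Q / real n)) \<and>
       (\<forall>k\<ge>1. moment (exp_weight (of_nat k ^ 2 - \<mu>1)) u = a k \<and> moment (dd_weight k) u = b k)"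
        using stage[OF n] n by (intro exI[of _ n]) simp
    qed (rule Q(1))
  next
    case True
    have ddT: "ddexp \<mu>1 \<mu>2 t = of_real t * exp (\<mu>1 * of_real t)" for t
      using True by (simp add: ddexp_def)
    have "\<exists>u u'. C1_supported 0 (real (2 * n) * T) u u' \<and> (\<forall>s. norm (u s) \<le> C * (2 * M / real n)) \<and>
       (\<forall>k\<ge>1. moment (exp_weight (of_nat k ^ 2 - \<mu>1)) u = a k \<and> moment (dd_weight k) u = b k)"
      if n: "n \<ge> 1" for n
    proof -
      \<comment> \<open>With weight \<open>w1\<close> on the first \<open>n\<close> stages and
        \<open>w2\<close> on the last \<open>n\<close>, the conditions read
        \<open>n * (w1 + w2) = 1\<close> and \<open>(n - 1) / 2 + w2 * n^2 = 0\<close>. Both weights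
        are of order \<open>1 / n\<close>.\<close>
      define w2 where "w2 = - (real n - 1) / (2 * real n ^ 2)"
      define w1 where "w1 = 1 / real n - w2"
      define w where "w i = (if i < n then w1 else w2)" for i
      have n0: "real n \<ge> 1" using n by simp
      have w2_le: "\<bar>w2\<bar> \<le> 1 / real n"
      proof -
        have "\<bar>w2\<bar> = (real n - 1) / (2 * real n ^ 2)" using n0 by (simp add: w2_def abs_divide)
        also have "\<dots> \<le> (2 * real n) / (2 * real n ^ 2)" using n0 by (intro divide_right_mono) auto
        also have "\<dots> = 1 / real n" by (simp add: power2_eq_square)
        finally show ?thesis .
      qed
      have w_le: "\<bar>w i\<bar> \<le> 2 / real n" for i
        using w2_le n0 by (auto simp: w_def w1_def abs_if split: if_splits)
      have split: "(\<Sum>i<2*n. f i * w i) = w1 * (\<Sum>i<n. f i) + w2 * (\<Sum>i<n. f (n + i))" for f :: "nat \<Rightarrow> real"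
      proof -
        have "(\<Sum>i<n+n. f i * w i) = (\<Sum>i<n. f i * w i) + (\<Sum>i<n. f (n + i) * w (n + i))"
          by (rule sum_split_add)
        also have "\<dots> = w1 * (\<Sum>i<n. f i) + w2 * (\<Sum>i<n. f (n + i))"
          by (simp add: w_def sum_distrib_left mult.commute)
        finally show ?thesis unfolding mult_2 .
      qed
      have sw: "(\<Sum>i<2*n. w i) = 1"
        using split[of "\<lambda>_. 1"] n0 by (simp add: w1_def algebra_simps)
      have siw: "(\<Sum>i<2*n. real i * w i) = 0"
      proof -
        have g: "(\<Sum>i<n. real i) = real n * (real n - 1) / 2"
          using n by (induction n rule: nat_induct_at_least) (simp_all add: field_simps)
        have "(\<Sum>i<2*n. real i * w i) = w1 * (\<Sum>i<n. real i) + w2 * (\<Sum>i<n. real (n + i))" by (rule split)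
        also have "(\<Sum>i<n. real (n + i)) = real n ^ 2 + (\<Sum>i<n. real i)" by (simp add: sum.distrib power2_eq_square)
        also have "w1 * (\<Sum>i<n. real i) + w2 * (real n ^ 2 + (\<Sum>i<n. real i)) = (\<Sum>i<n. real i) / real n + w2 * real n ^ 2"
          by (simp add: w1_def algebra_simps)
        also have "\<dots> = 0" using n0 unfolding g w2_def by (simp add: field_simps)
        finally show ?thesis .
      qed
      define p where "p i k = exp (- ((of_nat k ^ 2 - \<mu>1) * of_real (real i * T))) * (of_real (w i) * a k)" for i k
      define r where "r i k = exp (- ((of_nat k ^ 2 - \<mu>1) * of_real (real i * T))) * (of_real (w i) * b k)" for i k
      have iT: "0 \<le> real i * T" for i using T by simp
      have pr: "norm (p i k) \<le> 2 * M / real n \<and> norm (r i k) \<le> 2 * M / real n" if k: "k \<ge> 1" for i k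
      proof -
        have "norm (exp (- ((of_nat k ^ 2 - \<mu>1) * of_real (real i * T))) * (of_real (w i) * c)) \<le> 1 * (2 / real n * M)"
          if "norm c \<le> M" for c
          unfolding norm_mult norm_of_real using M that
          by (intro mult_mono norm_exp_decay k iT w_le) auto
        then show ?thesis using ab[OF k] by (simp add: p_def r_def)
      qed
      obtain u u' where u: "C1_supported 0 (real (2 * n) * T) u u'" "\<And>s. norm (u s) \<le> C * (2 * M / real n)"
        "\<And>k. k \<ge> 1 \<Longrightarrow> moment (exp_weight (of_nat k ^ 2 - \<mu>1)) u =
            (\<Sum>i<2*n. exp ((of_nat k ^ 2 - \<mu>1) * of_real (real i * T)) * p i k)"
        "\<And>k. k \<ge> 1 \<Longrightarrow> moment (dd_weight k) u =
            (\<Sum>i<2*n. exp ((of_nat k ^ 2 - \<mu>2) * of_real (real i * T)) * r i k +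
               exp (of_nat k ^ 2 * of_real (real i * T)) * ddexp \<mu>1 \<mu>2 (- (real i * T)) * p i k)"
        using staged[of "2 * M / n" p r "2 * n"] pr M by fastforce
      have cancel: "exp z * (exp (- z) * x) = x" for z x :: complex
        by (simp add: mult.assoc[symmetric] exp_add[symmetric])
      have c2: "exp ((z - \<mu>2) * t) * (exp (- ((z - \<mu>1) * t)) * x) = x" for z t x
        unfolding True by (rule cancel)
      have dd: "exp (of_nat k ^ 2 * of_real t) * ddexp \<mu>1 \<mu>2 (- t) * (exp (- ((of_nat k ^ 2 - \<mu>1) * of_real t)) * x) = - (of_real t * x)" for k t x
      proof -
        have "exp (of_nat k ^ 2 * of_real t) * exp (\<mu>1 * of_real (- t)) * exp (- ((of_nat k ^ 2 - \<mu>1) * of_real t)) = 1"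
          by (simp add: exp_add[symmetric] algebra_simps)
        moreover have "exp (of_nat k ^ 2 * of_real t) * ddexp \<mu>1 \<mu>2 (- t) * (exp (- ((of_nat k ^ 2 - \<mu>1) * of_real t)) * x) =
          - (of_real t * (exp (of_nat k ^ 2 * of_real t) * exp (\<mu>1 * of_real (- t)) * exp (- ((of_nat k ^ 2 - \<mu>1) * of_real t))) * x)"
          unfolding ddT by (simp add: mult_ac)
        ultimately show ?thesis by simp
      qed
      have "moment (exp_weight (of_nat k ^ 2 - \<mu>1)) u = a k \<and> moment (dd_weight k) u = b k" if k: "k \<ge> 1" for k
      proof
        have "moment (exp_weight (of_nat k ^ 2 - \<mu>1)) u = of_real (\<Sum>i<2*n. w i) * a k"
          unfolding u(3)[OF k] p_def cancel by (simp only: of_real_sum sum_distrib_right)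
        then show "moment (exp_weight (of_nat k ^ 2 - \<mu>1)) u = a k" unfolding sw by simp
        have "moment (dd_weight k) u = (\<Sum>i<2*n. of_real (w i) * b k - of_real (real i * w i) * (of_real T * a k))"
          unfolding u(4)[OF k] p_def r_def dd c2 by (simp add: mult_ac)
        also have "\<dots> = of_real (\<Sum>i<2*n. w i) * b k - of_real (\<Sum>i<2*n. real i * w i) * (of_real T * a k)"
          by (simp only: sum_subtractf of_real_sum sum_distrib_right)
        finally show "moment (dd_weight k) u = b k" unfolding sw siw by simp
      qed
      then show ?thesis using u(1,2) by blast
    qed note stage = this
    show ?thesis
    proof (intro exI[of _ "2 * M"] conjI allI impI)
      fix n :: nat assume n: "1 \<le> n"
      show "\<exists>N u u'. 1 \<le> N \<and> N \<le> 2 * n \<and> C1_supported 0 (real N * T) u u' \<and>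
       (\<forall>s. norm (u s) \<le> C * (2 * M / real n)) \<and>
       (\<forall>k\<ge>1. moment (exp_weight (of_nat k ^ 2 - \<mu>1)) u = a k \<and> moment (dd_weight k) u = b k)"
        using stage[OF n] n by (intro exI[of _ "2 * n"]) simp
    qed (use M in simp)
  qed
  then obtain Q where Q: "Q \<ge> 0" "\<And>n. n \<ge> 1 \<Longrightarrow> \<exists>N u u'. 1 \<le> N \<and> N \<le> 2 * n \<and> C1_supported 0 (real N * T) u u' \<and>
       (\<forall>s. norm (u s) \<le> C * (Q / real n)) \<and>
       (\<forall>k\<ge>1. moment (exp_weight (of_nat k ^ 2 - \<mu>1)) u = a k \<and> moment (dd_weight k) u = b k)" by blast
  \<comment> \<open>At most \<open>2 n\<close> stages of length \<open>T\<close> with amplitude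
    \<open>C * Q / n\<close> have energy at most \<open>2 * T * (C * Q)^2 / n\<close>.\<close>
  obtain n :: nat where n: "2 * T * (C * Q)\<^sup>2 / \<epsilon>\<^sup>2 < real n" using reals_Archimedean2 by blast
  have "0 \<le> 2 * T * (C * Q)\<^sup>2 / \<epsilon>\<^sup>2" using T by simp
  then have n1: "n \<ge> 1" using n by linarith
  obtain N u u' where u: "1 \<le> N" "N \<le> 2 * n" "C1_supported 0 (real N * T) u u'" "\<And>s. norm (u s) \<le> C * (Q / real n)"
    "\<And>k. k\<ge>1 \<Longrightarrow> moment (exp_weight (of_nat k ^ 2 - \<mu>1)) u = a k" "\<And>k. k\<ge>1 \<Longrightarrow> moment (dd_weight k) u = b k"
    using Q(2)[OF n1] by blast
  have NT: "0 < real N * T" using u(1) T by simp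
  have "(LINT s|lborel. (norm (u s))\<^sup>2) \<le> (real N * T) * (C * (Q / real n))\<^sup>2"
    by (rule staged_control_energy[OF u(3,4)]) (use NT in simp)
  also have "\<dots> \<le> (2 * real n * T) * (C * (Q / real n))\<^sup>2"
  proof -
    have "real N \<le> 2 * real n" using u(2) by linarith
    then show ?thesis using T by (intro mult_right_mono) auto
  qed
  also have "\<dots> = 2 * T * (C * Q)\<^sup>2 / real n" using n1 by (simp add: power2_eq_square)
  also have "\<dots> \<le> \<epsilon>\<^sup>2" using n n1 assms(2) by (simp add: field_simps)
  finally show ?thesis using that[OF NT u(3) _ u(5,6)] by blast
qed

end

section \<open>Fubini's theorem and weak integration by parts\<close>

lemma completion_measurable_cong_AE:
  assumes f: "f \<in> borel_measurable (completion M)" and ae: "AE x in M. f x = g x"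
  shows "g \<in> borel_measurable (completion M)"
proof (rule measurableI)
  fix A :: "'b set" assume A: "A \<in> sets borel"
  show "g -` A \<inter> space (completion M) \<in> sets (completion M)"
  proof (rule complete_measure.in_sets_AE)
    show "complete_measure (completion M)" by (rule completion.complete_measure_axioms)
    show "f -` A \<inter> space (completion M) \<in> sets (completion M)" by (rule measurable_sets[OF f A])
    show "AE x in completion M. x \<in> f -` A \<inter> space (completion M) \<longleftrightarrow> x \<in> g -` A \<inter> space (completion M)"
      using ae unfolding AE_completion_iff by eventually_elim auto
  qed auto
qed auto

lemma completion_ex_borel_measurable_complex:
  fixes g :: "'a \<Rightarrow> complex"
  assumes g: "g \<in> borel_measurable (completion M)"
  shows "\<exists>g'\<in>borel_measurable M. AE x in M. g x = g' x"
proof -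
  have "(\<lambda>x. Re (g x)) \<in> borel_measurable (completion M)" using g by measurable
  from completion_ex_borel_measurable_real[OF this] obtain r where [measurable]: "r \<in> borel_measurable M"
    and r: "AE x in M. Re (g x) = r x" by blast
  have "(\<lambda>x. Im (g x)) \<in> borel_measurable (completion M)" using g by measurable
  from completion_ex_borel_measurable_real[OF this] obtain i where [measurable]: "i \<in> borel_measurable M"
    and i: "AE x in M. Im (g x) = i x" by blast
  have m: "(\<lambda>x. Complex (r x) (i x)) \<in> borel_measurable M" unfolding Complex_eq by measurable
  have "AE x in M. g x = Complex (r x) (i x)"
    using r i by eventually_elim (simp add: complex_eq_iff)
  then show ?thesis by (intro bexI[of _ "\<lambda>x. Complex (r x) (i x)"] m)
qed

text \<open>Fubini's theorem is available for the Borel product only, so the sections are compared almost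
  everywhere with those of a Borel representative.\<close>

lemma Fubini_lebesgue:
  fixes f :: "real \<times> real \<Rightarrow> complex"
  assumes f: "integrable lebesgue f"
  shows "AE y in lborel. integrable lebesgue (\<lambda>x. f (x, y))"
    and "integrable lebesgue (\<lambda>y. LINT x|lebesgue. f (x, y))"
    and "(LINT y|lebesgue. LINT x|lebesgue. f (x, y)) = integral\<^sup>L lebesgue f"
    and "AE x in lborel. integrable lebesgue (\<lambda>y. f (x, y))"
    and "integrable lebesgue (\<lambda>x. LINT y|lebesgue. f (x, y))"
    and "(LINT x|lebesgue. LINT y|lebesgue. f (x, y)) = integral\<^sup>L lebesgue f"
proof -
  obtain g where g[measurable]: "g \<in> borel_measurable lborel" and fg: "AE p in lborel. f p = g p"
    using completion_ex_borel_measurable_complex[OF borel_measurable_integrable[OF f]] by blast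
  have fg': "AE p in lebesgue. f p = g p" using fg by (simp add: AE_completion_iff)
  have gm: "g \<in> borel_measurable lebesgue" by (rule measurable_completion[OF g])
  have "integrable lebesgue g"
    using integrable_cong_AE[OF borel_measurable_integrable[OF f] gm fg'] f by blast
  then have gi: "integrable (lborel \<Otimes>\<^sub>M lborel) g"
    by (simp add: lborel_prod integrable_completion)
  have int_eq: "integral\<^sup>L lebesgue f = integral\<^sup>L (lborel \<Otimes>\<^sub>M lborel) g"
    unfolding lborel_prod integral_completion[OF g, symmetric]
    by (rule integral_cong_AE[OF borel_measurable_integrable[OF f] gm fg'])
  from fg have "AE p in lborel \<Otimes>\<^sub>M lborel. f p = g p" unfolding lborel_prod .
  then obtain N where N: "\<And>p. p \<in> space (lborel \<Otimes>\<^sub>M lborel) - N \<Longrightarrow> f p = g p" "N \<in> null_sets (lborel \<Otimes>\<^sub>M lborel)"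
    by (rule AE_E3) blast
  have Ng: "g p = f p" if "p \<notin> N" for p using N(1)[of p] that by (simp add: space_pair_measure)
  have "AE p in lborel \<Otimes>\<^sub>M lborel. p \<notin> N" by (rule AE_not_in[OF N(2)])
  from lborel_pair.AE_pair[OF this] have N1: "AE x in lborel. AE y in lborel. (x, y) \<notin> N" .
  have "{p \<in> space (lborel \<Otimes>\<^sub>M lborel). (fst p, snd p) \<notin> N} = space (lborel \<Otimes>\<^sub>M lborel) - N" by auto
  then have "{p \<in> space (lborel \<Otimes>\<^sub>M lborel). (fst p, snd p) \<notin> N} \<in> sets (lborel \<Otimes>\<^sub>M lborel)"
    using sets.compl_sets[OF null_setsD2[OF N(2)]] by (simp only:)
  from lborel_pair.AE_commute[OF this] N1 have N2: "AE y in lborel. AE x in lborel. (x, y) \<notin> N" by simp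
  have eq1: "AE x in lborel. AE y in lborel. g (x, y) = f (x, y)"
    using N1
  proof eventually_elim
    case (elim x)
    then show ?case by eventually_elim (rule Ng)
  qed
  have eq2: "AE y in lborel. AE x in lborel. g (x, y) = f (x, y)"
    using N2
  proof eventually_elim
    case (elim y)
    then show ?case by eventually_elim (rule Ng)
  qed
  \<comment> \<open>Moves one section from the Borel representative to the Lebesgue measurable
    function that equals it almost everywhere on that section; applied to sections and again to the
    iterated integrals.\<close>
  have sec: "integrable lebesgue h'" "integral\<^sup>L lebesgue h' = integral\<^sup>L lborel h"
    if h: "integrable lborel h" and ae: "AE x in lborel. h x = h' x" for h h' :: "real \<Rightarrow> complex"
  proof -
    have hb: "h \<in> borel_measurable lborel" using h by auto
    then have hm: "h \<in> borel_measurable lebesgue" by (rule measurable_completion)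
    have h'm: "h' \<in> borel_measurable lebesgue" by (rule completion_measurable_cong_AE[OF hm ae])
    have ae': "AE x in lebesgue. h x = h' x" using ae by (simp add: AE_completion_iff)
    show "integrable lebesgue h'"
      using integrable_cong_AE[OF hm h'm ae'] h integrable_completion[OF hb] by simp
    show "integral\<^sup>L lebesgue h' = integral\<^sup>L lborel h"
      using integral_cong_AE[OF hm h'm ae'] integral_completion[OF hb] by simp
  qed
  have s2: "AE y in lborel. integrable lborel (\<lambda>x. g (x, y))"
    by (rule lborel_pair.AE_integrable_snd) (simp add: gi)
  have s1: "AE x in lborel. integrable lborel (\<lambda>y. g (x, y))"
    by (rule lborel_pair.AE_integrable_fst'[OF gi])
  show "AE y in lborel. integrable lebesgue (\<lambda>x. f (x, y))"
    using s2 eq2 by eventually_elim (rule sec(1))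
  show "AE x in lborel. integrable lebesgue (\<lambda>y. f (x, y))"
    using s1 eq1 by eventually_elim (rule sec(1))
  have e2: "AE y in lborel. (LINT x|lborel. g (x, y)) = (LINT x|lebesgue. f (x, y))"
    using s2 eq2 by eventually_elim (rule sec(2)[symmetric])
  have e1: "AE x in lborel. (LINT y|lborel. g (x, y)) = (LINT y|lebesgue. f (x, y))"
    using s1 eq1 by eventually_elim (rule sec(2)[symmetric])
  have i2: "integrable lborel (\<lambda>y. LINT x|lborel. g (x, y))"
    by (rule lborel_pair.integrable_snd) (simp add: gi)
  have i1: "integrable lborel (\<lambda>x. LINT y|lborel. g (x, y))"
    by (rule lborel_pair.integrable_fst'[OF gi])
  show "integrable lebesgue (\<lambda>y. LINT x|lebesgue. f (x, y))" by (rule sec(1)[OF i2 e2])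
  show "integrable lebesgue (\<lambda>x. LINT y|lebesgue. f (x, y))" by (rule sec(1)[OF i1 e1])
  show "(LINT y|lebesgue. LINT x|lebesgue. f (x, y)) = integral\<^sup>L lebesgue f"
    unfolding sec(2)[OF i2 e2] int_eq
    by (subst lborel_pair.integral_snd) (simp_all add: gi)
  show "(LINT x|lebesgue. LINT y|lebesgue. f (x, y)) = integral\<^sup>L lebesgue f"
    unfolding sec(2)[OF i1 e1] int_eq by (rule lborel_pair.integral_fst'[OF gi])
qed

lemma Fubini_lebesgue_on:
  fixes f :: "real \<times> real \<Rightarrow> complex"
  assumes f: "integrable (lebesgue_on (S \<times> T)) f" and S: "S \<in> sets borel" and T: "T \<in> sets borel"
  shows "AE y in lebesgue_on T. integrable (lebesgue_on S) (\<lambda>x. f (x, y))"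
    and "integrable (lebesgue_on T) (\<lambda>y. LINT x|lebesgue_on S. f (x, y))"
    and "(LINT y|lebesgue_on T. LINT x|lebesgue_on S. f (x, y)) = (LINT p|lebesgue_on (S \<times> T). f p)"
    and "AE x in lebesgue_on S. integrable (lebesgue_on T) (\<lambda>y. f (x, y))"
    and "integrable (lebesgue_on S) (\<lambda>x. LINT y|lebesgue_on T. f (x, y))"
    and "(LINT x|lebesgue_on S. LINT y|lebesgue_on T. f (x, y)) = (LINT p|lebesgue_on (S \<times> T). f p)"
proof -
  have [measurable]: "S \<in> sets lebesgue" "T \<in> sets lebesgue" using S T by auto
  have "S \<times> T \<in> sets borel" by (rule borel_Times[OF S T])
  then have ST: "S \<times> T \<in> sets lebesgue" by auto
  define g where "g p = indicator (S \<times> T) p *\<^sub>R f p" for p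
  have g: "integrable lebesgue g"
    using f ST unfolding g_def[abs_def] by (subst (asm) integrable_restrict_space) auto
  have g1: "g (x, y) = indicator T y *\<^sub>R (indicator S x *\<^sub>R f (x, y))"
    "g (x, y) = indicator S x *\<^sub>R (indicator T y *\<^sub>R f (x, y))" for x y
    by (auto simp: g_def indicator_def)
  have gI: "integral\<^sup>L lebesgue g = (LINT p|lebesgue_on (S \<times> T). f p)"
    unfolding g_def[abs_def] using ST by (subst integral_restrict_space) auto
  have r1: "(LINT x|lebesgue. g (x, y)) = indicator T y *\<^sub>R (LINT x|lebesgue_on S. f (x, y))" for y
    unfolding g1(1) by (cases "y \<in> T") (auto simp: integral_restrict_space)
  have r2: "(LINT y|lebesgue. g (x, y)) = indicator S x *\<^sub>R (LINT y|lebesgue_on T. f (x, y))" for x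
    unfolding g1(2) by (cases "x \<in> S") (auto simp: integral_restrict_space)
  have F: "AE y in lebesgue. integrable lebesgue (\<lambda>x. g (x, y))" "AE x in lebesgue. integrable lebesgue (\<lambda>y. g (x, y))"
    using Fubini_lebesgue(1,4)[OF g] by (simp_all add: AE_completion_iff)
  show "AE y in lebesgue_on T. integrable (lebesgue_on S) (\<lambda>x. f (x, y))"
    by (subst AE_restrict_space_iff, simp, use F(1) in eventually_elim)
       (auto simp: g1(1) integrable_restrict_space)
  show "AE x in lebesgue_on S. integrable (lebesgue_on T) (\<lambda>y. f (x, y))"
    by (subst AE_restrict_space_iff, simp, use F(2) in eventually_elim)
       (auto simp: g1(2) integrable_restrict_space)
  show "integrable (lebesgue_on T) (\<lambda>y. LINT x|lebesgue_on S. f (x, y))"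
    using Fubini_lebesgue(2)[OF g] unfolding r1 by (subst integrable_restrict_space) auto
  show "integrable (lebesgue_on S) (\<lambda>x. LINT y|lebesgue_on T. f (x, y))"
    using Fubini_lebesgue(5)[OF g] unfolding r2 by (subst integrable_restrict_space) auto
  show "(LINT y|lebesgue_on T. LINT x|lebesgue_on S. f (x, y)) = (LINT p|lebesgue_on (S \<times> T). f p)"
    using Fubini_lebesgue(3)[OF g] unfolding r1 gI by (subst integral_restrict_space) auto
  show "(LINT x|lebesgue_on S. LINT y|lebesgue_on T. f (x, y)) = (LINT p|lebesgue_on (S \<times> T). f p)"
    using Fubini_lebesgue(6)[OF g] unfolding r2 gI by (subst integral_restrict_space) auto
qed

section \<open>A cut-off function and integration by parts against weak derivatives\<close>

text \<open>Piecewise quadratic and C1, rising from 0 at \<open>t = 0\<close> to 1 at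
  \<open>t = 1\<close>. Its derivative \<open>tent\<close> is a triangular kernel of mass 1.\<close>

definition quad_step :: "real \<Rightarrow> real" where
  "quad_step t = 2 * ((max 0 t)\<^sup>2 - 2 * (max 0 (t - 1 / 2))\<^sup>2 + (max 0 (t - 1))\<^sup>2)"

definition tent :: "real \<Rightarrow> real" where
  "tent t = 4 * (max 0 t - 2 * max 0 (t - 1 / 2) + max 0 (t - 1))"

lemma quad_step_deriv: "(quad_step has_real_derivative tent t) (at t)"
proof -
  have *: "((\<lambda>t. (max 0 (t - c))\<^sup>2) has_real_derivative 2 * max 0 (t - c)) (at t)" for c :: real
  proof -
    have "((\<lambda>t. t - c) has_real_derivative 1) (at t)" by (auto intro!: derivative_eq_intros)
    from DERIV_chain2[where f="\<lambda>x. (max 0 x)\<^sup>2" and g="\<lambda>t. t - c", OF max_zero_square_deriv this]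
    show ?thesis by simp
  qed
  have "((\<lambda>t. 2 * ((max 0 (t - 0))\<^sup>2 - 2 * (max 0 (t - 1 / 2))\<^sup>2 + (max 0 (t - 1))\<^sup>2)) has_real_derivative
     2 * (2 * max 0 (t - 0) - 2 * (2 * max 0 (t - 1 / 2)) + 2 * max 0 (t - 1))) (at t)"
    by (intro DERIV_cmult DERIV_add DERIV_diff *)
  then show ?thesis unfolding quad_step_def[abs_def] tent_def by simp
qed

lemma quad_step_simps: "t \<le> 0 \<Longrightarrow> quad_step t = 0" "1 \<le> t \<Longrightarrow> quad_step t = 1"
  by (simp_all add: quad_step_def max_def power2_eq_square algebra_simps)

lemma tent_simps: "t \<le> 0 \<Longrightarrow> tent t = 0" "1 \<le> t \<Longrightarrow> tent t = 0" "0 \<le> tent t" "tent t \<le> 2"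
  by (simp_all add: tent_def max_def)

lemma tent_cont [continuous_intros]: "continuous_on A f \<Longrightarrow> continuous_on A (\<lambda>x. tent (f x))"
  unfolding tent_def by (intro continuous_intros)

lemma quad_step_range: "0 \<le> quad_step t" "quad_step t \<le> 1"
proof -
  have mono: "quad_step s \<le> quad_step t" if "s \<le> t" for s t
    by (rule DERIV_nonneg_imp_nondecreasing[OF that]) (use quad_step_deriv tent_simps(3) in blast)
  show "0 \<le> quad_step t" using mono[of "min 0 t" t] quad_step_simps(1)[of "min 0 t"] by simp
  show "quad_step t \<le> 1" using mono[of t "max 1 t"] quad_step_simps(2)[of "max 1 t"] by simp
qed

lemma integral_tent: "(LINT t|lborel. tent t) = 1" "integrable lborel tent"
proof -
  have "has_bochner_integral lborel (\<lambda>x. tent x * indicator {0..1} x) (quad_step 1 - quad_step 0)"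
    by (rule has_bochner_integral_FTC_Icc_real)
       (use quad_step_deriv tent_cont[OF continuous_on_id, of UNIV] in \<open>auto simp: continuous_on_eq_continuous_at\<close>)
  moreover have "(\<lambda>x. tent x * indicator {0..1} x) = tent"
  proof
    show "tent x * indicator {0..1} x = tent x" for x
      by (cases "x \<le> 0 \<or> 1 \<le> x") (auto simp: tent_simps)
  qed
  moreover have "quad_step 1 - quad_step 0 = 1" by (simp add: quad_step_simps)
  ultimately show "(LINT t|lborel. tent t) = 1" "integrable lborel tent"
    by (simp_all add: has_bochner_integral_iff)
qed

text \<open>Rescaled tents sit on \<open>[c n, c n + d n]\<close> with mass 1 and form an
  approximate identity: substitute \<open>x = c n + d n * t\<close> and apply dominated
  convergence.\<close>

lemma tent_approx:
  fixes g :: "real \<Rightarrow> complex"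
  assumes g: "continuous_on UNIV g" "\<And>x. norm (g x) \<le> K" and c: "c \<longlonglongrightarrow> c0" and d: "d \<longlonglongrightarrow> 0" "\<And>n. 0 < d n"
  shows "(\<lambda>n. LINT x|lborel. (tent ((x - c n) / d n) / d n) *\<^sub>R g x) \<longlonglongrightarrow> g c0"
proof -
  have gm: "g \<in> borel_measurable borel" using g(1) by (rule borel_measurable_continuous_onI)
  have tm[measurable]: "tent \<in> borel_measurable borel"
    by (rule borel_measurable_continuous_onI) (intro continuous_intros)
  have K: "0 \<le> K" using g(2)[of 0] by (meson norm_ge_zero order_trans)
  have eq: "(LINT x|lborel. (tent ((x - c n) / d n) / d n) *\<^sub>R g x) = (LINT t|lborel. tent t *\<^sub>R g (c n + d n * t))" for n
    using d(2)[of n] by (subst lborel_integral_real_affine[where c="d n" and t="c n"]) (auto simp flip: integral_scaleR_right)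
  have "(\<lambda>n. LINT t|lborel. tent t *\<^sub>R g (c n + d n * t)) \<longlonglongrightarrow> (LINT t|lborel. tent t *\<^sub>R g c0)"
  proof (rule integral_dominated_convergence[where w="\<lambda>t. tent t * K"])
    show "integrable lborel (\<lambda>t. tent t * K)" by (intro integrable_mult_left integral_tent(2))
    show "AE t in lborel. (\<lambda>n. tent t *\<^sub>R g (c n + d n * t)) \<longlonglongrightarrow> tent t *\<^sub>R g c0"
    proof (intro AE_I2 tendsto_scaleR tendsto_const)
      fix t
      have "(\<lambda>n. c n + d n * t) \<longlonglongrightarrow> c0 + 0 * t" by (intro tendsto_intros c d)
      then show "(\<lambda>n. g (c n + d n * t)) \<longlonglongrightarrow> g c0"
        using g(1) by (intro continuous_on_tendsto_compose[of UNIV g]) auto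
    qed
    show "AE t in lborel. norm (tent t *\<^sub>R g (c n + d n * t)) \<le> tent t * K" for n
      using g(2) tent_simps(3) by (intro AE_I2) (simp add: mult_left_mono)
  qed (use gm in measurable)
  also have "(LINT t|lborel. tent t *\<^sub>R g c0) = g c0" using integral_tent by simp
  finally show ?thesis unfolding eq .
qed

lemma lebesgue_on_eq_lborel:
  fixes F :: "real \<Rightarrow> complex"
  assumes F: "continuous_on UNIV F" "\<And>x. x \<notin> S \<Longrightarrow> F x = 0" and S: "S \<in> sets lebesgue"
  shows "(LINT x|lebesgue_on S. F x) = (LINT x|lborel. F x)"
proof -
  have "(LINT x|lebesgue_on S. F x) = (LINT x|lebesgue. indicator S x *\<^sub>R F x)"
    using S by (subst integral_restrict_space) auto
  also have "(\<lambda>x. indicator S x *\<^sub>R F x) = F" using F(2) by (auto simp: indicator_def fun_eq_iff)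
  also have "integral\<^sup>L lebesgue F = (LINT x|lborel. F x)"
    by (rule integral_completion) (use borel_measurable_continuous_onI[OF F(1)] in simp)
  finally show ?thesis .
qed

lemma integrable_scaleR_bounded:
  fixes f :: "'a \<Rightarrow> 'b::{banach, second_countable_topology}"
  assumes "integrable M f" "g \<in> borel_measurable M" "\<And>x. x \<in> space M \<Longrightarrow> \<bar>g x\<bar> \<le> K"
  shows "integrable M (\<lambda>x. g x *\<^sub>R f x)"
proof (rule Bochner_Integration.integrable_bound)
  show "integrable M (\<lambda>x. K * norm (f x))" using assms(1) by (intro integrable_mult_right integrable_norm)
  show "(\<lambda>x. g x *\<^sub>R f x) \<in> borel_measurable M"
    using assms(1,2) by (intro borel_measurable_scaleR) auto
  show "AE x in M. norm (g x *\<^sub>R f x) \<le> norm (K * norm (f x))"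
  proof (rule AE_I2)
    fix x assume "x \<in> space M"
    then have "\<bar>g x\<bar> \<le> K" by (rule assms(3))
    then have "\<bar>g x\<bar> * norm (f x) \<le> \<bar>K\<bar> * norm (f x)" by (intro mult_right_mono) auto
    then show "norm (g x *\<^sub>R f x) \<le> norm (K * norm (f x))" by (simp add: abs_mult)
  qed
qed

lemma cont_bounded_Icc:
  fixes g :: "real \<Rightarrow> 'b::real_normed_vector"
  assumes "continuous_on {a..b} g"
  obtains K where "0 < K" "\<And>x. x \<in> {a..b} \<Longrightarrow> norm (g x) \<le> K"
proof -
  have "bounded (g ` {a..b})" by (intro compact_imp_bounded compact_continuous_image assms) auto
  then show ?thesis unfolding bounded_pos using that by auto
qed

lemma measurable_lebesgue_on_Ioo:
  fixes g :: "real \<Rightarrow> 'b::{second_countable_topology, real_normed_vector}"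
  assumes "continuous_on {a..b} g"
  shows "g \<in> borel_measurable (lebesgue_on {a<..<b})"
  by (rule continuous_imp_measurable_on_sets_lebesgue)
     (auto intro: continuous_on_subset[OF assms])

lemma integrable_cont_Ioo:
  fixes g :: "real \<Rightarrow> 'b::{banach, second_countable_topology}"
  assumes "continuous_on {a..b} g"
  shows "integrable (lebesgue_on {a<..<b}) g"
proof -
  obtain K where K: "0 < K" "\<And>x. x \<in> {a..b} \<Longrightarrow> norm (g x) \<le> K"
    using cont_bounded_Icc[OF assms] by blast
  show ?thesis
  proof (rule Bochner_Integration.integrable_bound[where f="\<lambda>_. K"])
    show "integrable (lebesgue_on {a<..<b}) (\<lambda>_. K)"
      by (rule finite_measure.integrable_const, rule finite_measureI, cases "a \<le> b") (auto simp: emeasure_restrict_space)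
    show "g \<in> borel_measurable (lebesgue_on {a<..<b})" by (rule measurable_lebesgue_on_Ioo[OF assms])
    show "AE x in lebesgue_on {a<..<b}. norm (g x) \<le> norm K"
      using K by (intro AE_I2) auto
  qed
qed

text \<open>The weak identity only admits test functions vanishing near the endpoints. Multiplying
  \<open>s\<close> by a cut-off \<open>\<eta> n\<close> makes it admissible; the derivative of the
  cut-off is a rescaled tent near \<open>a\<close> minus one near \<open>b\<close>, and in the limit
  these two produce the boundary values.\<close>

lemma weak_ibp_real:
  fixes f f' :: "real \<Rightarrow> complex" and s s' :: "real \<Rightarrow> real"
  assumes ab: "a < b" and f: "continuous_on {a..b} f" and f': "integrable (lebesgue_on {a<..<b}) f'"
   and weak: "\<And>\<psi> \<psi>'. C1_test_function a b \<psi> \<psi>' \<Longrightarrow>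
     (LINT x|lebesgue_on {a<..<b}. \<psi>' x *\<^sub>R f x) = - (LINT x|lebesgue_on {a<..<b}. \<psi> x *\<^sub>R f' x)"
   and s: "\<And>x. x \<in> {a..b} \<Longrightarrow> (s has_real_derivative s' x) (at x within {a..b})" "continuous_on {a..b} s'"
  shows "(LINT x|lebesgue_on {a<..<b}. s x *\<^sub>R f' x) =
     s b *\<^sub>R f b - s a *\<^sub>R f a - (LINT x|lebesgue_on {a<..<b}. s' x *\<^sub>R f x)"
proof -
  \<comment> \<open>Clipping extends functions given on [a, b] to continuous functions on the line,
    as test functions have to live there.\<close>
  define cl :: "real \<Rightarrow> real" where "cl x = max a (min b x)" for x
  have cl: "cl x \<in> {a..b}" "x \<in> {a..b} \<Longrightarrow> cl x = x" for x using ab by (auto simp: cl_def)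
  have clc: "continuous_on UNIV cl" unfolding cl_def by (intro continuous_intros)
  have ext: "continuous_on UNIV (\<lambda>x. h (cl x))" if "continuous_on {a..b} h" for h :: "real \<Rightarrow> 'c::topological_space"
    by (rule continuous_on_compose2[OF that clc]) (use cl in auto)
  have sc: "continuous_on {a..b} s"
    using s(1) by (meson DERIV_continuous continuous_on_eq_continuous_within)
  obtain Ks where Ks: "0 < Ks" "\<And>x. x \<in> {a..b} \<Longrightarrow> norm (s x) \<le> Ks" using cont_bounded_Icc[OF sc] by blast
  obtain Ks' where Ks': "0 < Ks'" "\<And>x. x \<in> {a..b} \<Longrightarrow> norm (s' x) \<le> Ks'" using cont_bounded_Icc[OF s(2)] by blast
  obtain Kf where Kf: "0 < Kf" "\<And>x. x \<in> {a..b} \<Longrightarrow> norm (f x) \<le> Kf" using cont_bounded_Icc[OF f] by blast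
  \<comment> \<open>\<open>5 * d n \<le> b - a\<close> keeps the rising ramp
    \<open>[a + d, a + 2 d]\<close> and the falling ramp \<open>[b - 2 d, b - d]\<close> disjoint
    and inside the open interval.\<close>
  define d where "d n = (b - a) / (real n + 5)" for n
  have d: "0 < d n" "5 * d n \<le> b - a" for n using ab by (auto simp: d_def field_simps intro: mult_right_mono)
  have dlim: "d \<longlonglongrightarrow> 0" unfolding d_def by real_asymp
  define c1 c2 where "c1 n = a + d n" "c2 n = b - 2 * d n" for n
  have c1lim: "c1 \<longlonglongrightarrow> a" and c2lim: "c2 \<longlonglongrightarrow> b"
    unfolding c1_c2_def using dlim by (auto intro!: tendsto_eq_intros)
  define \<eta> where "\<eta> n x = quad_step ((x - c1 n) / d n) - quad_step ((x - c2 n) / d n)" for n x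
  define \<eta>' where "\<eta>' n x = tent ((x - c1 n) / d n) / d n - tent ((x - c2 n) / d n) / d n" for n x
  have step_deriv: "((\<lambda>x. quad_step ((x - c) / e)) has_real_derivative tent ((x - c) / e) / e) (at x)" if "e > 0" for c e x
  proof -
    have "((\<lambda>x. (x - c) / e) has_real_derivative 1 / e) (at x)" using that by (auto intro!: derivative_eq_intros)
    from DERIV_chain2[where f=quad_step and g="\<lambda>x. (x - c) / e", OF quad_step_deriv this] show ?thesis by simp
  qed
  have \<eta>_deriv: "(\<eta> n has_real_derivative \<eta>' n x) (at x)" for n x
    unfolding \<eta>_def[abs_def] \<eta>'_def by (intro DERIV_diff step_deriv d)
  have \<eta>_out: "\<eta> n x = 0" if "x \<notin> {a + d n..b - d n}" for n x
  proof -
    have "x < a + d n \<or> x > b - d n" using that by auto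
    then show ?thesis
    proof
      assume x: "x < a + d n"
      have "(x - c1 n) / d n \<le> 0" "(x - c2 n) / d n \<le> 0"
        using x d[of n] by (auto simp: c1_c2_def divide_le_0_iff)
      then show ?thesis by (simp add: \<eta>_def quad_step_simps)
    next
      assume x: "x > b - d n"
      have "1 \<le> (x - c1 n) / d n" "1 \<le> (x - c2 n) / d n"
        using x d[of n] by (auto simp: c1_c2_def le_divide_eq)
      then show ?thesis by (simp add: \<eta>_def quad_step_simps)
    qed
  qed
  have tent_out: "tent ((x - c1 n) / d n) = 0" "tent ((x - c2 n) / d n) = 0" if "x \<notin> {a<..<b}" for n x
  proof -
    have "x \<le> a \<or> x \<ge> b" using that by auto
    then have "((x - c1 n) / d n \<le> 0 \<or> 1 \<le> (x - c1 n) / d n) \<and> ((x - c2 n) / d n \<le> 0 \<or> 1 \<le> (x - c2 n) / d n)"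
      using d[of n] by (auto simp: c1_c2_def divide_le_0_iff le_divide_eq)
    then show "tent ((x - c1 n) / d n) = 0" "tent ((x - c2 n) / d n) = 0" by (auto simp: tent_simps)
  qed
  have \<eta>_in: "\<eta> n x = 1" if "a + 2 * d n \<le> x" "x \<le> b - 2 * d n" for n x
  proof -
    have "1 \<le> (x - c1 n) / d n" "(x - c2 n) / d n \<le> 0"
      using that d[of n] by (auto simp: c1_c2_def divide_le_0_iff le_divide_eq)
    then show ?thesis by (simp add: \<eta>_def quad_step_simps)
  qed
  have \<eta>_le: "\<bar>\<eta> n x\<bar> \<le> 1" for n x
    using quad_step_range[of "(x - c1 n) / d n"] quad_step_range[of "(x - c2 n) / d n"] by (simp add: \<eta>_def)
  have \<eta>_lim: "(\<lambda>n. \<eta> n x) \<longlonglongrightarrow> 1" if x: "x \<in> {a<..<b}" for x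
  proof (rule tendsto_eventually)
    have "\<forall>\<^sub>F n in sequentially. d n < (x - a) / 2" "\<forall>\<^sub>F n in sequentially. d n < (b - x) / 2"
      by (intro order_tendstoD(2)[OF dlim]; use x in simp)+
    then show "\<forall>\<^sub>F n in sequentially. \<eta> n x = 1"
      by eventually_elim (rule \<eta>_in; simp)
  qed
  have \<eta>c: "continuous_on UNIV (\<eta> n)" for n
    using \<eta>_deriv by (meson DERIV_continuous_on)
  define g where "g x = s (cl x) *\<^sub>R f (cl x)" for x
  have gc: "continuous_on UNIV g" unfolding g_def by (intro continuous_on_scaleR ext sc f)
  have gb: "norm (g x) \<le> Ks * Kf" for x
    unfolding g_def norm_scaleR using Ks Kf cl(1)[of x] by (intro mult_mono) auto
  define \<psi> \<psi>' where "\<psi> n x = \<eta> n x * s (cl x)" "\<psi>' n x = \<eta>' n x * s (cl x) + \<eta> n x * s' (cl x)" for n x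
  have \<eta>'c: "continuous_on UNIV (\<eta>' n)" for n
    unfolding \<eta>'_def using d(1)[of n] by (intro continuous_intros) auto
  have \<eta>'_out: "\<eta>' n x = 0" if "x \<notin> {a<..<b}" for n x
    using tent_out[OF that] by (simp add: \<eta>'_def)
  have test: "C1_test_function a b (\<psi> n) (\<psi>' n)" for n
    unfolding C1_test_function_def
  proof (intro conjI allI)
    fix x
    show "(\<psi> n has_real_derivative \<psi>' n x) (at x)"
    proof (cases "x \<in> {a<..<b}")
      case True
      have "(s has_real_derivative s' x) (at x)"
        using s(1)[of x] True at_within_interior[of x "{a..b}"] by auto
      then have "((\<lambda>x. \<eta> n x * s x) has_real_derivative \<eta>' n x * s x + s' x * \<eta> n x) (at x)"
        by (rule DERIV_mult[OF \<eta>_deriv])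
      then have "(\<psi> n has_real_derivative \<eta>' n x * s x + s' x * \<eta> n x) (at x)"
        by (rule has_field_derivative_transform_within_open[where S="{a<..<b}"])
           (use True cl(2) in \<open>auto simp: \<psi>_\<psi>'_def\<close>)
      then show ?thesis using True cl(2)[of x] by (simp add: \<psi>_\<psi>'_def mult.commute)
    next
      case False
      have x: "x \<in> - {a + d n..b - d n}" using False d(1)[of n] by auto
      have "((\<lambda>x. 0) has_real_derivative 0) (at x)" by simp
      then have "(\<psi> n has_real_derivative 0) (at x)"
        by (rule has_field_derivative_transform_within_open[where S="- {a + d n..b - d n}"])
           (use x \<eta>_out in \<open>auto simp: \<psi>_\<psi>'_def intro!: open_Compl\<close>)
      moreover have "\<psi>' n x = 0" using \<eta>_out[of x n] \<eta>'_out[OF False] x by (simp add: \<psi>_\<psi>'_def)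
      ultimately show ?thesis by simp
    qed
  next
    show "continuous_on UNIV (\<psi>' n)"
      unfolding \<psi>_\<psi>'_def by (intro continuous_on_add continuous_on_mult \<eta>c \<eta>'c ext sc s)
    show "\<exists>c e. a < c \<and> e < b \<and> (\<forall>x. x \<notin> {c..e} \<longrightarrow> \<psi> n x = 0)"
      by (intro exI[of _ "a + d n"] exI[of _ "b - d n"]) (use d(1)[of n] \<eta>_out in \<open>auto simp: \<psi>_\<psi>'_def\<close>)
  qed
  let ?M = "lebesgue_on {a<..<b}"
  have spM: "x \<in> space ?M \<longleftrightarrow> x \<in> {a<..<b}" for x by simp
  have fi: "integrable ?M f" by (rule integrable_cont_Ioo[OF f])
  have s'm: "(\<lambda>x. s' (cl x)) \<in> borel_measurable ?M" and sm: "(\<lambda>x. s (cl x)) \<in> borel_measurable ?M"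
    by (intro measurable_lebesgue_on_Ioo continuous_on_subset[OF ext] sc s; simp)+
  have \<eta>m: "\<eta> n \<in> borel_measurable ?M" for n
    by (intro measurable_lebesgue_on_Ioo continuous_on_subset[OF \<eta>c]) simp
  have tents: "continuous_on UNIV (\<lambda>x. (tent ((x - c1 n) / d n) / d n) *\<^sub>R g x)"
       "continuous_on UNIV (\<lambda>x. (tent ((x - c2 n) / d n) / d n) *\<^sub>R g x)" for n
    using d(1)[of n] by (intro continuous_intros gc; simp)+
  have lhs: "(LINT x|?M. \<psi>' n x *\<^sub>R f x) =
     (LINT x|lborel. (tent ((x - c1 n) / d n) / d n) *\<^sub>R g x) - (LINT x|lborel. (tent ((x - c2 n) / d n) / d n) *\<^sub>R g x)
      + (LINT x|?M. \<eta> n x *\<^sub>R (s' (cl x) *\<^sub>R f x))" for n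
  proof -
    have i3: "integrable ?M (\<lambda>x. \<eta> n x *\<^sub>R (s' (cl x) *\<^sub>R f x))"
      by (intro integrable_scaleR_bounded[where K=1] integrable_scaleR_bounded[where K=Ks'] fi \<eta>m s'm)
         (use \<eta>_le Ks' cl in auto)
    have i1: "integrable ?M (\<lambda>x. (tent ((x - c1 n) / d n) / d n) *\<^sub>R g x)"
      "integrable ?M (\<lambda>x. (tent ((x - c2 n) / d n) / d n) *\<^sub>R g x)"
      by (intro integrable_cont_Ioo continuous_on_subset[OF tents(1)] continuous_on_subset[OF tents(2)]; simp)+
    have "(LINT x|?M. \<psi>' n x *\<^sub>R f x) = (LINT x|?M. (tent ((x - c1 n) / d n) / d n) *\<^sub>R g x - (tent ((x - c2 n) / d n) / d n) *\<^sub>R g x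
      + \<eta> n x *\<^sub>R (s' (cl x) *\<^sub>R f x))"
      by (rule Bochner_Integration.integral_cong[OF refl])
         (use cl in \<open>auto simp: \<psi>_\<psi>'_def \<eta>'_def g_def scaleR_add_left left_diff_distrib scaleR_diff_left\<close>)
    also have "\<dots> = (LINT x|?M. (tent ((x - c1 n) / d n) / d n) *\<^sub>R g x) - (LINT x|?M. (tent ((x - c2 n) / d n) / d n) *\<^sub>R g x)
      + (LINT x|?M. \<eta> n x *\<^sub>R (s' (cl x) *\<^sub>R f x))"
      using i1 i3 by (simp add: Bochner_Integration.integral_add Bochner_Integration.integral_diff)
    also have "(LINT x|?M. (tent ((x - c1 n) / d n) / d n) *\<^sub>R g x) = (LINT x|lborel. (tent ((x - c1 n) / d n) / d n) *\<^sub>R g x)"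
      by (rule lebesgue_on_eq_lborel[OF tents(1)]) (simp_all add: tent_out)
    also have "(LINT x|?M. (tent ((x - c2 n) / d n) / d n) *\<^sub>R g x) = (LINT x|lborel. (tent ((x - c2 n) / d n) / d n) *\<^sub>R g x)"
      by (rule lebesgue_on_eq_lborel[OF tents(2)]) (simp_all add: tent_out)
    finally show ?thesis .
  qed
  have dom: "(\<lambda>n. LINT x|?M. \<eta> n x *\<^sub>R h x) \<longlonglongrightarrow> (LINT x|?M. h x)" if h: "integrable ?M h" for h :: "real \<Rightarrow> complex"
  proof (rule integral_dominated_convergence[where w="\<lambda>x. norm (h x)"])
    show "AE x in ?M. (\<lambda>n. \<eta> n x *\<^sub>R h x) \<longlonglongrightarrow> h x"
    proof (rule AE_I2)
      fix x assume "x \<in> space ?M"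
      then have "(\<lambda>n. \<eta> n x *\<^sub>R h x) \<longlonglongrightarrow> 1 *\<^sub>R h x" by (intro tendsto_intros \<eta>_lim) simp
      then show "(\<lambda>n. \<eta> n x *\<^sub>R h x) \<longlonglongrightarrow> h x" by simp
    qed
    show "AE x in ?M. norm (\<eta> n x *\<^sub>R h x) \<le> norm (h x)" for n
      using \<eta>_le by (intro AE_I2) (simp add: mult_left_le_one_le)
    show "(\<lambda>x. \<eta> n x *\<^sub>R h x) \<in> borel_measurable ?M" for n
      by (intro borel_measurable_scaleR \<eta>m borel_measurable_integrable h)
  qed (use h in auto)
  have i': "integrable ?M (\<lambda>x. s' (cl x) *\<^sub>R f x)"
    by (intro integrable_scaleR_bounded[where K=Ks'] fi s'm) (use Ks' cl in auto)
  have i2: "integrable ?M (\<lambda>x. s (cl x) *\<^sub>R f' x)"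
    by (intro integrable_scaleR_bounded[where K=Ks] f' sm) (use Ks cl in auto)
  have L1: "(\<lambda>n. LINT x|?M. \<psi>' n x *\<^sub>R f x) \<longlonglongrightarrow> g a - g b + (LINT x|?M. s' (cl x) *\<^sub>R f x)"
    unfolding lhs by (intro tendsto_add tendsto_diff tent_approx[OF gc gb] c1lim c2lim dlim d dom i')
  have "(\<lambda>n. - (LINT x|?M. \<psi> n x *\<^sub>R f' x)) \<longlonglongrightarrow> - (LINT x|?M. s (cl x) *\<^sub>R f' x)"
    using dom[OF i2] by (intro tendsto_minus) (simp add: \<psi>_\<psi>'_def)
  then have "(\<lambda>n. LINT x|?M. \<psi>' n x *\<^sub>R f x) \<longlonglongrightarrow> - (LINT x|?M. s (cl x) *\<^sub>R f' x)"
    by (simp only: weak[OF test])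
  then have "- (LINT x|?M. s (cl x) *\<^sub>R f' x) = g a - g b + (LINT x|?M. s' (cl x) *\<^sub>R f x)"
    by (rule LIMSEQ_unique[OF _ L1])
  moreover have "(LINT x|?M. s (cl x) *\<^sub>R f' x) = (LINT x|?M. s x *\<^sub>R f' x)"
    "(LINT x|?M. s' (cl x) *\<^sub>R f x) = (LINT x|?M. s' x *\<^sub>R f x)"
    by (rule Bochner_Integration.integral_cong; simp add: cl)+
  moreover have "g a = s a *\<^sub>R f a" "g b = s b *\<^sub>R f b" using ab by (simp_all add: g_def cl)
  ultimately show ?thesis by (simp add: algebra_simps)
qed

lemma measurable_lebesgue_on_cong_AE:
  fixes f g :: "'a::euclidean_space \<Rightarrow> complex"
  assumes f: "f \<in> borel_measurable (lebesgue_on S)" and ae: "AE x in lebesgue_on S. f x = g x"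
    and S: "S \<in> sets lebesgue"
  shows "g \<in> borel_measurable (lebesgue_on S)"
proof -
  have "(\<lambda>x. indicator S x *\<^sub>R f x) \<in> borel_measurable lebesgue"
    using f S by (subst (asm) borel_measurable_restrict_space_iff) auto
  moreover have "AE x in lborel. indicator S x *\<^sub>R f x = indicator S x *\<^sub>R g x"
    using ae S by (subst (asm) AE_restrict_space_iff) (auto simp: AE_completion_iff indicator_def elim!: eventually_mono)
  ultimately have "(\<lambda>x. indicator S x *\<^sub>R g x) \<in> borel_measurable lebesgue"
    by (rule completion_measurable_cong_AE)
  then show ?thesis using S by (subst borel_measurable_restrict_space_iff) auto
qed

lemma integrable_lebesgue_on_cong_AE:
  fixes f g :: "'a::euclidean_space \<Rightarrow> complex"
  assumes f: "integrable (lebesgue_on S) f" and ae: "AE x in lebesgue_on S. f x = g x" and S: "S \<in> sets lebesgue"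
  shows "integrable (lebesgue_on S) g" "(LINT x|lebesgue_on S. f x) = (LINT x|lebesgue_on S. g x)"
proof -
  have m: "f \<in> borel_measurable (lebesgue_on S)" using f by auto
  have m': "g \<in> borel_measurable (lebesgue_on S)" by (rule measurable_lebesgue_on_cong_AE[OF m ae S])
  show "integrable (lebesgue_on S) g" using integrable_cong_AE[OF m m' ae] f by simp
  show "(LINT x|lebesgue_on S. f x) = (LINT x|lebesgue_on S. g x)" by (rule integral_cong_AE[OF m m' ae])
qed

lemma integrable_mult_bounded:
  fixes f g :: "'a \<Rightarrow> complex"
  assumes "integrable M f" "g \<in> borel_measurable M" "\<And>x. x \<in> space M \<Longrightarrow> norm (g x) \<le> K"
  shows "integrable M (\<lambda>x. g x * f x)"
proof (rule Bochner_Integration.integrable_bound)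
  show "integrable M (\<lambda>x. K * norm (f x))" using assms(1) by (intro integrable_mult_right integrable_norm)
  show "(\<lambda>x. g x * f x) \<in> borel_measurable M"
    using assms(1,2) by (intro borel_measurable_times) auto
  show "AE x in M. norm (g x * f x) \<le> norm (K * norm (f x))"
  proof (rule AE_I2)
    fix x assume "x \<in> space M"
    then have "norm (g x) \<le> K" by (rule assms(3))
    then have "norm (g x) * norm (f x) \<le> \<bar>K\<bar> * norm (f x)" by (intro mult_right_mono) auto
    then show "norm (g x * f x) \<le> norm (K * norm (f x))" by (simp add: abs_mult norm_mult)
  qed
qed

lemma integrable_mult_cont_Ioo:
  fixes f g :: "real \<Rightarrow> complex"
  assumes "integrable (lebesgue_on {a<..<b}) f" "continuous_on {a..b} g"
  shows "integrable (lebesgue_on {a<..<b}) (\<lambda>x. g x * f x)"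
proof -
  obtain K where "\<And>x. x \<in> {a..b} \<Longrightarrow> norm (g x) \<le> K" using cont_bounded_Icc[OF assms(2)] by blast
  then show ?thesis
    by (intro integrable_mult_bounded[where K=K] assms measurable_lebesgue_on_Ioo) auto
qed

text \<open>Test functions are real, so a complex multiplier is split into real and imaginary
  part.\<close>

lemma weak_ibp:
  fixes f f' s s' :: "real \<Rightarrow> complex"
  assumes ab: "a < b" and f: "continuous_on {a..b} f" and f': "integrable (lebesgue_on {a<..<b}) f'"
   and weak: "\<And>\<psi> \<psi>'. C1_test_function a b \<psi> \<psi>' \<Longrightarrow>
     (LINT x|lebesgue_on {a<..<b}. \<psi>' x *\<^sub>R f x) = - (LINT x|lebesgue_on {a<..<b}. \<psi> x *\<^sub>R f' x)"
   and s: "\<And>x. x \<in> {a..b} \<Longrightarrow> (s has_vector_derivative s' x) (at x within {a..b})" "continuous_on {a..b} s'"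
  shows "(LINT x|lebesgue_on {a<..<b}. s x * f' x) = s b * f b - s a * f a - (LINT x|lebesgue_on {a<..<b}. s' x * f x)"
proof -
  let ?M = "lebesgue_on {a<..<b}"
  have sc: "continuous_on {a..b} s"
    using s(1) by (meson has_vector_derivative_continuous continuous_on_eq_continuous_within)
  have re: "((\<lambda>x. Re (s x)) has_real_derivative Re (s' x)) (at x within {a..b})"
    and im: "((\<lambda>x. Im (s x)) has_real_derivative Im (s' x)) (at x within {a..b})" if "x \<in> {a..b}" for x
    using bounded_linear.has_vector_derivative[OF bounded_linear_Re s(1)[OF that]]
      bounded_linear.has_vector_derivative[OF bounded_linear_Im s(1)[OF that]]
    by (simp_all add: has_real_derivative_iff_has_vector_derivative)
  have fi: "integrable ?M f" by (rule integrable_cont_Ioo[OF f])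
  have split: "(LINT x|?M. q x * h x) = (LINT x|?M. Re (q x) *\<^sub>R h x) + \<i> * (LINT x|?M. Im (q x) *\<^sub>R h x)"
    if q: "continuous_on {a..b} q" and h: "integrable ?M h" for q h
  proof -
    have i: "integrable ?M (\<lambda>x. of_real (Re (q x)) * h x)" "integrable ?M (\<lambda>x. of_real (Im (q x)) * h x)"
      by (intro integrable_mult_cont_Ioo h continuous_intros q)+
    have "(LINT x|?M. q x * h x) = (LINT x|?M. of_real (Re (q x)) * h x + \<i> * (of_real (Im (q x)) * h x))"
      by (rule Bochner_Integration.integral_cong[OF refl]) (simp add: complex_eq_iff)
    also have "\<dots> = (LINT x|?M. of_real (Re (q x)) * h x) + \<i> * (LINT x|?M. of_real (Im (q x)) * h x)"
      using i by (subst Bochner_Integration.integral_add) auto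
    finally show ?thesis by (simp add: scaleR_conv_of_real)
  qed
  have r: "(LINT x|?M. Re (s x) *\<^sub>R f' x) = Re (s b) *\<^sub>R f b - Re (s a) *\<^sub>R f a - (LINT x|?M. Re (s' x) *\<^sub>R f x)"
    by (rule weak_ibp_real[OF ab f f' weak re continuous_on_Re[OF s(2)]])
  have i: "(LINT x|?M. Im (s x) *\<^sub>R f' x) = Im (s b) *\<^sub>R f b - Im (s a) *\<^sub>R f a - (LINT x|?M. Im (s' x) *\<^sub>R f x)"
    by (rule weak_ibp_real[OF ab f f' weak im continuous_on_Im[OF s(2)]])
  show ?thesis
    unfolding split[OF sc f'] split[OF s(2) fi] r i
    by (simp add: complex_eq_iff algebra_simps)
qed

lemma L2_integrable:
  fixes f :: "'a::euclidean_space \<Rightarrow> 'b::euclidean_space"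
  assumes "L2_on S f" "S \<in> lmeasurable"
  shows "integrable (lebesgue_on S) f"
proof (rule Bochner_Integration.integrable_bound)
  have "integrable (lebesgue_on S) (\<lambda>_. 1 :: real)"
    by (intro finite_measure.integrable_const finite_measure_lebesgue_on assms)
  then show "integrable (lebesgue_on S) (\<lambda>x. 1 + (norm (f x))\<^sup>2)"
    using assms(1) unfolding L2_on_def by (intro Bochner_Integration.integrable_add) auto
  show "f \<in> borel_measurable (lebesgue_on S)" using assms(1) by (simp add: L2_on_def)
  show "AE x in lebesgue_on S. norm (f x) \<le> norm (1 + (norm (f x))\<^sup>2)"
  proof (rule AE_I2)
    fix x
    have "0 \<le> (norm (f x) - 1)\<^sup>2" by simp
    then have "2 * norm (f x) \<le> 1 + (norm (f x))\<^sup>2" by (simp add: power2_diff)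
    then have "norm (f x) \<le> 1 + (norm (f x))\<^sup>2" using norm_ge_zero[of "f x"] by linarith
    then show "norm (f x) \<le> norm (1 + (norm (f x))\<^sup>2)" by simp
  qed
qed

lemma Ioo_lmeasurable: "{a<..<b::real} \<in> lmeasurable"
  by (rule bounded_set_imp_lmeasurable) auto

lemma space_time_lmeasurable: "space_time T \<in> lmeasurable"
  by (intro lmeasurable_open bounded_Times open_Times) auto

section \<open>The adjoint problem\<close>

text \<open>The adjoint problem is used only through its pairings with vectors, which are scalar complex
  functions with the following properties.\<close>

locale scalar_adjoint =
  fixes T :: real and f fx fxx ft :: "real \<times> real \<Rightarrow> complex"
  assumes T: "0 < T"
    and f_cont: "\<And>t. t \<in> {0..T} \<Longrightarrow> continuous_on {0..pi} (\<lambda>x. f (x, t))"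
    and f_bd: "\<And>t. t \<in> {0..T} \<Longrightarrow> f (0, t) = 0" "\<And>t. t \<in> {0..T} \<Longrightarrow> f (pi, t) = 0"
    and f_H1: "\<And>t. t \<in> {0..T} \<Longrightarrow> H1_deriv 0 pi (\<lambda>x. f (x, t)) (\<lambda>x. fx (x, t))"
    and f_C: "\<And>s. s \<in> {0..T} \<Longrightarrow> ((\<lambda>t. LINT x|lebesgue_on {0<..<pi}. (norm (f (x, t) - f (x, s)))\<^sup>2) \<longlongrightarrow> 0) (at s within {0..T})"
    and f_T: "\<And>x. x \<in> {0..pi} \<Longrightarrow> f (x, T) = 0"
    and L2: "L2_on (space_time T) f" "L2_on (space_time T) fxx" "L2_on (space_time T) ft"
    and fx_H1: "AE t in lebesgue_on {0<..<T}. continuous_on {0..pi} (\<lambda>x. fx (x, t)) \<and> H1_deriv 0 pi (\<lambda>x. fx (x, t)) (\<lambda>x. fxx (x, t))"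
    and f_t: "AE x in lebesgue_on {0<..<pi}. H1_deriv 0 T (\<lambda>t. f (x, t)) (\<lambda>t. ft (x, t))"
begin

definition mode :: "(real \<Rightarrow> complex) \<Rightarrow> real \<Rightarrow> complex" where
  "mode s t = (LINT x|lebesgue_on {0<..<pi}. s x * f (x, t))"

lemma integrable_product:
  fixes h s :: "real \<Rightarrow> complex"
  assumes h: "continuous_on {0..T} h" and s: "continuous_on {0..pi} s" and F: "integrable (lebesgue_on (space_time T)) F"
  shows "integrable (lebesgue_on (space_time T)) (\<lambda>p. (h (snd p) * s (fst p)) * F p)"
proof -
  have c: "continuous_on ({0..pi} \<times> {0..T}) (\<lambda>p. h (snd p) * s (fst p))"
  proof (rule continuous_on_mult)
    show "continuous_on ({0..pi} \<times> {0..T}) (\<lambda>p. h (snd p))"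
      by (rule continuous_on_compose2[OF h continuous_on_snd[OF continuous_on_id]]) auto
    show "continuous_on ({0..pi} \<times> {0..T}) (\<lambda>p. s (fst p))"
      by (rule continuous_on_compose2[OF s continuous_on_fst[OF continuous_on_id]]) auto
  qed
  have "bounded ((\<lambda>p. h (snd p) * s (fst p)) ` ({0..pi} \<times> {0..T}))"
    by (intro compact_imp_bounded compact_continuous_image c compact_Times) auto
  then obtain K where K: "\<And>p. p \<in> {0..pi} \<times> {0..T} \<Longrightarrow> norm (h (snd p) * s (fst p)) \<le> K"
  proof -
    assume "bounded ((\<lambda>p. h (snd p) * s (fst p)) ` ({0..pi} \<times> {0..T}))"
    then obtain K where "\<forall>z\<in>(\<lambda>p. h (snd p) * s (fst p)) ` ({0..pi} \<times> {0..T}). norm z \<le> K"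
      unfolding bounded_iff by blast
    then show ?thesis using that by blast
  qed
  have st: "space_time T \<in> sets lebesgue" using space_time_lmeasurable[of T] by (simp add: fmeasurable_def)
  have "space_time T \<subseteq> {0..pi} \<times> {0..T}" by auto
  then have "(\<lambda>p. h (snd p) * s (fst p)) \<in> borel_measurable (lebesgue_on (space_time T))"
    by (intro continuous_imp_measurable_on_sets_lebesgue st continuous_on_subset[OF c])
  then show ?thesis
    by (rule integrable_mult_bounded[OF F, where K=K]) (use K in auto)
qed

lemma fubini:
  fixes h s :: "real \<Rightarrow> complex"
  assumes h: "continuous_on {0..T} h" and s: "continuous_on {0..pi} s" and F: "integrable (lebesgue_on (space_time T)) F"
  shows "integrable (lebesgue_on {0<..<T}) (\<lambda>t. LINT x|lebesgue_on {0<..<pi}. s x * F (x, t))"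
    and "(LINT p|lebesgue_on (space_time T). (h (snd p) * s (fst p)) * F p) =
      (LINT t|lebesgue_on {0<..<T}. h t * (LINT x|lebesgue_on {0<..<pi}. s x * F (x, t)))"
    and "(LINT p|lebesgue_on (space_time T). (h (snd p) * s (fst p)) * F p) =
      (LINT x|lebesgue_on {0<..<pi}. s x * (LINT t|lebesgue_on {0<..<T}. h t * F (x, t)))"
proof -
  have "integrable (lebesgue_on (space_time T)) (\<lambda>p. (1 * s (fst p)) * F p)"
    by (rule integrable_product[OF continuous_on_const s F])
  from Fubini_lebesgue_on(2)[OF this]
  show "integrable (lebesgue_on {0<..<T}) (\<lambda>t. LINT x|lebesgue_on {0<..<pi}. s x * F (x, t))" by simp
  note i = integrable_product[OF h s F]
  have "(LINT p|lebesgue_on (space_time T). (h (snd p) * s (fst p)) * F p) =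
      (LINT t|lebesgue_on {0<..<T}. LINT x|lebesgue_on {0<..<pi}. (h t * s x) * F (x, t))"
    by (subst Fubini_lebesgue_on(3)[OF i, symmetric]) simp_all
  then show "(LINT p|lebesgue_on (space_time T). (h (snd p) * s (fst p)) * F p) =
      (LINT t|lebesgue_on {0<..<T}. h t * (LINT x|lebesgue_on {0<..<pi}. s x * F (x, t)))"
    by (simp add: mult.assoc)
  have "(LINT p|lebesgue_on (space_time T). (h (snd p) * s (fst p)) * F p) =
      (LINT x|lebesgue_on {0<..<pi}. LINT t|lebesgue_on {0<..<T}. (h t * s x) * F (x, t))"
    by (subst Fubini_lebesgue_on(6)[OF i, symmetric]) simp_all
  also have "\<dots> = (LINT x|lebesgue_on {0<..<pi}. LINT t|lebesgue_on {0<..<T}. s x * (h t * F (x, t)))"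
    by (simp add: mult_ac)
  finally show "(LINT p|lebesgue_on (space_time T). (h (snd p) * s (fst p)) * F p) =
      (LINT x|lebesgue_on {0<..<pi}. s x * (LINT t|lebesgue_on {0<..<T}. h t * F (x, t)))" by simp
qed

lemma f_int: "integrable (lebesgue_on (space_time T)) f" and fxx_int: "integrable (lebesgue_on (space_time T)) fxx"
  and ft_int: "integrable (lebesgue_on (space_time T)) ft"
  by (rule L2_integrable[OF _ space_time_lmeasurable], rule L2)+

text \<open>Only continuity of \<open>t \<mapsto> f (\<cdot>, t)\<close> in L2 is at hand. The
  inequality \<open>w \<le> \<delta> + w^2 / \<delta>\<close> bounds the integral of the difference
  by its L2 norm, with \<open>\<delta>\<close> chosen so that each of the two terms contributes half
  of the tolerance.\<close>

lemma mode_cont: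
  assumes s: "continuous_on {0..pi} s"
  shows "continuous_on {0..T} (mode s)"
  unfolding continuous_on_def
proof
  fix t0 assume t0: "t0 \<in> {0..T}"
  let ?M = "lebesgue_on {0<..<pi}"
  obtain K where K: "0 < K" "\<And>x. x \<in> {0..pi} \<Longrightarrow> norm (s x) \<le> K" using cont_bounded_Icc[OF s] by blast
  let ?D = "\<lambda>t. LINT x|?M. (norm (f (x, t) - f (x, t0)))\<^sup>2"
  have sf: "integrable ?M (\<lambda>x. s x * f (x, t))" if "t \<in> {0..T}" for t
    by (intro integrable_cont_Ioo continuous_on_mult s f_cont[OF that])
  have bound: "norm (mode s t - mode s t0) \<le> K * (pi * \<delta> + ?D t / \<delta>)" if t: "t \<in> {0..T}" and \<delta>: "\<delta> > 0" for t \<delta>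
  proof -
    have c: "continuous_on {0..pi} (\<lambda>x. f (x, t) - f (x, t0))" by (intro continuous_on_diff f_cont t t0)
    have i2: "integrable ?M (\<lambda>x. (norm (f (x, t) - f (x, t0)))\<^sup>2)"
    proof -
      have "integrable ?M (\<lambda>x. complex_of_real ((norm (f (x, t) - f (x, t0)))\<^sup>2))"
        by (intro integrable_cont_Ioo continuous_on_of_real continuous_on_power continuous_on_norm c)
      from integrable_norm[OF this] show ?thesis by (simp only: norm_of_real abs_power2)
    qed
    have ic: "integrable ?M (\<lambda>x. \<delta>)"
      by (intro finite_measure.integrable_const finite_measure_lebesgue_on Ioo_lmeasurable)
    have "mode s t - mode s t0 = (LINT x|?M. s x * (f (x, t) - f (x, t0)))"
      unfolding mode_def right_diff_distrib using sf[OF t] sf[OF t0] by simp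
    also have "norm \<dots> \<le> (LINT x|?M. norm (s x * (f (x, t) - f (x, t0))))" by (rule integral_norm_bound)
    also have "\<dots> \<le> (LINT x|?M. K * (\<delta> + (norm (f (x, t) - f (x, t0)))\<^sup>2 / \<delta>))"
    proof (rule integral_mono)
      show "integrable ?M (\<lambda>x. norm (s x * (f (x, t) - f (x, t0))))"
        by (intro integrable_norm integrable_cont_Ioo continuous_on_mult s c)
      show "integrable ?M (\<lambda>x. K * (\<delta> + (norm (f (x, t) - f (x, t0)))\<^sup>2 / \<delta>))"
        using i2 ic by (intro integrable_mult_right Bochner_Integration.integrable_add integrable_divide) auto
      fix x assume "x \<in> space ?M"
      then have x: "norm (s x) \<le> K" using K by simp
      let ?w = "norm (f (x, t) - f (x, t0))"
      have "0 \<le> (?w - \<delta>)\<^sup>2" by simp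
      then have "2 * \<delta> * ?w \<le> \<delta> * \<delta> + ?w\<^sup>2" by (simp add: power2_diff power2_eq_square algebra_simps)
      moreover have "0 \<le> \<delta> * ?w" using \<delta> by simp
      ultimately have "\<delta> * ?w \<le> \<delta> * \<delta> + ?w\<^sup>2" by linarith
      then have "?w \<le> \<delta> + ?w\<^sup>2 / \<delta>" using \<delta> by (simp add: field_simps)
      then show "norm (s x * (f (x, t) - f (x, t0))) \<le> K * (\<delta> + ?w\<^sup>2 / \<delta>)"
        unfolding norm_mult using x K by (intro mult_mono) auto
    qed
    also have "\<dots> = K * (pi * \<delta> + ?D t / \<delta>)"
      using i2 ic by (simp add: Bochner_Integration.integral_add measure_restrict_space)
    finally show ?thesis .
  qed
  show "(mode s \<longlongrightarrow> mode s t0) (at t0 within {0..T})"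
  proof (rule tendstoI)
    fix e :: real assume e: "e > 0"
    define \<delta> where "\<delta> = e / (2 * K * pi)"
    have \<delta>: "\<delta> > 0" using e K by (simp add: \<delta>_def)
    have "\<forall>\<^sub>F t in at t0 within {0..T}. ?D t < e * \<delta> / (2 * K)"
      using e \<delta> K by (intro order_tendstoD(2)[OF f_C[OF t0]]) simp
    moreover have "\<forall>\<^sub>F t in at t0 within {0..T}. t \<in> {0..T}" by (simp add: eventually_at_filter)
    ultimately show "\<forall>\<^sub>F t in at t0 within {0..T}. dist (mode s t) (mode s t0) < e"
    proof eventually_elim
      case (elim t)
      have "dist (mode s t) (mode s t0) \<le> K * (pi * \<delta> + ?D t / \<delta>)"
        unfolding dist_norm by (rule bound[OF elim(2) \<delta>])
      also have "\<dots> < K * (pi * \<delta> + (e * \<delta> / (2 * K)) / \<delta>)"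
        using elim(1) \<delta> K by (intro mult_strict_left_mono add_strict_left_mono divide_strict_right_mono) auto
      also have "\<dots> = e" using \<delta> K by (simp add: \<delta>_def field_simps)
      finally show ?case .
    qed
  qed
qed

text \<open>Fubini turns the time integral of the mode into an integral over \<open>x\<close> of
  time sections, and for almost every \<open>x\<close> the section has the weak derivative
  \<open>ft\<close>; Fubini turns the result back.\<close>

lemma mode_weak:
  assumes s: "continuous_on {0..pi} s" and \<psi>: "C1_test_function 0 T \<psi> \<psi>'"
  shows "(LINT t|lebesgue_on {0<..<T}. \<psi>' t *\<^sub>R mode s t) =
    - (LINT t|lebesgue_on {0<..<T}. \<psi> t *\<^sub>R (LINT x|lebesgue_on {0<..<pi}. s x * ft (x, t)))"
proof -
  have c: "continuous_on {0..T} (\<lambda>t. complex_of_real (\<psi> t))" "continuous_on {0..T} (\<lambda>t. complex_of_real (\<psi>' t))"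
    using \<psi> unfolding C1_test_function_def
    by (auto intro!: continuous_on_of_real intro: DERIV_continuous_on continuous_on_subset DERIV_isCont continuous_at_imp_continuous_on)
  have "(LINT t|lebesgue_on {0<..<T}. \<psi>' t *\<^sub>R mode s t) =
      (LINT x|lebesgue_on {0<..<pi}. s x * (LINT t|lebesgue_on {0<..<T}. complex_of_real (\<psi>' t) * f (x, t)))"
    unfolding mode_def scaleR_conv_of_real
    by (subst fubini(2)[OF c(2) s f_int, symmetric]) (rule fubini(3)[OF c(2) s f_int])
  also have "\<dots> = (LINT x|lebesgue_on {0<..<pi}. s x * - (LINT t|lebesgue_on {0<..<T}. complex_of_real (\<psi> t) * ft (x, t)))"
  proof (rule integrable_lebesgue_on_cong_AE(2))
    have i: "integrable (lebesgue_on (space_time T)) (\<lambda>p. (complex_of_real (\<psi>' (snd p)) * s (fst p)) * f p)"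
      by (rule integrable_product[OF c(2) s f_int])
    have "integrable (lebesgue_on {0<..<pi}) (\<lambda>x. LINT t|lebesgue_on {0<..<T}. s x * (complex_of_real (\<psi>' t) * f (x, t)))"
      using Fubini_lebesgue_on(5)[OF i] by (simp add: mult_ac)
    then show "integrable (lebesgue_on {0<..<pi}) (\<lambda>x. s x * (LINT t|lebesgue_on {0<..<T}. complex_of_real (\<psi>' t) * f (x, t)))"
      by simp
    show "AE x in lebesgue_on {0<..<pi}. s x * (LINT t|lebesgue_on {0<..<T}. complex_of_real (\<psi>' t) * f (x, t)) =
       s x * - (LINT t|lebesgue_on {0<..<T}. complex_of_real (\<psi> t) * ft (x, t))"
      using f_t
    proof eventually_elim
      case (elim x)
      then show ?case using \<psi> unfolding H1_deriv_def by (simp add: scaleR_conv_of_real)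
    qed
  qed auto
  also have "\<dots> = - (LINT x|lebesgue_on {0<..<pi}. s x * (LINT t|lebesgue_on {0<..<T}. complex_of_real (\<psi> t) * ft (x, t)))"
    by simp
  also have "\<dots> = - (LINT t|lebesgue_on {0<..<T}. \<psi> t *\<^sub>R (LINT x|lebesgue_on {0<..<pi}. s x * ft (x, t)))"
    unfolding scaleR_conv_of_real
    by (subst fubini(3)[OF c(1) s ft_int, symmetric]) (simp only: fubini(2)[OF c(1) s ft_int])
  finally show ?thesis .
qed

text \<open>One integration by parts in time, where the zero final state removes the upper boundary
  term, and two in space. There \<open>s pi = 0\<close> removes the trace of \<open>fx\<close> at
  \<open>pi\<close> and the Dirichlet condition removes the terms with \<open>s'\<close>; the trace
  at 0 remains, and through it the control enters.\<close>

lemma green: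
  assumes h: "\<And>t. t \<in> {0..T} \<Longrightarrow> (h has_vector_derivative h' t) (at t within {0..T})" "continuous_on {0..T} h'"
    and s: "\<And>x. (s has_vector_derivative s' x) (at x)" "\<And>x. (s' has_vector_derivative s'' x) (at x)" "continuous_on UNIV s''"
    and s_pi: "s pi = 0"
  shows "(LINT p|lebesgue_on (space_time T). (h (snd p) * s (fst p)) * (- ft p - fxx p)) =
     h 0 * mode s 0 + (LINT t|lebesgue_on {0<..<T}. h' t * mode s t)
      - (LINT t|lebesgue_on {0<..<T}. h t * mode s'' t) + s 0 * (LINT t|lebesgue_on {0<..<T}. h t * fx (0, t))"
proof -
  let ?M = "lebesgue_on {0<..<pi}" and ?N = "lebesgue_on {0<..<T}"
  have hc: "continuous_on {0..T} h"
    using h(1) by (meson has_vector_derivative_continuous continuous_on_eq_continuous_within)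
  have sc: "continuous_on A s" "continuous_on A s'" "continuous_on A s''" for A
    using s by (meson has_vector_derivative_continuous continuous_at_imp_continuous_on continuous_on_subset subset_UNIV)+
  have It: "(LINT p|lebesgue_on (space_time T). (h (snd p) * s (fst p)) * ft p) =
     - h 0 * mode s 0 - (LINT t|?N. h' t * mode s t)"
  proof -
    have "(LINT p|lebesgue_on (space_time T). (h (snd p) * s (fst p)) * ft p) =
        (LINT t|?N. h t * (LINT x|?M. s x * ft (x, t)))"
      by (rule fubini(2)[OF hc sc(1) ft_int])
    also have "\<dots> = h T * mode s T - h 0 * mode s 0 - (LINT t|?N. h' t * mode s t)"
      by (rule weak_ibp[OF T mode_cont[OF sc(1)] fubini(1)[OF hc sc(1) ft_int] mode_weak[OF sc(1)] h])
    also have "mode s T = (LINT x|?M. 0)"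
      unfolding mode_def by (rule Bochner_Integration.integral_cong[OF refl]) (simp add: f_T)
    finally show ?thesis by simp
  qed
  let ?G = "\<lambda>t. LINT x|?M. s x * fxx (x, t)"
  have G: "AE t in ?N. ?G t = mode s'' t - s 0 * fx (0, t)"
    using fx_H1 AE_space
  proof eventually_elim
    case (elim t)
    then have t: "t \<in> {0..T}" by simp
    have w1: "integrable ?M (\<lambda>x. fxx (x, t))" and w2: "integrable ?M (\<lambda>x. fx (x, t))"
      using elim(1) f_H1[OF t] unfolding H1_deriv_def by (auto intro: L2_integrable[OF _ Ioo_lmeasurable])
    have "?G t = s pi * fx (pi, t) - s 0 * fx (0, t) - (LINT x|?M. s' x * fx (x, t))"
      by (rule weak_ibp[OF pi_gt_zero _ w1])
         (use elim(1) s sc in \<open>auto simp: H1_deriv_def intro: has_vector_derivative_at_within\<close>)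
    also have "(LINT x|?M. s' x * fx (x, t)) = s' pi * f (pi, t) - s' 0 * f (0, t) - (LINT x|?M. s'' x * f (x, t))"
      by (rule weak_ibp[OF pi_gt_zero f_cont[OF t] w2])
         (use f_H1[OF t] s sc in \<open>auto simp: H1_deriv_def intro: has_vector_derivative_at_within\<close>)
    finally show ?case using f_bd[OF t] s_pi by (simp add: mode_def)
  qed
  have iG: "integrable ?N (\<lambda>t. h t * ?G t)"
    by (rule integrable_mult_cont_Ioo[OF fubini(1)[OF hc sc(1) fxx_int] hc])
  have im: "integrable ?N (\<lambda>t. h t * mode s'' t)"
    by (intro integrable_cont_Ioo continuous_on_mult hc mode_cont sc)
  have eq: "(LINT t|?N. h t * mode s'' t - h t * ?G t) = (LINT t|?N. s 0 * (h t * fx (0, t)))"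
  proof -
    have ae: "AE t in ?N. h t * mode s'' t - h t * ?G t = s 0 * (h t * fx (0, t))"
      using G
    proof eventually_elim
      case (elim t)
      show ?case unfolding elim by (simp add: algebra_simps)
    qed
    have i: "integrable ?N (\<lambda>t. h t * mode s'' t - h t * ?G t)" by (intro Bochner_Integration.integrable_diff im iG)
    show "(LINT t|?N. h t * mode s'' t - h t * ?G t) = (LINT t|?N. s 0 * (h t * fx (0, t)))"
      by (rule integrable_lebesgue_on_cong_AE(2)[OF i ae]) simp
  qed
  have Ixx: "(LINT p|lebesgue_on (space_time T). (h (snd p) * s (fst p)) * fxx p) =
     (LINT t|?N. h t * mode s'' t) - s 0 * (LINT t|?N. h t * fx (0, t))"
  proof -
    have "(LINT t|?N. h t * mode s'' t) - (LINT t|?N. h t * ?G t) = s 0 * (LINT t|?N. h t * fx (0, t))"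
      using eq im iG by (simp add: Bochner_Integration.integral_diff)
    then show ?thesis unfolding fubini(2)[OF hc sc(1) fxx_int] by (simp add: algebra_simps)
  qed
  have "(LINT p|lebesgue_on (space_time T). (h (snd p) * s (fst p)) * (- ft p - fxx p)) =
     - (LINT p|lebesgue_on (space_time T). (h (snd p) * s (fst p)) * ft p)
     - (LINT p|lebesgue_on (space_time T). (h (snd p) * s (fst p)) * fxx p)"
    using integrable_product[OF hc sc(1) ft_int] integrable_product[OF hc sc(1) fxx_int]
    by (simp add: right_diff_distrib Bochner_Integration.integral_diff)
  then show "(LINT p|lebesgue_on (space_time T). (h (snd p) * s (fst p)) * (- ft p - fxx p)) =
     h 0 * mode s 0 + (LINT t|lebesgue_on {0<..<T}. h' t * mode s t)
      - (LINT t|lebesgue_on {0<..<T}. h t * mode s'' t) + s 0 * (LINT t|lebesgue_on {0<..<T}. h t * fx (0, t))"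
    unfolding It Ixx by simp
qed

end

section \<open>Pairing the vector adjoint problem with fixed vectors\<close>

definition cmat :: "real^2^2 \<Rightarrow> complex^2^2" where
  "cmat A = (\<chi> i j. complex_of_real (A $ i $ j))"

lemma real_pairing_bounded_linear: "bounded_linear (real_pairing w)"
proof -
  have "linear (real_pairing w)"
  proof (rule linearI)
    show "real_pairing w (r *\<^sub>R b) = r *\<^sub>R real_pairing w b" for r b
      unfolding real_pairing_def vector_scaleR_component scaleR_sum_right
      by (rule sum.cong) (simp_all add: scaleR_conv_of_real)
  qed (simp add: real_pairing_def distrib_left sum.distrib)
  then show ?thesis by (simp add: linear_conv_bounded_linear)
qed

lemma real_pairing_add_left: "real_pairing (v + w) g = real_pairing v g + real_pairing w g"
  and real_pairing_scale_left: "real_pairing (c *s w) g = c * real_pairing w g"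
  by (simp_all add: real_pairing_def distrib_right sum.distrib sum_distrib_left mult.assoc)

text \<open>The pairing is bilinear without conjugation, so the transpose on the test side becomes
  \<open>A\<close> on the complex side; pairing with eigenvectors of \<open>A\<close> therefore
  decouples the adjoint system.\<close>

lemma real_pairing_transpose: "real_pairing w (transpose A *v g) = real_pairing (cmat A *v w) g"
  by (simp add: real_pairing_def cmat_def matrix_vector_mult_def transpose_def sum_2 algebra_simps)

lemma L2_on_bounded_linear:
  assumes L: "bounded_linear L" and f: "L2_on S f"
  shows "L2_on S (\<lambda>x. L (f x))"
  unfolding L2_on_def
proof
  have m: "f \<in> borel_measurable (lebesgue_on S)" and i: "integrable (lebesgue_on S) (\<lambda>x. (norm (f x))\<^sup>2)"
    using f by (auto simp: L2_on_def)
  have "L \<in> borel_measurable borel"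
    using L by (intro borel_measurable_continuous_onI linear_continuous_on)
  then show mL: "(\<lambda>x. L (f x)) \<in> borel_measurable (lebesgue_on S)" using m by (rule measurable_compose[rotated])
  obtain K where K: "\<And>x. norm (L x) \<le> norm x * K" using bounded_linear.bounded[OF L] by blast
  show "integrable (lebesgue_on S) (\<lambda>x. (norm (L (f x)))\<^sup>2)"
  proof (rule Bochner_Integration.integrable_bound)
    show "integrable (lebesgue_on S) (\<lambda>x. K\<^sup>2 * (norm (f x))\<^sup>2)" by (intro integrable_mult_right i)
    show "(\<lambda>x. (norm (L (f x)))\<^sup>2) \<in> borel_measurable (lebesgue_on S)" using mL by measurable
    show "AE x in lebesgue_on S. norm ((norm (L (f x)))\<^sup>2) \<le> norm (K\<^sup>2 * (norm (f x))\<^sup>2)"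
    proof (rule AE_I2)
      fix x
      have "(norm (L (f x)))\<^sup>2 \<le> (norm (f x) * K)\<^sup>2" by (rule power_mono[OF K]) simp
      then show "norm ((norm (L (f x)))\<^sup>2) \<le> norm (K\<^sup>2 * (norm (f x))\<^sup>2)" by (simp add: power_mult_distrib mult.commute)
    qed
  qed
qed

lemma C1_test_function_bounded:
  assumes "C1_test_function a b \<psi> \<psi>'"
  shows "continuous_on A \<psi>" "continuous_on A \<psi>'"
  using assms unfolding C1_test_function_def
  by (meson DERIV_isCont continuous_at_imp_continuous_on, meson continuous_on_subset subset_UNIV)

lemma H1_deriv_bounded_linear:
  assumes L: "bounded_linear L" and f: "H1_deriv a b f f'"
  shows "H1_deriv a b (\<lambda>x. L (f x)) (\<lambda>x. L (f' x))"
  unfolding H1_deriv_def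
proof (intro conjI allI impI)
  have f1: "L2_on {a<..<b} f" and f2: "L2_on {a<..<b} f'" using f by (auto simp: H1_deriv_def)
  show "L2_on {a<..<b} (\<lambda>x. L (f x))" "L2_on {a<..<b} (\<lambda>x. L (f' x))"
    by (rule L2_on_bounded_linear[OF L f1], rule L2_on_bounded_linear[OF L f2])
  fix \<psi> \<psi>' assume t: "C1_test_function a b \<psi> \<psi>'"
  have lin: "(LINT x|lebesgue_on {a<..<b}. q x *\<^sub>R L (g x)) = L (LINT x|lebesgue_on {a<..<b}. q x *\<^sub>R g x)"
    if g: "L2_on {a<..<b} g" and q: "continuous_on {a..b} q" for q :: "real \<Rightarrow> real" and g
  proof -
    obtain K where "\<And>x. x \<in> {a..b} \<Longrightarrow> norm (q x) \<le> K" using cont_bounded_Icc[OF q] by blast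
    then have i: "integrable (lebesgue_on {a<..<b}) (\<lambda>x. q x *\<^sub>R g x)"
      by (intro integrable_scaleR_bounded[where K=K] L2_integrable[OF g Ioo_lmeasurable] measurable_lebesgue_on_Ioo q) auto
    have "(LINT x|lebesgue_on {a<..<b}. q x *\<^sub>R L (g x)) = (LINT x|lebesgue_on {a<..<b}. L (q x *\<^sub>R g x))"
      by (simp add: linear_scale[OF bounded_linear.linear[OF L]])
    also have "\<dots> = L (LINT x|lebesgue_on {a<..<b}. q x *\<^sub>R g x)"
      by (rule integral_bounded_linear[OF L i])
    finally show ?thesis .
  qed
  show "(LINT x|lebesgue_on {a<..<b}. \<psi>' x *\<^sub>R L (f x)) = - (LINT x|lebesgue_on {a<..<b}. \<psi> x *\<^sub>R L (f' x))"
    unfolding lin[OF f1 C1_test_function_bounded(2)[OF t]] lin[OF f2 C1_test_function_bounded(1)[OF t]]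
    using f t unfolding H1_deriv_def by (simp add: linear_neg[OF bounded_linear.linear[OF L]])
qed

lemma L2_on_diff_square:
  fixes f g :: "'a::euclidean_space \<Rightarrow> 'b::euclidean_space"
  assumes f: "L2_on S f" and g: "L2_on S g"
  shows "integrable (lebesgue_on S) (\<lambda>x. (norm (f x - g x))\<^sup>2)"
proof (rule Bochner_Integration.integrable_bound)
  show "integrable (lebesgue_on S) (\<lambda>x. 2 * (norm (f x))\<^sup>2 + 2 * (norm (g x))\<^sup>2)"
    using f g unfolding L2_on_def by (intro Bochner_Integration.integrable_add integrable_mult_right) auto
  show "(\<lambda>x. (norm (f x - g x))\<^sup>2) \<in> borel_measurable (lebesgue_on S)"
  proof -
    have [measurable]: "f \<in> borel_measurable (lebesgue_on S)" "g \<in> borel_measurable (lebesgue_on S)"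
      using f g by (auto simp: L2_on_def)
    show ?thesis by measurable
  qed
  show "AE x in lebesgue_on S. norm ((norm (f x - g x))\<^sup>2) \<le> norm (2 * (norm (f x))\<^sup>2 + 2 * (norm (g x))\<^sup>2)"
  proof (rule AE_I2)
    fix x
    have "(norm (f x - g x))\<^sup>2 \<le> (norm (f x) + norm (g x))\<^sup>2" by (rule power_mono[OF norm_triangle_ineq4]) simp
    also have "\<dots> \<le> 2 * (norm (f x))\<^sup>2 + 2 * (norm (g x))\<^sup>2"
      using sum_squares_bound[of "norm (f x)" "norm (g x)"] by (simp add: power2_sum)
    finally show "norm ((norm (f x - g x))\<^sup>2) \<le> norm (2 * (norm (f x))\<^sup>2 + 2 * (norm (g x))\<^sup>2)" by simp
  qed
qed

text \<open>The witnesses \<open>\<phi>xx\<close> and \<open>\<phi>t\<close> are extracted once and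
  serve all vectors \<open>w\<close>, so that the equations paired with \<open>Bc\<close> and with
  \<open>C\<close> speak of the same derivatives.\<close>

lemma strong_adjoint_pairing:
  assumes T: "0 < T" and S: "strong_adjoint_solution A T g \<phi> \<phi>x"
  obtains \<phi>xx \<phi>t where
    "\<And>w. scalar_adjoint T (\<lambda>p. real_pairing w (\<phi> p)) (\<lambda>p. real_pairing w (\<phi>x p))
        (\<lambda>p. real_pairing w (\<phi>xx p)) (\<lambda>p. real_pairing w (\<phi>t p))"
    "\<And>w. AE p in lebesgue_on (space_time T). real_pairing w (g p) =
        - real_pairing w (\<phi>t p) - real_pairing w (\<phi>xx p) - real_pairing (cmat A *v w) (\<phi> p)"
proof -
  from S obtain \<phi>xx \<phi>t where L: "L2_on (space_time T) \<phi>" "L2_on (space_time T) \<phi>xx"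
    and ae1: "AE t in lebesgue_on {0<..<T}.
           continuous_on {0..pi} (\<lambda>x. \<phi>x (x, t)) \<and> H1_deriv 0 pi (\<lambda>x. \<phi>x (x, t)) (\<lambda>x. \<phi>xx (x, t))"
    and L': "L2_on (space_time T) \<phi>t"
    and ae2: "AE x in lebesgue_on {0<..<pi}. H1_deriv 0 T (\<lambda>t. \<phi> (x, t)) (\<lambda>t. \<phi>t (x, t))"
    and ae3: "AE p in lebesgue_on (space_time T). - \<phi>t p - \<phi>xx p = transpose A *v \<phi> p + g p"
    unfolding strong_adjoint_solution_def by blast
  have S1: "\<And>t. t \<in> {0..T} \<Longrightarrow> continuous_on {0..pi} (\<lambda>x. \<phi> (x, t)) \<and>
        H1_deriv 0 pi (\<lambda>x. \<phi> (x, t)) (\<lambda>x. \<phi>x (x, t)) \<and> \<phi> (0, t) = 0 \<and> \<phi> (pi, t) = 0"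
    and S2: "\<And>s. s \<in> {0..T} \<Longrightarrow> ((\<lambda>t. LINT x|lebesgue_on {0<..<pi}.
             (norm (\<phi> (x, t) - \<phi> (x, s)))\<^sup>2 + (norm (\<phi>x (x, t) - \<phi>x (x, s)))\<^sup>2) \<longlongrightarrow> 0) (at s within {0..T})"
    and S3: "\<And>x. x \<in> {0..pi} \<Longrightarrow> \<phi> (x, T) = 0"
    using S unfolding strong_adjoint_solution_def by blast+
  show ?thesis
  proof (rule that)
    fix w
    note P = real_pairing_bounded_linear[of w]
    have lin: "linear (real_pairing w)" by (rule bounded_linear.linear[OF P])
    have cP: "continuous_on A (\<lambda>x. real_pairing w (h x))" if "continuous_on A h" for A :: "real set" and h
      by (rule bounded_linear.continuous_on[OF P that])
    show "scalar_adjoint T (\<lambda>p. real_pairing w (\<phi> p)) (\<lambda>p. real_pairing w (\<phi>x p))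
        (\<lambda>p. real_pairing w (\<phi>xx p)) (\<lambda>p. real_pairing w (\<phi>t p))"
    proof
      show "0 < T" by (rule T)
      show "continuous_on {0..pi} (\<lambda>x. real_pairing w (\<phi> (x, t)))" if "t \<in> {0..T}" for t
        using S1[OF that] by (intro cP) blast
      show "real_pairing w (\<phi> (0, t)) = 0" if "t \<in> {0..T}" for t
        using S1[OF that] linear_0[OF lin] by simp
      show "real_pairing w (\<phi> (pi, t)) = 0" if "t \<in> {0..T}" for t
        using S1[OF that] linear_0[OF lin] by simp
      show "H1_deriv 0 pi (\<lambda>x. real_pairing w (\<phi> (x, t))) (\<lambda>x. real_pairing w (\<phi>x (x, t)))" if "t \<in> {0..T}" for t
        using S1[OF that] by (intro H1_deriv_bounded_linear[OF P]) blast
      show "real_pairing w (\<phi> (x, T)) = 0" if "x \<in> {0..pi}" for x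
        using S3[OF that] linear_0[OF lin] by simp
      show "L2_on (space_time T) (\<lambda>p. real_pairing w (\<phi> p))" "L2_on (space_time T) (\<lambda>p. real_pairing w (\<phi>xx p))"
        "L2_on (space_time T) (\<lambda>p. real_pairing w (\<phi>t p))"
        by (intro L2_on_bounded_linear[OF P] L L')+
      show "AE t in lebesgue_on {0<..<T}. continuous_on {0..pi} (\<lambda>x. real_pairing w (\<phi>x (x, t))) \<and>
           H1_deriv 0 pi (\<lambda>x. real_pairing w (\<phi>x (x, t))) (\<lambda>x. real_pairing w (\<phi>xx (x, t)))"
        using ae1
      proof eventually_elim
        case (elim t)
        then show ?case by (intro conjI cP H1_deriv_bounded_linear[OF P]) auto
      qed
      show "AE x in lebesgue_on {0<..<pi}. H1_deriv 0 T (\<lambda>t. real_pairing w (\<phi> (x, t))) (\<lambda>t. real_pairing w (\<phi>t (x, t)))"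
        using ae2 by eventually_elim (rule H1_deriv_bounded_linear[OF P])
      fix s assume s: "s \<in> {0..T}"
      obtain K where K: "\<And>x. norm (real_pairing w x) \<le> norm x * K" using bounded_linear.bounded[OF P] by blast
      let ?E = "\<lambda>t. LINT x|lebesgue_on {0<..<pi}.
             (norm (\<phi> (x, t) - \<phi> (x, s)))\<^sup>2 + (norm (\<phi>x (x, t) - \<phi>x (x, s)))\<^sup>2"
      let ?F = "\<lambda>t. LINT x|lebesgue_on {0<..<pi}. (norm (real_pairing w (\<phi> (x, t)) - real_pairing w (\<phi> (x, s))))\<^sup>2"
      show "(?F \<longlongrightarrow> 0) (at s within {0..T})"
      proof (rule Lim_null_comparison)
        have "((\<lambda>t. K\<^sup>2 * ?E t) \<longlongrightarrow> K\<^sup>2 * 0) (at s within {0..T})" by (intro tendsto_intros S2 s)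
        then show "((\<lambda>t. K\<^sup>2 * ?E t) \<longlongrightarrow> 0) (at s within {0..T})" by simp
        have "\<forall>\<^sub>F t in at s within {0..T}. t \<in> {0..T}" by (simp add: eventually_at_filter)
        then show "\<forall>\<^sub>F t in at s within {0..T}. norm (?F t) \<le> K\<^sup>2 * ?E t"
        proof eventually_elim
          case (elim t)
          have l2: "L2_on {0<..<pi} (\<lambda>x. \<phi> (x, t))" "L2_on {0<..<pi} (\<lambda>x. \<phi> (x, s))"
             "L2_on {0<..<pi} (\<lambda>x. \<phi>x (x, t))" "L2_on {0<..<pi} (\<lambda>x. \<phi>x (x, s))"
            using S1[OF elim] S1[OF s] by (auto simp: H1_deriv_def)
          have "0 \<le> ?F t" by (rule integral_nonneg_AE) simp
          then have "norm (?F t) = ?F t" by simp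
          also have "?F t \<le> (LINT x|lebesgue_on {0<..<pi}. K\<^sup>2 * ((norm (\<phi> (x, t) - \<phi> (x, s)))\<^sup>2 + (norm (\<phi>x (x, t) - \<phi>x (x, s)))\<^sup>2))"
          proof (rule integral_mono)
            show "integrable (lebesgue_on {0<..<pi}) (\<lambda>x. (norm (real_pairing w (\<phi> (x, t)) - real_pairing w (\<phi> (x, s))))\<^sup>2)"
              by (intro L2_on_diff_square L2_on_bounded_linear[OF P] l2)
            show "integrable (lebesgue_on {0<..<pi}) (\<lambda>x. K\<^sup>2 * ((norm (\<phi> (x, t) - \<phi> (x, s)))\<^sup>2 + (norm (\<phi>x (x, t) - \<phi>x (x, s)))\<^sup>2))"
              by (intro integrable_mult_right Bochner_Integration.integrable_add L2_on_diff_square l2)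
            fix x
            have "(norm (real_pairing w (\<phi> (x, t)) - real_pairing w (\<phi> (x, s))))\<^sup>2 = (norm (real_pairing w (\<phi> (x, t) - \<phi> (x, s))))\<^sup>2"
              by (simp add: linear_diff[OF lin])
            also have "\<dots> \<le> (norm (\<phi> (x, t) - \<phi> (x, s)) * K)\<^sup>2" by (rule power_mono[OF K]) simp
            also have "\<dots> = K\<^sup>2 * (norm (\<phi> (x, t) - \<phi> (x, s)))\<^sup>2" by (simp add: power_mult_distrib mult.commute)
            also have "\<dots> \<le> K\<^sup>2 * ((norm (\<phi> (x, t) - \<phi> (x, s)))\<^sup>2 + (norm (\<phi>x (x, t) - \<phi>x (x, s)))\<^sup>2)"
              by (intro mult_left_mono) auto
            finally show "(norm (real_pairing w (\<phi> (x, t)) - real_pairing w (\<phi> (x, s))))\<^sup>2 \<le>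
              K\<^sup>2 * ((norm (\<phi> (x, t) - \<phi> (x, s)))\<^sup>2 + (norm (\<phi>x (x, t) - \<phi>x (x, s)))\<^sup>2)" .
          qed
          finally show ?case by simp
        qed
      qed
    qed
    show "AE p in lebesgue_on (space_time T). real_pairing w (g p) =
        - real_pairing w (\<phi>t p) - real_pairing w (\<phi>xx p) - real_pairing (cmat A *v w) (\<phi> p)"
      using ae3
    proof eventually_elim
      case (elim p)
      have eq: "g p = - \<phi>t p - \<phi>xx p - transpose A *v \<phi> p" using elim by (simp add: algebra_simps)
      show ?case unfolding eq linear_diff[OF lin] linear_neg[OF lin] real_pairing_transpose ..
    qed
  qed
qed

section \<open>Sine series\<close>

abbreviation Omega :: "real measure" where "Omega \<equiv> lebesgue_on {0<..<pi}"

lemma LINT_Ioo_FTC: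
  fixes f F :: "real \<Rightarrow> real"
  assumes "a \<le> b" "continuous_on {a..b} f" "\<And>x. (F has_real_derivative f x) (at x)"
  shows "(LINT x|lebesgue_on {a<..<b}. f x) = F b - F a"
proof -
  have "(LINT x|lebesgue_on {a<..<b}. f x) = integral {a<..<b} f"
    by (rule lebesgue_integral_eq_integral[OF integrable_cont_Ioo[OF assms(2)]]) simp
  also have "\<dots> = integral {a..b} f" by (rule integral_open_interval_real[symmetric])
  also have "\<dots> = F b - F a"
  proof (rule integral_unique, rule fundamental_theorem_of_calculus[OF assms(1)])
    show "(F has_vector_derivative f x) (at x within {a..b})" if "x \<in> {a..b}" for x
      using assms(3)[of x] by (simp add: has_real_derivative_iff_has_vector_derivative has_vector_derivative_at_within)
  qed
  finally show ?thesis .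
qed

lemma sine_orthogonal:
  assumes "1 \<le> j" "1 \<le> k"
  shows "(LINT x|Omega. sin (real j * x) * sin (real k * x)) = (if j = k then pi / 2 else 0)"
proof (cases "j = k")
  case True
  have "(LINT x|Omega. sin (real k * x) * sin (real k * x)) =
     (pi / 2 - sin (2 * real k * pi) / (4 * real k)) - (0 / 2 - sin (2 * real k * 0) / (4 * real k))"
  proof (rule LINT_Ioo_FTC)
    show "((\<lambda>x. x / 2 - sin (2 * real k * x) / (4 * real k)) has_real_derivative sin (real k * x) * sin (real k * x)) (at x)" for x
    proof -
      have "cos (2 * (real k * x)) = 1 - 2 * (sin (real k * x))\<^sup>2" by (rule cos_double_sin)
      then have "1 / 2 - cos (2 * real k * x) / 2 = sin (real k * x) * sin (real k * x)"
        by (simp add: power2_eq_square mult.assoc diff_divide_distrib)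
      moreover have "((\<lambda>x. x / 2 - sin (2 * real k * x) / (4 * real k)) has_real_derivative
          1 / 2 - cos (2 * real k * x) * (2 * real k) / (4 * real k)) (at x)"
        using assms(2) by (auto intro!: derivative_eq_intros)
      ultimately show ?thesis using assms(2) by (simp add: mult.assoc)
    qed
  qed (auto intro!: continuous_intros)
  also have "sin (2 * real k * pi) = 0" by (metis mult.commute mult.left_commute sin_npi of_nat_mult of_nat_numeral)
  finally show ?thesis using True by simp
next
  case False
  define p q where "p = real j - real k" "q = real j + real k"
  have pq: "p \<noteq> 0" "q \<noteq> 0" using False assms by (auto simp: p_q_def)
  have "(LINT x|Omega. sin (real j * x) * sin (real k * x)) =
     (sin (p * pi) / (2 * p) - sin (q * pi) / (2 * q)) - (sin (p * 0) / (2 * p) - sin (q * 0) / (2 * q))"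
  proof (rule LINT_Ioo_FTC)
    show "((\<lambda>x. sin (p * x) / (2 * p) - sin (q * x) / (2 * q)) has_real_derivative sin (real j * x) * sin (real k * x)) (at x)" for x
    proof -
      have "sin (real j * x) * sin (real k * x) = (cos (real j * x - real k * x) - cos (real j * x + real k * x)) / 2"
        by (rule sin_times_sin)
      also have "\<dots> = cos (p * x) / 2 - cos (q * x) / 2" by (simp add: p_q_def algebra_simps diff_divide_distrib)
      also have "\<dots> = cos (p * x) * p / (2 * p) - cos (q * x) * q / (2 * q)" using pq by simp
      finally have eq: "sin (real j * x) * sin (real k * x) = cos (p * x) * p / (2 * p) - cos (q * x) * q / (2 * q)" .
      show ?thesis unfolding eq using pq by (auto intro!: derivative_eq_intros)
    qed
  qed (auto intro!: continuous_intros)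
  also have "sin (p * pi) = 0"
  proof -
    have "p = of_int (int j - int k)" by (simp add: p_q_def)
    then show ?thesis by (simp add: sin_zero_iff_int2 exI[of _ "int j - int k"])
  qed
  also have "sin (q * pi) = 0"
    using sin_npi[of "j + k"] by (simp add: p_q_def)
  finally show ?thesis using False by simp
qed

definition sine_coeff :: "nat \<Rightarrow> (real \<Rightarrow> real) \<Rightarrow> real" where
  "sine_coeff k y = (LINT x|Omega. sin (real k * x) * y x)"

definition sine_proj :: "nat \<Rightarrow> (real \<Rightarrow> real) \<Rightarrow> real \<Rightarrow> real" where
  "sine_proj N y x = 2 / pi * (\<Sum>k=1..N. sine_coeff k y * sin (real k * x))"

lemma sine_proj_cont [continuous_intros]: "continuous_on A (sine_proj N y)"
  unfolding sine_proj_def[abs_def] by (intro continuous_intros)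

lemma integrable_mult_cont_real:
  fixes f g :: "real \<Rightarrow> real"
  assumes "integrable (lebesgue_on {a<..<b}) f" "continuous_on {a..b} g"
  shows "integrable (lebesgue_on {a<..<b}) (\<lambda>x. g x * f x)"
proof -
  obtain K where "\<And>x. x \<in> {a..b} \<Longrightarrow> norm (g x) \<le> K" using cont_bounded_Icc[OF assms(2)] by blast
  then have "integrable (lebesgue_on {a<..<b}) (\<lambda>x. g x *\<^sub>R f x)"
    by (intro integrable_scaleR_bounded[where K=K] assms measurable_lebesgue_on_Ioo) auto
  then show ?thesis by simp
qed

lemma L2_Omega_integrable: "L2_on {0<..<pi} (y :: real \<Rightarrow> 'b::euclidean_space) \<Longrightarrow> integrable Omega y"
  by (rule L2_integrable[OF _ Ioo_lmeasurable])

lemma L2_on_cont: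
  fixes y :: "real \<Rightarrow> 'b::euclidean_space"
  assumes "continuous_on {a..b} y"
  shows "L2_on {a<..<b} y"
  unfolding L2_on_def
  by (intro conjI measurable_lebesgue_on_Ioo integrable_cont_Ioo continuous_intros assms)

text \<open>Pythagoras: by orthogonality the cross term \<open>\<integral> sine_proj N y * y\<close>
  and the integral of the squared projection have the same value.\<close>

lemma bessel_identity:
  assumes y: "L2_on {0<..<pi} y"
  shows "(LINT x|Omega. (y x - sine_proj N y x)\<^sup>2) = (LINT x|Omega. (y x)\<^sup>2) - 2 / pi * (\<Sum>k=1..N. (sine_coeff k y)\<^sup>2)"
    and "integrable Omega (\<lambda>x. (y x - sine_proj N y x)\<^sup>2)"
proof -
  have yi: "integrable Omega y" by (rule L2_Omega_integrable[OF y])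
  have y2: "integrable Omega (\<lambda>x. (y x)\<^sup>2)" using y by (simp add: L2_on_def)
  let ?s = "sine_proj N y"
  have ys: "integrable Omega (\<lambda>x. ?s x * y x)" by (rule integrable_mult_cont_real[OF yi sine_proj_cont])
  have s2: "integrable Omega (\<lambda>x. (?s x)\<^sup>2)" by (intro integrable_cont_Ioo continuous_intros)
  have eq: "(y x - ?s x)\<^sup>2 = (y x)\<^sup>2 - 2 * (?s x * y x) + (?s x)\<^sup>2" for x by (simp add: power2_diff)
  show "integrable Omega (\<lambda>x. (y x - sine_proj N y x)\<^sup>2)"
    unfolding eq by (intro Bochner_Integration.integrable_add Bochner_Integration.integrable_diff integrable_mult_right y2 ys s2)
  have sy: "integrable Omega (\<lambda>x. sin (real k * x) * y x)" for k
    by (intro integrable_mult_cont_real[OF yi] continuous_intros)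
  have I1: "(LINT x|Omega. ?s x * y x) = 2 / pi * (\<Sum>k=1..N. (sine_coeff k y)\<^sup>2)"
  proof -
    have "(LINT x|Omega. ?s x * y x) = (LINT x|Omega. 2 / pi * (\<Sum>k=1..N. sine_coeff k y * (sin (real k * x) * y x)))"
      by (simp add: sine_proj_def sum_distrib_right mult.assoc)
    also have "\<dots> = 2 / pi * (\<Sum>k=1..N. sine_coeff k y * (LINT x|Omega. sin (real k * x) * y x))"
      using sy by (simp add: Bochner_Integration.integral_sum)
    finally show ?thesis by (simp add: sine_coeff_def power2_eq_square)
  qed
  have I2: "(LINT x|Omega. (?s x)\<^sup>2) = 2 / pi * (\<Sum>k=1..N. (sine_coeff k y)\<^sup>2)"
  proof -
    have ss: "integrable Omega (\<lambda>x. sin (real j * x) * sin (real k * x))" for j k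
      by (intro integrable_cont_Ioo continuous_intros)
    have "(LINT x|Omega. (?s x)\<^sup>2) = (LINT x|Omega. (2 / pi)\<^sup>2 * (\<Sum>j=1..N. \<Sum>k=1..N. (sine_coeff j y * sine_coeff k y) * (sin (real j * x) * sin (real k * x))))"
      unfolding sine_proj_def power_mult_distrib power2_eq_square[of "sum _ _"] sum_product by (simp add: mult_ac)
    also have "\<dots> = (2 / pi)\<^sup>2 * (\<Sum>j=1..N. \<Sum>k=1..N. (sine_coeff j y * sine_coeff k y) * (LINT x|Omega. sin (real j * x) * sin (real k * x)))"
      using ss by (simp add: Bochner_Integration.integral_sum)
    also have "(\<Sum>j=1..N. \<Sum>k=1..N. (sine_coeff j y * sine_coeff k y) * (LINT x|Omega. sin (real j * x) * sin (real k * x)))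
       = (\<Sum>j=1..N. \<Sum>k=1..N. if j = k then (sine_coeff j y * sine_coeff k y) * (pi / 2) else 0)"
      by (intro sum.cong refl) (auto simp: sine_orthogonal)
    also have "\<dots> = (\<Sum>j=1..N. (sine_coeff j y)\<^sup>2 * (pi / 2))"
      by (intro sum.cong refl) (auto simp: power2_eq_square)
    also have "(2 / pi)\<^sup>2 * (\<Sum>j=1..N. (sine_coeff j y)\<^sup>2 * (pi / 2)) = 2 / pi * (\<Sum>k=1..N. (sine_coeff k y)\<^sup>2)"
    proof -
      have "(2 / pi)\<^sup>2 * (S * (pi / 2)) = 2 / pi * S" for S by (simp add: power2_eq_square)
      then show ?thesis by (simp only: sum_distrib_right[symmetric])
    qed
    finally show ?thesis .
  qed
  have "(LINT x|Omega. (y x - ?s x)\<^sup>2) = (LINT x|Omega. (y x)\<^sup>2) - 2 * (LINT x|Omega. ?s x * y x) + (LINT x|Omega. (?s x)\<^sup>2)"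
    unfolding eq using y2 ys s2 by (simp add: Bochner_Integration.integral_add Bochner_Integration.integral_diff)
  then show "(LINT x|Omega. (y x - sine_proj N y x)\<^sup>2) = (LINT x|Omega. (y x)\<^sup>2) - 2 / pi * (\<Sum>k=1..N. (sine_coeff k y)\<^sup>2)"
    unfolding I1 I2 by simp
qed

lemma bessel:
  assumes y: "L2_on {0<..<pi} y"
  shows "(\<Sum>k=1..N. (sine_coeff k y)\<^sup>2) \<le> pi / 2 * (LINT x|Omega. (y x)\<^sup>2)"
    and "(LINT x|Omega. (y x - sine_proj N y x)\<^sup>2) \<le> (LINT x|Omega. (y x)\<^sup>2)"
proof -
  have "0 \<le> (LINT x|Omega. (y x - sine_proj N y x)\<^sup>2)" by (rule integral_nonneg_AE) simp
  then show "(\<Sum>k=1..N. (sine_coeff k y)\<^sup>2) \<le> pi / 2 * (LINT x|Omega. (y x)\<^sup>2)"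
    unfolding bessel_identity[OF y] by (simp add: field_simps)
  show "(LINT x|Omega. (y x - sine_proj N y x)\<^sup>2) \<le> (LINT x|Omega. (y x)\<^sup>2)"
    unfolding bessel_identity[OF y] by (simp add: sum_nonneg)
qed

section \<open>Density of sine polynomials\<close>

inductive sine_poly :: "(real \<Rightarrow> real) \<Rightarrow> bool" where
  zero: "sine_poly (\<lambda>x. 0)"
| add_sin: "sine_poly s \<Longrightarrow> 1 \<le> k \<Longrightarrow> sine_poly (\<lambda>x. c * sin (real k * x) + s x)"

text \<open>The algebra generated by the cosine, given by the closure rules that the
  Stone-Weierstrass theorem asks for; the cosine alone separates the points of [0, pi].\<close>

inductive cos_poly :: "(real \<Rightarrow> real) \<Rightarrow> bool" where
  const: "cos_poly (\<lambda>x. c)"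
| cos: "cos_poly cos"
| add: "cos_poly f \<Longrightarrow> cos_poly g \<Longrightarrow> cos_poly (\<lambda>x. f x + g x)"
| mult: "cos_poly f \<Longrightarrow> cos_poly g \<Longrightarrow> cos_poly (\<lambda>x. f x * g x)"

lemma sine_poly_add: "sine_poly s \<Longrightarrow> sine_poly t \<Longrightarrow> sine_poly (\<lambda>x. s x + t x)"
  by (induction s rule: sine_poly.induct) (auto simp: add.assoc intro: sine_poly.intros)

lemma sine_poly_scale: "sine_poly s \<Longrightarrow> sine_poly (\<lambda>x. d * s x)"
proof (induction s rule: sine_poly.induct)
  case (add_sin s k c)
  from sine_poly.add_sin[OF add_sin.IH add_sin.hyps(2), of "d * c"]
  show ?case by (simp add: distrib_left mult.assoc)
qed (auto intro: sine_poly.intros)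

lemma sine_poly_sin: "1 \<le> k \<Longrightarrow> sine_poly (\<lambda>x. c * sin (real k * x))"
  using sine_poly.add_sin[OF sine_poly.zero, of k c] by simp

text \<open>\<open>sin (k x) cos x\<close> is half the sum of \<open>sin ((k + 1) x)\<close> and
  \<open>sin ((k - 1) x)\<close>; for \<open>k = 1\<close> the second term vanishes, so no index 0
  arises.\<close>

lemma sine_poly_cos: "sine_poly s \<Longrightarrow> sine_poly (\<lambda>x. cos x * s x)"
proof (induction s rule: sine_poly.induct)
  case (add_sin s k c)
  have "cos x * (c * sin (real k * x) + s x) =
      c / 2 * sin (real (k + 1) * x) + (c / 2 * sin (real (k - 1) * x) + cos x * s x)" for x
  proof -
    have "sin (real k * x) * cos x = (sin (real k * x + x) + sin (real k * x - x)) / 2" by (rule sin_times_cos)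
    moreover have "real k * x - x = real (k - 1) * x" "real k * x + x = real (k + 1) * x"
      using add_sin.hyps(2) by (simp_all add: of_nat_diff algebra_simps)
    ultimately have "sin (real k * x) * cos x = (sin (real (k + 1) * x) + sin (real (k - 1) * x)) / 2" by simp
    moreover have "cos x * (c * sin (real k * x) + s x) = c * (sin (real k * x) * cos x) + cos x * s x"
      by (simp add: algebra_simps)
    ultimately show ?thesis by (simp only: distrib_left add_divide_distrib)
  qed
  moreover have "sine_poly (\<lambda>x. c / 2 * sin (real (k + 1) * x) + (c / 2 * sin (real (k - 1) * x) + cos x * s x))"
  proof (cases "k = 1")
    case True
    then show ?thesis using sine_poly.add_sin[OF add_sin.IH, of "k + 1" "c / 2"] by simp
  next
    case False
    then have "1 \<le> k - 1" using add_sin.hyps(2) by simp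
    then show ?thesis by (intro sine_poly.add_sin add_sin.IH) auto
  qed
  ultimately show ?case by simp
qed (auto intro: sine_poly.intros)

lemma sine_poly_cos_poly: "cos_poly f \<Longrightarrow> sine_poly s \<Longrightarrow> sine_poly (\<lambda>x. f x * s x)"
proof (induction f arbitrary: s rule: cos_poly.induct)
  case (add f g)
  then show ?case by (simp add: distrib_right sine_poly_add)
next
  case (mult f g)
  then show ?case by (simp add: mult.assoc)
qed (auto intro: sine_poly_scale sine_poly_cos)

lemma sine_poly_cont: "sine_poly s \<Longrightarrow> continuous_on A s"
  by (induction s rule: sine_poly.induct) (auto intro!: continuous_intros)

lemma cos_poly_cont: "cos_poly s \<Longrightarrow> continuous_on A s"
  by (induction s rule: cos_poly.induct) (auto intro!: continuous_intros simp: continuous_on_cos)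

lemma sine_coeff_add:
  assumes "integrable Omega f" "integrable Omega g"
  shows "sine_coeff k (\<lambda>x. f x + g x) = sine_coeff k f + sine_coeff k g"
  unfolding sine_coeff_def distrib_left
  by (intro Bochner_Integration.integral_add integrable_mult_cont_real assms continuous_intros)

lemma sine_proj_add:
  assumes "integrable Omega f" "integrable Omega g"
  shows "sine_proj N (\<lambda>x. f x + g x) x = sine_proj N f x + sine_proj N g x"
  unfolding sine_proj_def sine_coeff_add[OF assms] by (simp add: distrib_right distrib_left sum.distrib)

lemma sine_proj_sin:
  assumes "1 \<le> j" "j \<le> N"
  shows "sine_proj N (\<lambda>x. c * sin (real j * x)) x = c * sin (real j * x)"
proof -
  have "sine_coeff k (\<lambda>x. c * sin (real j * x)) = (if k = j then c * (pi / 2) else 0)" if "1 \<le> k" for k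
    unfolding sine_coeff_def using sine_orthogonal[OF that assms(1)] by (simp add: mult.left_commute)
  then have "sine_proj N (\<lambda>x. c * sin (real j * x)) x = 2 / pi * (\<Sum>k=1..N. if k = j then c * (pi / 2) * sin (real k * x) else 0)"
    unfolding sine_proj_def by (intro arg_cong2[where f="(*)"] sum.cong refl) auto
  then show ?thesis using assms by simp
qed

lemma sine_poly_proj: "sine_poly s \<Longrightarrow> \<exists>m. \<forall>N\<ge>m. \<forall>x. sine_proj N s x = s x"
proof (induction s rule: sine_poly.induct)
  case zero
  then show ?case by (simp add: sine_proj_def sine_coeff_def)
next
  case (add_sin s k c)
  then obtain m where m: "\<And>N x. N \<ge> m \<Longrightarrow> sine_proj N s x = s x" by blast
  show ?case
  proof (intro exI[of _ "max m k"] allI impI)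
    fix N x assume "max m k \<le> N"
    then show "sine_proj N (\<lambda>x. c * sin (real k * x) + s x) x = c * sin (real k * x) + s x"
    proof (subst sine_proj_add)
      show "integrable Omega (\<lambda>x. c * sin (real k * x))" "integrable Omega s"
        by (intro integrable_cont_Ioo continuous_intros sine_poly_cont add_sin.hyps)+
      show "sine_proj N (\<lambda>x. c * sin (real k * x)) x + sine_proj N s x = c * sin (real k * x) + s x"
        using \<open>max m k \<le> N\<close> by (simp add: m sine_proj_sin[OF add_sin.hyps(2)])
    qed
  qed
qed

text \<open>Density of sine polynomials: \<open>f sin / (sin\<^sup>2 + \<delta>)\<close> is continuous, hence uniformly close to a
  polynomial in \<open>cos\<close> by the Stone-Weierstrass theorem, and multiplication by \<open>sin\<close> brings it back
  close to \<open>f\<close> in the mean.\<close>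

lemma sine_poly_dense:
  fixes f :: "real \<Rightarrow> real"
  assumes f: "continuous_on {0..pi} f" and e: "0 < e"
  obtains s where "sine_poly s" "(LINT x|Omega. (f x - s x)\<^sup>2) < e"
proof -
  define \<delta> where "\<delta> n = 1 / real (Suc n)" for n
  have \<delta>: "0 < \<delta> n" for n by (simp add: \<delta>_def)
  have \<delta>0: "\<delta> \<longlonglongrightarrow> 0" unfolding \<delta>_def by (rule LIMSEQ_inverse_real_of_nat[unfolded inverse_eq_divide])
  have den: "0 < (sin x)\<^sup>2 + \<delta> n" for x n using \<delta>[of n] by (simp add: add_nonneg_pos)
  \<comment> \<open>The remainder \<open>f - h sin\<close> for the \<open>h\<close> introduced
    below. It tends to 0 wherever the sine is positive and is dominated by
    \<open>\<bar>f\<bar>\<close>, so it tends to 0 in the mean.\<close>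
  define r where "r n x = f x * (\<delta> n / ((sin x)\<^sup>2 + \<delta> n))" for n x
  have "(\<lambda>n. LINT x|Omega. (r n x)\<^sup>2) \<longlonglongrightarrow> (LINT x|Omega. 0)"
  proof (rule integral_dominated_convergence[where w="\<lambda>x. (f x)\<^sup>2"])
    show "integrable Omega (\<lambda>x. (f x)\<^sup>2)" by (intro integrable_cont_Ioo continuous_intros f)
    show "(\<lambda>x. (r n x)\<^sup>2) \<in> borel_measurable Omega" for n
      unfolding r_def using den[of _ n]
      by (intro measurable_lebesgue_on_Ioo continuous_intros f) (metis less_irrefl)
    show "AE x in Omega. (\<lambda>n. (r n x)\<^sup>2) \<longlonglongrightarrow> 0"
    proof (rule AE_I2)
      fix x assume "x \<in> space Omega"
      then have "sin x > 0" by (intro sin_gt_zero) auto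
      then have "(\<lambda>n. (f x * (\<delta> n / ((sin x)\<^sup>2 + \<delta> n)))\<^sup>2) \<longlonglongrightarrow> (f x * (0 / ((sin x)\<^sup>2 + 0)))\<^sup>2"
        by (intro tendsto_intros \<delta>0) auto
      then show "(\<lambda>n. (r n x)\<^sup>2) \<longlonglongrightarrow> 0" by (simp add: r_def)
    qed
    show "AE x in Omega. norm ((r n x)\<^sup>2) \<le> (f x)\<^sup>2" for n
    proof (rule AE_I2)
      fix x
      have "0 \<le> \<delta> n / ((sin x)\<^sup>2 + \<delta> n)" "\<delta> n / ((sin x)\<^sup>2 + \<delta> n) \<le> 1"
        using \<delta>[of n] den[of x n] by auto
      then have "(\<delta> n / ((sin x)\<^sup>2 + \<delta> n))\<^sup>2 \<le> 1" by (simp add: power_le_one)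
      then have "(f x)\<^sup>2 * (\<delta> n / ((sin x)\<^sup>2 + \<delta> n))\<^sup>2 \<le> (f x)\<^sup>2 * 1" by (intro mult_left_mono) auto
      then show "norm ((r n x)\<^sup>2) \<le> (f x)\<^sup>2"
        unfolding real_norm_def abs_power2 r_def power_mult_distrib by simp
    qed
  qed simp
  then have "(\<lambda>n. LINT x|Omega. (r n x)\<^sup>2) \<longlonglongrightarrow> 0" by simp
  then have "\<forall>\<^sub>F n in sequentially. (LINT x|Omega. (r n x)\<^sup>2) < e / 4"
    by (rule order_tendstoD(2)) (use e in simp)
  then obtain n where n: "(LINT x|Omega. (r n x)\<^sup>2) < e / 4" by (auto simp: eventually_sequentially)
  define h where "h x = f x * sin x / ((sin x)\<^sup>2 + \<delta> n)" for x
  have hc: "continuous_on {0..pi} h"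
    unfolding h_def using den[of _ n] by (intro continuous_intros f) (metis less_irrefl)
  \<comment> \<open>Chosen so that \<open>2 * \<eta>^2 * pi = e / 4\<close>; with twice the mean
    remainder, below \<open>e / 2\<close>, the total stays under \<open>e\<close>.\<close>
  define \<eta> where "\<eta> = sqrt (e / (8 * pi))"
  have \<eta>: "0 < \<eta>" "\<eta>\<^sup>2 = e / (8 * pi)" using e by (auto simp: \<eta>_def)
  have "\<exists>q. cos_poly q \<and> (\<forall>x\<in>{0..pi}. \<bar>h x - q x\<bar> < \<eta>)"
  proof (rule Stone_Weierstrass_HOL[OF _ _ _ _ _ _ hc \<eta>(1)])
    show "\<exists>f. cos_poly f \<and> f x \<noteq> f y" if "x \<in> {0..pi} \<and> y \<in> {0..pi} \<and> x \<noteq> y" for x y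
      using that cos_inj_pi[of x y] by (intro exI[of _ cos]) (auto intro: cos_poly.cos)
  qed (auto intro: cos_poly.intros cos_poly_cont)
  then obtain q where q: "cos_poly q" "\<And>x. x \<in> {0..pi} \<Longrightarrow> \<bar>h x - q x\<bar> < \<eta>" by blast
  define s where "s x = q x * sin x" for x
  have s: "sine_poly s" using sine_poly_cos_poly[OF q(1) sine_poly_sin[of 1 1]] by (simp add: s_def[abs_def])
  have "(LINT x|Omega. (f x - s x)\<^sup>2) \<le> (LINT x|Omega. 2 * (r n x)\<^sup>2 + 2 * \<eta>\<^sup>2)"
  proof (rule integral_mono)
    show "integrable Omega (\<lambda>x. (f x - s x)\<^sup>2)"
      by (intro integrable_cont_Ioo continuous_intros f sine_poly_cont s)
    show "integrable Omega (\<lambda>x. 2 * (r n x)\<^sup>2 + 2 * \<eta>\<^sup>2)"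
      unfolding r_def using den[of _ n] by (intro integrable_cont_Ioo continuous_intros f) (metis less_irrefl)
    fix x assume "x \<in> space Omega"
    then have x: "x \<in> {0..pi}" by simp
    have "f x - h x * sin x = r n x"
      using den[of x n] by (simp add: h_def r_def power2_eq_square field_simps)
    then have "f x - s x = r n x + (h x - q x) * sin x" by (simp add: s_def algebra_simps)
    moreover have "(r n x + (h x - q x) * sin x)\<^sup>2 \<le> 2 * (r n x)\<^sup>2 + 2 * ((h x - q x) * sin x)\<^sup>2"
      using sum_squares_bound[of "r n x" "(h x - q x) * sin x"] by (simp add: power2_sum)
    moreover have "((h x - q x) * sin x)\<^sup>2 \<le> \<eta>\<^sup>2"
    proof -
      have "\<bar>h x - q x\<bar> * \<bar>sin x\<bar> \<le> \<eta> * 1" using q(2)[OF x] \<eta> by (intro mult_mono) auto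
      then have "\<bar>(h x - q x) * sin x\<bar> \<le> \<bar>\<eta>\<bar>" using \<eta> by (simp add: abs_mult)
      then show ?thesis by (simp only: abs_le_square_iff)
    qed
    ultimately show "(f x - s x)\<^sup>2 \<le> 2 * (r n x)\<^sup>2 + 2 * \<eta>\<^sup>2" by simp
  qed
  also have "\<dots> = 2 * (LINT x|Omega. (r n x)\<^sup>2) + 2 * \<eta>\<^sup>2 * pi"
  proof -
    have "integrable Omega (\<lambda>x. (r n x)\<^sup>2)"
      unfolding r_def using den[of _ n] by (intro integrable_cont_Ioo continuous_intros f) (metis less_irrefl)
    moreover have "integrable Omega (\<lambda>x. 2 * \<eta>\<^sup>2)" by (intro integrable_cont_Ioo continuous_intros)
    ultimately show ?thesis by (simp add: Bochner_Integration.integral_add measure_restrict_space)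
  qed
  also have "\<dots> < e" using n e by (simp add: \<eta>(2))
  finally show ?thesis using that s by blast
qed

text \<open>For a sine polynomial \<open>s\<close> and large \<open>N\<close> the projection fixes
  \<open>s\<close>, so \<open>f - P f\<close> equals \<open>(f - s) - P (f - s)\<close>, and
  subtracting the projection does not increase the L2 norm by \<open>bessel\<close>.\<close>

lemma sine_proj_tendsto:
  fixes f :: "real \<Rightarrow> real"
  assumes f: "continuous_on {0..pi} f"
  shows "(\<lambda>N. LINT x|Omega. (f x - sine_proj N f x)\<^sup>2) \<longlonglongrightarrow> 0"
proof (rule LIMSEQ_I)
  fix e :: real assume "0 < e"
  then obtain s where s: "sine_poly s" "(LINT x|Omega. (f x - s x)\<^sup>2) < e" using sine_poly_dense[OF f] by blast
  obtain m where m: "\<And>N x. N \<ge> m \<Longrightarrow> sine_proj N s x = s x" using sine_poly_proj[OF s(1)] by blast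
  have c: "continuous_on {0..pi} (\<lambda>x. f x - s x)" by (intro continuous_intros f sine_poly_cont s)
  have "norm ((LINT x|Omega. (f x - sine_proj N f x)\<^sup>2) - 0) < e" if N: "N \<ge> m" for N
  proof -
    have "sine_proj N f x = sine_proj N (\<lambda>x. f x - s x) x + sine_proj N s x" for x
      using sine_proj_add[of "\<lambda>x. f x - s x" s N x]
      by (simp add: integrable_cont_Ioo[OF c] integrable_cont_Ioo[OF sine_poly_cont[OF s(1)]])
    then have eq: "f x - sine_proj N f x = (f x - s x) - sine_proj N (\<lambda>x. f x - s x) x" for x using m[OF N] by simp
    have "(LINT x|Omega. (f x - sine_proj N f x)\<^sup>2) \<le> (LINT x|Omega. (f x - s x)\<^sup>2)"
      using bessel(2)[OF L2_on_cont[OF c], of N] by (simp only: eq)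
    moreover have "0 \<le> (LINT x|Omega. (f x - sine_proj N f x)\<^sup>2)" by (rule integral_nonneg_AE) simp
    ultimately show ?thesis using s(2) by simp
  qed
  then show "\<exists>no. \<forall>n\<ge>no. norm ((LINT x|Omega. (f x - sine_proj n f x)\<^sup>2) - 0) < e" by blast
qed

section \<open>Sine coefficients of complex functions and Parseval's formula\<close>

text \<open>Plays the role of the Cauchy-Schwarz inequality:
  \<open>a b \<le> a^2 / \<eta> + \<eta> b^2\<close> with \<open>\<eta>\<close> small against the
  norm of \<open>y\<close> first, then \<open>n\<close> large.\<close>

lemma L2_null_pairing:
  fixes y :: "'a \<Rightarrow> complex" and e :: "nat \<Rightarrow> 'a \<Rightarrow> real"
  assumes y: "y \<in> borel_measurable M" "integrable M (\<lambda>x. (norm (y x))\<^sup>2)"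
    and e: "\<And>n. e n \<in> borel_measurable M" "\<And>n. integrable M (\<lambda>x. (e n x)\<^sup>2)" "(\<lambda>n. LINT x|M. (e n x)\<^sup>2) \<longlonglongrightarrow> 0"
  shows "(\<lambda>n. LINT x|M. of_real (e n x) * y x) \<longlonglongrightarrow> 0"
proof (rule LIMSEQ_I)
  fix r :: real assume r: "0 < r"
  define Y where "Y = (LINT x|M. (norm (y x))\<^sup>2)"
  have Y: "0 \<le> Y" unfolding Y_def by (rule integral_nonneg_AE) simp
  define \<eta> where "\<eta> = r / (2 * (Y + 1))"
  have \<eta>: "0 < \<eta>" using r Y by (simp add: \<eta>_def)
  have "\<forall>\<^sub>F n in sequentially. (LINT x|M. (e n x)\<^sup>2) < r * \<eta> / 2"
    using e(3) by (rule order_tendstoD(2)) (use r \<eta> in simp)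
  then obtain n0 where n0: "\<And>n. n \<ge> n0 \<Longrightarrow> (LINT x|M. (e n x)\<^sup>2) < r * \<eta> / 2"
    unfolding eventually_sequentially by blast
  show "\<exists>no. \<forall>n\<ge>no. norm ((LINT x|M. of_real (e n x) * y x) - 0) < r"
  proof (intro exI allI impI)
    fix n assume n: "n \<ge> n0"
    have i: "integrable M (\<lambda>x. (e n x)\<^sup>2 / \<eta> + \<eta> * (norm (y x))\<^sup>2)"
      by (intro Bochner_Integration.integrable_add integrable_divide integrable_mult_right e y)
    have le: "norm (of_real (e n x) * y x) \<le> (e n x)\<^sup>2 / \<eta> + \<eta> * (norm (y x))\<^sup>2" for x
    proof -
      let ?a = "\<bar>e n x\<bar>" and ?b = "norm (y x)"
      have "0 \<le> (?a - \<eta> * ?b)\<^sup>2" by simp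
      then have "2 * \<eta> * (?a * ?b) \<le> ?a\<^sup>2 + \<eta> * (\<eta> * ?b\<^sup>2)" by (simp add: power2_eq_square algebra_simps)
      moreover have "0 \<le> \<eta> * (?a * ?b)" using \<eta> by simp
      ultimately have "\<eta> * (?a * ?b) \<le> (e n x)\<^sup>2 + \<eta> * (\<eta> * ?b\<^sup>2)" by (simp only: power2_abs)
      then have "?a * ?b \<le> ((e n x)\<^sup>2 + \<eta> * (\<eta> * ?b\<^sup>2)) / \<eta>" using \<eta> by (simp add: pos_le_divide_eq mult.commute)
      then show ?thesis using \<eta> by (simp add: norm_mult add_divide_distrib)
    qed
    have "norm (LINT x|M. of_real (e n x) * y x) \<le> (LINT x|M. norm (of_real (e n x) * y x))"
      by (rule integral_norm_bound)
    also have "\<dots> \<le> (LINT x|M. (e n x)\<^sup>2 / \<eta> + \<eta> * (norm (y x))\<^sup>2)"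
    proof (rule integral_mono[OF _ i le])
      show "integrable M (\<lambda>x. norm (of_real (e n x) * y x))"
      proof (rule Bochner_Integration.integrable_bound[OF i])
        show "(\<lambda>x. norm (of_real (e n x) * y x)) \<in> borel_measurable M" using y(1) e(1)[of n] by measurable
        show "AE x in M. norm (norm (of_real (e n x) * y x)) \<le> norm ((e n x)\<^sup>2 / \<eta> + \<eta> * (norm (y x))\<^sup>2)"
          using order_trans[OF le abs_ge_self] by (intro AE_I2) simp
      qed
    qed
    also have "\<dots> = (LINT x|M. (e n x)\<^sup>2) / \<eta> + \<eta> * Y"
      using e(2)[of n] y(2) by (simp add: Y_def Bochner_Integration.integral_add)
    also have "\<dots> < (r * \<eta> / 2) / \<eta> + \<eta> * (Y + 1)"
      using n0[OF n] \<eta> by (intro add_strict_mono divide_strict_right_mono mult_strict_left_mono) auto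
    also have "\<dots> = r"
    proof -
      have "r / (2 * Z) * Z = r / 2" if "Z > 0" for Z using that by simp
      from this[of "Y + 1"] have "\<eta> * (Y + 1) = r / 2" using Y by (simp only: \<eta>_def)
      then show ?thesis using \<eta> by simp
    qed
    finally show "norm ((LINT x|M. of_real (e n x) * y x) - 0) < r" by simp
  qed
qed

definition csine :: "nat \<Rightarrow> (real \<Rightarrow> complex) \<Rightarrow> complex" where
  "csine k y = (LINT x|Omega. of_real (sin (real k * x)) * y x)"

lemma sin_mult_integrable:
  fixes y :: "real \<Rightarrow> complex"
  assumes "integrable Omega y"
  shows "integrable Omega (\<lambda>x. of_real (sin (real k * x)) * y x)"
  by (intro integrable_mult_cont_Ioo assms continuous_intros)

lemma csine_Re_Im:
  assumes y: "integrable Omega y"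
  shows "csine k y = Complex (sine_coeff k (\<lambda>x. Re (y x))) (sine_coeff k (\<lambda>x. Im (y x)))"
proof (rule complex_eqI)
  note i = sin_mult_integrable[OF y, of k]
  show "Re (csine k y) = Re (Complex (sine_coeff k (\<lambda>x. Re (y x))) (sine_coeff k (\<lambda>x. Im (y x))))"
    using integral_Re[OF i] by (simp add: csine_def sine_coeff_def)
  show "Im (csine k y) = Im (Complex (sine_coeff k (\<lambda>x. Re (y x))) (sine_coeff k (\<lambda>x. Im (y x))))"
    using integral_Im[OF i] by (simp add: csine_def sine_coeff_def)
qed

lemma L2_Re_Im:
  fixes y :: "'a::euclidean_space \<Rightarrow> complex"
  assumes y: "L2_on S y"
  shows "L2_on S (\<lambda>x. Re (y x))" "L2_on S (\<lambda>x. Im (y x))"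
proof -
  have m: "y \<in> borel_measurable (lebesgue_on S)" and i: "integrable (lebesgue_on S) (\<lambda>x. (norm (y x))\<^sup>2)"
    using y by (auto simp: L2_on_def)
  have mR: "(\<lambda>x. Re (y x)) \<in> borel_measurable (lebesgue_on S)" "(\<lambda>x. Im (y x)) \<in> borel_measurable (lebesgue_on S)"
    using m by measurable
  show "L2_on S (\<lambda>x. Re (y x))" unfolding L2_on_def
  proof (intro conjI mR Bochner_Integration.integrable_bound[OF i])
    show "AE x in lebesgue_on S. norm ((norm (Re (y x)))\<^sup>2) \<le> norm ((norm (y x))\<^sup>2)"
      by (intro AE_I2) (simp add: cmod_power2)
  qed (use mR in measurable)
  show "L2_on S (\<lambda>x. Im (y x))" unfolding L2_on_def
  proof (intro conjI mR Bochner_Integration.integrable_bound[OF i])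
    show "AE x in lebesgue_on S. norm ((norm (Im (y x)))\<^sup>2) \<le> norm ((norm (y x))\<^sup>2)"
      by (intro AE_I2) (simp add: cmod_power2)
  qed (use mR in measurable)
qed

lemma csine_square_summable:
  assumes y: "L2_on {0<..<pi} y"
  shows "summable (\<lambda>k. (norm (csine k y))\<^sup>2)"
proof (rule summableI_nonneg_bounded)
  let ?R = "\<lambda>x. Re (y x)" and ?I = "\<lambda>x. Im (y x)"
  define B where "B = pi / 2 * (LINT x|Omega. (?R x)\<^sup>2) + pi / 2 * (LINT x|Omega. (?I x)\<^sup>2)"
  show "(\<Sum>k<n. (norm (csine k y))\<^sup>2) \<le> B" for n
  proof -
    have c: "(norm (csine k y))\<^sup>2 = (sine_coeff k ?R)\<^sup>2 + (sine_coeff k ?I)\<^sup>2" for k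
      by (simp add: csine_Re_Im[OF L2_Omega_integrable[OF y]] cmod_power2)
    have c0: "csine 0 y = 0" by (simp add: csine_def)
    have "(\<Sum>k<n. (norm (csine k y))\<^sup>2) \<le> (\<Sum>k\<in>insert 0 {1..n}. (norm (csine k y))\<^sup>2)"
      by (rule sum_mono2) auto
    also have "\<dots> = (\<Sum>k=1..n. (sine_coeff k ?R)\<^sup>2) + (\<Sum>k=1..n. (sine_coeff k ?I)\<^sup>2)"
      by (simp add: c0 flip: sum.distrib) (simp add: c)
    also have "\<dots> \<le> B"
      unfolding B_def by (intro add_mono bessel(1) L2_Re_Im y)
    finally show ?thesis .
  qed
qed simp

text \<open>Parseval's formula with the projection error placed on the continuous function
  \<open>f\<close>, whose sine sums are known to converge in the mean; \<open>y\<close> is merely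
  square integrable.\<close>

lemma sine_pairing_real:
  fixes y :: "real \<Rightarrow> complex" and f :: "real \<Rightarrow> real"
  assumes y: "L2_on {0<..<pi} y" and f: "continuous_on {0..pi} f"
  shows "(\<lambda>N. 2 / pi * (\<Sum>k=1..N. of_real (sine_coeff k f) * csine k y)) \<longlonglongrightarrow> (LINT x|Omega. of_real (f x) * y x)"
proof -
  have yi: "integrable Omega y" by (rule L2_Omega_integrable[OF y])
  have "(\<lambda>N. LINT x|Omega. of_real (f x - sine_proj N f x) * y x) \<longlonglongrightarrow> 0"
  proof (rule L2_null_pairing)
    show "y \<in> borel_measurable Omega" "integrable Omega (\<lambda>x. (norm (y x))\<^sup>2)" using y by (auto simp: L2_on_def)
  qed (intro sine_proj_tendsto f measurable_lebesgue_on_Ioo integrable_cont_Ioo continuous_intros)+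
  then have "(\<lambda>N. (LINT x|Omega. of_real (f x) * y x) - (LINT x|Omega. of_real (f x - sine_proj N f x) * y x)) \<longlonglongrightarrow> (LINT x|Omega. of_real (f x) * y x) - 0"
    by (intro tendsto_diff tendsto_const)
  moreover have "(LINT x|Omega. of_real (f x) * y x) - (LINT x|Omega. of_real (f x - sine_proj N f x) * y x)
      = 2 / pi * (\<Sum>k=1..N. of_real (sine_coeff k f) * csine k y)" for N
  proof -
    have i: "integrable Omega (\<lambda>x. of_real (f x) * y x)" "integrable Omega (\<lambda>x. of_real (f x - sine_proj N f x) * y x)"
      by (intro integrable_mult_cont_Ioo yi continuous_intros f)+
    have "(LINT x|Omega. of_real (f x) * y x) - (LINT x|Omega. of_real (f x - sine_proj N f x) * y x)
       = (LINT x|Omega. of_real (sine_proj N f x) * y x)"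
      using i by (subst Bochner_Integration.integral_diff[symmetric]) (auto simp: algebra_simps)
    also have "\<dots> = (LINT x|Omega. 2 / pi * (\<Sum>k=1..N. of_real (sine_coeff k f) * (of_real (sin (real k * x)) * y x)))"
      by (simp add: sine_proj_def sum_distrib_right mult.assoc)
    also have "\<dots> = 2 / pi * (\<Sum>k=1..N. of_real (sine_coeff k f) * csine k y)"
      using sin_mult_integrable[OF yi] by (simp add: Bochner_Integration.integral_sum csine_def)
    finally show ?thesis .
  qed
  ultimately show ?thesis by simp
qed

lemma sine_pairing:
  fixes y f :: "real \<Rightarrow> complex"
  assumes y: "L2_on {0<..<pi} y" and f: "continuous_on {0..pi} f"
  shows "(\<lambda>N. 2 / pi * (\<Sum>k=1..N. csine k f * csine k y)) \<longlonglongrightarrow> (LINT x|Omega. f x * y x)"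
proof -
  have yi: "integrable Omega y" by (rule L2_Omega_integrable[OF y])
  have fR: "continuous_on {0..pi} (\<lambda>x. Re (f x))" "continuous_on {0..pi} (\<lambda>x. Im (f x))"
    by (intro continuous_intros f)+
  have fi: "integrable Omega f" by (rule integrable_cont_Ioo[OF f])
  have "(\<lambda>N. 2 / pi * (\<Sum>k=1..N. of_real (sine_coeff k (\<lambda>x. Re (f x))) * csine k y)
      + \<i> * (2 / pi * (\<Sum>k=1..N. of_real (sine_coeff k (\<lambda>x. Im (f x))) * csine k y)))
      \<longlonglongrightarrow> (LINT x|Omega. of_real (Re (f x)) * y x) + \<i> * (LINT x|Omega. of_real (Im (f x)) * y x)"
    by (intro tendsto_intros sine_pairing_real y fR)
  moreover have "(LINT x|Omega. of_real (Re (f x)) * y x) + \<i> * (LINT x|Omega. of_real (Im (f x)) * y x) = (LINT x|Omega. f x * y x)"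
  proof -
    have i: "integrable Omega (\<lambda>x. of_real (Re (f x)) * y x)" "integrable Omega (\<lambda>x. of_real (Im (f x)) * y x)"
      by (intro integrable_mult_cont_Ioo yi continuous_on_of_real fR)+
    have "(LINT x|Omega. of_real (Re (f x)) * y x) + \<i> * (LINT x|Omega. of_real (Im (f x)) * y x)
       = (LINT x|Omega. of_real (Re (f x)) * y x + \<i> * (of_real (Im (f x)) * y x))"
      using i by (subst Bochner_Integration.integral_add) auto
    also have "\<dots> = (LINT x|Omega. f x * y x)"
      by (rule Bochner_Integration.integral_cong[OF refl]) (simp add: complex_eq_iff algebra_simps)
    finally show ?thesis .
  qed
  moreover have "2 / pi * (\<Sum>k=1..N. of_real (sine_coeff k (\<lambda>x. Re (f x))) * csine k y)
      + \<i> * (2 / pi * (\<Sum>k=1..N. of_real (sine_coeff k (\<lambda>x. Im (f x))) * csine k y))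
     = 2 / pi * (\<Sum>k=1..N. csine k f * csine k y)" for N
    unfolding csine_Re_Im[OF fi] Complex_eq
    by (simp add: distrib_right sum.distrib distrib_left sum_distrib_left mult_ac)
  ultimately show ?thesis by simp
qed

text \<open>\<open>1 - x / pi\<close> has boundary values 1 and 0, so \<open>u t\<close> times it
  carries the boundary control; its sine coefficients are the origin of \<open>gain\<close>.\<close>

lemma csine_lift:
  assumes "1 \<le> k"
  shows "sine_coeff k (\<lambda>x. 1 - x / pi) = 1 / real k"
proof -
  have "sine_coeff k (\<lambda>x. 1 - x / pi) = (- (1 - pi / pi) * cos (real k * pi) / real k - sin (real k * pi) / (pi * (real k)\<^sup>2))
    - (- (1 - 0 / pi) * cos (real k * 0) / real k - sin (real k * 0) / (pi * (real k)\<^sup>2))"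
    unfolding sine_coeff_def
  proof (rule LINT_Ioo_FTC)
    show "((\<lambda>x. - (1 - x / pi) * cos (real k * x) / real k - sin (real k * x) / (pi * (real k)\<^sup>2))
        has_real_derivative sin (real k * x) * (1 - x / pi)) (at x)" for x
      using assms by (auto intro!: derivative_eq_intros simp: field_simps power2_eq_square)
  qed (auto intro!: continuous_intros)
  then show ?thesis using assms by simp
qed

section \<open>The controlled solution\<close>

lemma moment_deriv:
  assumes u: "C1_supported a b u u'" and e: "\<And>s. (e has_vector_derivative e' s) (at s)" "continuous_on UNIV e'"
  shows "moment e u' = - moment e' u"
proof -
  have ec: "continuous_on UNIV e"
    using e(1) by (meson continuous_at_imp_continuous_on has_vector_derivative_continuous)
  have supp: "s \<notin> {a..b} \<Longrightarrow> u s = 0" "s \<notin> {a..b} \<Longrightarrow> u' s = 0" for s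
    using u by (auto simp: C1_supported_def)
  let ?f = "\<lambda>s. e' s * u s + e s * u' s"
  have fc: "continuous_on UNIV ?f" by (intro continuous_intros e ec C1_supported_cont[OF u])
  have i1: "integrable lborel (\<lambda>s. e' s * u s)" "integrable lborel (\<lambda>s. e s * u' s)"
    using supp by (auto intro!: integrable_cont_supported[of _ a b] continuous_intros e ec C1_supported_cont[OF u])
  \<comment> \<open>Enlarging by 1 makes \<open>u\<close> vanish at both ends; \<open>min\<close>
    and \<open>max\<close> cover the case \<open>b < a\<close>.\<close>
  define c d where "c = min a b - 1" "d = max a b + 1"
  have cd: "c \<le> d" by (simp add: c_d_def)
  have "has_bochner_integral lborel (\<lambda>s. indicator {c..d} s *\<^sub>R ?f s) (e d * u d - e c * u c)"
  proof (rule has_bochner_integral_FTC_Icc[OF cd])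
    show "((\<lambda>s. e s * u s) has_vector_derivative ?f s) (at s within {c..d})" for s
    proof -
      have "((\<lambda>s. e s * u s) has_vector_derivative (e s * u' s + e' s * u s)) (at s)"
        by (rule has_vector_derivative_mult) (use e u in \<open>auto simp: C1_supported_def\<close>)
      then show ?thesis by (simp add: add.commute has_vector_derivative_at_within)
    qed
  qed (rule continuous_on_subset[OF fc], simp)
  moreover have "(\<lambda>s. indicator {c..d} s *\<^sub>R ?f s) = ?f"
  proof
    fix s show "indicator {c..d} s *\<^sub>R ?f s = ?f s"
      using supp[of s] by (cases "s \<in> {a..b}") (auto simp: indicator_def c_d_def)
  qed
  moreover have "u d = 0" "u c = 0" by (auto intro!: supp simp: c_d_def)
  ultimately have "(LINT s|lborel. ?f s) = 0" by (simp add: has_bochner_integral_iff)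
  then show ?thesis using i1 by (simp add: moment_def Bochner_Integration.integral_add eq_neg_iff_add_eq_0 add.commute)
qed

lemma exp_real_deriv: fixes z :: complex shows "((\<lambda>t. exp (z * of_real t)) has_vector_derivative z * exp (z * of_real t)) (at t within A)"
proof -
  have "((\<lambda>w. exp (z * w)) has_field_derivative z * exp (z * of_real t)) (at (of_real t))"
    by (auto intro!: derivative_eq_intros)
  then show ?thesis by (rule has_vector_derivative_real_field)
qed

text \<open>With \<open>x = k^2 t\<close> the bound is
  \<open>k powr (- 3 / 4) * t powr (- 3 / 8)\<close>. The exponent 3/8 lies between 1/4 and 1/2,
  which makes the first factor square summable in \<open>k\<close> and the second square integrable
  near \<open>t = 0\<close>.\<close>

lemma exp_le_powr: "0 < x \<Longrightarrow> exp (- x) \<le> x powr (- 3 / 8)" for x :: real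
proof -
  assume x: "0 < x"
  have "x powr (3 / 8) \<le> exp x"
  proof (cases "x \<le> 1")
    case True
    then have "x powr (3 / 8) \<le> 1" using x by (simp add: powr_le1)
    then show ?thesis using x by (meson one_le_exp_iff less_imp_le order_trans)
  next
    case False
    then have "x powr (3 / 8) \<le> x powr 1" by (intro powr_mono) auto
    then have "x powr (3 / 8) \<le> x" using x by simp
    then show ?thesis using exp_ge_add_one_self[of x] by linarith
  qed
  then have "1 / exp x \<le> 1 / x powr (3 / 8)" using x by (intro divide_left_mono) auto
  then show ?thesis by (simp add: exp_minus powr_minus inverse_eq_divide)
qed

text \<open>Convolution with a decaying exponential gains \<open>1 / q\<close>; with
  \<open>q = k^2\<close> this makes the forced part of the modes summable.\<close>

lemma integral_exp_decay_bound:
  fixes f :: "real \<Rightarrow> complex"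
  assumes f: "continuous_on {0..t} f" "\<And>s. s \<in> {0..t} \<Longrightarrow> norm (f s) \<le> M * exp (- (q * (t - s)))"
    and "0 \<le> t" "0 < q" "0 \<le> M"
  shows "norm (integral {0..t} f) \<le> M / q"
proof -
  have "((\<lambda>s. M * exp (- (q * (t - s)))) has_integral (M * exp (- (q * (t - t))) / q - M * exp (- (q * (t - 0))) / q)) {0..t}"
  proof (rule fundamental_theorem_of_calculus[OF assms(3)])
    fix s
    have "((\<lambda>s. M * exp (- (q * (t - s))) / q) has_real_derivative M * exp (- (q * (t - s)))) (at s within {0..t})"
      using assms(4) by (auto intro!: derivative_eq_intros)
    then show "((\<lambda>s. M * exp (- (q * (t - s))) / q) has_vector_derivative M * exp (- (q * (t - s)))) (at s within {0..t})"
      by (simp add: has_real_derivative_iff_has_vector_derivative)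
  qed
  then have i: "(\<lambda>s. M * exp (- (q * (t - s)))) integrable_on {0..t}"
    and I: "integral {0..t} (\<lambda>s. M * exp (- (q * (t - s)))) = M / q - M * exp (- (q * t)) / q"
    by (auto simp: has_integral_integrable_integral)
  have "norm (integral {0..t} f) \<le> integral {0..t} (\<lambda>s. M * exp (- (q * (t - s))))"
    by (rule integral_norm_bound_integral[OF integrable_continuous_interval[OF f(1)] i f(2)])
  also have "\<dots> \<le> M / q" unfolding I using assms by simp
  finally show ?thesis .
qed

section \<open>The modes by variation of constants\<close>

locale controlled_modes = decoupled_spectrum +
  fixes T0 :: real and u u' :: "real \<Rightarrow> complex" and y1 y2 :: "real \<Rightarrow> complex"
  assumes u: "C1_supported 0 T0 u u'" and y: "L2_on {0<..<pi} y1" "L2_on {0<..<pi} y2"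
begin

definition coeff1 :: "nat \<Rightarrow> complex" where "coeff1 k = 2 / pi * csine k y1"
definition coeff2 :: "nat \<Rightarrow> complex" where "coeff2 k = 2 / pi * csine k y2"
definition gain :: "nat \<Rightarrow> complex" where "gain k = of_real (2 / (pi * real k))"

text \<open>The sources of the modes along \<open>B\<close> and \<open>C\<close> after subtracting \<open>u(t) (1 - x / \<pi>) B\<close>, which carries the
  boundary value, are \<open>gain k * src\<close> and \<open>gain k * u\<close>, since \<open>A B = \<mu>1 B + C\<close>.\<close>

definition src :: "real \<Rightarrow> complex" where "src s = \<mu>1 * u s - u' s"

definition kern :: "nat \<Rightarrow> real \<Rightarrow> complex" where
  "kern k s = exp (of_nat k ^ 2 * of_real s) * (ddexp \<mu>1 \<mu>2 (- s) * src s + exp (- (\<mu>2 * of_real s)) * u s)"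

definition J1 :: "nat \<Rightarrow> real \<Rightarrow> complex" where
  "J1 k t = integral {0..t} (\<lambda>s. exp ((of_nat k ^ 2 - \<mu>1) * of_real s) * src s)"

definition J2 :: "nat \<Rightarrow> real \<Rightarrow> complex" where
  "J2 k t = integral {0..t} (kern k)"

definition z1 :: "nat \<Rightarrow> real \<Rightarrow> complex" where
  "z1 k t = exp ((\<mu>1 - of_nat k ^ 2) * of_real t) * (coeff1 k + gain k * J1 k t)"

text \<open>Variation of constants for the second, coupled equation: the coupling to the first mode
  enters through \<open>ddexp \<mu>1 \<mu>2 t\<close>, the convolution of
  \<open>exp (\<mu>1 t)\<close> and \<open>exp (\<mu>2 t)\<close>, and \<open>J2\<close> collects
  what remains of both sources.\<close>

definition z2 :: "nat \<Rightarrow> real \<Rightarrow> complex" where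
  "z2 k t = exp (- (of_nat k ^ 2) * of_real t) *
     (exp (\<mu>2 * of_real t) * (coeff2 k + gain k * J2 k t) + ddexp \<mu>1 \<mu>2 t * (coeff1 k + gain k * J1 k t))"

lemma u_cont: "continuous_on A u" "continuous_on A u'" "continuous_on A src"
  unfolding src_def by (intro continuous_intros C1_supported_cont[OF u])+

lemma kern_cont: "continuous_on A (kern k)"
  unfolding kern_def by (intro continuous_intros u_cont)

text \<open>\<open>sin 0\<close> kills the coefficients, and \<open>gain 0\<close> is 0 because
  division by zero yields 0; series over all natural numbers therefore start effectively at
  1.\<close>

lemma z_zero_index: "z1 0 t = 0" "z2 0 t = 0"
  by (simp_all add: z1_def z2_def coeff1_def coeff2_def gain_def csine_def)

lemma z_initial: "z1 k 0 = coeff1 k" "z2 k 0 = coeff2 k"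
  by (simp_all add: z1_def z2_def J1_def J2_def)

lemma J_deriv:
  assumes "t \<in> {0..T}"
  shows "(J1 k has_vector_derivative exp ((of_nat k ^ 2 - \<mu>1) * of_real t) * src t) (at t within {0..T})"
    and "(J2 k has_vector_derivative kern k t) (at t within {0..T})"
  unfolding J1_def[abs_def] J2_def[abs_def]
  by (rule integral_has_vector_derivative[OF _ assms]; intro continuous_intros u_cont kern_cont)+

lemma z1_deriv:
  assumes t: "t \<in> {0..T}"
  shows "(z1 k has_vector_derivative (\<mu>1 - of_nat k ^ 2) * z1 k t + gain k * src t) (at t within {0..T})"
proof -
  let ?e = "exp ((\<mu>1 - of_nat k ^ 2) * of_real t)"
  have d: "((\<lambda>t. exp ((\<mu>1 - of_nat k ^ 2) * of_real t) * (coeff1 k + gain k * J1 k t)) has_vector_derivative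
      (?e * (0 + gain k * (exp ((of_nat k ^ 2 - \<mu>1) * of_real t) * src t)) + (\<mu>1 - of_nat k ^ 2) * ?e * (coeff1 k + gain k * J1 k t))) (at t within {0..T})"
    by (intro has_vector_derivative_mult has_vector_derivative_add has_vector_derivative_const has_vector_derivative_mult_right
        exp_real_deriv J_deriv[OF t])
  have eq: "?e * (0 + gain k * (exp ((of_nat k ^ 2 - \<mu>1) * of_real t) * src t)) = gain k * src t"
  proof -
    have "?e * exp ((of_nat k ^ 2 - \<mu>1) * of_real t) = 1" by (simp add: exp_add[symmetric] algebra_simps)
    then have "?e * exp ((of_nat k ^ 2 - \<mu>1) * of_real t) * (gain k * src t) = gain k * src t" by simp
    then show ?thesis by (simp add: mult_ac)
  qed
  have eq': "gain k * src t + (\<mu>1 - of_nat k ^ 2) * ?e * (coeff1 k + gain k * J1 k t) = (\<mu>1 - of_nat k ^ 2) * z1 k t + gain k * src t"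
    by (simp add: z1_def)
  have zf: "z1 k = (\<lambda>t. exp ((\<mu>1 - of_nat k ^ 2) * of_real t) * (coeff1 k + gain k * J1 k t))"
    by (rule ext) (simp add: z1_def)
  show ?thesis using d unfolding eq eq' zf[symmetric] .
qed

lemma z2_deriv:
  assumes t: "t \<in> {0..T}"
  shows "(z2 k has_vector_derivative (\<mu>2 - of_nat k ^ 2) * z2 k t + z1 k t + gain k * u t) (at t within {0..T})"
proof -
  let ?K = "exp (- (of_nat k ^ 2) * of_real t) :: complex" and ?D = "ddexp \<mu>1 \<mu>2 t" and ?e2 = "exp (\<mu>2 * of_real t)"
  let ?A = "coeff1 k + gain k * J1 k t" and ?B = "coeff2 k + gain k * J2 k t"
  let ?p1 = "exp ((of_nat k ^ 2 - \<mu>1) * of_real t) * src t"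
  have zf: "z2 k = (\<lambda>t. exp (- (of_nat k ^ 2) * of_real t) *
     (exp (\<mu>2 * of_real t) * (coeff2 k + gain k * J2 k t) + ddexp \<mu>1 \<mu>2 t * (coeff1 k + gain k * J1 k t)))"
    by (rule ext) (simp add: z2_def)
  have d: "((\<lambda>t. exp (- (of_nat k ^ 2) * of_real t) *
     (exp (\<mu>2 * of_real t) * (coeff2 k + gain k * J2 k t) + ddexp \<mu>1 \<mu>2 t * (coeff1 k + gain k * J1 k t))) has_vector_derivative
     (?K * ((?e2 * (0 + gain k * kern k t) + (\<mu>2 * ?e2) * ?B) + (?D * (0 + gain k * ?p1) + (\<mu>1 * ?D + ?e2) * ?A))
       + (- (of_nat k ^ 2) * ?K) * (?e2 * ?B + ?D * ?A))) (at t within {0..T})"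
    by (intro has_vector_derivative_mult has_vector_derivative_add has_vector_derivative_const has_vector_derivative_mult_right
        exp_real_deriv ddexp_deriv J_deriv[OF t])
  have eq: "?K * ((?e2 * (0 + gain k * kern k t) + (\<mu>2 * ?e2) * ?B) + (?D * (0 + gain k * ?p1) + (\<mu>1 * ?D + ?e2) * ?A))
       + (- (of_nat k ^ 2) * ?K) * (?e2 * ?B + ?D * ?A)
     = (\<mu>2 - of_nat k ^ 2) * z2 k t + z1 k t + gain k * u t"
  proof -
    have D': "\<mu>1 * ?D + ?e2 = \<mu>2 * ?D + exp (\<mu>1 * of_real t)"
      using ddexp_mult[of \<mu>1 \<mu>2 t] by (simp add: algebra_simps)
    have z1: "?K * exp (\<mu>1 * of_real t) * ?A = z1 k t"
      by (simp add: z1_def exp_add[symmetric] algebra_simps)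
    have z2: "?K * (?e2 * ?B + ?D * ?A) = z2 k t" by (simp add: z2_def)
    \<comment> \<open>Since \<open>ddexp\<close> vanishes at 0, the two direct contributions of
      \<open>src\<close> cancel: it acts on \<open>z2\<close> only through
      \<open>z1\<close>.\<close>
    have "ddexp \<mu>1 \<mu>2 (t + - t) = ?e2 * ddexp \<mu>1 \<mu>2 (- t) + ?D * exp (\<mu>1 * of_real (- t))" by (rule ddexp_add)
    then have D0: "?e2 * ddexp \<mu>1 \<mu>2 (- t) + ?D * exp (- (\<mu>1 * of_real t)) = 0" by simp
    have q1: "?K * kern k t = ddexp \<mu>1 \<mu>2 (- t) * src t + exp (- (\<mu>2 * of_real t)) * u t"
      by (simp add: kern_def mult.assoc[symmetric] exp_add[symmetric])
    have p1: "?K * ?p1 = exp (- (\<mu>1 * of_real t)) * src t"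
    proof -
      have "?K * exp ((of_nat k ^ 2 - \<mu>1) * of_real t) = exp (- (\<mu>1 * of_real t))"
        by (simp add: exp_add[symmetric] algebra_simps)
      then show ?thesis by (simp only: mult.assoc[symmetric])
    qed
    have e2: "?e2 * exp (- (\<mu>2 * of_real t)) = 1" by (simp add: exp_add[symmetric])
    have "?e2 * (?K * kern k t) + ?D * (?K * ?p1) = (?e2 * ddexp \<mu>1 \<mu>2 (- t) + ?D * exp (- (\<mu>1 * of_real t))) * src t
        + (?e2 * exp (- (\<mu>2 * of_real t))) * u t"
      unfolding q1 p1 by (simp add: algebra_simps)
    then have f: "?e2 * (?K * kern k t) + ?D * (?K * ?p1) = u t" unfolding D0 e2 by simp
    have "?K * ((?e2 * (0 + gain k * kern k t) + (\<mu>2 * ?e2) * ?B) + (?D * (0 + gain k * ?p1) + (\<mu>1 * ?D + ?e2) * ?A))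
       + (- (of_nat k ^ 2) * ?K) * (?e2 * ?B + ?D * ?A)
      = gain k * (?e2 * (?K * kern k t) + ?D * (?K * ?p1)) + \<mu>2 * (?K * (?e2 * ?B + ?D * ?A)) + ?K * exp (\<mu>1 * of_real t) * ?A
       - of_nat k ^ 2 * (?K * (?e2 * ?B + ?D * ?A))"
      unfolding D' by (simp add: algebra_simps)
    also have "\<dots> = gain k * u t + \<mu>2 * z2 k t + z1 k t - of_nat k ^ 2 * z2 k t"
      unfolding f z1 z2 ..
    finally show ?thesis by (simp add: algebra_simps)
  qed
  show ?thesis using d unfolding eq zf[symmetric] .
qed

lemma z_cont: "continuous_on {0..T} (z1 k)" "continuous_on {0..T} (z2 k)"
  using z1_deriv z2_deriv by (meson has_vector_derivative_continuous continuous_on_eq_continuous_within)+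

lemma integral_eq_lborel:
  fixes f :: "real \<Rightarrow> complex"
  assumes f: "continuous_on UNIV f" "\<And>s. s \<notin> {0..T0} \<Longrightarrow> f s = 0" and t: "T0 \<le> t"
  shows "integral {0..t} f = (LINT s|lborel. f s)"
proof -
  have i: "integrable lborel f" by (rule integrable_cont_supported[OF f])
  have "(LINT s|lborel. f s) = integral UNIV f"
    using integral_unique[OF has_integral_integral_lborel[OF i]] by simp
  also have "\<dots> = integral {0..t} f"
  proof (rule integral_spike_set[symmetric])
    have "{x \<in> {0..t} - UNIV. f x \<noteq> 0} = {}" "{x \<in> UNIV - {0..t}. f x \<noteq> 0} = {}" using f(2) t by force+
    then show "negligible {x \<in> {0..t} - UNIV. f x \<noteq> 0}" "negligible {x \<in> UNIV - {0..t}. f x \<noteq> 0}"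
      by (simp_all only: negligible_empty)
  qed
  finally show ?thesis by simp
qed

text \<open>Integrating by parts the term \<open>- u'\<close> of \<open>src\<close> turns the
  exponents \<open>k^2 - \<mu>\<close> into \<open>k^2\<close>, so \<open>J1\<close> and
  \<open>J2\<close> are \<open>k^2\<close> times the moments of \<open>u\<close>. As
  \<open>gain k\<close> has the factor \<open>1 / k\<close>, moments \<open>- csine k y / k\<close>
  are exactly those that cancel the initial coefficients.\<close>

lemma z_vanish:
  assumes m: "moment (exp_weight (of_nat k ^ 2 - \<mu>1)) u = - csine k y1 / of_nat k"
     "moment (dd_weight k) u = - csine k y2 / of_nat k" and t: "T0 \<le> t"
  shows "z1 k t = 0 \<and> z2 k t = 0"
proof (cases "k = 0")
  case False
  have supp: "s \<notin> {0..T0} \<Longrightarrow> u s = 0" "s \<notin> {0..T0} \<Longrightarrow> u' s = 0" for s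
    using u by (auto simp: C1_supported_def)
  let ?l1 = "of_nat k ^ 2 - \<mu>1" and ?l2 = "of_nat k ^ 2 - \<mu>2"
  have i: "integrable lborel (\<lambda>s. e s * u s)" "integrable lborel (\<lambda>s. e s * u' s)" if "continuous_on UNIV e" for e
    using supp by (auto intro!: integrable_cont_supported[of _ 0 T0] continuous_intros that u_cont)
  have d1: "moment (exp_weight ?l1) u' = - (?l1 * moment (exp_weight ?l1) u)"
  proof -
    have "moment (exp_weight ?l1) u' = - moment (\<lambda>s. ?l1 * exp_weight ?l1 s) u"
      by (rule moment_deriv[OF u]) (auto simp: exp_weight_def[abs_def] intro!: exp_real_deriv continuous_intros)
    then show ?thesis by (simp add: moment_cmult_left)
  qed
  have dd: "(dd_weight k has_vector_derivative ?l1 * dd_weight k s + (- 1) * exp_weight ?l2 s) (at s)" for s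
  proof -
    have "((\<lambda>s. ddexp \<mu>1 \<mu>2 (- s)) has_vector_derivative (- 1) *\<^sub>R (\<mu>1 * ddexp \<mu>1 \<mu>2 (- s) + exp (\<mu>2 * of_real (- s)))) (at s)"
    proof -
      have n: "((\<lambda>s::real. - s) has_vector_derivative - 1) (at s)" by (auto intro!: derivative_eq_intros)
      from vector_diff_chain_at[OF n ddexp_deriv[of \<mu>1 \<mu>2 "- s"]] show ?thesis by (simp only: o_def)
    qed
    from has_vector_derivative_mult[OF exp_real_deriv[of "of_nat k ^ 2"] this]
    have "(dd_weight k has_vector_derivative
      exp (of_nat k ^ 2 * of_real s) * ((- 1) *\<^sub>R (\<mu>1 * ddexp \<mu>1 \<mu>2 (- s) + exp (\<mu>2 * of_real (- s))))
      + of_nat k ^ 2 * exp (of_nat k ^ 2 * of_real s) * ddexp \<mu>1 \<mu>2 (- s)) (at s)"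
      unfolding dd_weight_def[abs_def] .
    moreover have "exp (of_nat k ^ 2 * of_real s) * exp (\<mu>2 * of_real (- s)) = exp_weight ?l2 s"
      by (simp add: exp_weight_def exp_add[symmetric] algebra_simps)
    ultimately show ?thesis by (simp add: dd_weight_def algebra_simps)
  qed
  have d2: "moment (dd_weight k) u' = - (?l1 * moment (dd_weight k) u - moment (exp_weight ?l2) u)"
  proof -
    have "moment (dd_weight k) u' = - moment (\<lambda>s. ?l1 * dd_weight k s + (- 1) * exp_weight ?l2 s) u"
      by (rule moment_deriv[OF u dd]) (intro continuous_intros)
    also have "moment (\<lambda>s. ?l1 * dd_weight k s + (- 1) * exp_weight ?l2 s) u
       = ?l1 * moment (dd_weight k) u + (- 1) * moment (exp_weight ?l2) u"
      by (subst moment_add_left[OF _ _ u]) (intro continuous_intros, intro continuous_intros, simp only: moment_cmult_left)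
    finally show ?thesis by simp
  qed
  have "J1 k t = (LINT s|lborel. exp (?l1 * of_real s) * src s)"
    unfolding J1_def by (rule integral_eq_lborel[OF _ _ t]) (auto intro!: continuous_intros u_cont simp: src_def supp)
  also have "\<dots> = (LINT s|lborel. \<mu>1 * (exp_weight ?l1 s * u s) - exp_weight ?l1 s * u' s)"
    by (simp add: exp_weight_def src_def algebra_simps)
  also have "\<dots> = \<mu>1 * moment (exp_weight ?l1) u - moment (exp_weight ?l1) u'"
    unfolding moment_def using i[OF exp_weight_cont] by simp
  finally have J1: "J1 k t = of_nat k ^ 2 * moment (exp_weight ?l1) u" unfolding d1 by (simp add: algebra_simps)
  have "J2 k t = (LINT s|lborel. kern k s)"
    unfolding J2_def by (rule integral_eq_lborel[OF kern_cont _ t]) (auto simp: kern_def src_def supp)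
  also have "\<dots> = (LINT s|lborel. (\<mu>1 * (dd_weight k s * u s) - dd_weight k s * u' s) + exp_weight ?l2 s * u s)"
    by (rule Bochner_Integration.integral_cong[OF refl])
       (simp add: kern_def src_def dd_weight_def exp_weight_def algebra_simps exp_diff exp_minus divide_inverse)
  also have "\<dots> = \<mu>1 * moment (dd_weight k) u - moment (dd_weight k) u' + moment (exp_weight ?l2) u"
    unfolding moment_def using i[OF exp_weight_cont] i[OF dd_weight_cont]
    by (simp add: Bochner_Integration.integral_add Bochner_Integration.integral_diff)
  \<comment> \<open>The \<open>\<mu>2\<close> moment produced by differentiating
    \<open>dd_weight\<close> cancels the direct contribution of \<open>u\<close> in
    \<open>kern\<close>.\<close>
  finally have J2: "J2 k t = of_nat k ^ 2 * moment (dd_weight k) u" unfolding d2 by (simp add: algebra_simps)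
  have "coeff1 k + gain k * J1 k t = 0" "coeff2 k + gain k * J2 k t = 0"
    unfolding J1 J2 m coeff1_def coeff2_def gain_def using False by (simp_all add: power2_eq_square)
  then show ?thesis by (simp add: z1_def z2_def)
qed (simp add: z_zero_index)

text \<open>Time-independent majorant of the modes: the first summand comes from the free part via
  \<open>exp_le_powr\<close>, the second from the forced part.\<close>

definition \<beta> :: "nat \<Rightarrow> real" where
  "\<beta> k = (norm (coeff1 k) + norm (coeff2 k)) * real k powr (- 3 / 4) + 1 / real k ^ 2"

lemma \<beta>_nonneg: "0 \<le> \<beta> k" by (simp add: \<beta>_def)

text \<open>The sine coefficients are only square summable; \<open>x w \<le> x^2 + w^2 / 2\<close>
  with \<open>w = k powr (- 3 / 4)\<close> splits the product into two summable terms.\<close>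

lemma \<beta>_summable: "summable \<beta>"
proof -
  have s: "summable (\<lambda>k. real k powr (- 3 / 2))" by (simp add: summable_real_powr_iff)
  have "summable (\<lambda>k. 4 / pi\<^sup>2 * (norm (csine k y1))\<^sup>2 + 4 / pi\<^sup>2 * (norm (csine k y2))\<^sup>2 + real k powr (- 3 / 2) + 1 / real k ^ 2)"
    by (intro summable_add summable_mult csine_square_summable y s)
       (use inverse_power_summable[of 2, where 'a=real] in \<open>simp add: divide_inverse\<close>)
  then show ?thesis
  proof (rule summable_comparison_test'[where N=0])
    fix k
    have w: "x * real k powr (- 3 / 4) \<le> x\<^sup>2 + real k powr (- 3 / 2) / 2" for x :: real
    proof -
      have "real k powr (- 3 / 2) = (real k powr (- 3 / 4))\<^sup>2"
        by (simp add: power2_eq_square powr_add[symmetric])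
      moreover have "2 * (x * real k powr (- 3 / 4)) \<le> x\<^sup>2 + (real k powr (- 3 / 4))\<^sup>2"
        using sum_squares_bound[of x "real k powr (- 3 / 4)"] by (simp only: mult.assoc)
      moreover have "0 \<le> x\<^sup>2" by simp
      ultimately show ?thesis by linarith
    qed
    have na: "(norm (coeff1 k))\<^sup>2 = 4 / pi\<^sup>2 * (norm (csine k y1))\<^sup>2" "(norm (coeff2 k))\<^sup>2 = 4 / pi\<^sup>2 * (norm (csine k y2))\<^sup>2"
      by (simp_all add: coeff1_def coeff2_def norm_mult norm_divide power_mult_distrib power_divide)
    have "norm (\<beta> k) = norm (coeff1 k) * real k powr (- 3 / 4) + norm (coeff2 k) * real k powr (- 3 / 4) + 1 / real k ^ 2"
      using \<beta>_nonneg[of k] by (simp add: \<beta>_def distrib_right)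
    also have "\<dots> \<le> ((norm (coeff1 k))\<^sup>2 + real k powr (- 3 / 2) / 2) + ((norm (coeff2 k))\<^sup>2 + real k powr (- 3 / 2) / 2) + 1 / real k ^ 2"
      by (intro add_mono w order_refl)
    finally show "norm (\<beta> k) \<le> 4 / pi\<^sup>2 * (norm (csine k y1))\<^sup>2 + 4 / pi\<^sup>2 * (norm (csine k y2))\<^sup>2 + real k powr (- 3 / 2) + 1 / real k ^ 2"
      by (simp add: na)
  qed
qed

text \<open>The free part decays like \<open>exp (- k^2 t)\<close>, which is traded for decay in
  \<open>k\<close> at the price of a singularity at \<open>t = 0\<close>, reflecting that the
  initial state is merely in L2. The forced part gains \<open>1 / k^2\<close> from
  \<open>integral_exp_decay_bound\<close>.\<close>

lemma z_bound:
  assumes T: "0 < T"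
  obtains K where "0 \<le> K" "\<And>k t. 0 < t \<Longrightarrow> t \<le> T \<Longrightarrow> norm (z1 k t) \<le> K * \<beta> k * (1 + t powr (- 3 / 8))"
    "\<And>k t. 0 < t \<Longrightarrow> t \<le> T \<Longrightarrow> norm (z2 k t) \<le> K * \<beta> k * (1 + t powr (- 3 / 8))"
proof -
  obtain P where P: "0 < P" "\<And>s. s \<in> {0..T} \<Longrightarrow> norm (src s) \<le> P" using cont_bounded_Icc[OF u_cont(3)] by blast
  obtain U where U: "0 < U" "\<And>s. s \<in> {0..T} \<Longrightarrow> norm (u s) \<le> U" using cont_bounded_Icc[OF u_cont(1)] by blast
  obtain E where E: "0 < E" "\<And>s. s \<in> {0..T} \<Longrightarrow> norm (ddexp \<mu>1 \<mu>2 s) \<le> E"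
    using cont_bounded_Icc[OF ddexp_cont[OF continuous_on_id]] by blast
  have Ex: "norm (exp (\<nu> * of_real s)) \<le> exp T" if "\<nu> \<in> {\<mu>1, \<mu>2}" "s \<in> {0..T}" for \<nu> s
  proof -
    have "Re \<nu> * s \<le> 1 * s" using that Re_le by (intro mult_right_mono) auto
    then show ?thesis using that by simp
  qed
  define F where "F = exp T + E"
  have F: "0 < F" using E by (simp add: F_def add_pos_pos)
  have ExF: "norm (exp (\<nu> * of_real s)) \<le> F" if "\<nu> \<in> {\<mu>1, \<mu>2}" "s \<in> {0..T}" for \<nu> s
    using Ex[OF that] E(1) unfolding F_def by linarith
  define K where "K = F + 2 * (F * (P + U))"
  have K: "0 \<le> K" "F \<le> K" "2 * (F * (P + U)) \<le> K" using F P U by (auto simp: K_def)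
  have Kt: "norm (exp (- (of_nat k ^ 2) * of_real s) :: complex) = exp (- (real k ^ 2 * s))" for k s
  proof -
    have "(exp (- (of_nat k ^ 2) * of_real s) :: complex) = of_real (exp (- (real k ^ 2 * s)))"
      unfolding exp_of_real[symmetric] by simp
    then show ?thesis by simp
  qed
  have bound: "norm w \<le> K * \<beta> k * (1 + t powr (- 3 / 8))"
    if k: "k \<ge> 1" and t: "0 < t" "t \<le> T"
      and w: "norm w \<le> F * (norm (coeff1 k) + norm (coeff2 k)) * exp (- (real k ^ 2 * t)) + norm (gain k) * (F * (P + U) / real k ^ 2)" for w :: complex and k t
  proof -
    have "exp (- (real k ^ 2 * t)) \<le> (real k ^ 2 * t) powr (- 3 / 8)"
      by (rule exp_le_powr) (use k t in auto)
    also have "\<dots> = real k powr (- 3 / 4) * t powr (- 3 / 8)"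
    proof -
      have "real k ^ 2 = real k powr 2" using k by (simp add: powr_numeral)
      then have "(real k ^ 2) powr (- 3 / 8) = real k powr (2 * (- 3 / 8))" by (simp only: powr_powr)
      then show ?thesis using k t by (simp add: powr_mult)
    qed
    finally have e: "exp (- (real k ^ 2 * t)) \<le> real k powr (- 3 / 4) * t powr (- 3 / 8)" .
    have ck: "norm (gain k) \<le> 2"
    proof -
      have "2 / (pi * real k) \<le> 2 / 1"
        using k pi_gt3 mult_mono[of 1 pi 1 "real k"] by (intro divide_left_mono) auto
      then show ?thesis by (simp add: gain_def norm_divide norm_mult)
    qed
    let ?al = "norm (coeff1 k) + norm (coeff2 k)" and ?T = "t powr (- 3 / 8)"
    have "F * ?al * exp (- (real k ^ 2 * t)) \<le> K * (?al * real k powr (- 3 / 4)) * ?T"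
    proof -
      have "F * ?al * exp (- (real k ^ 2 * t)) \<le> K * ?al * (real k powr (- 3 / 4) * ?T)"
        using K F e by (intro mult_mono) auto
      then show ?thesis by (simp add: mult.assoc)
    qed
    also have "\<dots> \<le> K * (?al * real k powr (- 3 / 4)) * (1 + ?T)"
      using K by (intro mult_left_mono) auto
    finally have 1: "F * ?al * exp (- (real k ^ 2 * t)) \<le> K * (?al * real k powr (- 3 / 4)) * (1 + ?T)" .
    have "norm (gain k) * (F * (P + U) / real k ^ 2) \<le> 2 * (F * (P + U) / real k ^ 2)"
      using F P U by (intro mult_right_mono ck) auto
    also have "\<dots> \<le> K * (1 / real k ^ 2) * 1" using K(3) by (simp add: divide_right_mono)
    also have "\<dots> \<le> K * (1 / real k ^ 2) * (1 + ?T)" using K by (intro mult_left_mono) auto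
    finally have 2: "norm (gain k) * (F * (P + U) / real k ^ 2) \<le> K * (1 / real k ^ 2) * (1 + ?T)" .
    have "norm w \<le> K * (?al * real k powr (- 3 / 4)) * (1 + ?T) + K * (1 / real k ^ 2) * (1 + ?T)"
      using w 1 2 by linarith
    then show ?thesis by (simp add: \<beta>_def algebra_simps)
  qed
  have b1: "norm (z1 k t) \<le> K * \<beta> k * (1 + t powr (- 3 / 8))" if t: "0 < t" "t \<le> T" for k t
  proof (cases "k = 0")
    case False
    then have k: "k \<ge> 1" by simp
    let ?e = "exp ((\<mu>1 - of_nat k ^ 2) * of_real t)"
    have es: "exp ((\<mu>1 - of_nat k ^ 2) * of_real s) = exp (\<mu>1 * of_real s) * exp (- (of_nat k ^ 2) * of_real s)" for s
      by (simp add: exp_add[symmetric] algebra_simps)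
    have ne: "norm (exp ((\<mu>1 - of_nat k ^ 2) * of_real s)) \<le> F * exp (- (real k ^ 2 * s))" if "s \<in> {0..T}" for s
      unfolding es norm_mult Kt using that by (intro mult_right_mono ExF) auto
    have "norm (?e * J1 k t) \<le> F * P / real k ^ 2"
    proof -
      have eq: "?e * J1 k t = integral {0..t} (\<lambda>s. exp ((\<mu>1 - of_nat k ^ 2) * of_real (t - s)) * src s)"
        unfolding J1_def integral_mult_right[symmetric]
      proof (rule integral_cong)
        fix s
        have "?e * exp ((of_nat k ^ 2 - \<mu>1) * of_real s) = exp ((\<mu>1 - of_nat k ^ 2) * of_real (t - s))"
          by (simp add: exp_add[symmetric] algebra_simps)
        then show "?e * (exp ((of_nat k ^ 2 - \<mu>1) * of_real s) * src s) = exp ((\<mu>1 - of_nat k ^ 2) * of_real (t - s)) * src s"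
          by (simp only: mult.assoc[symmetric])
      qed
      show ?thesis unfolding eq
      proof (rule integral_exp_decay_bound)
        fix s assume s: "s \<in> {0..t}"
        have "norm (exp ((\<mu>1 - of_nat k ^ 2) * of_real (t - s)) * src s) \<le> (F * exp (- (real k ^ 2 * (t - s)))) * P"
          unfolding norm_mult using s t F by (intro mult_mono ne P) auto
        then show "norm (exp ((\<mu>1 - of_nat k ^ 2) * of_real (t - s)) * src s) \<le> F * P * exp (- (real k ^ 2 * (t - s)))"
          by (simp add: mult_ac)
      qed (use t k F P in \<open>auto intro!: continuous_intros u_cont\<close>)
    qed
    also have "\<dots> \<le> F * (P + U) / real k ^ 2" using F U by (intro divide_right_mono mult_left_mono) auto
    finally have i: "norm (?e * J1 k t) \<le> F * (P + U) / real k ^ 2" .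
    have "z1 k t = ?e * coeff1 k + gain k * (?e * J1 k t)" by (simp add: z1_def algebra_simps)
    then have "norm (z1 k t) \<le> norm ?e * norm (coeff1 k) + norm (gain k) * norm (?e * J1 k t)"
      by (metis norm_mult norm_triangle_ineq)
    also have "\<dots> \<le> (F * exp (- (real k ^ 2 * t))) * (norm (coeff1 k) + norm (coeff2 k)) + norm (gain k) * (F * (P + U) / real k ^ 2)"
      using t F by (intro add_mono mult_mono ne i) auto
    finally show ?thesis by (intro bound[OF k t]) (simp add: mult_ac)
  qed (use K \<beta>_nonneg in \<open>simp add: z_zero_index\<close>)
  have b2: "norm (z2 k t) \<le> K * \<beta> k * (1 + t powr (- 3 / 8))" if t: "0 < t" "t \<le> T" for k t
  proof (cases "k = 0")
    case False
    then have k: "k \<ge> 1" by simp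
    let ?K = "exp (- (of_nat k ^ 2) * of_real t) :: complex" and ?D = "ddexp \<mu>1 \<mu>2 t" and ?e2 = "exp (\<mu>2 * of_real t)"
    let ?w = "\<lambda>s. exp (- (of_nat k ^ 2) * of_real (t - s)) * (ddexp \<mu>1 \<mu>2 (t - s) * src s + exp (\<mu>2 * of_real (t - s)) * u s)"
    have "norm (?K * ?e2 * J2 k t + ?K * ?D * J1 k t) \<le> F * (P + U) / real k ^ 2"
    proof -
      have i1: "(\<lambda>s. ?K * ?e2 * kern k s) integrable_on {0..t}" "(\<lambda>s. ?K * ?D * (exp ((of_nat k ^ 2 - \<mu>1) * of_real s) * src s)) integrable_on {0..t}"
        by (intro integrable_continuous_interval continuous_intros kern_cont u_cont)+
      have "?K * ?e2 * J2 k t + ?K * ?D * J1 k t = integral {0..t} (\<lambda>s. ?K * ?e2 * kern k s + ?K * ?D * (exp ((of_nat k ^ 2 - \<mu>1) * of_real s) * src s))"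
        unfolding J1_def J2_def integral_add[OF i1] integral_mult_right ..
      also have "\<dots> = integral {0..t} ?w"
      proof (rule integral_cong)
        fix s
        have Ks: "?K * exp (of_nat k ^ 2 * of_real s) = exp (- (of_nat k ^ 2) * of_real (t - s))"
          by (simp add: exp_add[symmetric] algebra_simps)
        have e1: "exp ((of_nat k ^ 2 - \<mu>1) * of_real s) = exp (of_nat k ^ 2 * of_real s) * exp (\<mu>1 * of_real (- s))"
          by (simp add: exp_add[symmetric] algebra_simps)
        have e2: "?e2 * exp (- (\<mu>2 * of_real s)) = exp (\<mu>2 * of_real (t - s))"
          by (simp add: exp_add[symmetric] algebra_simps)
        have dd: "ddexp \<mu>1 \<mu>2 (t - s) = ?e2 * ddexp \<mu>1 \<mu>2 (- s) + ?D * exp (\<mu>1 * of_real (- s))"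
          using ddexp_add[of \<mu>1 \<mu>2 t "- s"] by simp
        have "?K * ?e2 * kern k s + ?K * ?D * (exp ((of_nat k ^ 2 - \<mu>1) * of_real s) * src s)
          = (?K * exp (of_nat k ^ 2 * of_real s)) * ((?e2 * ddexp \<mu>1 \<mu>2 (- s) + ?D * exp (\<mu>1 * of_real (- s))) * src s + (?e2 * exp (- (\<mu>2 * of_real s))) * u s)"
          unfolding kern_def e1 by (simp add: algebra_simps)
        then show "?K * ?e2 * kern k s + ?K * ?D * (exp ((of_nat k ^ 2 - \<mu>1) * of_real s) * src s) = ?w s"
          unfolding Ks e2 dd[symmetric] .
      qed
      finally have eq: "?K * ?e2 * J2 k t + ?K * ?D * J1 k t = integral {0..t} ?w" .
      show ?thesis unfolding eq
      proof (rule integral_exp_decay_bound)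
        fix s assume s: "s \<in> {0..t}"
        have "norm (ddexp \<mu>1 \<mu>2 (t - s) * src s + exp (\<mu>2 * of_real (t - s)) * u s) \<le> F * P + F * U"
        proof (rule order_trans[OF norm_triangle_ineq], unfold norm_mult, intro add_mono mult_mono P U)
          show "norm (ddexp \<mu>1 \<mu>2 (t - s)) \<le> F" using E(2)[of "t - s"] s t by (auto simp: F_def intro: add_increasing)
          show "norm (exp (\<mu>2 * of_real (t - s))) \<le> F" using s t by (intro ExF) auto
        qed (use s t F in auto)
        then have "norm (?w s) \<le> exp (- (real k ^ 2 * (t - s))) * (F * P + F * U)"
          unfolding norm_mult[of "exp (- (of_nat k ^ 2) * of_real (t - s))"] Kt by (intro mult_left_mono) auto
        then show "norm (?w s) \<le> F * (P + U) * exp (- (real k ^ 2 * (t - s)))"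
          by (simp add: algebra_simps)
      qed (use t k F P U in \<open>auto intro!: continuous_intros u_cont\<close>)
    qed note i = this
    have "z2 k t = ?K * (?e2 * coeff2 k + ?D * coeff1 k) + gain k * (?K * ?e2 * J2 k t + ?K * ?D * J1 k t)"
      by (simp add: z2_def algebra_simps)
    then have "norm (z2 k t) \<le> norm ?K * norm (?e2 * coeff2 k + ?D * coeff1 k) + norm (gain k) * norm (?K * ?e2 * J2 k t + ?K * ?D * J1 k t)"
      by (metis norm_mult norm_triangle_ineq)
    also have "\<dots> \<le> exp (- (real k ^ 2 * t)) * (F * norm (coeff2 k) + F * norm (coeff1 k)) + norm (gain k) * (F * (P + U) / real k ^ 2)"
    proof (intro add_mono mult_mono i)
      show "norm ?K \<le> exp (- (real k ^ 2 * t))" unfolding Kt ..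
      show "norm (?e2 * coeff2 k + ?D * coeff1 k) \<le> F * norm (coeff2 k) + F * norm (coeff1 k)"
      proof (rule order_trans[OF norm_triangle_ineq], unfold norm_mult, intro add_mono mult_right_mono)
        show "norm ?D \<le> F" using E(2)[of t] t by (auto simp: F_def intro: add_increasing)
        show "norm ?e2 \<le> F" using t by (intro ExF) auto
      qed auto
    qed auto
    finally show ?thesis by (intro bound[OF k t]) (simp add: algebra_simps)
  qed (use K \<beta>_nonneg in \<open>simp add: z_zero_index\<close>)
  show ?thesis using that K(1) b1 b2 by blast
qed

end

section \<open>The candidate solution and its square integrability\<close>

text \<open>The square of the weight \<open>t powr (- 3 / 8)\<close> from \<open>z_bound\<close>;
  integrable at 0 because 3/4 is less than 1.\<close>

lemma space_time_weight_integrable: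
  assumes T: "0 < T"
  shows "integrable (lebesgue_on (space_time T)) (\<lambda>p. snd p powr (- 3 / 4))"
proof -
  define w :: "real \<Rightarrow> real" where "w t = indicator {0<..<T} t * t powr (- 3 / 4)" for t
  have wm[measurable]: "w \<in> borel_measurable borel" unfolding w_def by measurable
  have "(\<lambda>t. t powr (- 3 / 4)) integrable_on {0..T}"
    using has_integral_powr_from_0[of "- 3 / 4" T] T by (auto simp: integrable_on_def)
  then have "(\<lambda>t. t powr (- 3 / 4)) absolutely_integrable_on {0..T}"
    by (rule nonnegative_absolutely_integrable_1) simp
  then have "set_integrable lebesgue {0<..<T} (\<lambda>t. t powr (- 3 / 4))"
    by (rule set_integrable_subset) auto
  then have "integrable lebesgue w" unfolding set_integrable_def w_def[abs_def] by simp
  then have wi: "integrable lborel w" by (subst (asm) integrable_completion) auto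
  define f :: "real \<times> real \<Rightarrow> real" where "f p = indicator {0<..<pi} (fst p) * w (snd p)" for p
  have fm: "f \<in> borel_measurable (lborel \<Otimes>\<^sub>M lborel)" unfolding f_def by measurable
  have "integrable (lborel \<Otimes>\<^sub>M lborel) f"
  proof (rule lborel_pair.Fubini_integrable[OF fm])
    have "(\<lambda>x. LINT y|lborel. norm (f (x, y))) = (\<lambda>x. indicator {0<..<pi} x * (LINT y|lborel. w y))"
      by (rule ext) (simp add: f_def abs_mult w_def)
    then show "integrable lborel (\<lambda>x. LINT y|lborel. norm (f (x, y)))"
      by (simp only:) (intro integrable_mult_left integrable_real_indicator, auto)
    show "AE x in lborel. integrable lborel (\<lambda>y. f (x, y))"
      by (rule AE_I2) (simp add: f_def wi)
  qed
  then have "integrable lborel f" by (simp only: lborel_prod)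
  moreover have "f \<in> borel_measurable lborel" using fm by (simp only: lborel_prod)
  ultimately have "integrable lebesgue f" by (subst integrable_completion) auto
  moreover have "f = (\<lambda>p. indicator (space_time T) p *\<^sub>R snd p powr (- 3 / 4))"
    by (rule ext) (auto simp: f_def w_def indicator_def)
  moreover have "space_time T \<in> sets lebesgue" using space_time_lmeasurable[of T] by (simp add: fmeasurable_def)
  ultimately show ?thesis by (subst integrable_restrict_space) auto
qed

lemma real_pairing_sol: "real_pairing (x *s v + z *s w) g = x * real_pairing v g + z * real_pairing w g"
  by (simp only: real_pairing_add_left real_pairing_scale_left)

lemma product_le_squares: "a * b \<le> a\<^sup>2 + (b::real)\<^sup>2"
proof -
  have "2 * (a * b) \<le> a\<^sup>2 + b\<^sup>2" using sum_squares_bound[of a b] by (simp only: mult.assoc)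
  moreover have "0 \<le> a\<^sup>2 + b\<^sup>2" by simp
  ultimately show ?thesis by linarith
qed

locale controlled_solution = controlled_modes +
  fixes A :: "real^2^2" and B :: "real^2" and Bc C :: "complex^2" and y0 :: "real \<Rightarrow> complex^2"
  assumes Bc: "Bc = (\<chi> i. of_real (B $ i))" "cmat A *v Bc = \<mu>1 *s Bc + C" "cmat A *v C = \<mu>2 *s C"
    and y0: "\<And>x. y0 x = y1 x *s Bc + y2 x *s C"
    and T0: "0 < T0"
begin

definition snk :: "nat \<Rightarrow> real \<Rightarrow> complex" where "snk k x = of_real (sin (real k * x))"

definition lift :: "real \<Rightarrow> complex" where "lift x = of_real (1 - x / pi)"

definition part1 :: "nat \<Rightarrow> real \<times> real \<Rightarrow> complex" where
  "part1 N p = (\<Sum>k=1..N. z1 k (snd p) * snk k (fst p))"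

definition part2 :: "nat \<Rightarrow> real \<times> real \<Rightarrow> complex" where
  "part2 N p = (\<Sum>k=1..N. z2 k (snd p) * snk k (fst p))"

text \<open>A pointwise series that includes the vanishing index 0; convergence is claimed at
  positive times only, where the majorant \<open>\<beta>\<close> applies.\<close>

definition full1 :: "real \<times> real \<Rightarrow> complex" where
  "full1 p = (\<Sum>k. z1 k (snd p) * snk k (fst p))"

definition full2 :: "real \<times> real \<Rightarrow> complex" where
  "full2 p = (\<Sum>k. z2 k (snd p) * snk k (fst p))"

definition sol :: "real \<times> real \<Rightarrow> complex^2" where
  "sol p = (u (snd p) * lift (fst p) + full1 p) *s Bc + full2 p *s C"

lemma sol_vanish:
  assumes m: "\<And>k. k \<ge> 1 \<Longrightarrow> moment (exp_weight (of_nat k ^ 2 - \<mu>1)) u = - csine k y1 / of_nat k"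
     "\<And>k. k \<ge> 1 \<Longrightarrow> moment (dd_weight k) u = - csine k y2 / of_nat k" and t: "T0 < snd p"
  shows "sol p = 0"
proof -
  have "z1 k (snd p) = 0 \<and> z2 k (snd p) = 0" for k
  proof (cases "k = 0")
    case False
    then show ?thesis using z_vanish[of k "snd p"] m[of k] t by auto
  qed (simp add: z_zero_index)
  then have "full1 p = 0" "full2 p = 0" by (simp_all add: full1_def full2_def)
  moreover have "u (snd p) = 0" using u t by (simp add: C1_supported_def)
  ultimately show ?thesis by (simp add: sol_def)
qed

lemma snk_le: "norm (snk k x) \<le> 1"
  by (simp add: snk_def)

lemma snk_cont: "continuous_on S (snk k)" and lift_cont: "continuous_on S lift"
  unfolding snk_def[abs_def] lift_def[abs_def] by (intro continuous_intros; simp)+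

lemma z_snk_measurable:
  "(\<lambda>p. z1 k (snd p) * snk k (fst p)) \<in> borel_measurable (lebesgue_on (space_time T))"
  "(\<lambda>p. z2 k (snd p) * snk k (fst p)) \<in> borel_measurable (lebesgue_on (space_time T))"
  "(\<lambda>p. u (snd p) * lift (fst p)) \<in> borel_measurable (lebesgue_on (space_time T))"
proof -
  have st: "space_time T \<in> sets lebesgue" using space_time_lmeasurable[of T] by (simp add: fmeasurable_def)
  have m: "(\<lambda>p. h (snd p) * s (fst p)) \<in> borel_measurable (lebesgue_on (space_time T))"
    if "continuous_on {0..T} h" "continuous_on UNIV s" for h s :: "real \<Rightarrow> complex"
  proof (rule continuous_imp_measurable_on_sets_lebesgue[OF _ st], rule continuous_on_mult)
    show "continuous_on (space_time T) (\<lambda>p. h (snd p))"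
      by (rule continuous_on_compose2[OF that(1) continuous_on_snd[OF continuous_on_id]]) auto
    show "continuous_on (space_time T) (\<lambda>p. s (fst p))"
      by (rule continuous_on_compose2[OF that(2) continuous_on_fst[OF continuous_on_id]]) auto
  qed
  show "(\<lambda>p. z1 k (snd p) * snk k (fst p)) \<in> borel_measurable (lebesgue_on (space_time T))"
  "(\<lambda>p. z2 k (snd p) * snk k (fst p)) \<in> borel_measurable (lebesgue_on (space_time T))"
  "(\<lambda>p. u (snd p) * lift (fst p)) \<in> borel_measurable (lebesgue_on (space_time T))"
    by (intro m z_cont u_cont snk_cont lift_cont)+
qed

lemma parts_bound:
  assumes T: "0 < T"
  obtains M where "0 \<le> M"
    "\<And>N p. p \<in> space_time T \<Longrightarrow> norm (u (snd p) * lift (fst p) + part1 N p) \<le> M * (1 + snd p powr (- 3 / 8))"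
    "\<And>N p. p \<in> space_time T \<Longrightarrow> norm (part2 N p) \<le> M * (1 + snd p powr (- 3 / 8))"
    "\<And>p. p \<in> space_time T \<Longrightarrow> (\<lambda>N. part1 N p) \<longlonglongrightarrow> full1 p"
    "\<And>p. p \<in> space_time T \<Longrightarrow> (\<lambda>N. part2 N p) \<longlonglongrightarrow> full2 p"
proof -
  obtain K where K: "0 \<le> K" "\<And>k t. 0 < t \<Longrightarrow> t \<le> T \<Longrightarrow> norm (z1 k t) \<le> K * \<beta> k * (1 + t powr (- 3 / 8))"
    "\<And>k t. 0 < t \<Longrightarrow> t \<le> T \<Longrightarrow> norm (z2 k t) \<le> K * \<beta> k * (1 + t powr (- 3 / 8))"
    using z_bound[OF T] by blast
  obtain U where U: "0 < U" "\<And>s. s \<in> {0..T} \<Longrightarrow> norm (u s) \<le> U" using cont_bounded_Icc[OF u_cont(1)] by blast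
  define S where "S = suminf \<beta>"
  have S: "0 \<le> S" unfolding S_def by (rule suminf_nonneg[OF \<beta>_summable \<beta>_nonneg])
  define M where "M = U + K * S"
  have gen: "norm (\<Sum>k=1..N. z k (snd p) * snk k (fst p)) \<le> K * S * (1 + snd p powr (- 3 / 8))"
    "(\<lambda>N. \<Sum>k=1..N. z k (snd p) * snk k (fst p)) \<longlonglongrightarrow> (\<Sum>k. z k (snd p) * snk k (fst p))"
    if p: "p \<in> space_time T" and z: "\<And>k t. 0 < t \<Longrightarrow> t \<le> T \<Longrightarrow> norm (z k t) \<le> K * \<beta> k * (1 + t powr (- 3 / 8))"
      and z0: "\<And>t. z 0 t = 0" for z p N
  proof -
    let ?W = "1 + snd p powr (- 3 / 8)"
    have t: "0 < snd p" "snd p \<le> T" using p by auto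
    have tb: "norm (z k (snd p) * snk k (fst p)) \<le> \<beta> k * (K * ?W)" for k
    proof -
      have "norm (z k (snd p)) * norm (snk k (fst p)) \<le> (K * \<beta> k * ?W) * 1"
        using K \<beta>_nonneg by (intro mult_mono z t snk_le) auto
      then show ?thesis by (simp add: norm_mult mult_ac)
    qed
    have sm: "summable (\<lambda>k. \<beta> k * (K * ?W))" by (intro summable_mult2 \<beta>_summable)
    have "norm (\<Sum>k=1..N. z k (snd p) * snk k (fst p)) \<le> (\<Sum>k=1..N. \<beta> k * (K * ?W))"
      by (rule sum_norm_le) (rule tb)
    also have "\<dots> = (\<Sum>k=1..N. \<beta> k) * (K * ?W)" by (simp add: sum_distrib_right)
    also have "\<dots> \<le> S * (K * ?W)"
      unfolding S_def using K by (intro mult_right_mono sum_le_suminf \<beta>_summable) (auto intro: \<beta>_nonneg)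
    finally show "norm (\<Sum>k=1..N. z k (snd p) * snk k (fst p)) \<le> K * S * ?W" by (simp add: mult_ac)
    have "summable (\<lambda>k. z k (snd p) * snk k (fst p))"
      by (rule summable_comparison_test'[OF sm, of 0]) (rule tb)
    then have "(\<lambda>N. \<Sum>k<N. z k (snd p) * snk k (fst p)) \<longlonglongrightarrow> (\<Sum>k. z k (snd p) * snk k (fst p))"
      by (rule summable_LIMSEQ)
    then have "(\<lambda>N. \<Sum>k<Suc N. z k (snd p) * snk k (fst p)) \<longlonglongrightarrow> (\<Sum>k. z k (snd p) * snk k (fst p))"
      by (rule LIMSEQ_Suc)
    moreover have "(\<Sum>k<Suc N. z k (snd p) * snk k (fst p)) = (\<Sum>k=1..N. z k (snd p) * snk k (fst p))" for N
    proof -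
      have "{..<Suc N} = insert 0 {1..N}" by auto
      then show ?thesis by (simp add: z0)
    qed
    ultimately show "(\<lambda>N. \<Sum>k=1..N. z k (snd p) * snk k (fst p)) \<longlonglongrightarrow> (\<Sum>k. z k (snd p) * snk k (fst p))"
      by (simp only:)
  qed
  show ?thesis
  proof (rule that)
    show "0 \<le> M" using U K S by (simp add: M_def)
    fix p assume p: "p \<in> space_time T"
    let ?W = "1 + snd p powr (- 3 / 8)"
    have W: "1 \<le> ?W" by simp
    show "(\<lambda>N. part1 N p) \<longlonglongrightarrow> full1 p" unfolding part1_def full1_def
      by (rule gen(2)[OF p K(2) z_zero_index(1)])
    show "(\<lambda>N. part2 N p) \<longlonglongrightarrow> full2 p" unfolding part2_def full2_def
      by (rule gen(2)[OF p K(3) z_zero_index(2)])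
    fix N
    have p1: "norm (part1 N p) \<le> K * S * ?W" unfolding part1_def
      by (rule gen(1)[OF p K(2) z_zero_index(1)])
    have p2: "norm (part2 N p) \<le> K * S * ?W" unfolding part2_def
      by (rule gen(1)[OF p K(3) z_zero_index(2)])
    have UW: "U * 1 \<le> U * ?W" using U W by (intro mult_left_mono) auto
    have "norm (u (snd p) * lift (fst p)) \<le> U * 1"
    proof -
      have "0 \<le> 1 - fst p / pi" "1 - fst p / pi \<le> 1" using p by auto
      then have "norm (lift (fst p)) \<le> 1" by (simp add: lift_def del: of_real_diff)
      then show ?thesis unfolding norm_mult using U p by (intro mult_mono U(2)) auto
    qed
    then show "norm (u (snd p) * lift (fst p) + part1 N p) \<le> M * ?W"
      using p1 UW norm_triangle_ineq[of "u (snd p) * lift (fst p)" "part1 N p"] by (simp add: M_def distrib_right)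
    show "norm (part2 N p) \<le> M * ?W"
      unfolding M_def distrib_right[of U] using p2 UW U by linarith
  qed
qed

text \<open>All partial sums have the common majorant \<open>M * (1 + t powr (- 3 / 8))\<close>,
  which is square integrable. It bounds the limit as well, and its product with a square integrable
  \<open>g\<close> is the dominating function that lets the pairing pass to the limit.\<close>

lemma sol_L2:
  assumes T: "0 < T"
  shows "L2_on (space_time T) sol"
    "\<And>g. L2_on (space_time T) g \<Longrightarrow>
      (\<lambda>N. LINT p|lebesgue_on (space_time T).
         (u (snd p) * lift (fst p) + part1 N p) * real_pairing Bc (g p) + part2 N p * real_pairing C (g p))
       \<longlonglongrightarrow> (LINT p|lebesgue_on (space_time T). real_pairing (sol p) (g p))"
proof -
  let ?Q = "lebesgue_on (space_time T)"
  obtain M where M: "0 \<le> M"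
    "\<And>N p. p \<in> space_time T \<Longrightarrow> norm (u (snd p) * lift (fst p) + part1 N p) \<le> M * (1 + snd p powr (- 3 / 8))"
    "\<And>N p. p \<in> space_time T \<Longrightarrow> norm (part2 N p) \<le> M * (1 + snd p powr (- 3 / 8))"
    "\<And>p. p \<in> space_time T \<Longrightarrow> (\<lambda>N. part1 N p) \<longlonglongrightarrow> full1 p"
    "\<And>p. p \<in> space_time T \<Longrightarrow> (\<lambda>N. part2 N p) \<longlonglongrightarrow> full2 p"
    using parts_bound[OF T] by blast
  let ?W = "\<lambda>p::real \<times> real. 1 + snd p powr (- 3 / 8)"
  have st: "space_time T \<in> sets lebesgue" using space_time_lmeasurable[of T] by (simp add: fmeasurable_def)
  have sp: "space ?Q = space_time T" by simp
  have pm: "part1 N \<in> borel_measurable ?Q" "part2 N \<in> borel_measurable ?Q" for N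
    unfolding part1_def[abs_def] part2_def[abs_def]
    by (intro borel_measurable_sum z_snk_measurable)+
  have fm1: "full1 \<in> borel_measurable ?Q"
    by (rule borel_measurable_LIMSEQ_metric[OF pm(1)]) (use M(4) in simp)
  have fm2: "full2 \<in> borel_measurable ?Q"
    by (rule borel_measurable_LIMSEQ_metric[OF pm(2)]) (use M(5) in simp)
  note fm = fm1 fm2
  note um = z_snk_measurable(3)[of T]
  have fb: "norm (u (snd p) * lift (fst p) + full1 p) \<le> M * ?W p" "norm (full2 p) \<le> M * ?W p" if p: "p \<in> space_time T" for p
  proof -
    have "(\<lambda>N. norm (u (snd p) * lift (fst p) + part1 N p)) \<longlonglongrightarrow> norm (u (snd p) * lift (fst p) + full1 p)"
      by (intro tendsto_intros M p)
    then show "norm (u (snd p) * lift (fst p) + full1 p) \<le> M * ?W p"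
      by (rule LIMSEQ_le_const2) (use M(2)[OF p] in blast)
    show "norm (full2 p) \<le> M * ?W p"
      by (rule LIMSEQ_le_const2[OF tendsto_norm[OF M(5)[OF p]]]) (use M(3)[OF p] in blast)
  qed
  have W2: "integrable ?Q (\<lambda>p. 2 + 2 * snd p powr (- 3 / 4))"
    by (intro Bochner_Integration.integrable_add integrable_mult_right space_time_weight_integrable T
        finite_measure.integrable_const finite_measure_lebesgue_on space_time_lmeasurable)
  have W2_le: "(?W p)\<^sup>2 \<le> 2 + 2 * snd p powr (- 3 / 4)" if "p \<in> space_time T" for p
  proof -
    have "(snd p powr (- 3 / 8))\<^sup>2 = snd p powr (- 3 / 4)"
      using that by (simp add: power2_eq_square powr_add[symmetric])
    moreover have "(?W p)\<^sup>2 \<le> 2 * 1\<^sup>2 + 2 * (snd p powr (- 3 / 8))\<^sup>2"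
      using sum_squares_bound[of 1 "snd p powr (- 3 / 8)"] by (simp add: power2_sum)
    ultimately show ?thesis by simp
  qed
  have scl: "(\<lambda>z. z *s w) \<in> borel_measurable borel" for w :: "complex^2"
    unfolding vector_scalar_mult_def
    by (intro borel_measurable_continuous_onI continuous_on_vec_lambda continuous_intros)
  have scn: "norm (z *s w) \<le> norm z * (norm (w $ 1) + norm (w $ 2))" for z :: complex and w :: "complex^2"
  proof -
    have "norm (z *s w) \<le> (\<Sum>i\<in>UNIV. norm ((z *s w) $ i))"
      unfolding norm_vec_def by (rule L2_set_le_sum) simp
    then show ?thesis by (simp add: sum_2 norm_mult distrib_left)
  qed
  define R where "R = (norm (Bc $ 1) + norm (Bc $ 2)) + (norm (C $ 1) + norm (C $ 2))"
  show "L2_on (space_time T) sol"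
    unfolding L2_on_def
  proof
    have "(\<lambda>p. (u (snd p) * lift (fst p) + full1 p) *s Bc) \<in> borel_measurable ?Q"
      by (rule measurable_compose[OF borel_measurable_add[OF um fm(1)] scl])
    moreover have "(\<lambda>p. full2 p *s C) \<in> borel_measurable ?Q" by (rule measurable_compose[OF fm(2) scl])
    ultimately show sm: "sol \<in> borel_measurable ?Q" unfolding sol_def[abs_def] by (rule borel_measurable_add)
    show "integrable ?Q (\<lambda>p. (norm (sol p))\<^sup>2)"
    proof (rule Bochner_Integration.integrable_bound)
      show "integrable ?Q (\<lambda>p. (M * R)\<^sup>2 * (2 + 2 * snd p powr (- 3 / 4)))" by (intro integrable_mult_right W2)
      show "(\<lambda>p. (norm (sol p))\<^sup>2) \<in> borel_measurable ?Q" using sm by measurable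
      show "AE p in ?Q. norm ((norm (sol p))\<^sup>2) \<le> norm ((M * R)\<^sup>2 * (2 + 2 * snd p powr (- 3 / 4)))"
      proof (rule AE_I2)
        fix p assume "p \<in> space ?Q"
        then have p: "p \<in> space_time T" by simp
        have "norm (sol p) \<le> (M * ?W p) * (norm (Bc $ 1) + norm (Bc $ 2)) + (M * ?W p) * (norm (C $ 1) + norm (C $ 2))"
          unfolding sol_def
          by (rule order_trans[OF norm_triangle_ineq], intro add_mono order_trans[OF scn] mult_right_mono fb[OF p]) auto
        also have "\<dots> = (M * R) * ?W p" by (simp add: R_def algebra_simps)
        finally have "(norm (sol p))\<^sup>2 \<le> ((M * R) * ?W p)\<^sup>2" by (intro power_mono) auto
        also have "\<dots> = (M * R)\<^sup>2 * (?W p)\<^sup>2" by (rule power_mult_distrib)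
        also have "\<dots> \<le> (M * R)\<^sup>2 * (2 + 2 * snd p powr (- 3 / 4))" by (intro mult_left_mono W2_le p) auto
        finally show "norm ((norm (sol p))\<^sup>2) \<le> norm ((M * R)\<^sup>2 * (2 + 2 * snd p powr (- 3 / 4)))" by simp
      qed
    qed
  qed
  fix g :: "real \<times> real \<Rightarrow> real^2" assume g: "L2_on (space_time T) g"
  have gL: "L2_on (space_time T) (\<lambda>p. real_pairing w (g p))" for w
    by (rule L2_on_bounded_linear[OF real_pairing_bounded_linear g])
  have gm: "(\<lambda>p. real_pairing w (g p)) \<in> borel_measurable ?Q"
    and g2: "integrable ?Q (\<lambda>p. (norm (real_pairing w (g p)))\<^sup>2)" for w
    using gL[of w] by (auto simp: L2_on_def)
  have eq: "real_pairing (sol p) (g p) = (u (snd p) * lift (fst p) + full1 p) * real_pairing Bc (g p) + full2 p * real_pairing C (g p)" for p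
    unfolding sol_def by (rule real_pairing_sol)
  define dom where "dom p = M * (2 * (2 + 2 * snd p powr (- 3 / 4)) + (norm (real_pairing Bc (g p)))\<^sup>2 + (norm (real_pairing C (g p)))\<^sup>2)" for p
  show "(\<lambda>N. LINT p|?Q.
         (u (snd p) * lift (fst p) + part1 N p) * real_pairing Bc (g p) + part2 N p * real_pairing C (g p))
       \<longlonglongrightarrow> (LINT p|?Q. real_pairing (sol p) (g p))"
    unfolding eq
  proof (rule integral_dominated_convergence[where w=dom])
    show "integrable ?Q dom"
      unfolding dom_def by (intro integrable_mult_right Bochner_Integration.integrable_add[of _ "\<lambda>p. 2 * _ p + _ p"] Bochner_Integration.integrable_add W2 g2)
    show "(\<lambda>p. (u (snd p) * lift (fst p) + full1 p) * real_pairing Bc (g p) + full2 p * real_pairing C (g p)) \<in> borel_measurable ?Q"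
      by (intro borel_measurable_add borel_measurable_times um fm gm)
    show "(\<lambda>p. (u (snd p) * lift (fst p) + part1 N p) * real_pairing Bc (g p) + part2 N p * real_pairing C (g p)) \<in> borel_measurable ?Q" for N
      by (intro borel_measurable_add borel_measurable_times um pm gm)
    show "AE p in ?Q. (\<lambda>N. (u (snd p) * lift (fst p) + part1 N p) * real_pairing Bc (g p) + part2 N p * real_pairing C (g p))
      \<longlonglongrightarrow> (u (snd p) * lift (fst p) + full1 p) * real_pairing Bc (g p) + full2 p * real_pairing C (g p)"
      by (rule AE_I2) (intro tendsto_intros M; simp)
    show "AE p in ?Q. norm ((u (snd p) * lift (fst p) + part1 N p) * real_pairing Bc (g p) + part2 N p * real_pairing C (g p)) \<le> dom p" for N
    proof (rule AE_I2)
      fix p assume "p \<in> space ?Q"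
      then have p: "p \<in> space_time T" by simp
      let ?b = "norm (real_pairing Bc (g p))" and ?c = "norm (real_pairing C (g p))"
      have "norm ((u (snd p) * lift (fst p) + part1 N p) * real_pairing Bc (g p) + part2 N p * real_pairing C (g p))
         \<le> (M * ?W p) * ?b + (M * ?W p) * ?c"
        by (rule order_trans[OF norm_triangle_ineq], unfold norm_mult, intro add_mono mult_right_mono M(2,3)[OF p]) auto
      also have "\<dots> = M * (?W p * ?b + ?W p * ?c)" by (simp add: algebra_simps)
      also have "\<dots> \<le> M * (((?W p)\<^sup>2 + ?b\<^sup>2) + ((?W p)\<^sup>2 + ?c\<^sup>2))"
        by (intro mult_left_mono add_mono product_le_squares M(1))
      also have "\<dots> \<le> dom p"
      proof -
        have "(X + b) + (X + c) \<le> 2 * Y + b + c" if "X \<le> Y" for X Y b c :: real using that by linarith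
        from this[OF W2_le[OF p]] show ?thesis unfolding dom_def by (rule mult_left_mono[OF _ M(1)])
      qed
      finally show "norm ((u (snd p) * lift (fst p) + part1 N p) * real_pairing Bc (g p) + part2 N p * real_pairing C (g p)) \<le> dom p" .
    qed
  qed
qed

end

section \<open>Verification of the transposition identity\<close>

lemma of_real_deriv:
  assumes "(f has_real_derivative D) (at x)"
  shows "((\<lambda>x. complex_of_real (f x)) has_vector_derivative of_real D) (at x)"
  using assms by (intro bounded_linear.has_vector_derivative[OF bounded_linear_of_real])
     (simp add: has_real_derivative_iff_has_vector_derivative)

context controlled_solution
begin

text \<open>Continuity and vanishing to the left of 0. This removes the initial-time term of the
  lift in \<open>green\<close>, so the modes may start from the coefficients of \<open>y0\<close>
  itself.\<close>

lemma u_zero: "u 0 = 0"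
proof -
  have "(\<lambda>n. u (- inverse (real (Suc n)))) \<longlonglongrightarrow> u 0"
  proof (rule continuous_on_tendsto_compose[OF u_cont(1)[of UNIV]])
    have "(\<lambda>n. - inverse (real (Suc n))) \<longlonglongrightarrow> - 0" by (intro tendsto_minus LIMSEQ_inverse_real_of_nat)
    then show "(\<lambda>n. - inverse (real (Suc n))) \<longlonglongrightarrow> 0" by simp
  qed auto
  moreover have "u (- inverse (real (Suc n))) = 0" for n using u by (simp add: C1_supported_def)
  ultimately show ?thesis by (simp add: LIMSEQ_const_iff)
qed

lemma snk_deriv:
  "((snk k) has_vector_derivative of_real (real k * cos (real k * x))) (at x)"
  "((\<lambda>x. of_real (real k * cos (real k * x))) has_vector_derivative - (of_nat k ^ 2) * snk k x) (at x)"
proof -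
  show "((snk k) has_vector_derivative of_real (real k * cos (real k * x))) (at x)"
    unfolding snk_def[abs_def] by (rule of_real_deriv) (auto intro!: derivative_eq_intros)
  have "((\<lambda>x. real k * cos (real k * x)) has_real_derivative - (real k ^ 2) * sin (real k * x)) (at x)"
    by (auto intro!: derivative_eq_intros simp: power2_eq_square)
  from of_real_deriv[OF this]
  show "((\<lambda>x. of_real (real k * cos (real k * x))) has_vector_derivative - (of_nat k ^ 2) * snk k x) (at x)"
    by (simp add: snk_def)
qed

lemma lift_deriv: "(lift has_vector_derivative of_real (- 1 / pi)) (at x)"
  unfolding lift_def[abs_def] by (rule of_real_deriv) (auto intro!: derivative_eq_intros)

text \<open>The tail of the sine series of the lift: what remains uncancelled when the series of
  modes is truncated at \<open>N\<close>.\<close>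

definition resid :: "nat \<Rightarrow> real \<Rightarrow> real" where
  "resid N x = (1 - x / pi) - sine_proj N (\<lambda>x. 1 - x / pi) x"

lemma resid_cont: "continuous_on S (resid N)"
  unfolding resid_def[abs_def] by (intro continuous_intros) auto

lemma resid_eq: "complex_of_real (resid N x) = lift x - (\<Sum>k=1..N. gain k * snk k x)"
proof -
  have "sine_proj N (\<lambda>x. 1 - x / pi) x = (\<Sum>k=1..N. 2 / (pi * real k) * sin (real k * x))"
    unfolding sine_proj_def sum_distrib_left by (rule sum.cong) (simp_all add: csine_lift)
  then show ?thesis by (simp add: resid_def lift_def gain_def snk_def)
qed

text \<open>The tail depends on \<open>x\<close> only, so its squared norm over the cylinder is
  \<open>T\<close> times that on (0, pi), which tends to 0 by
  \<open>sine_proj_tendsto\<close>.\<close>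

lemma resid_pairing:
  fixes h :: "real \<Rightarrow> complex" and f :: "real \<times> real \<Rightarrow> complex"
  assumes T: "0 < T" and h: "continuous_on {0..T} h" and f: "L2_on (space_time T) f"
  shows "(\<lambda>N. LINT p|lebesgue_on (space_time T). complex_of_real (resid N (fst p)) * (h (snd p) * f p)) \<longlonglongrightarrow> 0"
proof (rule L2_null_pairing)
  let ?Q = "lebesgue_on (space_time T)"
  have st: "space_time T \<in> sets lebesgue" using space_time_lmeasurable[of T] by (simp add: fmeasurable_def)
  obtain K where K: "0 < K" "\<And>t. t \<in> {0..T} \<Longrightarrow> norm (h t) \<le> K" using cont_bounded_Icc[OF h] by blast
  have hm: "(\<lambda>p. h (snd p)) \<in> borel_measurable ?Q"
    by (rule continuous_imp_measurable_on_sets_lebesgue[OF _ st],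
        rule continuous_on_compose2[OF h continuous_on_snd[OF continuous_on_id]]) auto
  have fm: "f \<in> borel_measurable ?Q" and f2: "integrable ?Q (\<lambda>p. (norm (f p))\<^sup>2)" using f by (auto simp: L2_on_def)
  show m: "(\<lambda>p. h (snd p) * f p) \<in> borel_measurable ?Q" by (intro borel_measurable_times hm fm)
  show "integrable ?Q (\<lambda>p. (norm (h (snd p) * f p))\<^sup>2)"
  proof (rule Bochner_Integration.integrable_bound)
    show "integrable ?Q (\<lambda>p. K\<^sup>2 * (norm (f p))\<^sup>2)" by (intro integrable_mult_right f2)
    show "(\<lambda>p. (norm (h (snd p) * f p))\<^sup>2) \<in> borel_measurable ?Q" using m by measurable
    show "AE p in ?Q. norm ((norm (h (snd p) * f p))\<^sup>2) \<le> norm (K\<^sup>2 * (norm (f p))\<^sup>2)"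
    proof (rule AE_I2)
      fix p assume "p \<in> space ?Q"
      then have "norm (h (snd p)) \<le> K" by (intro K) auto
      then have "(norm (h (snd p)))\<^sup>2 \<le> K\<^sup>2" by (rule power_mono) simp
      then show "norm ((norm (h (snd p) * f p))\<^sup>2) \<le> norm (K\<^sup>2 * (norm (f p))\<^sup>2)"
        by (simp add: norm_mult power_mult_distrib mult_right_mono)
    qed
  qed
  have rm: "(\<lambda>p. resid N (fst p)) \<in> borel_measurable ?Q" for N
    by (rule continuous_imp_measurable_on_sets_lebesgue[OF _ st],
        rule continuous_on_compose2[OF resid_cont[of UNIV] continuous_on_fst[OF continuous_on_id]]) auto
  then show "(\<lambda>p. resid N (fst p)) \<in> borel_measurable ?Q" for N .
  have ci: "integrable ?Q (\<lambda>p. complex_of_real ((resid N (fst p))\<^sup>2))" for N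
  proof -
    obtain R where R: "\<And>x. x \<in> {0..pi} \<Longrightarrow> norm (resid N x) \<le> R" using cont_bounded_Icc[OF resid_cont] by blast
    have one: "integrable ?Q (\<lambda>p. 1 :: complex)"
      by (intro finite_measure.integrable_const finite_measure_lebesgue_on space_time_lmeasurable)
    have "integrable ?Q (\<lambda>p. complex_of_real ((resid N (fst p))\<^sup>2) * 1)"
    proof (rule integrable_mult_bounded[OF one, where K="R\<^sup>2"])
      show "(\<lambda>p. complex_of_real ((resid N (fst p))\<^sup>2)) \<in> borel_measurable ?Q" using rm[of N] by measurable
      show "norm (complex_of_real ((resid N (fst p))\<^sup>2)) \<le> R\<^sup>2" if "p \<in> space ?Q" for p
        using power_mono[OF R[of "fst p"], of 2] that by (auto simp: norm_power)
    qed
    then show ?thesis by simp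
  qed
  show ri: "integrable ?Q (\<lambda>p. (resid N (fst p))\<^sup>2)" for N
    using integrable_norm[OF ci[of N]] by (simp only: norm_of_real abs_power2)
  have "(LINT p|?Q. (resid N (fst p))\<^sup>2) = T * (LINT x|Omega. (resid N x)\<^sup>2)" for N
  proof -
    have "(LINT p|?Q. complex_of_real ((resid N (fst p))\<^sup>2)) =
        (LINT t|lebesgue_on {0<..<T}. LINT x|Omega. complex_of_real ((resid N x)\<^sup>2))"
      using Fubini_lebesgue_on(3)[OF ci[of N]] by simp
    also have "\<dots> = of_real (T * (LINT x|Omega. (resid N x)\<^sup>2))"
      using T by (simp add: measure_restrict_space scaleR_conv_of_real del: of_real_power)
    finally show ?thesis by (simp only: integral_complex_of_real of_real_eq_iff)
  qed
  moreover have "(\<lambda>N. T * (LINT x|Omega. (resid N x)\<^sup>2)) \<longlonglongrightarrow> T * 0"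
    unfolding resid_def by (intro tendsto_intros sine_proj_tendsto) (auto intro!: continuous_intros)
  ultimately show "(\<lambda>N. LINT p|?Q. (resid N (fst p))\<^sup>2) \<longlonglongrightarrow> 0" by simp
qed

text \<open>Linearity in the spatial profile together with Fubini: the source of the lift minus the
  sources of the first \<open>N\<close> modes is a pairing with the tail.\<close>

lemma resid_mode:
  assumes S: "scalar_adjoint T f fx fxx ft" and h: "continuous_on {0..T} h"
  shows "(LINT t|lebesgue_on {0<..<T}. h t * scalar_adjoint.mode f lift t)
      - (\<Sum>k=1..N. gain k * (LINT t|lebesgue_on {0<..<T}. h t * scalar_adjoint.mode f (snk k) t)) =
     (LINT p|lebesgue_on (space_time T). complex_of_real (resid N (fst p)) * (h (snd p) * f p))"
proof -
  interpret S: scalar_adjoint T f fx fxx ft by (rule S)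
  let ?Q = "lebesgue_on (space_time T)"
  have e: "(LINT t|lebesgue_on {0<..<T}. h t * S.mode s t) = (LINT p|?Q. (h (snd p) * s (fst p)) * f p)"
    if "continuous_on {0..pi} s" for s
    unfolding S.mode_def by (rule S.fubini(2)[OF h that S.f_int, symmetric])
  have i: "integrable ?Q (\<lambda>p. (h (snd p) * lift (fst p)) * f p)" "integrable ?Q (\<lambda>p. (h (snd p) * snk k (fst p)) * f p)" for k
    by (intro S.integrable_product h lift_cont snk_cont S.f_int)+
  have "(LINT p|?Q. complex_of_real (resid N (fst p)) * (h (snd p) * f p)) =
      (LINT p|?Q. (h (snd p) * lift (fst p)) * f p - (\<Sum>k=1..N. gain k * ((h (snd p) * snk k (fst p)) * f p)))"
    unfolding resid_eq
    by (rule Bochner_Integration.integral_cong[OF refl])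
       (simp add: left_diff_distrib right_diff_distrib sum_distrib_right sum_distrib_left mult_ac)
  also have "\<dots> = (LINT p|?Q. (h (snd p) * lift (fst p)) * f p) - (\<Sum>k=1..N. gain k * (LINT p|?Q. (h (snd p) * snk k (fst p)) * f p))"
  proof -
    have j: "integrable ?Q (\<lambda>p. gain k * ((h (snd p) * snk k (fst p)) * f p))" for k
      by (rule integrable_mult_right[OF i(2)])
    show ?thesis
      unfolding Bochner_Integration.integral_diff[OF i(1) Bochner_Integration.integrable_sum[OF j]]
        Bochner_Integration.integral_sum[OF j] by simp
  qed
  finally show ?thesis unfolding e[OF lift_cont] e[OF snk_cont] by simp
qed

text \<open>Partial sums are tested with \<open>green\<close>. Every mode leaves its initial value
  plus a source term, and the lift leaves the boundary trace minus the same source with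
  \<open>1 - x / pi\<close> in place of its sine sum. The two sources cancel up to the tail, which
  tends to 0, while the initial values converge by Parseval's formula.\<close>

lemma sol_transposition:
  assumes T: "0 < T"
  shows "transposition_solution A B T y0 u sol"
  unfolding transposition_solution_def
proof (intro conjI allI impI sol_L2(1)[OF T])
  fix g \<phi> \<phi>x assume "L2_on (space_time T) g \<and> strong_adjoint_solution A T g \<phi> \<phi>x"
  then have g: "L2_on (space_time T) g" and strong: "strong_adjoint_solution A T g \<phi> \<phi>x" by auto
  obtain \<phi>xx \<phi>t where SA: "\<And>w. scalar_adjoint T (\<lambda>p. real_pairing w (\<phi> p)) (\<lambda>p. real_pairing w (\<phi>x p))
        (\<lambda>p. real_pairing w (\<phi>xx p)) (\<lambda>p. real_pairing w (\<phi>t p))"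
    and ae: "\<And>w. AE p in lebesgue_on (space_time T). real_pairing w (g p) =
        - real_pairing w (\<phi>t p) - real_pairing w (\<phi>xx p) - real_pairing (cmat A *v w) (\<phi> p)"
    by (rule strong_adjoint_pairing[OF T strong]) blast
  interpret sB: scalar_adjoint T "\<lambda>p. real_pairing Bc (\<phi> p)" "\<lambda>p. real_pairing Bc (\<phi>x p)"
        "\<lambda>p. real_pairing Bc (\<phi>xx p)" "\<lambda>p. real_pairing Bc (\<phi>t p)" by (rule SA)
  interpret sC: scalar_adjoint T "\<lambda>p. real_pairing C (\<phi> p)" "\<lambda>p. real_pairing C (\<phi>x p)"
        "\<lambda>p. real_pairing C (\<phi>xx p)" "\<lambda>p. real_pairing C (\<phi>t p)" by (rule SA)
  let ?Q = "lebesgue_on (space_time T)" and ?N = "lebesgue_on {0<..<T}"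
  have st: "space_time T \<in> sets lebesgue" using space_time_lmeasurable[of T] by (simp add: fmeasurable_def)
  define gB gC where "gB p = real_pairing Bc (g p)" "gC p = real_pairing C (g p)" for p
  have gi: "integrable ?Q gB" "integrable ?Q gC"
    unfolding gB_gC_def[abs_def]
    by (intro L2_integrable[OF L2_on_bounded_linear[OF real_pairing_bounded_linear g] space_time_lmeasurable])+
  have aeB: "AE p in ?Q. gB p = (- real_pairing Bc (\<phi>t p) - real_pairing Bc (\<phi>xx p))
      - (\<mu>1 * real_pairing Bc (\<phi> p) + real_pairing C (\<phi> p))"
    using ae[of Bc] unfolding gB_gC_def Bc(2) real_pairing_add_left real_pairing_scale_left .
  have aeC: "AE p in ?Q. gC p = (- real_pairing C (\<phi>t p) - real_pairing C (\<phi>xx p)) - \<mu>2 * real_pairing C (\<phi> p)"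
    using ae[of C] unfolding gB_gC_def Bc(3) real_pairing_scale_left .
  note vd_cont = has_vector_derivative_continuous
  \<comment> \<open>Green's formula combined with the adjoint equation paired with \<open>Bc\<close>
    and \<open>C\<close>: the first brings in \<open>\<mu>1\<close> and the coupling to
    \<open>C\<close>, the second \<open>\<mu>2\<close> alone.\<close>
  have pairB: "(LINT p|?Q. (h (snd p) * s (fst p)) * gB p) =
      h 0 * sB.mode s 0 + (LINT t|?N. h' t * sB.mode s t) - (LINT t|?N. h t * sB.mode s'' t)
       + s 0 * (LINT t|?N. h t * real_pairing Bc (\<phi>x (0, t)))
       - (\<mu>1 * (LINT t|?N. h t * sB.mode s t) + (LINT t|?N. h t * sC.mode s t))"
    and pairC: "(LINT p|?Q. (h (snd p) * s (fst p)) * gC p) =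
      h 0 * sC.mode s 0 + (LINT t|?N. h' t * sC.mode s t) - (LINT t|?N. h t * sC.mode s'' t)
       + s 0 * (LINT t|?N. h t * real_pairing C (\<phi>x (0, t)))
       - \<mu>2 * (LINT t|?N. h t * sC.mode s t)"
    if h: "\<And>t. t \<in> {0..T} \<Longrightarrow> (h has_vector_derivative h' t) (at t within {0..T})" "continuous_on {0..T} h'"
    and s: "\<And>x. (s has_vector_derivative s' x) (at x)" "\<And>x. (s' has_vector_derivative s'' x) (at x)" "continuous_on UNIV s''"
    and s_pi: "s pi = 0"
    for h h' s s' s''
  proof -
    have hc: "continuous_on {0..T} h"
      using h(1) by (meson vd_cont continuous_on_eq_continuous_within)
    have sc: "continuous_on {0..pi} s"
      using s(1) by (meson vd_cont continuous_at_imp_continuous_on)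
    let ?hs = "\<lambda>p. h (snd p) * s (fst p)"
    let ?LB = "\<lambda>p. - real_pairing Bc (\<phi>t p) - real_pairing Bc (\<phi>xx p)"
    let ?LC = "\<lambda>p. - real_pairing C (\<phi>t p) - real_pairing C (\<phi>xx p)"
    have gB: "(LINT p|?Q. ?hs p * ?LB p) = h 0 * sB.mode s 0 + (LINT t|?N. h' t * sB.mode s t) - (LINT t|?N. h t * sB.mode s'' t)
       + s 0 * (LINT t|?N. h t * real_pairing Bc (\<phi>x (0, t)))"
      by (rule sB.green[OF h s s_pi])
    have gC: "(LINT p|?Q. ?hs p * ?LC p) = h 0 * sC.mode s 0 + (LINT t|?N. h' t * sC.mode s t) - (LINT t|?N. h t * sC.mode s'' t)
       + s 0 * (LINT t|?N. h t * real_pairing C (\<phi>x (0, t)))"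
      by (rule sC.green[OF h s s_pi])
    have iLB: "integrable ?Q (\<lambda>p. ?hs p * ?LB p)" and iLC: "integrable ?Q (\<lambda>p. ?hs p * ?LC p)"
      by (intro sB.integrable_product hc sc Bochner_Integration.integrable_diff Bochner_Integration.integrable_minus sB.ft_int sB.fxx_int sC.ft_int sC.fxx_int)+
    have iB: "integrable ?Q (\<lambda>p. ?hs p * real_pairing Bc (\<phi> p))" and iC: "integrable ?Q (\<lambda>p. ?hs p * real_pairing C (\<phi> p))"
      by (intro sB.integrable_product hc sc sB.f_int sC.f_int)+
    have "(LINT p|?Q. ?hs p * gB p) = (LINT p|?Q. ?hs p * ?LB p - (\<mu>1 * (?hs p * real_pairing Bc (\<phi> p)) + ?hs p * real_pairing C (\<phi> p)))"
    proof (rule integrable_lebesgue_on_cong_AE(2)[OF sB.integrable_product[OF hc sc gi(1)] _ st])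
      show "AE p in ?Q. ?hs p * gB p = ?hs p * ?LB p - (\<mu>1 * (?hs p * real_pairing Bc (\<phi> p)) + ?hs p * real_pairing C (\<phi> p))"
        using aeB
      proof eventually_elim
        case (elim p)
        show ?case unfolding elim by (simp add: algebra_simps)
      qed
    qed
    also have "\<dots> = (LINT p|?Q. ?hs p * ?LB p) - (\<mu>1 * (LINT p|?Q. ?hs p * real_pairing Bc (\<phi> p)) + (LINT p|?Q. ?hs p * real_pairing C (\<phi> p)))"
    proof -
      have m: "integrable ?Q (\<lambda>p. \<mu>1 * (?hs p * real_pairing Bc (\<phi> p)))" by (rule integrable_mult_right[OF iB])
      show ?thesis
        unfolding Bochner_Integration.integral_diff[OF iLB Bochner_Integration.integrable_add[OF m iC]]
          Bochner_Integration.integral_add[OF m iC] by simp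
    qed
    finally show "(LINT p|?Q. ?hs p * gB p) =
      h 0 * sB.mode s 0 + (LINT t|?N. h' t * sB.mode s t) - (LINT t|?N. h t * sB.mode s'' t)
       + s 0 * (LINT t|?N. h t * real_pairing Bc (\<phi>x (0, t)))
       - (\<mu>1 * (LINT t|?N. h t * sB.mode s t) + (LINT t|?N. h t * sC.mode s t))"
      unfolding gB sB.fubini(2)[OF hc sc sB.f_int] sB.fubini(2)[OF hc sc sC.f_int]
        sB.mode_def[symmetric] sC.mode_def[symmetric] .
    have "(LINT p|?Q. ?hs p * gC p) = (LINT p|?Q. ?hs p * ?LC p - \<mu>2 * (?hs p * real_pairing C (\<phi> p)))"
    proof (rule integrable_lebesgue_on_cong_AE(2)[OF sB.integrable_product[OF hc sc gi(2)] _ st])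
      show "AE p in ?Q. ?hs p * gC p = ?hs p * ?LC p - \<mu>2 * (?hs p * real_pairing C (\<phi> p))"
        using aeC
      proof eventually_elim
        case (elim p)
        show ?case unfolding elim by (simp add: algebra_simps)
      qed
    qed
    also have "\<dots> = (LINT p|?Q. ?hs p * ?LC p) - \<mu>2 * (LINT p|?Q. ?hs p * real_pairing C (\<phi> p))"
      unfolding Bochner_Integration.integral_diff[OF iLC integrable_mult_right[OF iC]] by simp
    finally show "(LINT p|?Q. ?hs p * gC p) =
      h 0 * sC.mode s 0 + (LINT t|?N. h' t * sC.mode s t) - (LINT t|?N. h t * sC.mode s'' t)
       + s 0 * (LINT t|?N. h t * real_pairing C (\<phi>x (0, t))) - \<mu>2 * (LINT t|?N. h t * sC.mode s t)"
      unfolding gC sC.fubini(2)[OF hc sc sC.f_int] sC.mode_def[symmetric] .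
  qed
  have mc: "continuous_on {0..T} (sB.mode s)" "continuous_on {0..T} (sC.mode s)" if "continuous_on {0..pi} s" for s
    by (intro sB.mode_cont sC.mode_cont that)+
  have inN: "integrable ?N (\<lambda>t. h t * m t)" if "continuous_on {0..T} h" "continuous_on {0..T} m" for h m :: "real \<Rightarrow> complex"
    by (intro integrable_cont_Ioo continuous_on_mult that)
  define XB XC where "XB k = (LINT t|?N. src t * sB.mode (snk k) t)" "XC k = (LINT t|?N. u t * sC.mode (snk k) t)" for k
  \<comment> \<open>By the differential equations of \<open>z1\<close> and \<open>z2\<close> the
    interior terms \<open>X1\<close>, \<open>X2\<close>, \<open>X3\<close> all cancel, leaving the
    initial values and the sources.\<close>
  have mode_k: "(LINT p|?Q. (z1 k (snd p) * snk k (fst p)) * gB p) + (LINT p|?Q. (z2 k (snd p) * snk k (fst p)) * gC p)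
     = coeff1 k * sB.mode (snk k) 0 + coeff2 k * sC.mode (snk k) 0 + gain k * (XB k + XC k)" for k
  proof -
    let ?s2 = "\<lambda>x. - (of_nat k ^ 2) * snk k x"
    have s: "snk k pi = 0" "snk k 0 = 0" by (simp_all add: snk_def sin_npi)
    have s2: "continuous_on UNIV ?s2" by (intro continuous_intros snk_cont)
    have m2: "sB.mode ?s2 t = - (of_nat k ^ 2) * sB.mode (snk k) t" "sC.mode ?s2 t = - (of_nat k ^ 2) * sC.mode (snk k) t" for t
      by (simp_all add: sB.mode_def sC.mode_def mult.assoc)
    note mk = mc[OF snk_cont[of _ k]]
    define X1 X2 X3 where "X1 = (LINT t|?N. z1 k t * sB.mode (snk k) t)" "X2 = (LINT t|?N. z1 k t * sC.mode (snk k) t)"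
      "X3 = (LINT t|?N. z2 k t * sC.mode (snk k) t)"
    have d1: "continuous_on {0..T} (\<lambda>t. (\<mu>1 - of_nat k ^ 2) * z1 k t + gain k * src t)"
      and d2: "continuous_on {0..T} (\<lambda>t. (\<mu>2 - of_nat k ^ 2) * z2 k t + z1 k t + gain k * u t)"
      by (intro continuous_intros z_cont u_cont)+
    have e1: "(LINT t|?N. ((\<mu>1 - of_nat k ^ 2) * z1 k t + gain k * src t) * sB.mode (snk k) t) = (\<mu>1 - of_nat k ^ 2) * X1 + gain k * XB k"
    proof -
      have "(LINT t|?N. ((\<mu>1 - of_nat k ^ 2) * z1 k t + gain k * src t) * sB.mode (snk k) t) =
         (LINT t|?N. (\<mu>1 - of_nat k ^ 2) * (z1 k t * sB.mode (snk k) t) + gain k * (src t * sB.mode (snk k) t))"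
        by (simp add: distrib_right mult.assoc)
      also have "\<dots> = (\<mu>1 - of_nat k ^ 2) * X1 + gain k * XB k"
        unfolding X1_X2_X3_def XB_XC_def
        by (subst Bochner_Integration.integral_add) (intro integrable_mult_right inN z_cont u_cont mk | simp)+
      finally show ?thesis .
    qed
    have e2: "(LINT t|?N. ((\<mu>2 - of_nat k ^ 2) * z2 k t + z1 k t + gain k * u t) * sC.mode (snk k) t) = (\<mu>2 - of_nat k ^ 2) * X3 + X2 + gain k * XC k"
    proof -
      have "(LINT t|?N. ((\<mu>2 - of_nat k ^ 2) * z2 k t + z1 k t + gain k * u t) * sC.mode (snk k) t) =
         (LINT t|?N. ((\<mu>2 - of_nat k ^ 2) * (z2 k t * sC.mode (snk k) t) + z1 k t * sC.mode (snk k) t) + gain k * (u t * sC.mode (snk k) t))"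
        by (simp add: distrib_right mult.assoc)
      also have "\<dots> = (\<mu>2 - of_nat k ^ 2) * X3 + X2 + gain k * XC k"
        unfolding X1_X2_X3_def XB_XC_def
        by (subst Bochner_Integration.integral_add, intro Bochner_Integration.integrable_add integrable_mult_right inN z_cont u_cont mk,
            intro integrable_mult_right inN z_cont u_cont mk, subst Bochner_Integration.integral_add)
           (intro integrable_mult_right inN z_cont u_cont mk | simp)+
      finally show ?thesis .
    qed
    have e3: "(LINT t|?N. z1 k t * (- (of_nat k ^ 2) * sB.mode (snk k) t)) = - (of_nat k ^ 2) * X1"
      "(LINT t|?N. z2 k t * (- (of_nat k ^ 2) * sC.mode (snk k) t)) = - (of_nat k ^ 2) * X3"
      by (simp_all add: X1_X2_X3_def mult.left_commute)
    have B1: "(LINT p|?Q. (z1 k (snd p) * snk k (fst p)) * gB p) =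
      coeff1 k * sB.mode (snk k) 0 + ((\<mu>1 - of_nat k ^ 2) * X1 + gain k * XB k) - (- (of_nat k ^ 2) * X1) - (\<mu>1 * X1 + X2)"
      using pairB[OF z1_deriv d1 snk_deriv s2 s(1)] unfolding m2 e1 e3 z_initial s X1_X2_X3_def[symmetric] by simp
    have C1: "(LINT p|?Q. (z2 k (snd p) * snk k (fst p)) * gC p) =
      coeff2 k * sC.mode (snk k) 0 + ((\<mu>2 - of_nat k ^ 2) * X3 + X2 + gain k * XC k) - (- (of_nat k ^ 2) * X3) - \<mu>2 * X3"
      using pairC[OF z2_deriv d2 snk_deriv s2 s(1)] unfolding m2 e2 e3 z_initial s X1_X2_X3_def[symmetric] by simp
    show ?thesis unfolding B1 C1 by (simp add: algebra_simps)
  qed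
  define YB YC where "YB = (LINT t|?N. src t * sB.mode lift t)" "YC = (LINT t|?N. u t * sC.mode lift t)"
  define bdry where "bdry = (LINT t|?N. u t * real_pairing Bc (\<phi>x (0, t)))"
  \<comment> \<open>The lift is affine, so its second derivative drops out, and its value 1 at
    \<open>x = 0\<close> produces the boundary trace.\<close>
  have lift_id: "(LINT p|?Q. (u (snd p) * lift (fst p)) * gB p) = bdry - (YB + YC)"
  proof -
    have l: "lift pi = 0" "lift 0 = 1" by (simp_all add: lift_def)
    have ud: "(u has_vector_derivative u' t) (at t within {0..T})" for t
      using u by (auto simp: C1_supported_def intro: has_vector_derivative_at_within)
    have z: "sB.mode (\<lambda>x. 0) t = 0" for t by (simp add: sB.mode_def)
    have "YB = (LINT t|?N. \<mu>1 * (u t * sB.mode lift t) - u' t * sB.mode lift t)"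
      unfolding YB_YC_def src_def by (simp add: left_diff_distrib mult.assoc)
    also have "\<dots> = \<mu>1 * (LINT t|?N. u t * sB.mode lift t) - (LINT t|?N. u' t * sB.mode lift t)"
      by (subst Bochner_Integration.integral_diff) (intro integrable_mult_right inN u_cont mc lift_cont | simp)+
    finally have YB: "YB = \<mu>1 * (LINT t|?N. u t * sB.mode lift t) - (LINT t|?N. u' t * sB.mode lift t)" .
    show ?thesis
      using pairB[of u u' lift "\<lambda>x. of_real (- 1 / pi)" "\<lambda>x. 0", OF ud u_cont(2) lift_deriv has_vector_derivative_const continuous_on_const l(1)]
      unfolding z l u_zero bdry_def[symmetric] YB_YC_def(2)[symmetric] YB by simp
  qed
  have part_int: "integrable ?Q (\<lambda>p. (z1 k (snd p) * snk k (fst p)) * gB p)" "integrable ?Q (\<lambda>p. (z2 k (snd p) * snk k (fst p)) * gC p)"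
    "integrable ?Q (\<lambda>p. (u (snd p) * lift (fst p)) * gB p)" for k
    by (intro sB.integrable_product z_cont snk_cont u_cont lift_cont gi)+
  have partial: "(LINT p|?Q. (u (snd p) * lift (fst p) + part1 N p) * real_pairing Bc (g p) + part2 N p * real_pairing C (g p))
     = bdry + (\<Sum>k=1..N. coeff1 k * sB.mode (snk k) 0) + (\<Sum>k=1..N. coeff2 k * sC.mode (snk k) 0)
       - (YB + YC - (\<Sum>k=1..N. gain k * (XB k + XC k)))" for N
  proof -
    have "(LINT p|?Q. (u (snd p) * lift (fst p) + part1 N p) * real_pairing Bc (g p) + part2 N p * real_pairing C (g p))
       = (LINT p|?Q. (u (snd p) * lift (fst p)) * gB p +
           (\<Sum>k=1..N. (z1 k (snd p) * snk k (fst p)) * gB p + (z2 k (snd p) * snk k (fst p)) * gC p))"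
      by (simp add: part1_def part2_def gB_gC_def distrib_right sum_distrib_right sum.distrib add.assoc)
    also have "\<dots> = (LINT p|?Q. (u (snd p) * lift (fst p)) * gB p) +
       (\<Sum>k=1..N. (LINT p|?Q. (z1 k (snd p) * snk k (fst p)) * gB p) + (LINT p|?Q. (z2 k (snd p) * snk k (fst p)) * gC p))"
    proof -
      have i: "integrable ?Q (\<lambda>p. (z1 k (snd p) * snk k (fst p)) * gB p + (z2 k (snd p) * snk k (fst p)) * gC p)" for k
        by (intro Bochner_Integration.integrable_add part_int)
      show ?thesis
        unfolding Bochner_Integration.integral_add[OF part_int(3) Bochner_Integration.integrable_sum[OF i]]
          Bochner_Integration.integral_sum[OF i] Bochner_Integration.integral_add[OF part_int(1,2)] ..
    qed
    finally show ?thesis unfolding mode_k lift_id by (simp add: sum.distrib)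
  qed
  \<comment> \<open>The truncation error: the sine tail of the lift paired with \<open>src\<close>
    in the direction of \<open>Bc\<close> and with \<open>u\<close> in the direction of
    \<open>C\<close>.\<close>
  define E where "E N = (LINT p|?Q. complex_of_real (resid N (fst p)) * (src (snd p) * real_pairing Bc (\<phi> p)))
      + (LINT p|?Q. complex_of_real (resid N (fst p)) * (u (snd p) * real_pairing C (\<phi> p)))" for N
  have err: "YB + YC - (\<Sum>k=1..N. gain k * (XB k + XC k)) = E N" for N
    unfolding E_def YB_YC_def XB_XC_def
    unfolding resid_mode[OF SA u_cont(3), symmetric] resid_mode[OF SA u_cont(1), symmetric]
    by (simp add: distrib_left sum.distrib)
  have E: "E \<longlonglongrightarrow> 0 + 0"
    unfolding E_def[abs_def] by (intro tendsto_add resid_pairing[OF T] u_cont sB.L2 sC.L2)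
  have T0': "0 \<in> {0..T}" using T by simp
  have initB: "(\<lambda>N. \<Sum>k=1..N. coeff1 k * sB.mode (snk k) 0) \<longlonglongrightarrow> (LINT x|Omega. real_pairing Bc (\<phi> (x, 0)) * y1 x)"
  proof -
    have "(\<Sum>k=1..N. coeff1 k * sB.mode (snk k) 0) = 2 / pi * (\<Sum>k=1..N. csine k (\<lambda>x. real_pairing Bc (\<phi> (x, 0))) * csine k y1)" for N
      by (simp add: coeff1_def sB.mode_def csine_def[of _ "\<lambda>x. real_pairing Bc (\<phi> (x, 0))"] snk_def sum_distrib_left mult_ac)
    then show ?thesis using sine_pairing[OF y(1) sB.f_cont[OF T0']] by simp
  qed
  have initC: "(\<lambda>N. \<Sum>k=1..N. coeff2 k * sC.mode (snk k) 0) \<longlonglongrightarrow> (LINT x|Omega. real_pairing C (\<phi> (x, 0)) * y2 x)"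
  proof -
    have "(\<Sum>k=1..N. coeff2 k * sC.mode (snk k) 0) = 2 / pi * (\<Sum>k=1..N. csine k (\<lambda>x. real_pairing C (\<phi> (x, 0))) * csine k y2)" for N
      by (simp add: coeff2_def sC.mode_def csine_def[of _ "\<lambda>x. real_pairing C (\<phi> (x, 0))"] snk_def sum_distrib_left mult_ac)
    then show ?thesis using sine_pairing[OF y(2) sC.f_cont[OF T0']] by simp
  qed
  have init: "(LINT x|Omega. real_pairing (y0 x) (\<phi> (x, 0))) =
      (LINT x|Omega. real_pairing Bc (\<phi> (x, 0)) * y1 x) + (LINT x|Omega. real_pairing C (\<phi> (x, 0)) * y2 x)"
  proof -
    have i: "integrable Omega (\<lambda>x. real_pairing Bc (\<phi> (x, 0)) * y1 x)" "integrable Omega (\<lambda>x. real_pairing C (\<phi> (x, 0)) * y2 x)"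
      by (intro integrable_mult_cont_Ioo L2_Omega_integrable y sB.f_cont[OF T0'] sC.f_cont[OF T0'])+
    show ?thesis
      unfolding y0 real_pairing_sol Bochner_Integration.integral_add[OF i, symmetric] by (simp add: mult.commute)
  qed
  have bd: "bdry = (LINT t|?N. complex_of_real (B \<bullet> \<phi>x (0, t)) * u t)"
    unfolding bdry_def Bc(1) real_pairing_def by (simp add: inner_vec_def mult.commute)
  have "(\<lambda>N. LINT p|?Q. (u (snd p) * lift (fst p) + part1 N p) * real_pairing Bc (g p) + part2 N p * real_pairing C (g p))
     \<longlonglongrightarrow> bdry + (LINT x|Omega. real_pairing Bc (\<phi> (x, 0)) * y1 x) + (LINT x|Omega. real_pairing C (\<phi> (x, 0)) * y2 x) - (0 + 0)"
    unfolding partial err by (intro tendsto_intros initB initC E)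
  from LIMSEQ_unique[OF sol_L2(2)[OF T g] this]
  show "(LINT p|?Q. real_pairing (sol p) (g p)) =
        (LINT x|lebesgue_on {0<..<pi}. real_pairing (y0 x) (\<phi> (x, 0))) +
        (LINT t|?N. complex_of_real (B \<bullet> \<phi>x (0, t)) * u t)"
    unfolding init bd by simp
qed

end

section \<open>Sufficiency\<close>

text \<open>A set of eigenvalues does not record multiplicity. The characteristic equation is
  invariant under replacing \<open>\<mu>\<close> by trace minus \<open>\<mu>\<close>, and this
  symmetry of the set forces the trace to be \<open>\<mu>1 + \<mu>2\<close>, also when the two
  coincide; the determinant follows.\<close>

lemma complex_eigenvalues_2:
  assumes "complex_eigenvalues (A :: real^2^2) = {\<mu>1, \<mu>2}"
  shows "of_real (A $ 1 $ 1) + of_real (A $ 2 $ 2) = \<mu>1 + \<mu>2"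
    "of_real (A $ 1 $ 1) * of_real (A $ 2 $ 2) - of_real (A $ 1 $ 2) * of_real (A $ 2 $ 1) = \<mu>1 * \<mu>2"
proof -
  define a b c d where "a = complex_of_real (A $ 1 $ 1)" "b = complex_of_real (A $ 1 $ 2)"
    "c = complex_of_real (A $ 2 $ 1)" "d = complex_of_real (A $ 2 $ 2)"
  have eq: "(\<chi> i j. complex_of_real (A $ i $ j)) *v v = \<mu> *s v \<longleftrightarrow>
      a * v $ 1 + b * v $ 2 = \<mu> * v $ 1 \<and> c * v $ 1 + d * v $ 2 = \<mu> * v $ 2" for v \<mu>
    by (simp add: vec_eq_iff forall_2 matrix_vector_mult_def sum_2 a_b_c_d_def)
  have char: "\<mu> \<in> complex_eigenvalues A \<longleftrightarrow> (a - \<mu>) * (d - \<mu>) = b * c" for \<mu>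
  proof
    assume "\<mu> \<in> complex_eigenvalues A"
    then have "\<exists>v::complex^2. v \<noteq> 0 \<and> a * v $ 1 + b * v $ 2 = \<mu> * v $ 1 \<and> c * v $ 1 + d * v $ 2 = \<mu> * v $ 2"
      by (simp only: complex_eigenvalues_def mem_Collect_eq eq)
    then obtain v :: "complex^2" where v: "v \<noteq> 0"
      and e: "a * v $ 1 + b * v $ 2 = \<mu> * v $ 1" "c * v $ 1 + d * v $ 2 = \<mu> * v $ 2" by blast
    have "v $ 1 \<noteq> 0 \<or> v $ 2 \<noteq> 0" using v by (simp add: vec_eq_iff forall_2)
    moreover    have "((a - \<mu>) * (d - \<mu>) - b * c) * v $ 1 = 0" "((a - \<mu>) * (d - \<mu>) - b * c) * v $ 2 = 0"
    proof -
      have "((a - \<mu>) * (d - \<mu>) - b * c) * v $ 1 =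
          (d - \<mu>) * (a * v $ 1 + b * v $ 2 - \<mu> * v $ 1) - b * (c * v $ 1 + d * v $ 2 - \<mu> * v $ 2)"
        "((a - \<mu>) * (d - \<mu>) - b * c) * v $ 2 =
          (a - \<mu>) * (c * v $ 1 + d * v $ 2 - \<mu> * v $ 2) - c * (a * v $ 1 + b * v $ 2 - \<mu> * v $ 1)"
        by (simp_all add: algebra_simps)
      then show "((a - \<mu>) * (d - \<mu>) - b * c) * v $ 1 = 0" "((a - \<mu>) * (d - \<mu>) - b * c) * v $ 2 = 0"
        by (simp_all add: e)
    qed
    ultimately show "(a - \<mu>) * (d - \<mu>) = b * c" by auto
  next
    assume h: "(a - \<mu>) * (d - \<mu>) = b * c"
    \<comment> \<open>The eigenvector is read off the first row as \<open>(b, \<mu> - a)\<close>; if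
      that is zero, off the second row as \<open>(\<mu> - d, c)\<close>, and if both vanish, any
      vector works.\<close>
    have "\<exists>x y. (x \<noteq> 0 \<or> y \<noteq> 0) \<and> a * x + b * y = \<mu> * x \<and> c * x + d * y = \<mu> * y"
    proof (cases "b = 0 \<and> \<mu> = a")
      case True
      show ?thesis
      proof (cases "\<mu> = d \<and> c = 0")
        case True
        with \<open>b = 0 \<and> \<mu> = a\<close> show ?thesis by (intro exI[of _ 1] exI[of _ 0]) auto
      next
        case False
        with True show ?thesis by (intro exI[of _ "\<mu> - d"] exI[of _ c]) (auto simp: algebra_simps)
      qed
    next
      case False
      then show ?thesis using h by (intro exI[of _ b] exI[of _ "\<mu> - a"]) (auto simp: algebra_simps)
    qed
    then obtain x y where xy: "x \<noteq> 0 \<or> y \<noteq> 0" "a * x + b * y = \<mu> * x" "c * x + d * y = \<mu> * y" by blast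
    define v :: "complex^2" where "v = (\<chi> i. if i = 1 then x else y)"
    have "v $ 1 = x" "v $ 2 = y" by (simp_all add: v_def)
    then show "\<mu> \<in> complex_eigenvalues A"
      unfolding complex_eigenvalues_def eq using xy by (intro CollectI exI[of _ v]) (auto simp: vec_eq_iff)
  qed
  have other: "a + d - \<mu> \<in> complex_eigenvalues A" if "\<mu> \<in> complex_eigenvalues A" for \<mu>
    using that unfolding char by (simp add: algebra_simps)
  have tr: "a + d = \<mu>1 + \<mu>2"
  proof -
    have "a + d - \<mu>1 = \<mu>1 \<or> a + d - \<mu>1 = \<mu>2" "a + d - \<mu>2 = \<mu>1 \<or> a + d - \<mu>2 = \<mu>2"
      using other[of \<mu>1] other[of \<mu>2] assms by auto
    then show ?thesis by (auto simp: algebra_simps)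
  qed
  then show "of_real (A $ 1 $ 1) + of_real (A $ 2 $ 2) = \<mu>1 + \<mu>2" by (simp add: a_b_c_d_def)
  have "(a - \<mu>1) * (d - \<mu>1) = b * c" using char[of \<mu>1] assms by simp
  then have "a * d - b * c = \<mu>1 * (a + d - \<mu>1)" by (simp add: algebra_simps)
  then have "a * d - b * c = \<mu>1 * \<mu>2" by (simp add: tr)
  then show "of_real (A $ 1 $ 1) * of_real (A $ 2 $ 2) - of_real (A $ 1 $ 2) * of_real (A $ 2 $ 1) = \<mu>1 * \<mu>2"
    by (simp add: a_b_c_d_def)
qed

lemma kalman_2:
  assumes "rank (transpose (vector [B, A *v B]) :: real^2^2) = 2"
  shows "B $ 1 * (A *v B) $ 2 - B $ 2 * (A *v B) $ 1 \<noteq> 0"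
proof -
  have "det (transpose (vector [B, A *v B]) :: real^2^2) \<noteq> 0" using assms by (simp add: det_eq_0_rank rank_transpose)
  then show ?thesis by (simp add: det_2 transpose_def mult.commute)
qed

text \<open>Trace and determinant fix the eigenvalues with multiplicity and are symmetric in
  \<open>\<mu>1\<close>, \<open>\<mu>2\<close>, so the locale can be instantiated a second time with
  the eigenvalues exchanged.\<close>

locale controllable_pair =
  fixes A :: "real^2^2" and B :: "real^2" and \<mu>1 \<mu>2 :: complex
  assumes trace: "of_real (A $ 1 $ 1) + of_real (A $ 2 $ 2) = \<mu>1 + \<mu>2"
    and det: "of_real (A $ 1 $ 1) * of_real (A $ 2 $ 2) - of_real (A $ 1 $ 2) * of_real (A $ 2 $ 1) = \<mu>1 * \<mu>2"
    and kalman: "B $ 1 * (A *v B) $ 2 - B $ 2 * (A *v B) $ 1 \<noteq> 0"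
begin

definition Bc :: "complex^2" where "Bc = (\<chi> i. of_real (B $ i))"

definition C :: "complex^2" where "C = cmat A *v Bc - \<mu>1 *s Bc"

text \<open>Equals the Kalman determinant of \<open>B\<close> and \<open>A B\<close>, because
  \<open>C\<close> differs from \<open>A B\<close> by a multiple of \<open>B\<close>.\<close>

definition wronski :: complex where "wronski = Bc $ 1 * C $ 2 - Bc $ 2 * C $ 1"

lemma cmat_Bc: "cmat A *v Bc = \<mu>1 *s Bc + C"
  by (simp add: C_def)

text \<open>The Cayley-Hamilton theorem in coordinates:
  \<open>(A - \<mu>2) (A - \<mu>1) B = 0\<close>.\<close>

lemma cmat_C: "cmat A *v C = \<mu>2 *s C"
proof -
  define a b c d x y where "a = complex_of_real (A $ 1 $ 1)" "b = complex_of_real (A $ 1 $ 2)"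
    "c = complex_of_real (A $ 2 $ 1)" "d = complex_of_real (A $ 2 $ 2)" "x = complex_of_real (B $ 1)" "y = complex_of_real (B $ 2)"
  note defs = a_b_c_d_x_y_def
  have C: "C $ 1 = a * x + b * y - \<mu>1 * x" "C $ 2 = c * x + d * y - \<mu>1 * y"
    by (simp_all add: C_def cmat_def Bc_def matrix_vector_mult_def sum_2 defs)
  have h: "a + d = \<mu>1 + \<mu>2" "a * d - b * c = \<mu>1 * \<mu>2" using trace det by (simp_all add: defs)
  have "a * C $ 1 + b * C $ 2 = \<mu>2 * C $ 1" "c * C $ 1 + d * C $ 2 = \<mu>2 * C $ 2"
  proof -
    have b: "b * c = a * d - \<mu>1 * \<mu>2" and d: "d = \<mu>1 + \<mu>2 - a" using h by (simp_all add: algebra_simps)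
    have "a * C $ 1 + b * C $ 2 = a * (a * x + b * y - \<mu>1 * x) + (b * c) * x + b * d * y - b * \<mu>1 * y"
      "c * C $ 1 + d * C $ 2 = c * a * x + (b * c) * y - c * \<mu>1 * x + d * (c * x + d * y - \<mu>1 * y)"
      unfolding C by (simp_all add: algebra_simps)
    then show "a * C $ 1 + b * C $ 2 = \<mu>2 * C $ 1" "c * C $ 1 + d * C $ 2 = \<mu>2 * C $ 2"
      unfolding C b d by (simp_all add: algebra_simps)
  qed
  then show ?thesis
    by (simp add: vec_eq_iff forall_2 matrix_vector_mult_def sum_2 cmat_def defs)
qed

lemma wronski_nonzero: "wronski \<noteq> 0"
proof -
  have "wronski = complex_of_real (B $ 1 * (A *v B) $ 2 - B $ 2 * (A *v B) $ 1)"
    by (simp add: wronski_def C_def Bc_def cmat_def matrix_vector_mult_def sum_2 algebra_simps)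
  then show ?thesis by (metis kalman of_real_eq_0_iff)
qed

text \<open>Cramer's rule with the nonzero determinant \<open>wronski\<close>; the coordinates are
  bounded linear in the vector and hence inherit square integrability.\<close>

lemma coordinates:
  assumes "L2_on S y0"
  obtains y1 y2 where "L2_on S y1" "L2_on S y2" "\<And>x. y0 x = y1 x *s Bc + y2 x *s C"
proof -
  have bl: "bounded_linear (\<lambda>v::complex^2. (v $ 1 * p + v $ 2 * q) / wronski)" for p q :: complex
    using bounded_linear_compose[OF bounded_linear_divide[of wronski] bounded_linear_add[OF
          bounded_linear_compose[OF bounded_linear_mult_left[of p] bounded_linear_vec_nth[of 1]]
          bounded_linear_compose[OF bounded_linear_mult_left[of q] bounded_linear_vec_nth[of 2]]]] .
  show ?thesis
  proof (rule that)
    show "L2_on S (\<lambda>x. (y0 x $ 1 * C $ 2 + y0 x $ 2 * - (C $ 1)) / wronski)"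
      "L2_on S (\<lambda>x. (y0 x $ 1 * - (Bc $ 2) + y0 x $ 2 * Bc $ 1) / wronski)"
      by (rule L2_on_bounded_linear[OF bl assms])+
    show "y0 x = ((y0 x $ 1 * C $ 2 + y0 x $ 2 * - (C $ 1)) / wronski) *s Bc +
       ((y0 x $ 1 * - (Bc $ 2) + y0 x $ 2 * Bc $ 1) / wronski) *s C" for x
    proof -
      define P Q where "P = y0 x $ 1 * C $ 2 + y0 x $ 2 * - (C $ 1)" "Q = y0 x $ 1 * - (Bc $ 2) + y0 x $ 2 * Bc $ 1"
      have e: "P * Bc $ 1 + Q * C $ 1 = wronski * y0 x $ 1" "P * Bc $ 2 + Q * C $ 2 = wronski * y0 x $ 2"
        by (simp_all add: wronski_def P_Q_def algebra_simps)
      have "y0 x $ i = (P * Bc $ i + Q * C $ i) / wronski" for i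
        using exhaust_2[of i] wronski_nonzero by (auto simp: e)
      then have "y0 x $ i = ((P / wronski) *s Bc + (Q / wronski) *s C) $ i" for i
        by (simp only: vector_add_component vector_smult_component times_divide_eq_left add_divide_distrib[symmetric])
      then have "y0 x = (P / wronski) *s Bc + (Q / wronski) *s C" unfolding vec_eq_iff by blast
      then show ?thesis unfolding P_Q_def .
    qed
  qed
qed

end

lemma C1_supported_energy:
  assumes u: "C1_supported a b u u'" and S: "S \<in> sets lebesgue"
  shows "(LINT s|lebesgue_on S. (norm (u s))\<^sup>2) \<le> (LINT s|lborel. (norm (u s))\<^sup>2)"
proof -
  have uc: "continuous_on UNIV u" using u by (rule C1_supported_cont)
  have i: "integrable lborel (\<lambda>s. (norm (u s))\<^sup>2)"
    by (rule integrable_cont_supported[where a=a and b=b])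
       (use u in \<open>auto intro!: continuous_intros uc simp: C1_supported_def\<close>)
  then have il: "integrable lebesgue (\<lambda>s. (norm (u s))\<^sup>2)" by (rule integrable_completion[THEN iffD2, rotated]) (use i in auto)
  have "(LINT s|lebesgue_on S. (norm (u s))\<^sup>2) = (LINT s|lebesgue. indicator S s *\<^sub>R (norm (u s))\<^sup>2)"
    using S by (simp add: integral_restrict_space)
  also have "\<dots> \<le> (LINT s|lebesgue. (norm (u s))\<^sup>2)"
    by (intro integral_mono integrable_mult_indicator[OF _ il] il) (use S in \<open>auto simp: indicator_def\<close>)
  also have "\<dots> = (LINT s|lborel. (norm (u s))\<^sup>2)" using i by (intro integral_completion) auto
  finally show ?thesis .
qed

text \<open>The moments to be realized are \<open>- csine k y1 / k\<close> and
  \<open>- csine k y2 / k\<close>. They are bounded since sine coefficients are square summable, and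
  boundedness is all that \<open>small_control\<close> asks for.\<close>

lemma (in controllable_pair) sufficiency:
  assumes gap: "\<And>j k :: nat. j \<ge> 1 \<Longrightarrow> k \<ge> 1 \<Longrightarrow> j \<noteq> k \<Longrightarrow> \<mu>1 - \<mu>2 \<noteq> of_nat j ^ 2 - of_nat k ^ 2"
    and Re: "Re \<mu>1 \<le> 1" "Re \<mu>2 \<le> 1"
    and y0: "y0 \<in> state_space" and \<epsilon>: "0 < \<epsilon>"
  obtains T u where "steers_to_rest A B T y0 u" "(LINT s|lebesgue_on {0<..}. (norm (u s))\<^sup>2) \<le> \<epsilon>\<^sup>2"
proof -
  interpret decoupled_spectrum \<mu>1 \<mu>2 by (unfold_locales) (use Re gap in auto)
  obtain y1 y2 where y: "L2_on {0<..<pi} y1" "L2_on {0<..<pi} y2" "\<And>x. y0 x = y1 x *s Bc + y2 x *s C"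
    by (rule coordinates[of "{0<..<pi}" y0]) (use y0 in \<open>auto simp: state_space_def\<close>)
  have bd: "\<exists>M. \<forall>k\<ge>1. norm (- csine k y / of_nat k) \<le> M" if "L2_on {0<..<pi} y" for y
  proof -
    have "(\<lambda>k. (norm (csine k y))\<^sup>2) \<longlonglongrightarrow> 0" by (rule summable_LIMSEQ_zero[OF csine_square_summable[OF that]])
    then have "Bseq (\<lambda>k. (norm (csine k y))\<^sup>2)" by (intro convergent_imp_Bseq convergentI)
    then obtain K where K: "\<And>k. norm ((norm (csine k y))\<^sup>2) \<le> K" unfolding Bseq_def by blast
    have "norm (- csine k y / of_nat k) \<le> sqrt K" if "k \<ge> 1" for k
    proof -
      have "norm (- csine k y / of_nat k) = norm (csine k y) / real k" by (simp add: norm_divide)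
      also have "\<dots> \<le> norm (csine k y) / 1" using that by (intro divide_left_mono) auto
      also have "\<dots> \<le> sqrt K" using K[of k] by (intro real_le_rsqrt) simp_all
      finally show ?thesis .
    qed
    then show ?thesis by blast
  qed
  obtain M1 where M1: "\<And>k. k \<ge> 1 \<Longrightarrow> norm (- csine k y1 / of_nat k) \<le> M1" using bd[OF y(1)] by blast
  obtain M2 where M2: "\<And>k. k \<ge> 1 \<Longrightarrow> norm (- csine k y2 / of_nat k) \<le> M2" using bd[OF y(2)] by blast
  have bounds: "norm (- csine k y1 / of_nat k) \<le> max M1 M2 \<and> norm (- csine k y2 / of_nat k) \<le> max M1 M2" if "k \<ge> 1" for k
    using M1[OF that] M2[OF that] by linarith
  obtain T u u' where T: "0 < T" and u: "C1_supported 0 T u u'" and e: "(LINT s|lborel. (norm (u s))\<^sup>2) \<le> \<epsilon>\<^sup>2"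
    and m: "\<And>k. k \<ge> 1 \<Longrightarrow> moment (exp_weight (of_nat k ^ 2 - \<mu>1)) u = - csine k y1 / of_nat k"
      "\<And>k. k \<ge> 1 \<Longrightarrow> moment (dd_weight k) u = - csine k y2 / of_nat k"
    by (rule small_control[where a="\<lambda>k. - csine k y1 / of_nat k" and b="\<lambda>k. - csine k y2 / of_nat k", OF bounds \<epsilon>]) auto
  interpret S: controlled_solution \<mu>1 \<mu>2 T u u' y1 y2 A B Bc C y0
    by unfold_locales (use u y T cmat_Bc cmat_C in \<open>auto simp: Bc_def\<close>)
  have "steers_to_rest A B T y0 u"
    unfolding steers_to_rest_def
  proof (intro conjI exI)
    show "0 \<le> T" using T by simp
    show "u \<in> admissible_controls"
      unfolding admissible_controls_def using L2_on_cont[OF S.u_cont(1)] by blast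
    show "AE t in lebesgue_on {T<..}. u t = 0"
      by (rule AE_I2) (use u in \<open>auto simp: C1_supported_def\<close>)
    show "global_solution A B y0 u S.sol" unfolding global_solution_def using S.sol_transposition by blast
    show "AE p in lebesgue_on ({0<..<pi} \<times> {T<..}). S.sol p = 0"
      by (rule AE_I2) (use S.sol_vanish[OF m] in auto)
  qed
  moreover have "(LINT s|lebesgue_on {0<..}. (norm (u s))\<^sup>2) \<le> \<epsilon>\<^sup>2"
    using C1_supported_energy[OF u, of "{0<..}"] e by simp
  ultimately show ?thesis by (rule that)
qed

section \<open>Necessity\<close>

lemma L2_on_bounded_cont:
  fixes f :: "'a::euclidean_space \<Rightarrow> 'b::euclidean_space"
  assumes f: "continuous_on K f" and K: "compact K" "S \<subseteq> K" and S: "S \<in> lmeasurable"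
  shows "L2_on S f"
  unfolding L2_on_def
proof
  have Ss: "S \<in> sets lebesgue" using S by (simp add: fmeasurable_def)
  show m: "f \<in> borel_measurable (lebesgue_on S)"
    by (rule continuous_imp_measurable_on_sets_lebesgue[OF continuous_on_subset[OF f K(2)] Ss])
  have "bounded (f ` K)" by (intro compact_imp_bounded compact_continuous_image f K)
  then obtain R where R: "\<forall>z\<in>f ` K. norm z \<le> R" unfolding bounded_iff by blast
  show "integrable (lebesgue_on S) (\<lambda>x. (norm (f x))\<^sup>2)"
  proof (rule Bochner_Integration.integrable_bound)
    show "integrable (lebesgue_on S) (\<lambda>x. R\<^sup>2)"
      by (intro finite_measure.integrable_const finite_measure_lebesgue_on S)
    show "(\<lambda>x. (norm (f x))\<^sup>2) \<in> borel_measurable (lebesgue_on S)" using m by measurable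
    show "AE x in lebesgue_on S. norm ((norm (f x))\<^sup>2) \<le> norm (R\<^sup>2)"
    proof (rule AE_I2)
      fix x assume "x \<in> space (lebesgue_on S)"
      then have "norm (f x) \<le> R" using R K(2) by auto
      then show "norm ((norm (f x))\<^sup>2) \<le> norm (R\<^sup>2)" by (simp add: power_mono)
    qed
  qed
qed

lemma H1_deriv_C1:
  fixes f f' :: "real \<Rightarrow> 'b::euclidean_space"
  assumes ab: "a < b" and f: "\<And>x. (f has_vector_derivative f' x) (at x)" "continuous_on UNIV f'"
  shows "H1_deriv a b f f'"
  unfolding H1_deriv_def
proof (intro conjI allI impI)
  let ?M = "lebesgue_on {a<..<b}"
  have fc: "continuous_on UNIV f"
    using f(1) by (meson has_vector_derivative_continuous continuous_at_imp_continuous_on)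
  have L2: "L2_on {a<..<b} h" if "continuous_on UNIV h" for h :: "real \<Rightarrow> 'b"
    by (rule L2_on_cont[OF continuous_on_subset[OF that]]) simp
  show "L2_on {a<..<b} f" "L2_on {a<..<b} f'" by (intro L2 fc f)+
  fix \<psi> \<psi>' assume \<psi>: "C1_test_function a b \<psi> \<psi>'"
  have d\<psi>: "\<And>x. (\<psi> has_real_derivative \<psi>' x) (at x)" and c\<psi>': "continuous_on UNIV \<psi>'"
    using \<psi> by (auto simp: C1_test_function_def)
  have c\<psi>: "continuous_on UNIV \<psi>" using d\<psi> DERIV_continuous_on by blast
  have z: "\<psi> a = 0" "\<psi> b = 0" using \<psi> unfolding C1_test_function_def by force+
  have c1: "continuous_on UNIV (\<lambda>x. \<psi>' x *\<^sub>R f x)" and c2: "continuous_on UNIV (\<lambda>x. \<psi> x *\<^sub>R f' x)"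
    by (intro continuous_on_scaleR c\<psi> c\<psi>' fc f)+
  note i = L2_integrable[OF L2[OF c1] Ioo_lmeasurable] L2_integrable[OF L2[OF c2] Ioo_lmeasurable]
  have "((\<lambda>x. \<psi> x *\<^sub>R f' x + \<psi>' x *\<^sub>R f x) has_integral \<psi> b *\<^sub>R f b - \<psi> a *\<^sub>R f a) {a..b}"
  proof (rule fundamental_theorem_of_calculus[of a b "\<lambda>x. \<psi> x *\<^sub>R f x"])
    show "((\<lambda>x. \<psi> x *\<^sub>R f x) has_vector_derivative (\<psi> x *\<^sub>R f' x + \<psi>' x *\<^sub>R f x)) (at x within {a..b})" for x
      by (intro has_vector_derivative_scaleR has_vector_derivative_at_within[OF f(1)] has_field_derivative_at_within[OF d\<psi>])
  qed (use ab in simp)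
  then have "integral {a..b} (\<lambda>x. \<psi> x *\<^sub>R f' x + \<psi>' x *\<^sub>R f x) = 0" using z by (simp add: integral_unique)
  then have "integral {a<..<b} (\<lambda>x. \<psi> x *\<^sub>R f' x + \<psi>' x *\<^sub>R f x) = 0"
    using integral_open_interval[of a b "\<lambda>x. \<psi> x *\<^sub>R f' x + \<psi>' x *\<^sub>R f x"] by simp
  moreover have "(LINT x|?M. \<psi> x *\<^sub>R f' x + \<psi>' x *\<^sub>R f x) = integral {a<..<b} (\<lambda>x. \<psi> x *\<^sub>R f' x + \<psi>' x *\<^sub>R f x)"
    by (rule lebesgue_integral_eq_integral[OF Bochner_Integration.integrable_add[OF i(2,1)]]) simp
  ultimately have "(LINT x|?M. \<psi> x *\<^sub>R f' x) + (LINT x|?M. \<psi>' x *\<^sub>R f x) = 0"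
    using Bochner_Integration.integral_add[OF i(2,1)] by simp
  then show "(LINT x|?M. \<psi>' x *\<^sub>R f x) = - (LINT x|?M. \<psi> x *\<^sub>R f' x)"
    by (simp add: eq_neg_iff_add_eq_0 add.commute)
qed

text \<open>\<open>sin x\<close> satisfies the Dirichlet conditions and
  \<open>- sin'' = sin\<close>, so every C1 profile \<open>m\<close> with \<open>m T = 0\<close>
  gives an adjoint solution once the source is read off the equation.\<close>

lemma separated_adjoint_solution:
  fixes A :: "real^2^2" and m m' :: "real \<Rightarrow> real^2"
  assumes T: "0 < T" and m: "\<And>t. (m has_vector_derivative m' t) (at t)" "continuous_on UNIV m'" "m T = 0"
  defines "g \<equiv> \<lambda>p. sin (fst p) *\<^sub>R (m (snd p) - m' (snd p) - transpose A *v m (snd p))"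
  shows "strong_adjoint_solution A T g (\<lambda>p. sin (fst p) *\<^sub>R m (snd p)) (\<lambda>p. cos (fst p) *\<^sub>R m (snd p))"
    and "L2_on (space_time T) g"
proof -
  have mc: "continuous_on S m" for S
    using m(1) by (meson has_vector_derivative_continuous continuous_at_imp_continuous_on)
  have m'c: "continuous_on S m'" for S using m(2) by (rule continuous_on_subset) simp
  have L2: "L2_on (space_time T) f" if "continuous_on UNIV f" for f :: "real \<times> real \<Rightarrow> real^2"
    by (rule L2_on_bounded_cont[OF continuous_on_subset[OF that] compact_Times[OF compact_Icc[of 0 pi] compact_Icc[of 0 T]] _ space_time_lmeasurable]) auto
  have mp: "continuous_on UNIV (\<lambda>p::real \<times> real. m (snd p))" "continuous_on UNIV (\<lambda>p::real \<times> real. m' (snd p))"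
    by (rule continuous_on_compose2[OF mc[of UNIV]] continuous_on_compose2[OF m'c[of UNIV]]; auto intro: continuous_intros)+
  have Am: "continuous_on UNIV (\<lambda>p::real \<times> real. transpose A *v m (snd p))"
    by (rule continuous_on_compose2[OF linear_continuous_on[OF matrix_vector_mul_bounded_linear] mp(1)]) auto
  show "L2_on (space_time T) g"
    unfolding g_def by (intro L2 continuous_intros mp Am)
  have dsin: "((\<lambda>x. sin x *\<^sub>R w) has_vector_derivative cos x *\<^sub>R w) (at x)" for w :: "real^2" and x
    by (rule bounded_linear.has_vector_derivative[OF bounded_linear_scaleR_left])
       (use DERIV_sin[of x] in \<open>simp add: has_real_derivative_iff_has_vector_derivative\<close>)
  have dcos: "((\<lambda>x. cos x *\<^sub>R w) has_vector_derivative (- sin x) *\<^sub>R w) (at x)" for w :: "real^2" and x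
    by (rule bounded_linear.has_vector_derivative[OF bounded_linear_scaleR_left])
       (use DERIV_cos[of x] in \<open>simp add: has_real_derivative_iff_has_vector_derivative\<close>)
  have dm: "((\<lambda>t. s *\<^sub>R m t) has_vector_derivative s *\<^sub>R m' t) (at t)" for s t
    by (rule bounded_linear.has_vector_derivative[OF bounded_linear_scaleR_right m(1)])
  have H: "H1_deriv 0 pi (\<lambda>x. sin x *\<^sub>R w) (\<lambda>x. cos x *\<^sub>R w)"
    "H1_deriv 0 pi (\<lambda>x. cos x *\<^sub>R w) (\<lambda>x. (- sin x) *\<^sub>R w)" for w :: "real^2"
    by (rule H1_deriv_C1[OF _ dsin] H1_deriv_C1[OF _ dcos]; intro continuous_intros pi_gt_zero)+
  have Ht: "H1_deriv 0 T (\<lambda>t. s *\<^sub>R m t) (\<lambda>t. s *\<^sub>R m' t)" for s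
    by (rule H1_deriv_C1[OF T dm]) (intro continuous_intros m'c)
  have cont: "((\<lambda>t. LINT x|Omega. (norm (sin x *\<^sub>R m t - sin x *\<^sub>R m s))\<^sup>2 + (norm (cos x *\<^sub>R m t - cos x *\<^sub>R m s))\<^sup>2)
          \<longlongrightarrow> 0) (at s within {0..T})" for s
  proof -
    \<comment> \<open>Since \<open>sin^2 + cos^2 = 1\<close>, the integrand of the H1 distance does
      not depend on \<open>x\<close>.\<close>
    have e: "(norm (sin x *\<^sub>R m t - sin x *\<^sub>R m s))\<^sup>2 + (norm (cos x *\<^sub>R m t - cos x *\<^sub>R m s))\<^sup>2 = (norm (m t - m s))\<^sup>2" for x t
    proof -
      have "(norm (sin x *\<^sub>R m t - sin x *\<^sub>R m s))\<^sup>2 + (norm (cos x *\<^sub>R m t - cos x *\<^sub>R m s))\<^sup>2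
         = ((sin x)\<^sup>2 + (cos x)\<^sup>2) * (norm (m t - m s))\<^sup>2"
        unfolding scaleR_diff_right[symmetric] norm_scaleR power_mult_distrib power2_abs distrib_right ..
      then show ?thesis by simp
    qed
    have "((\<lambda>t. pi * (norm (m t - m s))\<^sup>2) \<longlongrightarrow> pi * (norm (m s - m s))\<^sup>2) (at s within {0..T})"
      using has_vector_derivative_continuous[OF has_vector_derivative_at_within[OF m(1)]]
      by (intro tendsto_intros) (simp add: continuous_within)
    then show ?thesis unfolding e by (simp add: measure_restrict_space)
  qed
  show "strong_adjoint_solution A T g (\<lambda>p. sin (fst p) *\<^sub>R m (snd p)) (\<lambda>p. cos (fst p) *\<^sub>R m (snd p))"
    unfolding strong_adjoint_solution_def
  proof (intro conjI ballI exI)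
    show "L2_on (space_time T) (\<lambda>p. (- sin (fst p)) *\<^sub>R m (snd p))"
      "L2_on (space_time T) (\<lambda>p. sin (fst p) *\<^sub>R m' (snd p))"
      "L2_on (space_time T) (\<lambda>p. sin (fst p) *\<^sub>R m (snd p))"
      "L2_on (space_time T) (\<lambda>p. cos (fst p) *\<^sub>R m (snd p))"
      by (intro L2 continuous_intros mp)+
    fix s assume "s \<in> {0..T}"
    show "((\<lambda>t. LINT x|Omega. (norm (sin (fst (x, t)) *\<^sub>R m (snd (x, t)) - sin (fst (x, s)) *\<^sub>R m (snd (x, s))))\<^sup>2
        + (norm (cos (fst (x, t)) *\<^sub>R m (snd (x, t)) - cos (fst (x, s)) *\<^sub>R m (snd (x, s))))\<^sup>2) \<longlongrightarrow> 0) (at s within {0..T})"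
      unfolding fst_conv snd_conv by (rule cont)
  qed (auto intro!: AE_I2 H(1) H(2)[unfolded scaleR_minus_left] Ht continuous_intros simp: m(3) g_def algebra_simps)
qed


section \<open>Testing with a left eigenvector\<close>

context controllable_pair
begin

text \<open>Orthogonal to \<open>C\<close>, the eigenvector for \<open>\<mu>2\<close>, in the
  bilinear pairing; in dimension two this makes it a left eigenvector for \<open>\<mu>1\<close>, and
  its pairing with \<open>B\<close> is the nonzero \<open>wronski\<close>.\<close>

definition left_vec :: "complex^2" where "left_vec = vector [C $ 2, - (C $ 1)]"

lemma left_vec: "of_real (B $ 1) * left_vec $ 1 + of_real (B $ 2) * left_vec $ 2 = wronski"
  by (simp add: left_vec_def wronski_def Bc_def)

text \<open>Replacing \<open>\<mu>1\<close> by the trace minus \<open>\<mu>2\<close> reduces the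
  claim to the eigenvector equation of \<open>C\<close>.\<close>

lemma left_eigenvector: "(\<Sum>j\<in>UNIV. of_real (A $ j $ i) * left_vec $ j) = \<mu>1 * left_vec $ i"
proof -
  have c: "of_real (A $ 1 $ 1) * C $ 1 + of_real (A $ 1 $ 2) * C $ 2 = \<mu>2 * C $ 1"
    "of_real (A $ 2 $ 1) * C $ 1 + of_real (A $ 2 $ 2) * C $ 2 = \<mu>2 * C $ 2"
    using cmat_C by (simp_all add: vec_eq_iff forall_2 matrix_vector_mult_def sum_2 cmat_def)
  have t: "\<mu>1 * z = of_real (A $ 1 $ 1) * z + of_real (A $ 2 $ 2) * z - \<mu>2 * z" for z
    unfolding distrib_right[symmetric] trace by (simp add: algebra_simps)
  have "of_real (A $ 1 $ 1) * C $ 2 - of_real (A $ 2 $ 1) * C $ 1 = \<mu>1 * C $ 2"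
    "of_real (A $ 1 $ 2) * C $ 2 - of_real (A $ 2 $ 2) * C $ 1 = - (\<mu>1 * C $ 1)"
    unfolding t c[symmetric] by (simp_all add: algebra_simps)
  then show ?thesis using exhaust_2[of i] by (auto simp: left_vec_def sum_2)
qed

text \<open>\<open>exp ((1 - \<mu>1) t)\<close> solves the source-free adjoint equation in time, but
  the adjoint state must vanish at the final time; the factor equals 1 up to \<open>T0\<close> and 0
  from \<open>T0 + 1\<close> on.\<close>

definition cutoff_exp :: "real \<Rightarrow> real \<Rightarrow> complex" where
  "cutoff_exp T0 t = of_real (1 - quad_step (t - T0)) * exp ((1 - \<mu>1) * of_real t)"

lemma cutoff_exp_deriv:
  "(cutoff_exp T0 has_vector_derivative
     (1 - \<mu>1) * cutoff_exp T0 t - of_real (tent (t - T0)) * exp ((1 - \<mu>1) * of_real t)) (at t)"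
proof -
  have "((\<lambda>t. t - T0) has_real_derivative 1) (at t)" by (auto intro!: derivative_eq_intros)
  from DERIV_diff[OF DERIV_const[of 1] DERIV_chain2[where f=quad_step and g="\<lambda>t. t - T0", OF quad_step_deriv this]]
  have "((\<lambda>t. 1 - quad_step (t - T0)) has_real_derivative - tent (t - T0)) (at t)" by simp
  from has_vector_derivative_mult[OF of_real_deriv[OF this] exp_real_deriv[of "1 - \<mu>1" t UNIV]]
  have "((\<lambda>t. of_real (1 - quad_step (t - T0)) * exp ((1 - \<mu>1) * of_real t)) has_vector_derivative
    (of_real (1 - quad_step (t - T0)) * ((1 - \<mu>1) * exp ((1 - \<mu>1) * of_real t)) + of_real (- tent (t - T0)) * exp ((1 - \<mu>1) * of_real t))) (at t)" .
  then show ?thesis unfolding cutoff_exp_def[abs_def] by (rule has_vector_derivative_eq_rhs) (simp add: algebra_simps)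
qed

text \<open>The adjoint solution \<open>cutoff_exp T0 t sin x left_vec\<close> has its source after time \<open>T0\<close>,
  where a solution at rest does not see it.\<close>

lemma steering_identity:
  assumes st: "steers_to_rest A B T0 y0 u" and y0: "L2_on {0<..<pi} y0"
  shows "left_vec $ 1 * (LINT x|Omega. of_real (sin x) * y0 x $ 1) + left_vec $ 2 * (LINT x|Omega. of_real (sin x) * y0 x $ 2)
     + wronski * (LINT t|lebesgue_on {0<..<T0 + 1}. cutoff_exp T0 t * u t) = 0"
proof -
  define T where "T = T0 + 1"
  obtain y where T0: "0 \<le> T0" and u: "u \<in> admissible_controls" and y: "global_solution A B y0 u y"
    and rest: "AE p in lebesgue_on ({0<..<pi} \<times> {T0<..}). y p = 0"
    using st unfolding steers_to_rest_def by blast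
  have T: "0 < T" using T0 by (simp add: T_def)
  let ?N = "lebesgue_on {0<..<T}" and ?Q = "lebesgue_on (space_time T)"
  define \<theta> where "\<theta> = cutoff_exp T0"
  define \<theta>' where "\<theta>' t = (1 - \<mu>1) * \<theta> t - of_real (tent (t - T0)) * exp ((1 - \<mu>1) * of_real t)" for t
  have d: "(\<theta> has_vector_derivative \<theta>' t) (at t)" for t
    unfolding \<theta>_def \<theta>'_def by (rule cutoff_exp_deriv)
  have \<theta>c: "continuous_on S \<theta>" for S
    using d by (meson has_vector_derivative_continuous continuous_at_imp_continuous_on)
  have \<theta>'c: "continuous_on S \<theta>'" for S
    unfolding \<theta>'_def by (intro continuous_intros \<theta>c)
  have \<theta>0: "\<theta> 0 = 1" and \<theta>T: "\<theta> T = 0" using T0 by (simp_all add: \<theta>_def cutoff_exp_def quad_step_simps T_def)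
  have before: "\<theta>' t = (1 - \<mu>1) * \<theta> t" if "t \<le> T0" for t using that by (simp add: \<theta>'_def tent_simps)
  have ui: "integrable ?N u"
    by (rule L2_integrable[OF _ Ioo_lmeasurable]) (use u T in \<open>simp add: admissible_controls_def\<close>)
  have Pi: "integrable Omega (\<lambda>x. of_real (sin x) * y0 x $ i)" for i
  proof (rule integrable_mult_cont_Ioo[OF L2_Omega_integrable])
    show "L2_on {0<..<pi} (\<lambda>x. y0 x $ i)" by (rule L2_on_bounded_linear[OF bounded_linear_vec_nth y0])
    show "continuous_on {0..pi} (\<lambda>x. complex_of_real (sin x))" by (intro continuous_intros)
  qed
  define I where "I i = (LINT x|Omega. of_real (sin x) * y0 x $ i)" for i
  \<comment> \<open>Transposition admits only real sources, whereas the adjoint solution is complex.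
    Each real functional \<open>\<rho>\<close> of it is admissible; real and imaginary part are
    recombined at the end.\<close>
  have part: "of_real (\<rho> (left_vec $ 1)) * I 1 + of_real (\<rho> (left_vec $ 2)) * I 2
      + (LINT t|?N. of_real (\<rho> (\<theta> t * wronski)) * u t) = 0" if \<rho>: "bounded_linear \<rho>" for \<rho> :: "complex \<Rightarrow> real"
  proof -
    interpret \<rho>: bounded_linear \<rho> by (rule \<rho>)
    have \<rho>r: "\<rho> (of_real r * z) = r * \<rho> z" for r z using \<rho>.scaleR[of r z] by (simp add: scaleR_conv_of_real)
    define m m' where "m t = (\<chi> i. \<rho> (\<theta> t * left_vec $ i))" "m' t = (\<chi> i. \<rho> (\<theta>' t * left_vec $ i))" for t
    have md: "(m has_vector_derivative m' t) (at t)" for t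
    proof -
      have "bounded_linear (\<lambda>z. \<chi> i. \<rho> (z * left_vec $ i))"
      proof -
        have "linear (\<lambda>z. \<chi> i. \<rho> (z * left_vec $ i))"
          by (rule linearI) (simp_all add: vec_eq_iff distrib_right \<rho>.add \<rho>.scaleR)
        then show ?thesis by (simp add: linear_conv_bounded_linear)
      qed
      from bounded_linear.has_vector_derivative[OF this d]
      show ?thesis unfolding m_m'_def[abs_def] .
    qed
    have m'c: "continuous_on UNIV m'"
      unfolding m_m'_def[abs_def] by (intro continuous_on_vec_lambda \<rho>.continuous_on continuous_intros \<theta>'c)
    have mT: "m T = 0" by (simp add: m_m'_def \<theta>T \<rho>.zero vec_eq_iff)
    define g where "g p = sin (fst p) *\<^sub>R (m (snd p) - m' (snd p) - transpose A *v m (snd p))" for p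
    have g0: "g p = 0" if "snd p \<le> T0" for p
    proof -
      have "(transpose A *v m (snd p)) $ i = \<rho> (\<mu>1 * (\<theta> (snd p) * left_vec $ i))" for i
      proof -
        have "(transpose A *v m (snd p)) $ i = (\<Sum>j\<in>UNIV. A $ j $ i * \<rho> (\<theta> (snd p) * left_vec $ j))"
          by (simp add: matrix_vector_mult_def transpose_def m_m'_def)
        also have "\<dots> = \<rho> (\<theta> (snd p) * (\<Sum>j\<in>UNIV. of_real (A $ j $ i) * left_vec $ j))"
          unfolding \<rho>r[symmetric] \<rho>.sum[symmetric] sum_distrib_left by (simp add: mult.left_commute)
        finally show ?thesis unfolding left_eigenvector by (simp add: mult.left_commute)
      qed
      then have "(m (snd p) - m' (snd p) - transpose A *v m (snd p)) $ i =
          \<rho> (\<theta> (snd p) * left_vec $ i - (1 - \<mu>1) * \<theta> (snd p) * left_vec $ i - \<mu>1 * (\<theta> (snd p) * left_vec $ i))" for i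
        by (simp add: m_m'_def before[OF that] \<rho>.diff)
      then have "m (snd p) - m' (snd p) - transpose A *v m (snd p) = 0"
        by (simp add: vec_eq_iff algebra_simps \<rho>.zero)
      then show ?thesis by (simp add: g_def)
    qed
    have "(LINT p|?Q. real_pairing (y p) (g p)) =
        (LINT x|Omega. real_pairing (y0 x) (sin x *\<^sub>R m 0)) + (LINT t|?N. complex_of_real (B \<bullet> (cos 0 *\<^sub>R m t)) * u t)"
    proof -
      have "strong_adjoint_solution A T g (\<lambda>p. sin (fst p) *\<^sub>R m (snd p)) (\<lambda>p. cos (fst p) *\<^sub>R m (snd p))" "L2_on (space_time T) g"
        unfolding g_def[abs_def] by (rule separated_adjoint_solution[OF T md m'c mT])+
      then show ?thesis
        using y T unfolding global_solution_def transposition_solution_def by fastforce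
    qed
    moreover have "(LINT p|?Q. real_pairing (y p) (g p)) = 0"
    proof -
      have "AE p in lebesgue. p \<in> {0<..<pi} \<times> {T0<..} \<longrightarrow> y p = 0"
        using rest
        by (subst (asm) AE_restrict_space_iff) (auto intro!: sets_completionI_sets borel_open open_Times)
      then have "AE p in lebesgue. p \<in> space_time T \<longrightarrow> real_pairing (y p) (g p) = 0"
      proof (rule eventually_mono, intro impI)
        fix p assume h: "p \<in> {0<..<pi} \<times> {T0<..} \<longrightarrow> y p = 0" "p \<in> space_time T"
        show "real_pairing (y p) (g p) = 0"
        proof (cases "snd p \<le> T0")
          case True then show ?thesis by (simp add: g0 real_pairing_def)
        next
          case False
          then have "y p = 0" using h by (auto simp: mem_Times_iff)
          then show ?thesis by (simp add: real_pairing_def)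
        qed
      qed
      then have "AE p in ?Q. real_pairing (y p) (g p) = 0"
        using space_time_lmeasurable[of T] by (subst AE_restrict_space_iff) (auto simp: fmeasurable_def)
      then show ?thesis by (rule integral_eq_zero_AE)
    qed
    moreover have "(LINT x|Omega. real_pairing (y0 x) (sin x *\<^sub>R m 0)) = of_real (\<rho> (left_vec $ 1)) * I 1 + of_real (\<rho> (left_vec $ 2)) * I 2"
    proof -
      have "(LINT x|Omega. real_pairing (y0 x) (sin x *\<^sub>R m 0)) =
         (LINT x|Omega. of_real (\<rho> (left_vec $ 1)) * (of_real (sin x) * y0 x $ 1) + of_real (\<rho> (left_vec $ 2)) * (of_real (sin x) * y0 x $ 2))"
        by (simp add: real_pairing_def sum_2 m_m'_def \<theta>0 mult_ac)
      also have "\<dots> = of_real (\<rho> (left_vec $ 1)) * I 1 + of_real (\<rho> (left_vec $ 2)) * I 2"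
        unfolding I_def Bochner_Integration.integral_add[OF integrable_mult_right[OF Pi] integrable_mult_right[OF Pi]] by simp
      finally show ?thesis .
    qed
    moreover have "B \<bullet> (cos 0 *\<^sub>R m t) = \<rho> (\<theta> t * wronski)" for t
      unfolding left_vec[symmetric]
      by (simp add: inner_vec_def sum_2 m_m'_def distrib_left mult.left_commute[of "\<theta> t"] \<rho>.add \<rho>r)
    ultimately show ?thesis by simp
  qed
  have iw: "integrable ?N (\<lambda>t. of_real (\<rho> (\<theta> t * wronski)) * u t)" if \<rho>: "bounded_linear \<rho>" for \<rho> :: "complex \<Rightarrow> real"
    by (intro integrable_mult_cont_Ioo ui continuous_on_of_real bounded_linear.continuous_on[OF \<rho>] continuous_on_mult \<theta>c continuous_on_const)
  note iR = iw[OF bounded_linear_Re] and iI = iw[OF bounded_linear_Im]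
  have ri: "of_real (Re z) + \<i> * of_real (Im z) = z" for z by (simp add: complex_eq_iff)
  have "(LINT t|?N. of_real (Re (\<theta> t * wronski)) * u t) + \<i> * (LINT t|?N. of_real (Im (\<theta> t * wronski)) * u t)
      = (LINT t|?N. of_real (Re (\<theta> t * wronski)) * u t + \<i> * (of_real (Im (\<theta> t * wronski)) * u t))"
    unfolding Bochner_Integration.integral_add[OF iR integrable_mult_right[OF iI]] by simp
  also have "\<dots> = (LINT t|?N. wronski * (\<theta> t * u t))"
  proof (rule Bochner_Integration.integral_cong[OF refl])
    fix t
    have "of_real (Re (\<theta> t * wronski)) * u t + \<i> * (of_real (Im (\<theta> t * wronski)) * u t) =
        (of_real (Re (\<theta> t * wronski)) + \<i> * of_real (Im (\<theta> t * wronski))) * u t" by (simp only: distrib_right mult.assoc)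
    then show "of_real (Re (\<theta> t * wronski)) * u t + \<i> * (of_real (Im (\<theta> t * wronski)) * u t) = wronski * (\<theta> t * u t)"
      unfolding ri by (simp only: mult_ac)
  qed
  finally have w: "wronski * (LINT t|?N. \<theta> t * u t) = (LINT t|?N. of_real (Re (\<theta> t * wronski)) * u t) + \<i> * (LINT t|?N. of_real (Im (\<theta> t * wronski)) * u t)"
    by simp
  have "left_vec $ 1 * I 1 + left_vec $ 2 * I 2 + wronski * (LINT t|?N. \<theta> t * u t)
    = (of_real (Re (left_vec $ 1)) * I 1 + of_real (Re (left_vec $ 2)) * I 2 + (LINT t|?N. of_real (Re (\<theta> t * wronski)) * u t))
    + \<i> * (of_real (Im (left_vec $ 1)) * I 1 + of_real (Im (left_vec $ 2)) * I 2 + (LINT t|?N. of_real (Im (\<theta> t * wronski)) * u t))"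
    unfolding w by (subst (1) ri[of "left_vec $ 1", symmetric], subst (1) ri[of "left_vec $ 2", symmetric]) (simp only: algebra_simps)
  also have "\<dots> = 0" unfolding part[OF bounded_linear_Re] part[OF bounded_linear_Im] by simp
  finally show ?thesis by (simp only: I_def \<theta>_def T_def)
qed

text \<open>The state is chosen so that its component along the left eigenvector is the positive
  number \<open>pi / 2 * V\<close>. The steering identity bounds this by
  \<open>K * \<epsilon>\<close>, where \<open>K\<close> depends neither on the steering time nor on
  \<open>\<epsilon>\<close>: the weight \<open>exp (- 2 c t)\<close> has integral at most
  \<open>1 / (2 c)\<close> on every interval.\<close>

lemma necessity:
  assumes "NCVE A B"
  shows "Re \<mu>1 \<le> 1"
proof (rule ccontr)
  assume "\<not> Re \<mu>1 \<le> 1"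
  define c where "c = Re \<mu>1 - 1"
  have c: "0 < c" using \<open>\<not> Re \<mu>1 \<le> 1\<close> by (simp add: c_def)
  define y0 :: "real \<Rightarrow> complex^2" where "y0 x = (\<chi> i. of_real (sin x) * cnj (left_vec $ i))" for x
  define V where "V = (norm (left_vec $ 1))\<^sup>2 + (norm (left_vec $ 2))\<^sup>2"
  have V: "0 < V"
  proof -
    have "left_vec $ 1 \<noteq> 0 \<or> left_vec $ 2 \<noteq> 0" using left_vec wronski_nonzero by auto
    then show ?thesis unfolding V_def by (auto intro: add_pos_nonneg add_nonneg_pos)
  qed
  have y0L: "L2_on {0<..<pi} y0"
    unfolding y0_def[abs_def] by (intro L2_on_cont continuous_on_vec_lambda continuous_intros)
  have I: "(LINT x|Omega. of_real (sin x) * y0 x $ i) = of_real (pi / 2) * cnj (left_vec $ i)" for i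
  proof -
    have "(LINT x|Omega. of_real (sin x) * y0 x $ i) = (LINT x|Omega. complex_of_real (sin x * sin x) * cnj (left_vec $ i))"
      by (simp add: y0_def mult.assoc)
    also have "\<dots> = of_real (LINT x|Omega. sin x * sin x) * cnj (left_vec $ i)"
      by (simp only: integral_mult_left_zero integral_complex_of_real)
    also have "(LINT x|Omega. sin x * sin x) = pi / 2" using sine_orthogonal[of 1 1] by simp
    finally show ?thesis .
  qed
  define K where "K = norm wronski * (1 / (2 * c) + 1)"
  have K: "0 \<le> K" using c by (simp add: K_def)
  have bound: "pi / 2 * V \<le> K * \<epsilon>" if \<epsilon>: "0 < \<epsilon>" for \<epsilon>
  proof -
    obtain T0 u where st: "steers_to_rest A B T0 y0 u" and e: "(LINT s|lebesgue_on {0<..}. (norm (u s))\<^sup>2) \<le> \<epsilon>\<^sup>2"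
      using assms y0L \<epsilon> unfolding NCVE_def NCVE_state_def state_space_def by blast
    have T0: "0 \<le> T0" and ua: "u \<in> admissible_controls" and uz: "AE t in lebesgue_on {T0<..}. u t = 0"
      using st unfolding steers_to_rest_def by auto
    define T where "T = T0 + 1"
    have T: "0 < T" "T0 < T" using T0 by (simp_all add: T_def)
    let ?N = "lebesgue_on {0<..<T}"
    have uL: "L2_on {0<..<T} u" using ua T by (simp add: admissible_controls_def)
    then have u2: "integrable ?N (\<lambda>t. (norm (u t))\<^sup>2)" by (simp add: L2_on_def)
    have energy: "(LINT t|?N. (norm (u t))\<^sup>2) \<le> \<epsilon>\<^sup>2"
    proof -
      \<comment> \<open>A complex copy of the integrand, because
        \<open>integrable_lebesgue_on_cong_AE\<close> is stated for complex functions. The half-line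
        integral reduces to (0, T) since the control vanishes almost everywhere after
        \<open>T0\<close>.\<close>
      let ?F = "\<lambda>t. complex_of_real ((norm (u t))\<^sup>2)"
      have iF: "integrable ?N ?F" by (simp only: complex_of_real_integrable_eq u2)
      then have il: "integrable lebesgue (\<lambda>t. indicator {0<..<T} t *\<^sub>R ?F t)"
        by (subst (asm) integrable_restrict_space) auto
      have "integrable (lebesgue_on {0<..}) (\<lambda>t. indicator {0<..<T} t *\<^sub>R ?F t)"
      proof (subst integrable_restrict_space)
        show "integrable lebesgue (\<lambda>t. indicator {0<..} t *\<^sub>R (indicator {0<..<T} t *\<^sub>R ?F t))"
          by (rule integrable_mult_indicator[OF _ il]) simp
      qed simp
      moreover have "AE t in lebesgue_on {0<..}. indicator {0<..<T} t *\<^sub>R ?F t = ?F t"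
      proof -
        have "AE t in lebesgue. t \<in> {T0<..} \<longrightarrow> u t = 0" using uz by (subst (asm) AE_restrict_space_iff) auto
        then have "AE t in lebesgue. t \<in> {0<..} \<longrightarrow> indicator {0<..<T} t *\<^sub>R ?F t = ?F t"
          by (rule eventually_mono) (use T in \<open>auto simp: indicator_def not_less\<close>)
        then show ?thesis by (subst AE_restrict_space_iff) auto
      qed
      ultimately have "(LINT t|lebesgue_on {0<..}. indicator {0<..<T} t *\<^sub>R ?F t) = (LINT t|lebesgue_on {0<..}. ?F t)"
        by (rule integrable_lebesgue_on_cong_AE(2)) simp
      also have "(LINT t|lebesgue_on {0<..}. indicator {0<..<T} t *\<^sub>R ?F t) = (LINT t|lebesgue. indicator {0<..} t *\<^sub>R (indicator {0<..<T} t *\<^sub>R ?F t))"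
        by (rule integral_restrict_space) simp
      also have "\<dots> = (LINT t|lebesgue. indicator {0<..<T} t *\<^sub>R ?F t)"
        by (rule Bochner_Integration.integral_cong) (auto simp: indicator_def)
      also have "\<dots> = (LINT t|?N. ?F t)" by (rule integral_restrict_space[symmetric]) simp
      finally have "(LINT t|?N. (norm (u t))\<^sup>2) = (LINT t|lebesgue_on {0<..}. (norm (u t))\<^sup>2)"
        by (simp only: integral_complex_of_real of_real_eq_iff)
      with e show ?thesis by simp
    qed
    let ?X = "LINT t|?N. cutoff_exp T0 t * u t"
    have Vc: "left_vec $ 1 * cnj (left_vec $ 1) + left_vec $ 2 * cnj (left_vec $ 2) = of_real V"
      by (simp only: complex_norm_square[symmetric] V_def of_real_add)
    have "left_vec $ 1 * (of_real (pi / 2) * cnj (left_vec $ 1)) + left_vec $ 2 * (of_real (pi / 2) * cnj (left_vec $ 2)) = of_real (pi / 2 * V)"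
      unfolding of_real_mult Vc[symmetric] distrib_left by (simp only: mult.left_commute)
    from steering_identity[OF st y0L, unfolded I this]
    have "of_real (pi / 2 * V) + wronski * ?X = 0" unfolding T_def .
    then have "complex_of_real (pi / 2 * V) = - (wronski * ?X)" by (simp add: eq_neg_iff_add_eq_0)
    then have "norm (complex_of_real (pi / 2 * V)) = norm wronski * norm ?X" by (simp only: norm_minus_cancel norm_mult)
    then have eq: "pi / 2 * V = norm wronski * norm ?X" using V by (simp only: norm_of_real) (simp add: abs_mult)
    let ?w = "\<lambda>t. exp (- 2 * c * t)"
    have wi: "integrable ?N ?w" by (intro integrable_cont_Ioo continuous_intros)
    have "norm ?X \<le> (LINT t|?N. norm (cutoff_exp T0 t * u t))" by (rule integral_norm_bound)
    also have "\<dots> \<le> (LINT t|?N. \<epsilon> * ?w t + (norm (u t))\<^sup>2 / \<epsilon>)"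
    proof (rule integral_mono)
      have "integrable ?N (\<lambda>t. cutoff_exp T0 t * u t)"
        using cutoff_exp_deriv
        by (intro integrable_mult_cont_Ioo L2_integrable[OF uL Ioo_lmeasurable])
           (meson has_vector_derivative_continuous continuous_at_imp_continuous_on)
      then show "integrable ?N (\<lambda>t. norm (cutoff_exp T0 t * u t))" by (rule integrable_norm)
      show "integrable ?N (\<lambda>t. \<epsilon> * ?w t + (norm (u t))\<^sup>2 / \<epsilon>)"
        by (intro Bochner_Integration.integrable_add integrable_mult_right integrable_divide wi u2)
      fix t
      have n: "norm (cutoff_exp T0 t) \<le> exp (- c * t)"
      proof -
        have "norm (cutoff_exp T0 t) = \<bar>1 - quad_step (t - T0)\<bar> * exp (- c * t)"
          by (simp add: cutoff_exp_def norm_mult c_def del: of_real_diff)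
        also have "\<dots> \<le> 1 * exp (- c * t)"
          using quad_step_range[of "t - T0"] by (intro mult_right_mono) auto
        finally show ?thesis by simp
      qed
      define a b where "a = exp (- c * t)" "b = norm (u t)"
      have a2: "?w t = a\<^sup>2" by (simp add: a_b_def power2_eq_square flip: exp_add)
      have "0 \<le> (\<epsilon> * a - b)\<^sup>2 + 2 * 0" by simp
      moreover have "0 \<le> \<epsilon> * a * b" using \<epsilon> by (simp add: a_b_def)
      ultimately have "\<epsilon> * a * b \<le> (\<epsilon> * a)\<^sup>2 + b\<^sup>2" by (simp add: power2_diff)
      then have "a * b \<le> \<epsilon> * a\<^sup>2 + b\<^sup>2 / \<epsilon>" using \<epsilon> by (simp add: field_simps power2_eq_square)
      moreover have "norm (cutoff_exp T0 t * u t) \<le> a * b"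
        unfolding norm_mult a_b_def by (rule mult_right_mono[OF n]) simp
      ultimately show "norm (cutoff_exp T0 t * u t) \<le> \<epsilon> * ?w t + (norm (u t))\<^sup>2 / \<epsilon>"
        unfolding a2 a_b_def(2) by linarith
    qed
    also have "\<dots> = \<epsilon> * (LINT t|?N. ?w t) + (LINT t|?N. (norm (u t))\<^sup>2) / \<epsilon>"
      unfolding Bochner_Integration.integral_add[OF integrable_mult_right[OF wi] integrable_divide[OF u2]] by simp
    also have "\<dots> \<le> \<epsilon> * (1 / (2 * c)) + \<epsilon>\<^sup>2 / \<epsilon>"
    proof (intro add_mono mult_left_mono divide_right_mono energy)
      have "(LINT t|?N. ?w t) = - ?w T / (2 * c) - - ?w 0 / (2 * c)"
        by (rule LINT_Ioo_FTC) (use T c in \<open>auto intro!: continuous_intros derivative_eq_intros simp: field_simps\<close>)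
      also have "\<dots> \<le> 1 / (2 * c)" using c by (simp add: field_simps)
      finally show "(LINT t|?N. ?w t) \<le> 1 / (2 * c)" .
    qed (use \<epsilon> in auto)
    also have "\<dots> = (1 / (2 * c) + 1) * \<epsilon>" using \<epsilon> by (simp add: power2_eq_square algebra_simps)
    finally have "norm ?X \<le> (1 / (2 * c) + 1) * \<epsilon>" .
    then have "norm wronski * norm ?X \<le> norm wronski * ((1 / (2 * c) + 1) * \<epsilon>)" by (rule mult_left_mono) simp
    then show ?thesis unfolding eq K_def by (simp only: mult.assoc)
  qed
  define L where "L = pi / 2 * V"
  have L: "0 < L" using V by (simp add: L_def)
  \<comment> \<open>Taking \<open>\<epsilon> = L / (K + 1)\<close> makes the bound strictly smaller
    than \<open>L\<close>; the 1 keeps the choice positive even for \<open>K = 0\<close>.\<close>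
  have "L \<le> K * (L / (K + 1))" unfolding L_def using V K by (intro bound) auto
  also have "\<dots> < L" using L K by (simp add: field_simps)
  finally show False by simp
qed

end

theorem theorem3p2:
  fixes A0 :: "real^2^2" and B0 :: "real^2" and \<mu>1 \<mu>2 :: complex
  assumes "complex_eigenvalues A0 = {\<mu>1, \<mu>2}"
    and "rank (transpose (vector [B0, A0 *v B0]) :: real^2^2) = 2"
    and "\<And>j k :: nat. j \<ge> 1 \<Longrightarrow> k \<ge> 1 \<Longrightarrow> j \<noteq> k \<Longrightarrow>
           \<mu>1 - \<mu>2 \<noteq> of_nat j ^ 2 - of_nat k ^ 2"
  shows "NCVE A0 B0 \<longleftrightarrow> Re \<mu>1 \<le> 1 \<and> Re \<mu>2 \<le> 1"
proof
  interpret P: controllable_pair A0 B0 \<mu>1 \<mu>2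
    by unfold_locales (rule complex_eigenvalues_2[OF assms(1)] kalman_2[OF assms(2)])+
  \<comment> \<open>\<open>necessity\<close> bounds the first eigenvalue of its locale; exchanging
    the roles gives the second.\<close>
  have swap: "complex_eigenvalues A0 = {\<mu>2, \<mu>1}" using assms(1) by (simp add: insert_commute)
  interpret P': controllable_pair A0 B0 \<mu>2 \<mu>1
    by unfold_locales (rule complex_eigenvalues_2[OF swap] kalman_2[OF assms(2)])+
  show "Re \<mu>1 \<le> 1 \<and> Re \<mu>2 \<le> 1" if "NCVE A0 B0"
    using P.necessity[OF that] P'.necessity[OF that] ..
  assume Re: "Re \<mu>1 \<le> 1 \<and> Re \<mu>2 \<le> 1"
  show "NCVE A0 B0"
    unfolding NCVE_def NCVE_state_def
  proof (intro ballI conjI allI impI)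
    fix y0 assume y0: "y0 \<in> state_space"
    note control = P.sufficiency[OF assms(3) _ _ y0]
    \<comment> \<open>Plain steerability is the case of any fixed energy level, here 1.\<close>
    show "\<exists>T u. steers_to_rest A0 B0 T y0 u" by (rule control[of 1]) (use Re in auto)
    fix \<epsilon> :: real assume \<epsilon>: "0 < \<epsilon>"
    show "\<exists>T u. steers_to_rest A0 B0 T y0 u \<and> (LINT s|lebesgue_on {0<..}. (norm (u s))\<^sup>2) \<le> \<epsilon>\<^sup>2"
      by (rule control[of \<epsilon>]) (use Re \<epsilon> in auto)
  qed
qed

end
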